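(* Let $n\ge 2$ be an integer and let $f:\partial B_n\to(0,\infty)$ be a positive continuous function with $\int_{\partial B_n} f\,d\mu_{\partial B_n}=1$. For $N\geq n+1$ let $Q_{n,N}^f$ denote the convex hull of $N$ random points chosen independently from $\partial B_n$ according to the probability distribution with density $f$ with respect to $\mu_{\partial B_n}$. Then for every fixed $p\in(-\infty,1]$, $$\lim_{N\to\infty}N^{\frac{2}{n-1}}\,\mathbb{E}[\Delta_{S_p}(B_n,Q_{n,N}^f)] = \frac{1}{2}\left(1-p+\frac{(n-1)^2}{n+1}\right)\frac{\int_{\partial B_n}f(x)^{-\frac{2}{n-1}}\,d\mu_{\partial B_n}(x)}{\mathrm{vol}_{n-1}(B_{n-1})^{\frac{2}{n-1}}}\cdot\frac{\Gamma\left(n+\frac{2}{n-1}\right)}{(n-1)!}.$$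
   Context: For $k\in\mathbb{N}$, $B_k$ is the Euclidean unit ball in $\mathbb{R}^k$ (centered at the origin), $\partial B_k$ is its boundary, the $(k-1)$-dimensional unit sphere, $\mu_{\partial B_k}$ is the $(k-1)$-dimensional spherical Lebesgue measure (surface area measure, not normalized) on $\partial B_k$, and $\mathrm{vol}_k$ is $k$-dimensional Lebesgue measure (volume). $\Gamma$ is the gamma function. For a polytope $Q\subset\mathbb{R}^n$ and $p\in(-\infty,1]$, the $L_p$ surface area is given by $$S_p(Q):=\sum_{F\in\mathcal{F}_{n-1}(Q)}\mathrm{dist}(o,\mathrm{aff}(F))^{1-p}\,\mathrm{vol}_{n-1}(F),$$ where $\mathcal{F}_{n-1}(Q)$ is the set of facets (i.e. $(n-1)$-dimensional faces) of $Q$, $\mathrm{aff}(F)$ is the affine hull of $F$, $o$ is the origin of $\mathbb{R}^n$, and $\mathrm{dist}(o,\mathrm{aff}(F))=\min\{\|x\|:x\in\mathrm{aff}(F)\}$ is the Euclidean distance (for $p=1$ the factor $\mathrm{dist}(o,\mathrm{aff}(F))^{0}$ is $1$). The $L_p$ surface area difference of the ball and a polytope $Q$ is $$\Delta_{S_p}(B_n,Q):=\mu_{\partial B_n}(\partial B_n)-S_p(Q).$$ The expectation in the claim is over all realizations of $Q_{n,N}^f$, with $S_p(Q_{n,N}^f)$ given by the formula above for each realization. *)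

theory Defs
  imports "HOL-Analysis.Analysis"
begin

text \<open>
  Spherical Lebesgue measure on the unit sphere, not normalized. It is the image of Lebesgue
  measure on the punctured unit ball under radial projection, scaled by the dimension \<open>n\<close>: a Borel
  set \<open>A\<close> of the sphere has measure \<open>n\<close> times the volume of \<open>{t x | x \<in> A, 0 < t \<le> 1}\<close>, which is
  its surface area.
\<close>

definition sphere_measure :: "'a::euclidean_space measure" where
  "sphere_measure =
     scale_measure (of_nat DIM('a))
       (distr (restrict_space lborel (cball 0 1 - {0})) (restrict_space borel (sphere 0 1))
          (\<lambda>x. x /\<^sub>R norm x))"

text \<open>
  Lebesgue measure on a nonempty affine subspace \<open>A\<close>, of the same dimension as \<open>A\<close>: the image
  of the product of one-dimensional Lebesgue measures under an orthonormal coordinate system of \<open>A\<close>.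
  The chosen origin and orthonormal basis do not matter, as Lebesgue measure is invariant under
  rigid motions. The result is a measure on the Borel sets of the surrounding space.
\<close>

definition direction_basis :: "'a::euclidean_space set \<Rightarrow> 'a set" where
  "direction_basis A =
     (SOME B. pairwise orthogonal B \<and> (\<forall>b\<in>B. norm b = 1) \<and>
        span B = span {x - y | x y. x \<in> A \<and> y \<in> A})"

definition affine_lborel :: "'a::euclidean_space set \<Rightarrow> 'a measure" where
  "affine_lborel A =
     distr (PiM (direction_basis A) (\<lambda>_. lborel)) borel
       (\<lambda>c. (SOME a. a \<in> A) + (\<Sum>b\<in>direction_basis A. c b *\<^sub>R b))"

definition facet_volume :: "'a::euclidean_space set \<Rightarrow> real" where
  "facet_volume F = measure (affine_lborel (affine hull F)) F"

text \<open>
  Facets are the faces of dimension \<open>n - 1\<close>, where \<open>n\<close> is the dimension of the ambient space. For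
  a full-dimensional polytope this agrees with the library's \<open>facet_of\<close>, which
  instead compares with the dimension of the polytope.
\<close>

definition facets :: "'a::euclidean_space set \<Rightarrow> 'a set set" where
  "facets Q = {F. F face_of Q \<and> aff_dim F = int DIM('a) - 1}"

text \<open>The case \<open>p = 1\<close> is separate because \<open>0 powr 0 = 0\<close>, whereas here the factor has to be \<open>1\<close>.\<close>

definition Lp_surface_area :: "real \<Rightarrow> 'a::euclidean_space set \<Rightarrow> real" where
  "Lp_surface_area p Q =
     (\<Sum>F\<in>facets Q.
        (if p = 1 then 1 else infdist 0 (affine hull F) powr (1 - p)) * facet_volume F)"

definition Lp_surface_area_diff :: "real \<Rightarrow> 'a::euclidean_space set \<Rightarrow> real" where
  "Lp_surface_area_diff p Q =
     measure (sphere_measure :: 'a measure) (sphere 0 1) - Lp_surface_area p Q"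

text \<open>The joint law of \<open>N\<close> independent points of the sphere, each with density \<open>f\<close>.\<close>

definition random_points :: "('a::euclidean_space \<Rightarrow> real) \<Rightarrow> nat \<Rightarrow> (nat \<Rightarrow> 'a) measure" where
  "random_points f N = PiM {..<N} (\<lambda>_. density sphere_measure (\<lambda>x. ennreal (f x)))"

definition random_polytope :: "nat \<Rightarrow> (nat \<Rightarrow> 'a::euclidean_space) \<Rightarrow> 'a set" where
  "random_polytope N X = convex hull (X ` {..<N})"

end

theory Submission
  imports Defs "HOL-Probability.Probability" "HOL-Real_Asymp.Real_Asymp"
begin

text \<open>
 Almost surely the points are in general position, and outside an event of exponentially small
 probability the origin is interior. Then the cones over the facets tile the space, so
 \<open>\<mu>(\<partial>B) - S_p\<close> is a sum over facets. Writing the measure of a cone in the ball as an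
 exponential integral over the simplicial cone and expanding \<open>|x|\<close> to second order, a facet with
 vertices \<open>x\<^sub>i\<close> and cap depth \<open>\<delta>\<close> contributes
 \<open>|det| (\<Sum>|x\<^sub>i - x\<^sub>j|\<^sup>2 / (4 (n + 1)) - p \<delta> / 2) / (n - 1)!\<close> up to \<open>O(|det| \<delta>\<^sup>2)\<close>.
 For the expectation, fix one vertex \<open>v\<close> and parametrize the others by the chords through \<open>v\<close>,
 with a Gaussian weight along the rays. For a fixed facet normal the integrand becomes a product times
 a squared determinant, so after scaling by \<open>N\<close> to the power \<open>-1/(n - 1)\<close> dominated convergence
 reduces the limit to Gaussian moments of determinants and a radial integral.
\<close>

section \<open>Translation-invariant integrals\<close>

text \<open>The chord coordinates take the place of an affine Blaschke-Petkantschin formula. If s_i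
  is the slope paired with the direction y_i, and z is the tangential part of the facet normal at
  the fixed vertex, then s = Y z is linear in z with Jacobian |det Y|. The simplex volume
  contributes |det Y| once more; the square is a polynomial, so its Gaussian moments are exact sums
  over permutations. The power of |y| in the Gaussian weight is free and is chosen to balance the
  denominators of the rational chord map. The powers of N match because there are N choose n
  candidate facets, about N^n / n!, each with an expected contribution of order N^(-n - 2/(n-1)).
  Measurability shapes the second half: the Bochner integral of a non-measurable function is 0 by
  convention, so S_p has to be measurable on all samples, degenerate ones included. Hence normals,
  facet volumes and sides of hyperplanes are expressed through distances to affine hulls and volumes
  of convex hulls.\<close>

lemma nn_integral_lborel_shift:
 fixes F :: "'a::euclidean_space => ennreal"
 assumes [measurable]: "F \<in> borel_measurable borel"
 shows "(\<integral>\<^sup>+x. F (x + c) \<partial>lborel) = (\<integral>\<^sup>+x. F x \<partial>lborel)"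
proof -
 have "(\<integral>\<^sup>+x. F x \<partial>lborel) = (\<integral>\<^sup>+x. F x \<partial>distr lborel borel ((+) c))"
  by (simp add: lborel_distr_plus)
 also have "\<dots> = (\<integral>\<^sup>+x. F (x + c) \<partial>lborel)"
  by (subst nn_integral_distr) (auto simp: add.commute)
 finally show ?thesis by simp
qed

lemma nn_integral_lborel_scale:
 fixes F :: "'a::euclidean_space => ennreal"
 assumes [measurable]: "F \<in> borel_measurable borel" and t: "t > 0"
 shows "(\<integral>\<^sup>+x. F x \<partial>lborel) = ennreal (t ^ DIM('a)) * (\<integral>\<^sup>+x. F (t *\<^sub>R x) \<partial>lborel)"
proof -
 have "(\<integral>\<^sup>+x. F x \<partial>lborel) = (\<integral>\<^sup>+x. F x \<partial>density (distr lborel borel (%x::'a. 0 + t *\<^sub>R x)) (%_. \<bar>t\<bar> ^ DIM('a)))"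
  using t by (subst lborel_affine[of t 0]) auto
 also have "\<dots> = (\<integral>\<^sup>+x. ennreal (t ^ DIM('a)) * F (t *\<^sub>R x) \<partial>lborel)"
  using t by (subst nn_integral_density) (auto simp: nn_integral_distr)
 also have "\<dots> = ennreal (t ^ DIM('a)) * (\<integral>\<^sup>+x. F (t *\<^sub>R x) \<partial>lborel)"
  by (rule nn_integral_cmult) auto
 finally show ?thesis .
qed

text \<open>Uniqueness of Haar measure: exchange the two translations under a double integral.\<close>

lemma translation_invariant_nn_integral:
 fixes L :: "'b => 'a::euclidean_space"
 assumes "sigma_finite_measure M" and [measurable]: "L \<in> borel_measurable M"
  and inv: "\<And>F y. F \<in> borel_measurable borel ==>
    (\<integral>\<^sup>+x. F (L x + y) \<partial>M) = (\<integral>\<^sup>+x. (F (L x) :: ennreal) \<partial>M)"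
 shows "\<exists>K. \<forall>F\<in>borel_measurable borel. (\<integral>\<^sup>+x. F (L x) \<partial>M) = K * (\<integral>\<^sup>+x. F x \<partial>lborel)"
proof (intro exI ballI)
 interpret M: sigma_finite_measure M by fact
 interpret P: pair_sigma_finite M "lborel :: 'a measure" ..
 \<comment> \<open>A function of total mass one allows an integral over a second variable to be
   inserted.\<close>
 define G :: "'a => ennreal" where "G = indicator (cbox 0 One)"
 have [measurable]: "G \<in> borel_measurable borel" by (simp add: G_def)
 have G1: "(\<integral>\<^sup>+x. G x \<partial>lborel) = 1"
  by (simp add: G_def inner_diff_left)
 fix F :: "'a => ennreal" assume [measurable]: "F \<in> borel_measurable borel"
 let ?f = "\<integral>\<^sup>+x. G (- L x) \<partial>M"
 let ?g = "%x. \<integral>\<^sup>+y. F (L x + y) * G y \<partial>lborel"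
 let ?h = "%y. \<integral>\<^sup>+x. G (- L x + y) \<partial>M"
 let ?p = "\<integral>\<^sup>+x. F x \<partial>lborel"
 let ?q = "\<integral>\<^sup>+x. F (L x) \<partial>M"
 have "?q = (\<integral>\<^sup>+x. (\<integral>\<^sup>+y. F (L x) * G y \<partial>lborel) \<partial>M)"
  by (subst nn_integral_cmult) (auto simp: G1)
 also have "\<dots> = (\<integral>\<^sup>+y. (\<integral>\<^sup>+x. F (L x) * G y \<partial>M) \<partial>lborel)"
  by (rule P.Fubini'[symmetric]) measurable
 also have "\<dots> = (\<integral>\<^sup>+y. (\<integral>\<^sup>+x. F (L x + y) * G y \<partial>M) \<partial>lborel)"
 proof (rule nn_integral_cong)
  fix y
  show "(\<integral>\<^sup>+x. F (L x) * G y \<partial>M) = (\<integral>\<^sup>+x. F (L x + y) * G y \<partial>M)"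
   by (rule inv[of "%x. F x * G y", symmetric]) measurable
 qed
 also have "\<dots> = (\<integral>\<^sup>+x. ?g x \<partial>M)"
  by (rule P.Fubini') measurable
 also have "\<dots> = (\<integral>\<^sup>+x. (\<integral>\<^sup>+y. F y * G (- L x + y) \<partial>lborel) \<partial>M)"
 proof (rule nn_integral_cong)
  fix x
  have "?g x
    = (\<integral>\<^sup>+y. F (L x + (y + - L x)) * G (y + - L x) \<partial>lborel)"
   by (rule nn_integral_lborel_shift[symmetric]) measurable
  then show "?g x = (\<integral>\<^sup>+y. F y * G (- L x + y) \<partial>lborel)"
   by (simp add: add.commute)
 qed
 also have "\<dots> = (\<integral>\<^sup>+y. (\<integral>\<^sup>+x. F y * G (- L x + y) \<partial>M) \<partial>lborel)"
  by (rule P.Fubini'[symmetric]) measurable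
 also have "\<dots> = (\<integral>\<^sup>+y. F y * ?h y \<partial>lborel)"
  by (intro nn_integral_cong, subst nn_integral_cmult) auto
 also have "\<dots> = (\<integral>\<^sup>+y. F y * ?f \<partial>lborel)"
 proof (rule nn_integral_cong)
  fix y
  have "?h y = ?f"
   using inv[of "%z. G (- z)" "- y"] by (simp add: add.commute)
  then show "F y * ?h y = F y * ?f"
   by simp
 qed
 also have "\<dots> = ?f * ?p"
  by (subst nn_integral_multc) (auto simp: mult.commute)
 finally show "?q = (\<integral>\<^sup>+x. indicator (cbox 0 One) (- L x) \<partial>M) * ?p"
  by (simp add: G_def)
qed

text \<open>Surjectivity lets a translation of the target be produced by one of the source.
  \<open>K\<close> is an extended real and is infinite when the kernel is nontrivial; where its
  value matters it is found from one test function.\<close>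

lemma linear_nn_integral:
 fixes L :: "'b::euclidean_space => 'a::euclidean_space"
 assumes L: "linear L" and "surj L"
 shows "\<exists>K. \<forall>F\<in>borel_measurable borel. (\<integral>\<^sup>+x. F (L x) \<partial>lborel) = K * (\<integral>\<^sup>+x. F x \<partial>lborel)"
proof (rule translation_invariant_nn_integral)
 show [measurable]: "L \<in> borel_measurable lborel"
  using L by (simp add: borel_measurable_continuous_onI linear_continuous_on linear_conv_bounded_linear)
 fix F :: "'a => ennreal" and y assume [measurable]: "F \<in> borel_measurable borel"
 obtain z where "y = L z" using \<open>surj L\<close> by blast
 then show "(\<integral>\<^sup>+x. F (L x + y) \<partial>lborel) = (\<integral>\<^sup>+x. F (L x) \<partial>lborel)"
  using nn_integral_lborel_shift[of "%x. F (L x)" z] by (simp add: linear_add[OF L])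
qed (rule lborel.sigma_finite_measure_axioms)

text \<open>The scaling constant is read off from the unit ball, whose preimage under a linear
  isometry is again the unit ball.\<close>

lemma isometry_nn_integral:
 fixes L :: "'b::euclidean_space => 'a::euclidean_space"
 assumes L: "linear L" and iso: "\<And>x. norm (L x) = norm x" and dim: "DIM('b) = DIM('a)"
  and F: "F \<in> borel_measurable borel"
 shows "(\<integral>\<^sup>+x. F (L x) \<partial>lborel) = (\<integral>\<^sup>+x. F x \<partial>lborel)"
proof -
 have "inj L" using L iso by (metis linear_injective_0 norm_eq_zero)
 then have "dim (range L) = DIM('a)"
  using dim_image_eq[OF L, of UNIV] dim by simp
 then have "span (range L) = UNIV" using dim_eq_full by blast
 then have "surj L" using L by (metis linear_subspace_image span_eq_iff subspace_UNIV)
 obtain K where K: "\<And>F. F\<in>borel_measurable borel ==> (\<integral>\<^sup>+x. F (L x) \<partial>lborel) = K * (\<integral>\<^sup>+x. F x \<partial>lborel)"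
  using linear_nn_integral[OF L \<open>surj L\<close>] by blast
 let ?f = "unit_ball_vol DIM('a)"
 have "(\<integral>\<^sup>+x. indicator (cball 0 1) (L x) \<partial>lborel) = K * (\<integral>\<^sup>+x. indicator (cball 0 1 :: 'a set) x \<partial>lborel)"
  by (rule K) (intro borel_measurable_indicator borel_closed closed_cball)
 moreover have "(%x. indicator (cball 0 1) (L x) :: ennreal) = indicator (cball 0 1)"
  by (auto simp: fun_eq_iff indicator_def iso)
 ultimately have "ennreal (unit_ball_vol DIM('b)) = K * ennreal ?f"
  by (simp add: emeasure_cball)
 then have "ennreal ?f * K = ennreal ?f * 1"
  using dim by (simp add: mult.commute)
 moreover have "ennreal ?f \<noteq> 0"
  using unit_ball_vol_pos[of "real DIM('a)"] by (simp add: ennreal_eq_0_iff not_le del: unit_ball_vol_pos)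
 ultimately have "K = 1" by (subst (asm) ennreal_mult_cancel_left) auto
 then show ?thesis using K[OF F] by simp
qed

text \<open>The maps \<phi> need not be injective: the weights w spread the mass of M over the
  fibres. The weighted image of the product of the N i agrees with the product of the M i on boxes,
  and that determines it.\<close>

lemma PiM_change_of_variables:
 fixes M :: "'i => 'a measure" and N :: "'i => 'b measure"
 assumes "product_sigma_finite M" "product_sigma_finite N" and [simp]: "finite I"
  and \<phi>: "\<And>i. i \<in> I ==> \<phi> i \<in> measurable (N i) (M i)"
  and w: "\<And>i. i \<in> I ==> w i \<in> borel_measurable (N i)"
  and eq: "\<And>i g. i \<in> I ==> g \<in> borel_measurable (M i) ==>
   (\<integral>\<^sup>+x. g x \<partial>M i) = (\<integral>\<^sup>+x. w i x * g (\<phi> i x) \<partial>N i)"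
  and G: "G \<in> borel_measurable (PiM I M)"
 shows "(\<integral>\<^sup>+x. G x \<partial>PiM I M) = (\<integral>\<^sup>+x. (\<Prod>i\<in>I. w i (x i)) * G (\<lambda>i\<in>I. \<phi> i (x i)) \<partial>PiM I N)"
proof -
 interpret M: product_sigma_finite M by fact
 interpret N: product_sigma_finite N by fact
 define T where "T = (%x. \<lambda>i\<in>I. \<phi> i (x i))"
 have T[measurable]: "T \<in> measurable (PiM I N) (PiM I M)"
  unfolding T_def
  by (intro measurable_restrict measurable_compose[OF _ \<phi>] measurable_component_singleton)
 have W[measurable]: "(%x. \<Prod>i\<in>I. w i (x i)) \<in> borel_measurable (PiM I N)"
  by (intro borel_measurable_prod_ennreal measurable_compose[OF _ w] measurable_component_singleton)
 define P where "P = distr (density (PiM I N) (%x. \<Prod>i\<in>I. w i (x i))) (PiM I M) T"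
 have "P = PiM I M"
 proof (rule M.PiM_eqI)
  fix A assume A: "\<And>i. i \<in> I ==> A i \<in> sets (M i)"
  have "emeasure P (Pi\<^sub>E I A) = (\<integral>\<^sup>+x. indicator (Pi\<^sub>E I A) x \<partial>P)"
   using A by (subst nn_integral_indicator) (auto simp: P_def)
  also have "\<dots> = (\<integral>\<^sup>+x. (\<Prod>i\<in>I. w i (x i)) * indicator (Pi\<^sub>E I A) (T x) \<partial>PiM I N)"
  proof -
   have [measurable]: "Pi\<^sub>E I A \<in> sets (PiM I M)" using A by (intro sets_PiM_I_finite) auto
   show ?thesis
    unfolding P_def by (subst nn_integral_distr, measurable, subst nn_integral_density, measurable)
  qed
  also have "\<dots> = (\<integral>\<^sup>+x. (\<Prod>i\<in>I. w i (x i) * indicator (A i) (\<phi> i (x i))) \<partial>PiM I N)"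
  proof (intro nn_integral_cong)
   fix x
   have "indicator (Pi\<^sub>E I A) (T x) = (\<Prod>i\<in>I. indicator (A i) (\<phi> i (x i)) :: ennreal)"
    unfolding T_def by (auto simp: indicator_def PiE_iff prod_zero_iff)
   then show "(\<Prod>i\<in>I. w i (x i)) * indicator (Pi\<^sub>E I A) (T x)
     = (\<Prod>i\<in>I. w i (x i) * indicator (A i) (\<phi> i (x i)))"
    by (simp add: prod.distrib)
  qed
  also have "\<dots> = (\<Prod>i\<in>I. \<integral>\<^sup>+x. w i x * indicator (A i) (\<phi> i x) \<partial>N i)"
   using A by (intro N.product_nn_integral_prod)
    (auto intro!: borel_measurable_times_ennreal w measurable_compose[OF \<phi>] borel_measurable_indicator)
  also have "\<dots> = (\<Prod>i\<in>I. emeasure (M i) (A i))"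
   using A by (intro prod.cong refl) (subst eq[symmetric], auto)
  finally show "emeasure P (Pi\<^sub>E I A) = (\<Prod>i\<in>I. emeasure (M i) (A i))" .
 qed (auto simp: P_def)
 then have "(\<integral>\<^sup>+x. G x \<partial>PiM I M) = (\<integral>\<^sup>+x. G x \<partial>P)" by simp
 also have "\<dots> = (\<integral>\<^sup>+x. (\<Prod>i\<in>I. w i (x i)) * G (T x) \<partial>PiM I N)"
  unfolding P_def using G by (simp add: nn_integral_distr nn_integral_density)
 finally show ?thesis by (simp add: T_def)
qed

text \<open>The outer integral runs over the second components, so that for fixed directions the
  whole family of slopes in the first components can be substituted jointly.\<close>

lemma PiM_pair_nn_integral:
 fixes M :: "'i => 'a measure" and N :: "'i => 'b measure"
 assumes "product_sigma_finite M" "product_sigma_finite N" and [simp]: "finite I"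
  and G: "G \<in> borel_measurable (PiM I (%i. M i \<Otimes>\<^sub>M N i))"
 shows "(\<integral>\<^sup>+x. G x \<partial>PiM I (%i. M i \<Otimes>\<^sub>M N i))
  = (\<integral>\<^sup>+y. (\<integral>\<^sup>+x. G (\<lambda>i\<in>I. (x i, y i)) \<partial>PiM I M) \<partial>PiM I N)"
proof -
 interpret M: product_sigma_finite M by fact
 interpret N: product_sigma_finite N by fact
 interpret FM: finite_product_sigma_finite M I by standard simp
 interpret FN: finite_product_sigma_finite N I by standard simp
 interpret P: pair_sigma_finite "PiM I N" "PiM I M" ..
 have pp: "pair_sigma_finite (M i) (N i)" for i
  by (intro pair_sigma_finite.intro M.sigma_finite_measures N.sigma_finite_measures)
 interpret MN: product_sigma_finite "%i. M i \<Otimes>\<^sub>M N i"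
  unfolding product_sigma_finite_def
  by (auto intro!: sigma_finite_pair_measure M.sigma_finite_measures N.sigma_finite_measures)
 define T where "T = (%(y :: _ => 'b, x :: _ => 'a). \<lambda>i\<in>I. (x i, y i))"
 let ?f = "%i. M i \<Otimes>\<^sub>M N i"
 let ?g = "PiM I N \<Otimes>\<^sub>M PiM I M"
 have T[measurable]: "T \<in> measurable ?g (PiM I ?f)"
  unfolding T_def by measurable
 define Q where "Q = distr ?g (PiM I ?f) T"
 let ?h = "%i. M i \<Otimes>\<^sub>M N i"
 have "Q = PiM I ?f"
 proof (rule MN.PiM_eqI)
  fix A assume A: "\<And>i. i \<in> I ==> A i \<in> sets (?h i)"
  have "emeasure Q (Pi\<^sub>E I A) = (\<integral>\<^sup>+x. indicator (Pi\<^sub>E I A) x \<partial>Q)"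
   using A by (subst nn_integral_indicator) (auto simp: Q_def)
  also have "\<dots> = (\<integral>\<^sup>+z. indicator (Pi\<^sub>E I A) (T z) \<partial>?g)"
  proof -
   have [measurable]: "Pi\<^sub>E I A \<in> sets (PiM I ?f)"
    using A by (intro sets_PiM_I_finite) auto
   show ?thesis
    unfolding Q_def by (subst nn_integral_distr) measurable
  qed
  also have "\<dots> = (\<integral>\<^sup>+y. (\<integral>\<^sup>+x. indicator (Pi\<^sub>E I A) (T (y, x)) \<partial>PiM I M) \<partial>PiM I N)"
   using A by (subst FM.nn_integral_fst[symmetric]) auto
  also have "\<dots> = (\<integral>\<^sup>+y. (\<integral>\<^sup>+x. (\<Prod>i\<in>I. indicator (A i) (x i, y i)) \<partial>PiM I M) \<partial>PiM I N)"
   unfolding T_def by (intro nn_integral_cong) (auto simp: indicator_def PiE_iff prod_zero_iff)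
  also have "\<dots> = (\<integral>\<^sup>+y. (\<Prod>i\<in>I. \<integral>\<^sup>+x. indicator (A i) (x, y i) \<partial>M i) \<partial>PiM I N)"
  proof (intro nn_integral_cong M.product_nn_integral_prod)
   fix y i assume y: "y \<in> space (PiM I N)" and i: "i \<in> I"
   then have "y i \<in> space (N i)" by (auto simp: space_PiM)
   then show "(%x. indicator (A i) (x, y i) :: ennreal) \<in> borel_measurable (M i)"
    using A[OF i] by measurable
  qed simp
  also have "\<dots> = (\<Prod>i\<in>I. \<integral>\<^sup>+y. (\<integral>\<^sup>+x. indicator (A i) (x, y) \<partial>M i) \<partial>N i)"
  proof (rule N.product_nn_integral_prod)
   fix i assume i: "i \<in> I"
   interpret pair_sigma_finite "M i" "N i" by (rule pp)
   have [measurable]: "A i \<in> sets (?h i)" using A i by auto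
   show "(%y. \<integral>\<^sup>+x. indicator (A i) (x, y) \<partial>M i) \<in> borel_measurable (N i)"
    by measurable
  qed simp
  also have "\<dots> = (\<Prod>i\<in>I. emeasure (?h i) (A i))"
  proof (intro prod.cong refl)
   fix i assume i: "i \<in> I"
   interpret pair_sigma_finite "M i" "N i" by (rule pp)
   show "(\<integral>\<^sup>+y. (\<integral>\<^sup>+x. indicator (A i) (x, y) \<partial>M i) \<partial>N i) = emeasure (?h i) (A i)"
    using A[OF i] by (subst nn_integral_snd) auto
  qed
  finally show "emeasure Q (Pi\<^sub>E I A) = (\<Prod>i\<in>I. emeasure (?h i) (A i))" .
 qed (auto simp: Q_def)
 then have "(\<integral>\<^sup>+x. G x \<partial>PiM I ?f) = (\<integral>\<^sup>+x. G x \<partial>Q)" by simp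
 also have "\<dots> = (\<integral>\<^sup>+z. G (T z) \<partial>?g)"
  unfolding Q_def using G by (simp add: nn_integral_distr)
 also have "\<dots> = (\<integral>\<^sup>+y. (\<integral>\<^sup>+x. G (T (y, x)) \<partial>PiM I M) \<partial>PiM I N)"
  by (subst FM.nn_integral_fst[symmetric]) (auto intro!: measurable_compose[OF T G])
 finally show ?thesis by (simp add: T_def)
qed

lemma lborel_vec_eq_distr_PiM:
 "distr (PiM (UNIV :: 'm::finite set) (%_. lborel :: real measure)) borel vec_lambda = (lborel :: (real ^ 'm) measure)"
proof (rule lborel_eqI[symmetric])
 interpret product_sigma_finite "%_::'m. lborel :: real measure" ..
 let ?f = "PiM UNIV (%_. lborel)"
 have m: "(vec_lambda :: ('m => real) => real ^ 'm) \<in> borel_measurable ?f"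
  by (subst borel_measurable_euclidean_space) (auto simp: Basis_vec_def inner_axis)
 fix l u :: "real ^ 'm" assume le: "\<And>b. b \<in> Basis ==> l \<bullet> b \<le> u \<bullet> b"
 have le': "l $ i \<le> u $ i" for i
  using le[of "axis i 1"] by (auto simp: inner_axis axis_in_Basis_iff)
 let ?g = "emeasure (distr ?f borel vec_lambda) (box l u)"
 have "?g
   = emeasure ?f (Pi\<^sub>E UNIV (%i::'m. {l $ i <..< u $ i}))"
  by (subst emeasure_distr[OF m])
   (auto simp: box_def Basis_vec_def inner_axis space_PiM PiE_iff intro!: arg_cong[where f="emeasure _"])
 also have "\<dots> = (\<Prod>i\<in>UNIV. ennreal (u $ i - l $ i))"
  using le' by (subst emeasure_PiM) auto
 also have "\<dots> = ennreal (\<Prod>i\<in>UNIV. u $ i - l $ i)"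
  using le' by (subst prod_ennreal) auto
 also have "(\<Prod>i\<in>UNIV. u $ i - l $ i) = (\<Prod>b\<in>Basis. (u - l) \<bullet> b)"
  by (rule prod.reindex_bij_witness[where j="%i. axis i 1" and i="%b. THE i. b = axis i 1"])
   (auto simp: Basis_vec_def inner_axis axis_eq_axis)
 finally show "?g = (\<Prod>b\<in>Basis. (u - l) \<bullet> b)"
  by simp
qed simp

lemma nn_integral_vec_PiM:
 fixes F :: "real ^ 'm::finite => ennreal"
 assumes "F \<in> borel_measurable borel"
 shows "(\<integral>\<^sup>+x. F x \<partial>lborel) = (\<integral>\<^sup>+x. F (vec_lambda x) \<partial>PiM UNIV (%_. lborel))"
proof -
 have m: "(vec_lambda :: ('m => real) => real ^ 'm) \<in> borel_measurable (PiM UNIV (%_. lborel))"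
  by (subst borel_measurable_euclidean_space) (auto simp: Basis_vec_def inner_axis)
 show ?thesis
  by (subst lborel_vec_eq_distr_PiM[symmetric]) (simp add: nn_integral_distr[OF m] assms)
qed

text \<open>The constant is found on the unit ball, whose image has |det A| times its measure. The
  well-order on the indices is asked for by \<open>measure_linear_image\<close>, and this is why a
  special index type is built next.\<close>

lemma nn_integral_matrix_vector_mult:
 fixes A :: "real ^ 'm::{finite,wellorder} ^ 'm::{finite,wellorder}"
 assumes A: "det A \<noteq> 0" and F: "F \<in> borel_measurable borel"
 shows "(\<integral>\<^sup>+x. F x \<partial>lborel) = ennreal \<bar>det A\<bar> * (\<integral>\<^sup>+x. F (A *v x) \<partial>lborel)"
proof -
 let ?L = "%x. A *v x"
 have L: "linear ?L" by (rule matrix_vector_mul_linear)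
 have inv: "invertible A" using A by (simp add: invertible_det_nz)
 then have surj: "surj ?L"
  by (metis invertible_def matrix_right_invertible_surjective)
 obtain K where K: "\<And>F. F\<in>borel_measurable borel ==> (\<integral>\<^sup>+x. F (A *v x) \<partial>lborel) = K * (\<integral>\<^sup>+x. F x \<partial>lborel)"
  using linear_nn_integral[OF L surj] by blast
 let ?S = "cball 0 1 :: (real,'m) vec set"
 have S: "?S \<in> lmeasurable" by simp
 have cm: "compact (?L ` ?S)"
  using L by (intro compact_continuous_image linear_continuous_on) (auto simp: linear_conv_bounded_linear)
 then have bm: "?L ` ?S \<in> sets borel" by (simp add: compact_imp_closed borel_closed)
 let ?f = "unit_ball_vol (real DIM((real,'m) vec))"
 have "inj ?L" using inv by (metis invertible_def matrix_left_invertible_injective)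
 then have "(%x. indicator (?L ` ?S) (A *v x) :: ennreal) = indicator ?S"
  by (simp add: fun_eq_iff indicator_def inj_image_mem_iff)
 then have "emeasure lborel ?S = K * emeasure lborel (?L ` ?S)"
  using K[of "indicator (?L ` ?S)"] bm by simp
 moreover have "measure lebesgue (?L ` ?S) = \<bar>det (matrix ?L)\<bar> * measure lebesgue ?S"
  by (rule measure_linear_image[OF L S])
 then have "emeasure lborel (?L ` ?S) = ennreal \<bar>det A\<bar> * emeasure lborel ?S"
  using cm bm emeasure_compact_finite[OF cm] emeasure_compact_finite[OF compact_cball[of "0::(real,'m) vec" 1]]
   emeasure_eq_ennreal_measure[of lborel "?L ` ?S"] emeasure_eq_ennreal_measure[of lborel ?S]
  by (simp add: ennreal_mult)
 moreover have "emeasure lborel ?S = ennreal ?f"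
  by (simp add: emeasure_cball)
 ultimately have 1: "ennreal ?f * 1 = ennreal ?f * (K * ennreal \<bar>det A\<bar>)"
  by (simp add: mult_ac)
 have "1 = K * ennreal \<bar>det A\<bar>"
  using 1 unit_ball_vol_pos[of "real DIM((real,'m) vec)"]
  by (subst (asm) ennreal_mult_cancel_left) (auto simp: ennreal_eq_0_iff not_le simp del: unit_ball_vol_pos)
 then show ?thesis using K[OF F] by (metis mult.assoc mult.commute mult_1)
qed

text \<open>Coordinates of a tangent hyperplane need a finite well-ordered index type with n - 1
  elements, while the theorem supplies only the type of the ambient space. The disjunct i = 0 keeps
  the type nonempty in dimension one.\<close>

typedef (overloaded) 'a hyperplane_index = "{i::nat. i = 0 \<or> i < DIM('a::euclidean_space) - 1}"
 by auto

instantiation hyperplane_index :: (euclidean_space) wellorder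
begin

definition less_eq_hyperplane_index :: "'a hyperplane_index => 'a hyperplane_index => bool" where
 "less_eq_hyperplane_index i j \<longleftrightarrow> Rep_hyperplane_index i \<le> Rep_hyperplane_index j"

definition less_hyperplane_index :: "'a hyperplane_index => 'a hyperplane_index => bool" where
 "less_hyperplane_index i j \<longleftrightarrow> Rep_hyperplane_index i < Rep_hyperplane_index j"

instance
proof
 fix P :: "'a hyperplane_index => bool" and a
 assume *: "\<And>x. (\<And>y. y < x ==> P y) ==> P x"
 show "P a"
  by (induction a rule: measure_induct_rule[of Rep_hyperplane_index])
   (rule *, simp add: less_hyperplane_index_def)
qed (auto simp: less_eq_hyperplane_index_def less_hyperplane_index_def Rep_hyperplane_index_inject)

end

instance hyperplane_index :: (euclidean_space) finite
proof
 have "finite {i::nat. i = 0 \<or> i < DIM('a) - 1}" by simp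
 then have "finite (Abs_hyperplane_index ` {i::nat. i = 0 \<or> i < DIM('a) - 1} :: 'a hyperplane_index set)"
  by (rule finite_imageI)
 then show "finite (UNIV :: 'a hyperplane_index set)"
  using type_definition.Abs_image[OF type_definition_hyperplane_index] by metis
qed

lemma card_hyperplane_index:
 assumes "DIM('a::euclidean_space) \<ge> 2"
 shows "CARD('a hyperplane_index) = DIM('a) - 1"
proof -
 have "{i::nat. i = 0 \<or> i < DIM('a) - 1} = {..<DIM('a)-1}" using assms by auto
 then show ?thesis
  using type_definition.card[OF type_definition_hyperplane_index] by (metis card_lessThan)
qed

section \<open>The surface measure of the sphere\<close>

lemma indicator_mono_ennreal: "A \<subseteq> B ==> indicator A x \<le> (indicator B x :: ennreal)"
 by (auto simp: indicator_def)

text \<open>The substitution rule on compact intervals exhausting the half-line, with monotone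
  convergence on both sides. The image of g is left open: it is the half-line for the Gamma integral
  and the whole line for the chord coordinates.\<close>

lemma nn_integral_substitution_Ioi:
 fixes f :: "real => ennreal" and g g' :: "real => real"
 assumes [measurable]: "f \<in> borel_measurable borel"
  and deriv: "\<And>x. x > 0 ==> (g has_real_derivative g' x) (at x)"
  and cont: "continuous_on {0<..} g'"
  and pos: "\<And>x. x > 0 ==> g' x \<ge> 0"
 shows "(\<integral>\<^sup>+x. f x * indicator (g ` {0<..}) x \<partial>lborel)
  = (\<integral>\<^sup>+x. f (g x) * ennreal (g' x) * indicator {0<..} x \<partial>lborel)"
proof -
 define a b where "a k = 1 / (real k + 2)" and "b k = real k + 2" for k :: nat
 have ab: "0 < a k" "a k < b k" for k
  unfolding a_def b_def by (auto simp: field_simps add_pos_nonneg)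
 have amono: "a l \<le> a k" and bmono: "b k \<le> b l" if "k \<le> l" for k l
  using that by (auto simp: a_def b_def field_simps)
 have ex: "\<exists>k. x \<in> {a k..b k}" if "x > 0" for x
 proof -
  obtain k :: nat where k: "1 / x \<le> real k" using real_arch_simple by blast
  obtain l :: nat where l: "x \<le> real l" using real_arch_simple by blast
  have "1 / x \<le> real (max k l) + 2" using k by linarith
  then have "1 / (real (max k l) + 2) \<le> x"
   using that by (simp add: field_simps)
  moreover have "x \<le> real (max k l) + 2" using l by linarith
  ultimately show ?thesis by (intro exI[of _ "max k l"]) (auto simp: a_def b_def)
 qed
 have gmono: "g x \<le> g y" if "0 < x" "x \<le> y" for x y
  using that by (intro DERIV_nonneg_imp_nondecreasing[of x y g]) (auto intro!: exI deriv pos)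
 have contg: "continuous_on {a k..b k} g" for k
  using ab[of k] by (intro continuous_at_imp_continuous_on) (auto intro!: DERIV_isCont deriv)
 let ?g = "\<Union>k. {g (a k)..g (b k)}"
 have img: "g ` {0<..} = ?g"
 proof safe
  fix x :: real assume "x > 0"
  from ex[OF this] obtain k where "x \<in> {a k..b k}" ..
  then have "g x \<in> {g (a k)..g (b k)}" using ab[of k] by (auto intro!: gmono)
  then show "g x \<in> ?g" by blast
 next
  fix k y assume "y \<in> {g (a k)..g (b k)}"
  then obtain x where "x \<in> {a k..b k}" "g x = y"
   using IVT'[of g "a k" y "b k"] ab[of k] contg[of k] by auto
  then show "y \<in> g ` {0<..}" using ab[of k] by auto
 qed
 let ?h = "restrict_space borel {0<..}"
 have [measurable]: "g \<in> borel_measurable ?h"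
  by (intro borel_measurable_continuous_on_restrict continuous_at_imp_continuous_on)
   (auto intro!: DERIV_isCont deriv)
 have [measurable]: "g' \<in> borel_measurable ?h"
  by (intro borel_measurable_continuous_on_restrict cont)
 have m: "(%x. f (g x) * ennreal (g' x) * indicator {0<..} x) \<in> borel_measurable borel"
 proof -
  have "(%x. f (g x) * ennreal (g' x)) \<in> borel_measurable ?h"
   by measurable
  then show ?thesis
   by (subst (asm) borel_measurable_restrict_space_iff_ennreal) auto
 qed
 let ?f = "%g x. f (g x) * ennreal (g' x) * indicator {0<..} x"
 have "(\<integral>\<^sup>+x. f x * indicator (g ` {0<..}) x \<partial>lborel)
   = (\<integral>\<^sup>+x. (SUP k. f x * indicator {g (a k)..g (b k)} x) \<partial>lborel)"
 proof (rule nn_integral_cong)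
  fix x
  have "indicator ?g x = (SUP k. indicator {g (a k)..g (b k)} x :: ennreal)"
  proof (cases "\<exists>k. x \<in> {g (a k)..g (b k)}")
   case True
   then obtain k where k: "x \<in> {g (a k)..g (b k)}" by blast
   then show ?thesis
    by (intro antisym SUP_least) (auto intro!: SUP_upper2[of k] indicator_le_1 simp: indicator_def)
  next
   case False
   then have "indicator {g (a k)..g (b k)} x = (0::ennreal)" for k by (auto simp: indicator_def)
   with False show ?thesis by (simp only:) (auto simp: indicator_def)
  qed
  then show "f x * indicator (g ` {0<..}) x = (SUP k. f x * indicator {g (a k)..g (b k)} x)"
   by (simp add: img SUP_mult_left_ennreal)
 qed
 also have "\<dots> = (SUP k. \<integral>\<^sup>+x. f x * indicator {g (a k)..g (b k)} x \<partial>lborel)"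
 proof (rule nn_integral_monotone_convergence_SUP)
  show "incseq (%k x. f x * indicator {g (a k)..g (b k)} x)"
  proof (intro incseq_SucI le_funI mult_left_mono indicator_mono_ennreal)
   fix k
   show "{g (a k)..g (b k)} \<subseteq> {g (a (Suc k))..g (b (Suc k))}"
    using gmono[of "a (Suc k)" "a k"] gmono[of "b k" "b (Suc k)"] ab[of k] ab[of "Suc k"]
     amono[of k "Suc k"] bmono[of k "Suc k"] by auto
  qed auto
 qed measurable
 also have "\<dots> = (SUP k. \<integral>\<^sup>+x. f (g x) * ennreal (g' x) * indicator {a k..b k} x \<partial>lborel)"
 proof (rule SUP_cong[OF refl])
  fix k
  show "(\<integral>\<^sup>+x. f x * indicator {g (a k)..g (b k)} x \<partial>lborel)
    = (\<integral>\<^sup>+x. f (g x) * ennreal (g' x) * indicator {a k..b k} x \<partial>lborel)"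
  proof (rule nn_integral_substitution_aux)
   show "continuous_on {a k..b k} g'"
    using cont ab[of k] by (rule_tac continuous_on_subset) auto
  qed (use ab[of k] deriv pos in auto)
 qed
 also have "\<dots> = (SUP k. \<integral>\<^sup>+x. ?f g x * indicator {a k..b k} x \<partial>lborel)"
 proof (intro SUP_cong refl nn_integral_cong)
  fix k x
  have "x > 0" if "x \<in> {a k..b k}" using that ab[of k] by auto
  then show "f (g x) * ennreal (g' x) * indicator {a k..b k} x
    = ?f g x * indicator {a k..b k} x"
   by (auto simp: indicator_def)
 qed
 also have "\<dots> = (\<integral>\<^sup>+x. (SUP k. ?f g x * indicator {a k..b k} x) \<partial>lborel)"
 proof (rule nn_integral_monotone_convergence_SUP[symmetric])
  show "incseq (%k x. ?f g x * indicator {a k..b k} x)"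
   using amono bmono by (intro incseq_SucI le_funI mult_left_mono indicator_mono_ennreal) (auto intro: order_trans)
 qed (use m in measurable)
 also have "\<dots> = (\<integral>\<^sup>+x. f (g x) * ennreal (g' x) * indicator {0<..} x \<partial>lborel)"
 proof (rule nn_integral_cong)
  fix x
  show "(SUP k. ?f g x * indicator {a k..b k} x)
    = ?f g x"
  proof (cases "x > 0")
   case True
   then obtain k where "x \<in> {a k..b k}" using ex by blast
   then have "(SUP k. indicator {a k..b k} x :: ennreal) = 1"
    by (intro antisym SUP_least) (auto intro!: SUP_upper2[of k] indicator_le_1 simp: indicator_def)
   then show ?thesis by (simp flip: SUP_mult_left_ennreal)
  qed simp
 qed
 finally show ?thesis .
qed

text \<open>The substitution u = c t^b in the Gamma integral. The case b = 1 serves simplices, b = 2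
  the Gaussian weight, and b equal to the dimension the radial integrals.\<close>

lemma nn_integral_powr_exp_powr:
 fixes a b c :: real
 assumes "a > 0" "b > 0" "c > 0"
 shows "(\<integral>\<^sup>+t. ennreal (t powr (a - 1) * exp (- (c * t powr b))) * indicator {0<..} t \<partial>lborel)
  = ennreal (Gamma (a / b) / (b * c powr (a / b)))"
proof -
 define g where "g t = c * t powr b" for t :: real
 define f where "f u = ennreal (u powr (a / b - 1) / exp u)" for u :: real
 have img: "g ` {0<..} = {0<..}"
 proof safe
  fix u :: real assume "u > 0"
  then have "g ((u / c) powr (1 / b)) = u" "(u / c) powr (1 / b) > 0"
   using assms by (auto simp: g_def powr_powr)
  then show "u \<in> g ` {0<..}" by (metis greaterThan_iff image_eqI)
 qed (use assms in \<open>auto simp: g_def\<close>)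
 let ?g = "b * c powr (a / b)"
 let ?h = "%t. t powr (a - 1) * exp (- (c * t powr b))"
 let ?f = "ennreal ?g * (\<integral>\<^sup>+t. ennreal (?h t) * indicator {0<..} t \<partial>lborel)"
 let ?p = "ennreal (Gamma (a / b))"
 have "?p = (\<integral>\<^sup>+t. ennreal (indicator {0..} t * t powr (a / b - 1) / exp t) \<partial>lborel)"
  using assms by (subst Gamma_conv_nn_integral_real) auto
 also have "\<dots> = (\<integral>\<^sup>+t. f t * indicator (g ` {0<..}) t \<partial>lborel)"
  unfolding img by (intro nn_integral_cong_AE AE_I[of _ _ "{0}"]) (auto simp: f_def indicator_def)
 also have "\<dots> = (\<integral>\<^sup>+t. f (g t) * ennreal (c * b * t powr (b - 1)) * indicator {0<..} t \<partial>lborel)"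
 proof (rule nn_integral_substitution_Ioi)
  show "(g has_real_derivative c * b * t powr (b - 1)) (at t)" if "t > 0" for t
   using that unfolding g_def by (auto intro!: derivative_eq_intros)
  show "continuous_on {0<..} (%t. c * b * t powr (b - 1))"
   by (intro continuous_intros) auto
 qed (use assms in \<open>auto simp: f_def\<close>)
 also have "\<dots> = (\<integral>\<^sup>+t. ennreal ?g * (ennreal (?h t) * indicator {0<..} t) \<partial>lborel)"
 proof (rule nn_integral_cong)
  fix t :: real
  have "g t powr (a / b - 1) / exp (g t) * (c * b * t powr (b - 1))
    = b * c powr (a / b) * ?h t" if "t > 0"
  proof -
   have "g t powr (a / b - 1) = c powr (a / b - 1) * t powr (a - b)"
   proof -
    have "b * (a / b - 1) = a - b" using assms by (simp add: field_simps)
    then show ?thesis using that assms by (simp add: g_def powr_mult powr_powr)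
   qed
   moreover have "c powr (a / b) = c powr (a / b - 1) * c"
    using assms by (simp add: powr_diff)
   moreover have "t powr (a - 1) = t powr (a - b) * t powr (b - 1)"
    using that by (simp flip: powr_add)
   ultimately show ?thesis by (simp add: g_def exp_minus field_simps)
  qed
  then show "f (g t) * ennreal (c * b * t powr (b - 1)) * indicator {0<..} t
    = ennreal ?g * (ennreal (?h t) * indicator {0<..} t)"
   using assms by (auto simp: f_def indicator_def simp flip: ennreal_mult)
 qed
 also have "\<dots> = ?f"
  by (rule nn_integral_cmult) measurable
 finally have *: "?p = ?f" .
 have p: "?g > 0" using assms by simp
 let ?q = "ennreal ?g * ennreal (Gamma (a / b) / ?g)"
 have "?q = ?p"
  using p assms by (subst ennreal_mult[symmetric]) (auto intro!: divide_nonneg_pos Gamma_real_nonneg)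
 then have "?f
  = ?q"
  using * by (simp only:)
 then show ?thesis using p
  by (subst (asm) ennreal_mult_cancel_left) (auto simp: ennreal_eq_0_iff not_le)
qed

lemma measurable_sphere_measure:
 "g \<in> borel_measurable borel ==> g \<in> borel_measurable (sphere_measure :: 'a::euclidean_space measure)"
 by (simp add: sphere_measure_def measurable_restrict_space1 cong: measurable_cong_sets)

lemma space_sphere_measure [simp]: "space (sphere_measure :: 'a::euclidean_space measure) = sphere 0 1"
 by (simp add: sphere_measure_def space_scale_measure space_restrict_space)

lemma sets_sphere_measure [simp, measurable_cong]:
 "sets (sphere_measure :: 'a::euclidean_space measure) = sets (restrict_space borel (sphere 0 1))"
 by (simp add: sphere_measure_def)

lemma nn_integral_sphere_measure:
 fixes g :: "'a::euclidean_space => ennreal"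
 assumes g: "g \<in> borel_measurable (restrict_space borel (sphere 0 1))"
 shows "(\<integral>\<^sup>+x. g x \<partial>sphere_measure)
  = (\<integral>\<^sup>+x. g (x /\<^sub>R norm x) * (of_nat DIM('a) * indicator (cball 0 1 - {0}) x) \<partial>lborel)"
proof -
 let ?f = "cball 0 1 - {0}"
 have m: "(%x. x /\<^sub>R norm x) \<in> measurable (restrict_space lborel ?f)
   (restrict_space borel (sphere (0::'a) 1))"
  by (intro measurable_restrict_space2 measurable_restrict_space1) (auto simp: space_restrict_space)
 have "(\<integral>\<^sup>+x. g x \<partial>sphere_measure)
   = of_nat DIM('a) * (\<integral>\<^sup>+x. g (x /\<^sub>R norm x) \<partial>restrict_space lborel ?f)"
  unfolding sphere_measure_def using g
  by (subst nn_integral_scale_measure) (auto simp: nn_integral_distr[OF m])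
 also have "\<dots> = of_nat DIM('a) * (\<integral>\<^sup>+x. g (x /\<^sub>R norm x) * indicator ?f x \<partial>lborel)"
  by (subst nn_integral_restrict_space) auto
 also have "\<dots> = (\<integral>\<^sup>+x. of_nat DIM('a) * (g (x /\<^sub>R norm x) * indicator ?f x) \<partial>lborel)"
 proof (rule nn_integral_cmult[symmetric])
  have "(%x. g (x /\<^sub>R norm x)) \<in> borel_measurable (restrict_space lborel ?f)"
   by (rule measurable_compose[OF m g])
  then show "(%x. g (x /\<^sub>R norm x) * indicator ?f x) \<in> borel_measurable lborel"
   by (subst (asm) borel_measurable_restrict_space_iff_ennreal) auto
 qed
 finally show ?thesis by (simp add: mult_ac)
qed

lemma emeasure_sphere_measure_space:
 "emeasure (sphere_measure :: 'a::euclidean_space measure) (sphere 0 1) = ennreal (DIM('a) * unit_ball_vol DIM('a))"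
proof -
 have "emeasure (sphere_measure :: 'a measure) (sphere 0 1) = (\<integral>\<^sup>+x. 1 \<partial>(sphere_measure :: 'a measure))"
  by simp
 also have "\<dots> = (\<integral>\<^sup>+x. 1 * (of_nat DIM('a) * indicator (cball 0 1 - {0::'a}) x) \<partial>lborel)"
  by (rule nn_integral_sphere_measure) simp
 also have "\<dots> = of_nat DIM('a) * emeasure lborel (cball 0 1 - {0::'a})"
  by (simp only: mult_1, subst nn_integral_cmult_indicator) auto
 also have "emeasure lborel (cball 0 1 - {0::'a}) = emeasure lborel (cball 0 1 :: 'a set)"
  by (subst emeasure_Diff) (auto simp: emeasure_lborel_countable)
 also have "\<dots> = ennreal (unit_ball_vol DIM('a))" by (simp add: emeasure_cball)
 finally show ?thesis by (simp add: ennreal_mult ennreal_of_nat_eq_real_of_nat)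
qed

lemma finite_sphere_measure: "finite_measure (sphere_measure :: 'a::euclidean_space measure)"
 by (rule finite_measureI) (simp add: emeasure_sphere_measure_space)

text \<open>This integrates the kernel defining the surface measure along the ray through x, in the
  inverse scale: the integrand is n / t^(n+1) for t at least |x| and 0 before.\<close>

lemma nn_integral_unit_ball_radial:
 fixes x :: "'a::euclidean_space"
 assumes "x \<noteq> 0"
 shows "(\<integral>\<^sup>+t. ennreal (1 / t ^ (DIM('a) + 1)) * indicator {0<..} t *
   (of_nat DIM('a) * indicator (cball 0 1 - {0}) (x /\<^sub>R t)) \<partial>lborel) = ennreal (1 / norm x ^ DIM('a))"
proof -
 let ?n = "DIM('a)"
 let ?f = "%t. - (1 / t ^ ?n)"
 have "(\<integral>\<^sup>+t. ennreal (1 / t ^ (?n + 1)) * indicator {0<..} t *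
   (of_nat ?n * indicator (cball 0 1 - {0}) (x /\<^sub>R t)) \<partial>lborel)
   = (\<integral>\<^sup>+t. ennreal (?n / t ^ (?n + 1)) * indicator {norm x..} t \<partial>lborel)"
 proof (rule nn_integral_cong)
  fix t :: real
  have "x /\<^sub>R t \<in> cball 0 1 - {0} \<longleftrightarrow> norm x \<le> t" if "t > 0"
   using that assms by (auto simp: field_simps)
  moreover have "norm x \<le> t ==> t > 0" using assms by (metis less_le_trans zero_less_norm_iff)
  ultimately show "ennreal (1 / t ^ (?n + 1)) * indicator {0<..} t *
    (of_nat ?n * indicator (cball 0 1 - {0}) (x /\<^sub>R t))
    = ennreal (?n / t ^ (?n + 1)) * indicator {norm x..} t"
   by (auto simp: indicator_def ennreal_of_nat_eq_real_of_nat simp flip: ennreal_mult)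
 qed
 also have "\<dots> = ennreal (0 - (- (1 / norm x ^ ?n)))"
 proof (rule nn_integral_FTC_atLeast)
  fix t assume "norm x \<le> t"
  then have t: "t > 0" using assms by (metis less_le_trans zero_less_norm_iff)
  have "(?f has_real_derivative (?n * t ^ (?n - 1)) / (t ^ ?n * t ^ ?n)) (at t)"
   using t by (auto intro!: derivative_eq_intros)
  also have "(?n * t ^ (?n - 1)) / (t ^ ?n * t ^ ?n) = ?n / t ^ (?n + 1)"
  proof -
   have "t ^ ?n = t * t ^ (?n - 1)" by (metis DIM_positive power_eq_if less_numeral_extra(3))
   then show ?thesis using t by (simp add: field_simps)
  qed
  finally show "(?f has_real_derivative ?n / t ^ (?n + 1)) (at t)" .
  show "0 \<le> ?n / t ^ (?n + 1)" using t by simp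
 next
  have "filterlim (%t::real. t ^ ?n) at_top at_top"
   by (rule filterlim_pow_at_top) (auto simp: filterlim_ident)
  from tendsto_divide_0[OF tendsto_const filterlim_at_top_imp_at_infinity[OF this]]
  have "((%t. 1 / t ^ ?n) \<longlongrightarrow> (0::real)) at_top" .
  then show "(?f \<longlongrightarrow> (0::real)) at_top"
   using tendsto_minus[of "%t::real. 1 / t ^ ?n" 0 at_top] by simp
 qed simp
 finally show ?thesis by simp
qed

text \<open>
 The kernel \<open>\<kappa>\<close> and the kernel \<open>n 1\<^bsub>|x| \<le> 1\<^esub>\<close> have proportional integrals along rays. Both sides
 are obtained from one double integral over a point and a dilation factor, so that
 no polar coordinates are needed.
\<close>

lemma nn_integral_homogeneous_kernel:
 fixes g \<kappa> :: "'a::euclidean_space => ennreal"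
 assumes [measurable]: "g \<in> borel_measurable borel" "\<kappa> \<in> borel_measurable borel"
  and K: "AE x in lborel. (\<integral>\<^sup>+t. ennreal (t ^ (DIM('a) - 1)) * indicator {0<..} t * \<kappa> (t *\<^sub>R x) \<partial>lborel)
   = C * ennreal (1 / norm x ^ DIM('a))"
 shows "(\<integral>\<^sup>+x. g (x /\<^sub>R norm x) * \<kappa> x \<partial>lborel) = C * (\<integral>\<^sup>+x. g x \<partial>sphere_measure)"
proof -
 let ?n = "DIM('a)"
 define H :: "'a => ennreal" where "H x = of_nat ?n * indicator (cball 0 1 - {0}) x" for x
 have [measurable]: "cball (0::'a) 1 - {0} \<in> sets borel" by simp
 have [measurable]: "H \<in> borel_measurable borel" unfolding H_def by measurable
 define G where "G x = g (x /\<^sub>R norm x)" for x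
 have [measurable]: "G \<in> borel_measurable borel" unfolding G_def by measurable
 let ?b = "%t x. t *\<^sub>R x"
 have Gs: "G (?b t x) = G x" if "t > 0" for t x
 proof -
  have "inverse t * inverse (norm x) * t = inverse (norm x)" using that by simp
  moreover have "?b t x /\<^sub>R norm (?b t x) = (inverse t * inverse (norm x) * t) *\<^sub>R x"
   using that by simp
  ultimately show ?thesis by (simp only: G_def)
 qed
 have AE0: "AE x in lborel. (x::'a) \<noteq> 0"
  by (rule AE_lborel_singleton)
 have n1: "?n = Suc (?n - 1)" using DIM_positive[where 'a='a] by linarith
 let ?f = "%t x. ennreal (t ^ (?n - 1)) * indicator {0<..} t * \<kappa> (?b t x)"
 let ?g = "%t x. G (?b t x) * \<kappa> (?b t x) * ennreal (norm (?b t x) ^ ?n) * (ennreal (1 / t ^ (?n + 1)) * indicator {0<..} t * H (?b t x /\<^sub>R t))"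
 let ?h = "%t x. ennreal (1 / t ^ (?n + 1)) * indicator {0<..} t * H (x /\<^sub>R t)"
 let ?p = "%x. \<integral>\<^sup>+t. G x * \<kappa> x * ennreal (norm x ^ ?n) * ?h t x \<partial>lborel"
 let ?q = "%t. \<integral>\<^sup>+x. G x * \<kappa> x * ennreal (norm x ^ ?n) * ?h t x \<partial>lborel"
 let ?r = "%t. \<integral>\<^sup>+x. G x * ennreal (norm x ^ ?n) * H x * ?f t x \<partial>lborel"
 let ?u = "%x. \<integral>\<^sup>+t. G x * ennreal (norm x ^ ?n) * H x * ?f t x \<partial>lborel"
 let ?v = "%x. ennreal (norm x ^ ?n) * ennreal (1 / norm x ^ ?n)"
 let ?w = "%x. \<integral>\<^sup>+t. ennreal (1 / t ^ (?n + 1)) * indicator {0<..} t * H (x /\<^sub>R t) \<partial>lborel"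
 let ?a = "%t x. ennreal (t ^ ?n) * ennreal (norm (?b t x) ^ ?n) * ennreal (1 / t ^ (?n + 1))"
 let ?c = "\<integral>\<^sup>+x. G x * H x \<partial>lborel"
 have "(\<integral>\<^sup>+x. g (x /\<^sub>R norm x) * \<kappa> x \<partial>lborel)
   = (\<integral>\<^sup>+x. ?p x \<partial>lborel)"
 \<comment> \<open>Multiply by 1 = |x|^n * \<open>?w x\<close>, which is an integral over dilation
   factors t.\<close>
 proof (rule nn_integral_cong_AE, use AE0 in eventually_elim)
  fix x :: 'a assume x: "x \<noteq> 0"
  have "?v x = 1"
   using x by (simp flip: ennreal_mult)
  moreover have "?p x
    = G x * \<kappa> x * ennreal (norm x ^ ?n) * ?w x"
   by (rule nn_integral_cmult) measurable
  moreover have "?w x = ennreal (1 / norm x ^ ?n)"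
   unfolding H_def by (rule nn_integral_unit_ball_radial[OF x])
  ultimately show "g (x /\<^sub>R norm x) * \<kappa> x = ?p x"
   by (simp only: G_def mult.assoc mult_1_right)
 qed
 also have "\<dots> = (\<integral>\<^sup>+t. ?q t \<partial>lborel)"
  by (rule lborel_pair.Fubini'[symmetric]) measurable
 also have "\<dots> = (\<integral>\<^sup>+t. ?r t \<partial>lborel)"
 proof (rule nn_integral_cong)
  fix t :: real
  show "?q t
    = ?r t"
  proof (cases "t > 0")
   case True
   \<comment> \<open>Replacing x by t x fixes G, which depends on the direction alone, and moves the
     dilation from H to \<kappa>.\<close>
   have "?q t
    = (\<integral>\<^sup>+x. ennreal (t ^ ?n) * ?g t x \<partial>lborel)"
    by (subst nn_integral_lborel_scale[OF _ True], measurable, subst nn_integral_cmult, measurable)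
   also have "\<dots> = ?r t"
   proof (rule nn_integral_cong)
    fix x :: 'a
    have "?a t x
      = ennreal (norm x ^ ?n) * ennreal (t ^ (?n - 1))"
    proof -
     have "t ^ ?n * norm (?b t x) ^ ?n * (1 / t ^ (?n + 1)) = norm x ^ ?n * t ^ (?n - 1)"
     proof -
      have "t ^ ?n = t * t ^ (?n - 1)" by (metis n1 power_Suc)
      then show ?thesis using True by (simp add: power_mult_distrib field_simps)
     qed
     then show ?thesis using True by (simp flip: ennreal_mult)
    qed
    moreover have "ennreal (t ^ ?n) * ?g t x
     = G x * H x * \<kappa> (?b t x) * ?a t x"
     using True by (simp only: Gs) (simp add: mult_ac)
    ultimately show "ennreal (t ^ ?n) * ?g t x
     = G x * ennreal (norm x ^ ?n) * H x *
     ?f t x"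
     using True by (simp only:) (simp add: mult_ac)
   qed
   finally show ?thesis .
  qed simp
 qed
 also have "\<dots> = (\<integral>\<^sup>+x. ?u x \<partial>lborel)"
  by (rule lborel_pair.Fubini') measurable
 also have "\<dots> = (\<integral>\<^sup>+x. C * (G x * H x) \<partial>lborel)"
 proof (rule nn_integral_cong_AE, use AE0 K in eventually_elim)
  fix x :: 'a assume x: "x \<noteq> 0"
   and Kx: "(\<integral>\<^sup>+t. ennreal (t ^ (?n - 1)) * indicator {0<..} t * \<kappa> (?b t x) \<partial>lborel)
    = C * ennreal (1 / norm x ^ ?n)"
  have 1: "?v x = 1"
   using x by (simp flip: ennreal_mult)
  have "?u x
    = G x * H x * C * ?v x"
   by (subst nn_integral_cmult, measurable, simp only: Kx) (simp only: mult_ac)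
  then show "?u x = C * (G x * H x)"
   unfolding 1 by (simp add: mult_ac)
 qed
 also have "\<dots> = C * ?c"
  by (rule nn_integral_cmult) measurable
 also have "?c = (\<integral>\<^sup>+x. g x \<partial>sphere_measure)"
  unfolding G_def H_def by (rule nn_integral_sphere_measure[symmetric]) (rule measurable_restrict_space1, measurable)
 finally show ?thesis .
qed

lemma borel_measurable_fst_borel [measurable]:
 "fst \<in> borel_measurable (borel :: ('b::topological_space \<times> 'c::topological_space) measure)"
 by (intro borel_measurable_continuous_onI continuous_intros)

lemma borel_measurable_snd_borel [measurable]:
 "snd \<in> borel_measurable (borel :: ('b::topological_space \<times> 'c::topological_space) measure)"
 by (intro borel_measurable_continuous_onI continuous_intros)

lemma hyperplane_null_sets:
 fixes a :: "'a::euclidean_space"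
 assumes "a \<noteq> 0"
 shows "{x. a \<bullet> x = b} \<in> null_sets lborel"
proof -
 have "negligible {x. a \<bullet> x = b}" using assms by (intro negligible_hyperplane) auto
 then have "{x. a \<bullet> x = b} \<in> null_sets lebesgue" by (simp add: negligible_iff_null_sets)
 moreover have "{x. a \<bullet> x = b} \<in> sets borel" by (simp add: borel_closed closed_hyperplane)
 ultimately show ?thesis by (auto simp: null_sets_def)
qed

lemma AE_lborel_inner_neq:
 fixes a :: "'a::euclidean_space"
 assumes "a \<noteq> 0"
 shows "AE x in lborel. a \<bullet> x \<noteq> b"
 using AE_not_in[OF hyperplane_null_sets[OF assms, of b]] by simp

lemma AE_lborel_snd_nonzero:
 "AE x in (lborel :: ('b::euclidean_space \<times> 'c::euclidean_space) measure). snd x \<noteq> 0"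
proof -
 obtain b :: 'c where b: "b \<in> Basis" by fastforce
 then have "((0::'b), b) \<noteq> 0" by (auto simp: zero_prod_def)
 from AE_lborel_inner_neq[OF this, of 0] show ?thesis
  by eventually_elim (auto simp: inner_prod_def)
qed

text \<open>The homogeneous kernel lemma with g = 1 stands in for polar coordinates. The exponent of
  |x| in the exponential is the dimension, because this is how the measure of a small cap grows with
  the tangential part of its normal.\<close>

lemma nn_integral_radial_exp:
 fixes c :: real and k :: nat
 assumes c: "c > 0"
 shows "(\<integral>\<^sup>+x. ennreal (norm x ^ k * exp (- (c * norm x ^ DIM('a)))) \<partial>(lborel :: 'a::euclidean_space measure))
  = ennreal (unit_ball_vol DIM('a) * Gamma ((k + DIM('a)) / DIM('a)) / c powr ((k + DIM('a)) / DIM('a)))"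
proof -
 let ?n = "DIM('a)"
 define \<kappa> :: "'a => ennreal" where "\<kappa> x = ennreal (norm x ^ k * exp (- (c * norm x ^ ?n)))" for x
 have [measurable]: "\<kappa> \<in> borel_measurable borel" unfolding \<kappa>_def by measurable
 let ?g = "(k + ?n) / ?n"
 define C where "C = Gamma ?g / (?n * c powr ?g)"
 have C: "C \<ge> 0" unfolding C_def using c
  by (intro divide_nonneg_nonneg Gamma_real_nonneg divide_pos_pos add_nonneg_pos) (auto intro!: add_nonneg_pos)
 let ?f = "%x. \<integral>\<^sup>+t. ennreal (t ^ (?n - 1)) * indicator {0<..} t * \<kappa> (t *\<^sub>R x) \<partial>lborel"
 let ?h = "%t \<rho>. t powr (real (k + ?n) - 1) * exp (- ((c * \<rho> ^ ?n) * t powr ?n))"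
 let ?p = "%\<rho>. Gamma ?g / (?n * (c * \<rho> ^ ?n) powr ?g)"
 have "(\<integral>\<^sup>+x. 1 * \<kappa> x \<partial>lborel) = ennreal C * (\<integral>\<^sup>+x. 1 \<partial>(sphere_measure :: 'a measure))"
 proof (rule nn_integral_homogeneous_kernel)
  show "AE x in lborel. ?f x
   = ennreal C * ennreal (1 / norm x ^ ?n)"
  proof (rule AE_mp[OF AE_lborel_singleton[of 0]], rule AE_I2, rule impI)
   fix x :: 'a assume x: "x \<noteq> 0"
   define \<rho> where "\<rho> = norm x"
   have \<rho>: "\<rho> > 0" using x by (simp add: \<rho>_def)
   have "?f x
     = (\<integral>\<^sup>+t. ennreal (\<rho> ^ k) * (ennreal (?h t \<rho>) * indicator {0<..} t) \<partial>lborel)"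
   proof (rule nn_integral_cong)
    fix t :: real
    have "t ^ (?n - 1) * (norm (t *\<^sub>R x) ^ k * exp (- (c * norm (t *\<^sub>R x) ^ ?n)))
     = \<rho> ^ k * ?h t \<rho>" if "t > 0"
    proof -
     have "real (k + ?n) - 1 = real (k + (?n - 1))"
      using DIM_positive[where 'a='a] by linarith
     then have "t powr (real (k + ?n) - 1) = t ^ k * t ^ (?n - 1)"
      by (simp only: powr_realpow[OF that] power_add)
     then show ?thesis
      using that by (simp add: \<rho>_def power_add power_mult_distrib powr_realpow mult_ac)
    qed
    then show "ennreal (t ^ (?n - 1)) * indicator {0<..} t * \<kappa> (t *\<^sub>R x)
     = ennreal (\<rho> ^ k) * (ennreal (?h t \<rho>) * indicator {0<..} t)"
     using \<rho> by (auto simp: indicator_def \<kappa>_def simp flip: ennreal_mult)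
   qed
   also have "\<dots> = ennreal (\<rho> ^ k) * (\<integral>\<^sup>+t. ennreal (?h t \<rho>) * indicator {0<..} t \<partial>lborel)"
    by (rule nn_integral_cmult) measurable
   also have "\<dots> = ennreal (\<rho> ^ k) * ennreal (?p \<rho>)"
    using c \<rho> by (subst nn_integral_powr_exp_powr) (auto simp: add_nonneg_pos)
   also have "\<dots> = ennreal (\<rho> ^ k * ?p \<rho>)"
    using \<rho> by (intro ennreal_mult'[symmetric]) auto
   also have "\<rho> ^ k * ?p \<rho> = C * (1 / \<rho> ^ ?n)"
   proof -
    have "(\<rho> ^ ?n) powr ?g = \<rho> powr (?n * ?g)"
     using \<rho> by (simp add: powr_powr flip: powr_realpow)
    also have "?n * ?g = real (k + ?n)" by simp
    also have "\<rho> powr (real (k + ?n)) = \<rho> ^ k * \<rho> ^ ?n"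
     using \<rho> by (simp add: powr_realpow power_add del: of_nat_add)
    finally show ?thesis using c \<rho> by (simp add: C_def powr_mult field_simps)
   qed
   finally show "?f x
    = ennreal C * ennreal (1 / norm x ^ ?n)"
    using C ennreal_mult'[of C "1 / norm x ^ ?n"] by (simp add: \<rho>_def)
  qed
 qed auto
 also have "\<dots> = ennreal (C * (?n * unit_ball_vol ?n))"
  using C by (simp add: emeasure_sphere_measure_space ennreal_mult)
 also have "C * (?n * unit_ball_vol ?n) = unit_ball_vol ?n * Gamma ?g / c powr ?g"
  by (simp add: C_def)
 finally show ?thesis by (simp add: \<kappa>_def)
qed

lemma nn_integral_sphere_isometry:
 fixes T :: "'b::euclidean_space => 'a::euclidean_space"
 assumes T: "linear T" "\<And>x. norm (T x) = norm x" "DIM('b) = DIM('a)"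
  and g[measurable]: "g \<in> borel_measurable borel"
 shows "(\<integral>\<^sup>+x. g x \<partial>sphere_measure) = (\<integral>\<^sup>+x. g (T x) \<partial>sphere_measure)"
proof -
 have Tm[measurable]: "T \<in> borel_measurable borel"
  using T by (simp add: borel_measurable_continuous_onI linear_continuous_on linear_conv_bounded_linear)
 have [measurable]: "cball (0::'a) 1 - {0} \<in> sets borel" by simp
 let ?f = "cball 0 1 - {0}"
 have "(\<integral>\<^sup>+x. g x \<partial>sphere_measure)
  = (\<integral>\<^sup>+x. g (x /\<^sub>R norm x) * (of_nat DIM('a) * indicator ?f x) \<partial>lborel)"
  by (rule nn_integral_sphere_measure) (rule measurable_restrict_space1, measurable)
 also have "\<dots> = (\<integral>\<^sup>+x. g (T x /\<^sub>R norm (T x)) * (of_nat DIM('a) * indicator ?f (T x)) \<partial>lborel)"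
  by (rule isometry_nn_integral[OF T, symmetric]) measurable
 also have "\<dots> = (\<integral>\<^sup>+x. g (T (x /\<^sub>R norm x)) * (of_nat DIM('b) * indicator ?f x) \<partial>lborel)"
 proof (rule nn_integral_cong)
  fix x :: 'b
  have "T x = 0 \<longleftrightarrow> x = 0" using T(2) by (metis norm_eq_zero)
  then show "g (T x /\<^sub>R norm (T x)) * (of_nat DIM('a) * indicator ?f (T x))
   = g (T (x /\<^sub>R norm x)) * (of_nat DIM('b) * indicator ?f x)"
   using T by (simp add: linear_scale[OF T(1)] indicator_def)
 qed
 also have "\<dots> = (\<integral>\<^sup>+x. g (T x) \<partial>sphere_measure)"
  by (rule nn_integral_sphere_measure[symmetric]) (rule measurable_restrict_space1, measurable)
 finally show ?thesis .
qed

text \<open>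
 The second intersection with the sphere of the line through the pole \<open>(1, 0)\<close> with direction
 \<open>(-s, y)\<close>. The direction is only determined up to a factor; the weight
 distributes the surface measure over all representatives.
\<close>

definition chord_point :: "real => 'e::euclidean_space => real \<times> 'e" where
 "chord_point s y = (if s = 0 \<and> y = 0 then (1, 0)
   else (((norm y)\<^sup>2 - s\<^sup>2) / ((norm y)\<^sup>2 + s\<^sup>2), (2 * s / ((norm y)\<^sup>2 + s\<^sup>2)) *\<^sub>R y))"

definition chord_weight :: "nat => real => 'e::euclidean_space => real" where
 "chord_weight m s y = (if s > 0 then
   4 / Gamma (m / 2) * norm y ^ m * exp (- (norm y)\<^sup>2) * (2 * s) ^ (DIM('e) - 1) / ((norm y)\<^sup>2 + s\<^sup>2) ^ DIM('e)
  else 0)"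

lemma measurable_chord_point [measurable (raw)]:
 assumes [measurable]: "s \<in> borel_measurable M" "y \<in> borel_measurable M"
 shows "(%x. chord_point (s x) (y x :: 'e::euclidean_space)) \<in> borel_measurable M"
 unfolding chord_point_def by measurable

lemma measurable_chord_weight [measurable (raw)]:
 assumes [measurable]: "s \<in> borel_measurable M" "y \<in> borel_measurable M"
 shows "(%x. chord_weight m (s x) (y x :: 'e::euclidean_space)) \<in> borel_measurable M"
 unfolding chord_weight_def by measurable

lemma chord_weight_nonneg: "m > 0 ==> chord_weight m s y \<ge> 0"
 by (auto simp: chord_weight_def intro!: divide_nonneg_nonneg mult_nonneg_nonneg Gamma_real_nonneg)

text \<open>The Gaussian and the power of |y| involve the second component only, so along every ray
  with nonzero second component the kernel integrates to Gamma(m/2)/2 divided by |x|^n; this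
  constant is normalised away in the weight. For fixed y the first coordinate is then reparametrised
  by s > 0.\<close>

lemma nn_integral_sphere_chord:
 fixes T :: "real \<times> 'e::euclidean_space => 'a::euclidean_space"
 assumes T: "linear T" "\<And>x. norm (T x) = norm x" "DIM('a) = DIM('e) + 1" and m: "m > 0"
  and g[measurable]: "g \<in> borel_measurable borel"
 shows "(\<integral>\<^sup>+x. g x \<partial>sphere_measure)
  = (\<integral>\<^sup>+p. ennreal (chord_weight m (fst p) (snd p)) * g (T (chord_point (fst p) (snd p))) \<partial>lborel)"
proof -
 let ?n = "DIM('e) + 1"
 have [measurable]: "T \<in> borel_measurable borel"
  using T by (simp add: borel_measurable_continuous_onI linear_continuous_on linear_conv_bounded_linear)
 define G where "G x = g (T x)" for x
 have [measurable]: "G \<in> borel_measurable borel" unfolding G_def by measurable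
 define C where "C = Gamma (m / 2) / 2"
 have C: "C > 0" using m by (simp add: C_def Gamma_real_pos)
 define \<kappa> :: "real \<times> 'e => ennreal" where
  "\<kappa> x = ennreal (norm (snd x) ^ m * exp (- (norm (snd x))\<^sup>2) / norm x ^ ?n)" for x
 have [measurable]: "\<kappa> \<in> borel_measurable borel" unfolding \<kappa>_def by measurable
 let ?f = "%x. \<integral>\<^sup>+t. ennreal (t ^ (DIM(real \<times> 'e) - 1)) * indicator {0<..} t * \<kappa> (t *\<^sub>R x) \<partial>lborel"
 let ?g = "%y. \<integral>\<^sup>+s. ennreal C * (ennreal (chord_weight m s y) * G (chord_point s y)) \<partial>lborel"
 let ?h = "%t \<rho>. t powr (real m - 1) * exp (- (\<rho>\<^sup>2 * t powr 2))"
 let ?p = "%u \<rho>. u\<^sup>2 + \<rho>\<^sup>2"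
 let ?q = "%s \<rho>. (s\<^sup>2 + \<rho>\<^sup>2) / (2 * s\<^sup>2)"
 let ?r = "%y. \<integral>\<^sup>+c. G ((c, y) /\<^sub>R norm (c, y)) * \<kappa> (c, y) \<partial>lborel"
 have "ennreal C * (\<integral>\<^sup>+x. g x \<partial>sphere_measure) = ennreal C * (\<integral>\<^sup>+x. G x \<partial>sphere_measure)"
  using T unfolding G_def by (subst nn_integral_sphere_isometry[OF T(1,2)]) auto
 also have "\<dots> = (\<integral>\<^sup>+x. G (x /\<^sub>R norm x) * \<kappa> x \<partial>lborel)"
 proof (rule nn_integral_homogeneous_kernel[symmetric])
  show "AE x in lborel. ?f x
   = ennreal C * ennreal (1 / norm x ^ DIM(real \<times> 'e))"
  proof (rule AE_mp[OF AE_lborel_snd_nonzero], rule AE_I2, rule impI)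
   fix x :: "real \<times> 'e" assume x: "snd x \<noteq> 0"
   define \<rho> where "\<rho> = norm (snd x)"
   have \<rho>: "\<rho> > 0" using x by (simp add: \<rho>_def)
   have x0: "norm x > 0" using x by auto
   have "?f x
    = (\<integral>\<^sup>+t. ennreal (\<rho> ^ m / norm x ^ ?n) * (ennreal (?h t \<rho>) * indicator {0<..} t) \<partial>lborel)"
   proof (rule nn_integral_cong)
    fix t :: real
    have "t ^ DIM('e) * (norm (snd (t *\<^sub>R x)) ^ m * exp (- (norm (snd (t *\<^sub>R x)))\<^sup>2) / norm (t *\<^sub>R x) ^ ?n)
     = \<rho> ^ m / norm x ^ ?n * ?h t \<rho>" if "t > 0"
    proof -
     have "t powr (real m - 1) = t ^ m / t"
      using that by (simp add: powr_diff powr_realpow)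
     then show ?thesis
      using that x0 by (simp add: \<rho>_def power_mult_distrib field_simps)
    qed
    then show "ennreal (t ^ (DIM(real \<times> 'e) - 1)) * indicator {0<..} t * \<kappa> (t *\<^sub>R x)
     = ennreal (\<rho> ^ m / norm x ^ ?n) * (ennreal (?h t \<rho>) * indicator {0<..} t)"
     using \<rho> by (auto simp: indicator_def \<kappa>_def simp flip: ennreal_mult)
   qed
   also have "\<dots> = ennreal (\<rho> ^ m / norm x ^ ?n) * (\<integral>\<^sup>+t. ennreal (?h t \<rho>) * indicator {0<..} t \<partial>lborel)"
    by (rule nn_integral_cmult) measurable
   also have "\<dots> = ennreal (\<rho> ^ m / norm x ^ ?n) * ennreal (Gamma (m / 2) / (2 * \<rho>\<^sup>2 powr (m / 2)))"
    using m \<rho> by (subst nn_integral_powr_exp_powr) auto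
   also have "\<dots> = ennreal (\<rho> ^ m / norm x ^ ?n * (Gamma (m / 2) / (2 * \<rho>\<^sup>2 powr (m / 2))))"
    using \<rho> by (intro ennreal_mult'[symmetric]) auto
   also have "\<rho>\<^sup>2 powr (m / 2) = \<rho> ^ m"
   proof -
    have "\<rho>\<^sup>2 powr (m / 2) = (\<rho> powr 2) powr (m / 2)" using \<rho> by simp
    also have "\<dots> = \<rho> powr m" by (simp add: powr_powr del: powr_numeral)
    also have "\<dots> = \<rho> ^ m" using \<rho> by (simp add: powr_realpow)
    finally show ?thesis .
   qed
   also have "\<rho> ^ m / norm x ^ ?n * (Gamma (m / 2) / (2 * \<rho> ^ m)) = C * (1 / norm x ^ ?n)"
    using \<rho> by (simp add: C_def)
   finally show "?f x
    = ennreal C * ennreal (1 / norm x ^ DIM(real \<times> 'e))"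
    using C ennreal_mult'[of C "1 / norm x ^ ?n"] by simp
  qed
 qed auto
 also have "\<dots> = (\<integral>\<^sup>+y. ?r y \<partial>lborel)"
  unfolding lborel_prod[symmetric] by (subst lborel_pair.nn_integral_snd[symmetric]) (auto simp: lborel_prod)
 also have "\<dots> = (\<integral>\<^sup>+y. ?g y \<partial>lborel)"
 proof (rule nn_integral_cong_AE, rule AE_mp[OF AE_lborel_singleton[of 0]], rule AE_I2, rule impI)
  fix y :: 'e assume y: "y \<noteq> 0"
  define \<rho> where "\<rho> = norm y"
  have \<rho>: "\<rho> > 0" using y by (simp add: \<rho>_def)
  \<comment> \<open>The first coordinate becomes - h s. Then |(- h s, y)| = (|y|^2 + s^2) / (2 s) is
    rational in s, and normalising gives \<open>chord_point s y\<close>.\<close>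
  define h where "h s = (s\<^sup>2 - \<rho>\<^sup>2) / (2 * s)" for s
  define F where "F c = G ((c, y) /\<^sub>R norm (c, y)) * \<kappa> (c, y)" for c
  have [measurable]: "F \<in> borel_measurable borel" unfolding F_def by measurable
  have img: "h ` {0<..} = UNIV"
  proof (intro set_eqI iffI UNIV_I)
   fix u :: real
   have r: "sqrt (?p u \<rho>) > \<bar>u\<bar>" using \<rho>
    by (metis less_add_same_cancel1 real_sqrt_abs real_sqrt_less_iff zero_less_power)
   \<comment> \<open>The positive root of s^2 - 2 u s - \<rho>^2 = 0.\<close>
   have "h (u + sqrt (?p u \<rho>)) = u"
   proof -
    have "(u + sqrt (?p u \<rho>))\<^sup>2 = u\<^sup>2 + 2 * u * sqrt (?p u \<rho>) + ?p u \<rho>"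
     by (simp add: power2_sum)
    then have "(u + sqrt (?p u \<rho>))\<^sup>2 - \<rho>\<^sup>2 = u * (2 * (u + sqrt (?p u \<rho>)))"
     by (simp add: power2_eq_square algebra_simps)
    moreover have "u + sqrt (?p u \<rho>) > 0" using r by linarith
    ultimately show ?thesis by (simp add: h_def)
   qed
   moreover have "u + sqrt (?p u \<rho>) \<in> {0<..}" using r by auto
   ultimately show "u \<in> h ` {0<..}" by (metis image_eqI)
  qed
  have "(\<integral>\<^sup>+c. F c \<partial>lborel) = (\<integral>\<^sup>+c. F (- c) \<partial>lborel)"
   by (subst lborel_distr_uminus[symmetric]) (simp add: nn_integral_distr)
  also have "\<dots> = (\<integral>\<^sup>+c. F (- c) * indicator (h ` {0<..}) c \<partial>lborel)" by (simp add: img)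
  also have "\<dots> = (\<integral>\<^sup>+s. F (- h s) * ennreal (?q s \<rho>) * indicator {0<..} s \<partial>lborel)"
  proof (rule nn_integral_substitution_Ioi)
   show "(h has_real_derivative (s\<^sup>2 + \<rho>\<^sup>2) / (2 * s\<^sup>2)) (at s)" if "s > 0" for s
    unfolding h_def using that
    by (auto intro!: derivative_eq_intros simp: power2_eq_square field_simps)
   show "continuous_on {0<..} (%s. (s\<^sup>2 + \<rho>\<^sup>2) / (2 * s\<^sup>2))"
    by (intro continuous_intros) auto
  qed auto
  also have "\<dots> = ?g y"
  proof (rule nn_integral_cong)
   fix s :: real
   show "F (- h s) * ennreal (?q s \<rho>) * indicator {0<..} s
    = ennreal C * (ennreal (chord_weight m s y) * G (chord_point s y))"
   proof (cases "s > 0")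
    case s: True
    define q where "q = \<rho>\<^sup>2 + s\<^sup>2"
    have q: "q > 0" using s by (simp add: q_def add_nonneg_pos)
    have n: "norm (- h s, y) = q / (2 * s)"
    proof -
     have "(h s)\<^sup>2 + \<rho>\<^sup>2 = (q / (2 * s))\<^sup>2"
      using s by (simp add: h_def q_def power2_eq_square field_simps)
     then show ?thesis using s q
      by (simp add: norm_Pair flip: \<rho>_def)
    qed
    have p: "(- h s, y) /\<^sub>R norm (- h s, y) = chord_point s y"
     using s q unfolding n by (simp add: chord_point_def h_def flip: \<rho>_def) (simp add: q_def field_simps)
    have 2: "(2 * s) ^ ?n = (2 * s) ^ (DIM('e) - 1) * (2 * s)\<^sup>2"
     using DIM_positive[where 'a='e] by (metis One_nat_def Suc_pred add.commute add_Suc_shift one_add_one plus_1_eq_Suc power_add)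
    have "\<rho> ^ m * exp (- \<rho>\<^sup>2) / (q / (2 * s)) ^ ?n * ?q s \<rho> = C * chord_weight m s y"
    proof -
     have "C * chord_weight m s y = 2 * \<rho> ^ m * exp (- \<rho>\<^sup>2) * (2 * s) ^ (DIM('e) - 1) / q ^ DIM('e)"
      using s C by (simp add: chord_weight_def C_def q_def flip: \<rho>_def)
     moreover have "s\<^sup>2 + \<rho>\<^sup>2 = q" by (simp add: q_def)
     ultimately show ?thesis
      using s q by (simp only: power_divide 2) (simp add: power2_eq_square field_simps)
    qed
    then have w: "ennreal (\<rho> ^ m * exp (- \<rho>\<^sup>2) / (q / (2 * s)) ^ ?n) * ennreal (?q s \<rho>)
      = ennreal C * ennreal (chord_weight m s y)"
     using C \<rho> q s by (subst (1 2) ennreal_mult'[symmetric]) auto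
    have Fh: "F (- h s) = G (chord_point s y) * ennreal (\<rho> ^ m * exp (- \<rho>\<^sup>2) / (q / (2 * s)) ^ ?n)"
     unfolding F_def \<kappa>_def p unfolding n by (simp only: snd_conv \<rho>_def)
    have i: "indicator {0<..} s = (1::ennreal)" using s by simp
    show ?thesis
     unfolding Fh i mult_1_right mult.assoc w by (rule mult.left_commute[THEN trans]) (simp only: mult.commute)
   qed (simp add: chord_weight_def)
  qed
  finally show "?r y
   = ?g y"
   by (simp add: F_def)
 qed
 also have "\<dots> = (\<integral>\<^sup>+p. ennreal C * (ennreal (chord_weight m (fst p) (snd p)) * G (chord_point (fst p) (snd p))) \<partial>lborel)"
  unfolding lborel_prod[symmetric] by (subst lborel_pair.nn_integral_snd[symmetric]) (auto simp: lborel_prod)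
 also have "\<dots> = ennreal C * (\<integral>\<^sup>+p. ennreal (chord_weight m (fst p) (snd p)) * G (chord_point (fst p) (snd p)) \<partial>lborel)"
  by (rule nn_integral_cmult) measurable
 finally show ?thesis
  using C by (subst (asm) ennreal_mult_cancel_left) (auto simp: G_def)
qed

section \<open>Gaussian moments of determinants\<close>

text \<open>The sum does not depend on k, since composing with a transposition moves k to any other
  index. Adding the sums over all k leaves the full sum of c for each permutation.\<close>

lemma sum_permutations_apply:
 fixes c :: "'m::finite => real"
 shows "real CARD('m) * (\<Sum>p | p permutes (UNIV::'m set). c (p k)) = fact CARD('m) * (\<Sum>i\<in>UNIV. c i)"
proof -
 let ?P = "{p. p permutes (UNIV::'m set)}"
 have same: "(\<Sum>p\<in>?P. c (p l)) = (\<Sum>p\<in>?P. c (p k))" for l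
 proof (rule sum.reindex_bij_witness[where i="%p. p \<circ> Transposition.transpose k l" and j="%p. p \<circ> Transposition.transpose k l"])
  fix p assume "p \<in> ?P"
  then show "p \<circ> Transposition.transpose k l \<in> ?P"
   by (auto intro!: permutes_compose permutes_swap_id)
 qed (auto simp: o_assoc[symmetric] intro!: permutes_compose permutes_swap_id)
 have "real CARD('m) * (\<Sum>p\<in>?P. c (p k)) = (\<Sum>l\<in>UNIV. \<Sum>p\<in>?P. c (p l))"
 proof -
  have "(\<Sum>l\<in>(UNIV::'m set). \<Sum>p\<in>?P. c (p l)) = (\<Sum>l\<in>(UNIV::'m set). \<Sum>p\<in>?P. c (p k))"
   by (intro sum.cong refl same)
  then show ?thesis by simp
 qed
 also have "\<dots> = (\<Sum>p\<in>?P. \<Sum>l\<in>UNIV. c (p l))" by (rule sum.swap)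
 also have "\<dots> = (\<Sum>p\<in>?P. \<Sum>l\<in>UNIV. c l)"
 proof (rule sum.cong[OF refl])
  fix p assume "p \<in> ?P"
  then show "(\<Sum>l\<in>UNIV. c (p l)) = (\<Sum>l\<in>UNIV. c l)"
   by (intro sum.reindex_bij_betw) (simp add: permutes_bij)
 qed
 also have "\<dots> = fact CARD('m) * (\<Sum>i\<in>UNIV. c i)"
  by (simp add: card_permutations[OF refl])
 finally show ?thesis .
qed

text \<open>Positivity of k makes the power of \<open>max 0 t\<close> vanish on the negative
  half-line; for k = 0 it would be 1 there.\<close>

lemma half_gaussian_moment:
 assumes "k > 0"
 shows "has_bochner_integral lborel (%t::real. max 0 t ^ k * exp (- t\<^sup>2)) (Gamma ((real k + 1) / 2) / 2)"
proof -
 let ?f = "\<integral>\<^sup>+t. ennreal (max 0 t ^ k * exp (- t\<^sup>2)) \<partial>lborel"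
 let ?g = "Gamma ((real k + 1) / 2) / 2"
 have "?f
  = (\<integral>\<^sup>+t. ennreal (t powr (real (k + 1) - 1) * exp (- (1 * t powr 2))) * indicator {0<..} t \<partial>lborel)"
  using assms by (intro nn_integral_cong) (auto simp: indicator_def max_def powr_realpow)
 also have "\<dots> = ennreal ?g"
  by (subst nn_integral_powr_exp_powr) (auto simp: add.commute)
 finally have "?f = ennreal ?g" .
 moreover have "0 \<le> ?g" by (intro divide_nonneg_nonneg Gamma_real_nonneg) auto
 ultimately show ?thesis by (intro has_bochner_integral_nn_integral) auto
qed

lemma has_bochner_integral_prod_vec:
 fixes f :: "'m::finite => real => real"
 assumes "\<And>i. has_bochner_integral lborel (f i) (I i)"
 shows "has_bochner_integral lborel (%y::real^'m. \<Prod>i\<in>UNIV. f i (y $ i)) (\<Prod>i\<in>UNIV. I i)"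
proof -
 interpret product_sigma_finite "%_::'m. lborel :: real measure" ..
 have m: "(vec_lambda :: ('m => real) => real ^ 'm) \<in> borel_measurable (PiM UNIV (%_. lborel))"
  by (subst borel_measurable_euclidean_space) (auto simp: Basis_vec_def inner_axis)
 have [measurable]: "f i \<in> borel_measurable borel" for i
  using assms[of i] by (auto simp: has_bochner_integral_iff dest: borel_measurable_integrable)
 have [measurable]: "(%y::real^'m. y $ i) \<in> borel_measurable borel" for i
  by (intro borel_measurable_continuous_onI continuous_intros)
 let ?g = "%y::real^'m. \<Prod>i\<in>UNIV. f i (y $ i)"
 have F: "?g \<in> borel_measurable borel" by measurable
 have I: "integrable lborel (f i)" "integral\<^sup>L lborel (f i) = I i" for i
  using assms[of i] by (auto simp: has_bochner_integral_iff)
 let ?f = "PiM UNIV (%_::'m. lborel)"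
 let ?h = "\<Prod>i\<in>UNIV. I i"
 have "integrable ?f (%x. \<Prod>i\<in>UNIV. f i (x i))"
  by (rule product_integrable_prod) (auto simp: I)
 moreover have "(\<integral>x. (\<Prod>i\<in>UNIV. f i (x i)) \<partial>PiM UNIV (%_::'m. lborel)) = ?h"
  by (subst product_integral_prod) (auto simp: I)
 ultimately have "has_bochner_integral ?f (%x. \<Prod>i\<in>UNIV. f i (vec_lambda x $ i)) ?h"
  by (simp add: has_bochner_integral_iff)
 then have "has_bochner_integral (distr ?f borel vec_lambda) ?g ?h"
  by (simp add: has_bochner_integral_iff integral_distr[OF m F] integrable_distr_eq[OF m F])
 then show ?thesis by (simp only: lborel_vec_eq_distr_PiM)
qed

text \<open>The moment of the square of a coordinate other than the truncated one. The truncated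
  coordinate has k + 1 times this value.\<close>

definition half_gauss_moment :: "nat => nat => real" where
 "half_gauss_moment d k = Gamma ((real k + 1) / 2) / 4 * sqrt pi ^ (d - 1)"

lemma half_gauss_moment_pos: "half_gauss_moment d k > 0"
 unfolding half_gauss_moment_def by (intro mult_pos_pos divide_pos_pos Gamma_real_pos) auto

text \<open>The integrand is a product over coordinates. Of two different indices at least one is
  not k0 and leaves an odd one-dimensional integral, which kills the mixed moments. For the
  truncated coordinate the functional equation of Gamma produces the factor k + 1.\<close>

lemma gaussian_second_moment:
 fixes a b k0 :: "'m::finite"
 assumes k: "k > 0"
 shows "has_bochner_integral lborel
   (%y::real^'m. exp (- (norm y)\<^sup>2) * max 0 (y $ k0) ^ k * (y $ a) * (y $ b))
   (if a = b then half_gauss_moment CARD('m) k * (if a = k0 then k + 1 else 1) else 0)"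
proof -
 define f where "f j t = exp (- t\<^sup>2) * (if j = k0 then max 0 t ^ k else 1) *
   (if j = a then t else 1) * (if j = b then t else 1)" for j and t :: real
 have G1: "has_bochner_integral lborel (%t::real. exp (- t\<^sup>2)) (sqrt pi)"
  using has_bochner_integral_even_function[OF gaussian_moment_0] by simp
 have G2: "has_bochner_integral lborel (%t::real. exp (- t\<^sup>2) * t) 0"
  using has_bochner_integral_odd_function[OF gaussian_moment_1] by simp
 have G3: "has_bochner_integral lborel (%t::real. exp (- t\<^sup>2) * t * t) (sqrt pi / 2)"
  using has_bochner_integral_even_function[OF gaussian_moment_even_pos[of 1]]
  by (simp add: power2_eq_square mult_ac)
 let ?h = "Gamma ((real k + 1) / 2) / 2"
 have H1: "has_bochner_integral lborel (%t::real. exp (- t\<^sup>2) * max 0 t ^ k) ?h"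
  using half_gaussian_moment[OF k] by (simp add: mult.commute)
 let ?q = "%t::real. exp (- t\<^sup>2) * max 0 t ^ k * t"
 have H2: "has_bochner_integral lborel ?q (Gamma ((real k + 2) / 2) / 2)"
 proof -
  have "?q = (%t. max 0 t ^ (k + 1) * exp (- t\<^sup>2))"
   using k by (auto simp: fun_eq_iff max_def)
  then show ?thesis using half_gaussian_moment[of "k + 1"] by (simp add: add.commute)
 qed
 let ?p = "%t::real. exp (- t\<^sup>2) * max 0 t ^ k * t * t"
 have H3: "has_bochner_integral lborel ?p
   ((real k + 1) / 2 * ?h)"
 proof -
  have "?p = (%t. max 0 t ^ (k + 2) * exp (- t\<^sup>2))"
   using k by (auto simp: fun_eq_iff max_def)
  moreover have "Gamma (real (k + 2 + 1) / 2) = real (k + 1) / 2 * Gamma (real (k + 1) / 2)"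
  proof -
   have "real (k + 1) / 2 \<notin> \<int>\<^sub>\<le>\<^sub>0" by (auto elim!: nonpos_Ints_cases)
   from Gamma_plus1[OF this] show ?thesis by (simp add: add_divide_distrib add_ac)
  qed
  moreover have "Gamma ((real (k + 2) + 1) / 2) / 2 = (real k + 1) / 2 * ?h"
   using calculation(2) by (simp add: add_ac)
  ultimately show ?thesis using half_gaussian_moment[of "k + 2"] by (simp only:)
 qed
 define I where "I j = (if a = b then
    (if j = k0 then (if j = a then (real k + 1) / 2 * ?h else Gamma ((real k + 1) / 2) / 2)
    else if j = a then sqrt pi / 2 else sqrt pi)
   else (if j = k0 then (if j = a \<or> j = b then Gamma ((real k + 2) / 2) / 2 else Gamma ((real k + 1) / 2) / 2)
    else if j = a \<or> j = b then 0 else sqrt pi))" for j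
 let ?f = "\<Prod>j\<in>UNIV. I j"
 let ?g = "\<Prod>j\<in>UNIV - {k0}. I j"
 have "has_bochner_integral lborel (f j) (I j)" for j
  unfolding f_def I_def using G1 G2 G3 H1 H2 H3 by auto
 then have "has_bochner_integral lborel (%y::real^'m. \<Prod>j\<in>UNIV. f j (y $ j)) ?f"
  by (rule has_bochner_integral_prod_vec)
 moreover have "(\<Prod>j\<in>UNIV. f j (y $ j)) = exp (- (norm y)\<^sup>2) * max 0 (y $ k0) ^ k * (y $ a) * (y $ b)" for y :: "real^'m"
 proof -
  have "(norm y)\<^sup>2 = (\<Sum>j\<in>UNIV. (y $ j)\<^sup>2)"
   by (simp add: norm_vec_def L2_set_def sum_nonneg)
  then have "exp (- (norm y)\<^sup>2) = (\<Prod>j\<in>UNIV. exp (- (y $ j)\<^sup>2))"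
   by (simp add: exp_sum sum_negf[symmetric])
  then show ?thesis
   by (simp add: f_def prod.distrib prod.delta)
 qed
 moreover have "?f = (if a = b then half_gauss_moment CARD('m) k * (if a = k0 then k + 1 else 1) else 0)"
 proof (cases "a = b")
  case False
  then obtain j where "j \<noteq> k0" "j = a \<or> j = b" by metis
  then have "I j = 0" using False by (simp add: I_def)
  then show ?thesis using False by (auto simp: prod_zero_iff)
 next
  case True
  show ?thesis
  proof (cases "a = k0")
   case a: True
   have "?f = I k0 * ?g"
    by (rule prod.remove) auto
   also have "?g = (\<Prod>j\<in>UNIV - {k0}. sqrt pi)"
    using True a by (intro prod.cong) (auto simp: I_def)
   finally show ?thesis
    using True a by (simp add: I_def half_gauss_moment_def card_Diff_singleton)
  next
   case a: False
   have "?f = I k0 * ?g"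
    by (rule prod.remove) auto
   also have "?g = I a * (\<Prod>j\<in>UNIV - {k0} - {a}. I j)"
    using a by (intro prod.remove) auto
   also have "(\<Prod>j\<in>UNIV - {k0} - {a}. I j) = (\<Prod>j\<in>UNIV - {k0} - {a}. sqrt pi)"
    using True a by (intro prod.cong) (auto simp: I_def)
   also have "\<dots> = sqrt pi ^ (CARD('m) - 2)"
    using a by (simp add: card_Diff_singleton numeral_2_eq_2)
   finally have "?f = I k0 * (I a * sqrt pi ^ (CARD('m) - 2))" .
   moreover have "sqrt pi ^ (CARD('m) - 1) = sqrt pi * sqrt pi ^ (CARD('m) - 2)"
   proof -
    have "card {a, k0} \<le> CARD('m)" by (rule card_mono) auto
    then have "CARD('m) - 1 = Suc (CARD('m) - 2)" using a by auto
    then show ?thesis by simp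
   qed
   ultimately show ?thesis
    using True a by (simp add: I_def half_gauss_moment_def)
  qed
 qed
 ultimately show ?thesis by simp
qed

text \<open>Both determinants are expanded over permutations. The rows are independent with diagonal
  second moments, so only pairs of equal permutations survive, and each contributes the common
  product times k + 1 of the row that it sends to k0. Summing over permutations averages over that
  row.\<close>

lemma det_square_moment_axis:
 fixes k :: "'m::finite => nat" and k0 :: 'm
 assumes k: "\<And>i. k i > 0"
 shows "(\<integral>\<^sup>+y. ennreal ((det (\<chi> i. y i))\<^sup>2 * (\<Prod>i\<in>UNIV. exp (- (norm (y i))\<^sup>2) * max 0 (y i $ k0) ^ k i))
   \<partial>PiM (UNIV::'m set) (%_. lborel :: (real^'m) measure))
  = ennreal ((\<Prod>i\<in>UNIV. half_gauss_moment CARD('m) (k i)) * fact (CARD('m) - 1) * (\<Sum>i\<in>UNIV. real (k i + 1)))"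
proof -
 interpret product_sigma_finite "%_::'m. lborel :: (real^'m) measure" ..
 let ?P = "{p. p permutes (UNIV::'m set)}"
 let ?M = "PiM (UNIV::'m set) (%_. lborel :: (real^'m) measure)"
 have fin: "finite ?P" by (rule finite_permutations) simp
 define W where "W i y = exp (- (norm y)\<^sup>2) * max 0 (y $ k0) ^ k i" for i and y :: "real^'m"
 define \<mu> where "\<mu> i a b = (if a = b then half_gauss_moment CARD('m) (k i) * (if a = k0 then k i + 1 else 1) else 0)" for i a b
 have \<mu>: "has_bochner_integral lborel (%y. W i y * (y $ a) * (y $ b)) (\<mu> i a b)" for i a b
  unfolding W_def \<mu>_def by (rule gaussian_second_moment[OF k])
 let ?q = "%p q. \<Prod>i\<in>UNIV. \<mu> i (p i) (q i)"
 have trm: "has_bochner_integral ?M (%y. of_int (sign p) * of_int (sign q) * (\<Prod>i\<in>UNIV. W i (y i) * (y i $ p i) * (y i $ q i)))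
   (of_int (sign p) * of_int (sign q) * ?q p q)" for p q
 proof -
  have I: "integrable lborel (%y. W i y * (y $ p i) * (y $ q i))"
   "integral\<^sup>L lborel (%y. W i y * (y $ p i) * (y $ q i)) = \<mu> i (p i) (q i)" for i
   using \<mu>[of i "p i" "q i"] by (auto simp: has_bochner_integral_iff)
  have "has_bochner_integral ?M (%y. \<Prod>i\<in>UNIV. W i (y i) * (y i $ p i) * (y i $ q i)) (?q p q)"
   unfolding has_bochner_integral_iff
   using product_integrable_prod[of UNIV "%i y. W i y * (y $ p i) * (y $ q i)"]
    product_integral_prod[of UNIV "%i y. W i y * (y $ p i) * (y $ q i)"] I by simp
  then show ?thesis by (rule has_bochner_integral_mult_right)
 qed
 let ?h = "%y. (det (\<chi> i. y i))\<^sup>2 * (\<Prod>i\<in>UNIV. W i (y i))"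
 have expand: "?h y
   = (\<Sum>p\<in>?P. \<Sum>q\<in>?P. of_int (sign p) * of_int (sign q) * (\<Prod>i\<in>UNIV. W i (y i) * (y i $ p i) * (y i $ q i)))" for y :: "'m => real^'m"
 proof -
  define a where "a p = of_int (sign p) * (\<Prod>i\<in>UNIV. y i $ p i)" for p
  have "?h y = (\<Sum>p\<in>?P. \<Sum>q\<in>?P. a p * a q * (\<Prod>i\<in>UNIV. W i (y i)))"
  proof -
   have "det (\<chi> i. y i) = sum a ?P" by (simp add: det_def a_def)
   then show ?thesis by (simp only: power2_eq_square sum_product) (simp only: sum_distrib_right)
  qed
  then show ?thesis
   by (simp add: a_def prod.distrib mult_ac)
 qed
 let ?g = "\<Sum>p\<in>?P. \<Sum>q\<in>?P. of_int (sign p) * of_int (sign q) * ?q p q"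
 let ?p = "%y. (det (\<chi> i. y i))\<^sup>2 * (\<Prod>i\<in>UNIV. W i (y i))"
 have bi: "has_bochner_integral ?M ?p
   ?g"
  unfolding expand by (intro has_bochner_integral_sum trm)
 let ?f = "\<Prod>i\<in>UNIV. half_gauss_moment CARD('m) (k i)"
 let ?r = "%p. \<Prod>i\<in>UNIV. \<mu> i (p i) (p i)"
 let ?u = "\<Sum>i\<in>UNIV. real (k i + 1)"
 have "(\<Sum>q\<in>?P. of_int (sign p) * of_int (sign q) * ?q p q) = ?r p"
  if p: "p \<in> ?P" for p
 proof -
  have "(\<Sum>q\<in>?P. of_int (sign p) * of_int (sign q) * ?q p q)
   = (\<Sum>q\<in>?P. if q = p then (?r p) else 0)"
  proof (rule sum.cong[OF refl])
   fix q
   show "of_int (sign p) * of_int (sign q) * ?q p q = (if q = p then (?r p) else 0)"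
   proof (cases "q = p")
    case True
    have "of_int (sign p) * of_int (sign p) = (1::real)"
     by (simp add: sign_def)
    then show ?thesis using True by simp
   next
    case False
    then obtain i where "q i \<noteq> p i" by auto
    then have "\<mu> i (p i) (q i) = 0" by (simp add: \<mu>_def)
    then show ?thesis using False by (auto simp: prod_zero_iff)
   qed
  qed
  then show ?thesis using fin p by (simp add: sum.delta)
 qed
 then have "?g
   = (\<Sum>p\<in>?P. \<Prod>i\<in>UNIV. \<mu> i (p i) (p i))" by (intro sum.cong refl) auto
 also have "\<dots> = (\<Sum>p\<in>?P. ?f * real (k (inv p k0) + 1))"
 proof (rule sum.cong[OF refl])
  fix p assume p: "p \<in> ?P"
  then have pb: "p i = k0 \<longleftrightarrow> i = inv p k0" for i
   by (metis mem_Collect_eq permutes_inv_eq)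
  have "?r p = ?f * (\<Prod>i\<in>UNIV. if i = inv p k0 then real (k i + 1) else 1)"
   unfolding prod.distrib[symmetric] by (intro prod.cong refl) (auto simp: \<mu>_def pb)
  then show "?r p = ?f * real (k (inv p k0) + 1)"
   by (simp add: prod.delta)
 qed
 also have "\<dots> = ?f * (\<Sum>p\<in>?P. real (k (inv p k0) + 1))"
  by (simp add: sum_distrib_left)
 also have "(\<Sum>p\<in>?P. real (k (inv p k0) + 1)) = (\<Sum>p\<in>?P. real (k (p k0) + 1))"
  by (rule sum.reindex_bij_witness[where i=inv and j=inv]) (auto simp: permutes_inv permutes_inv_inv)
 also have "\<dots> = fact (CARD('m) - 1) * ?u"
 proof -
  have "real CARD('m) * (\<Sum>p\<in>?P. real (k (p k0) + 1)) = fact CARD('m) * ?u"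
   by (rule sum_permutations_apply)
  also have "fact CARD('m) = real CARD('m) * fact (CARD('m) - 1)"
   by (rule fact_reduce) simp
  finally show ?thesis by simp
 qed
 finally have val: "?g
  = ?f * fact (CARD('m) - 1) * ?u"
  by (simp add: mult.assoc)
 have nn: "?h y \<ge> 0" for y :: "'m => real^'m"
  by (auto intro!: mult_nonneg_nonneg prod_nonneg simp: W_def)
 have "(\<integral>\<^sup>+y. ennreal (?h y) \<partial>?M)
  = ennreal (integral\<^sup>L ?M ?p)"
  using bi nn by (intro nn_integral_eq_integral) (auto simp: has_bochner_integral_iff)
 also have "integral\<^sup>L ?M ?p
   = ?f * fact (CARD('m) - 1) * ?u"
  using bi val by (simp add: has_bochner_integral_iff)
 finally show ?thesis by (simp add: W_def)
qed

lemma measurable_det [measurable (raw)]: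
 fixes y :: "'x => 'm::finite => real^'m"
 assumes [measurable]: "\<And>i. (%x. y x i) \<in> borel_measurable M"
 shows "(%x. det (\<chi> i. y x i)) \<in> borel_measurable M"
proof -
 have [measurable]: "(%v::real^'m. v $ i) \<in> borel_measurable borel" for i
  by (intro borel_measurable_continuous_onI continuous_intros)
 show ?thesis unfolding det_def by simp measurable
qed

text \<open>An orthogonal map takes the axis to the direction of \<zeta>. The squared determinant
  does not change, and the positive part is homogeneous in |\<zeta>|.\<close>

lemma det_square_moment:
 fixes k :: "'m::finite => nat" and \<zeta> :: "real^'m"
 assumes k: "\<And>i. k i > 0"
 shows "(\<integral>\<^sup>+y. ennreal ((det (\<chi> i. y i))\<^sup>2 * (\<Prod>i\<in>UNIV. exp (- (norm (y i))\<^sup>2) * max 0 (\<zeta> \<bullet> y i) ^ k i))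
   \<partial>PiM (UNIV::'m set) (%_. lborel :: (real^'m) measure))
  = ennreal (norm \<zeta> ^ (\<Sum>i\<in>UNIV. k i) * (\<Prod>i\<in>UNIV. half_gauss_moment CARD('m) (k i)) * fact (CARD('m) - 1) * (\<Sum>i\<in>UNIV. real (k i + 1)))"
proof -
 let ?M = "PiM (UNIV::'m set) (%_. lborel :: (real^'m) measure)"
 have ps: "product_sigma_finite (%_::'m. lborel :: (real^'m) measure)" ..
 obtain k0 :: 'm where True by simp
 let ?g = "norm \<zeta> *\<^sub>R axis k0 1"
 obtain f :: "real^'m => real^'m" where f: "orthogonal_transformation f" and f\<zeta>: "f ?g = \<zeta>"
  by (rule orthogonal_transformation_exists[of "?g" \<zeta>]) (auto simp: norm_axis_1)
 have lf: "linear f" using f by (rule orthogonal_transformation_linear)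
 have nf: "norm (f x) = norm x" for x using f by (rule orthogonal_transformation_norm)
 have [measurable]: "f \<in> borel_measurable borel"
  using lf by (simp add: borel_measurable_continuous_onI linear_continuous_on linear_conv_bounded_linear)
 have \<zeta>f: "\<zeta> \<bullet> f x = norm \<zeta> * (x $ k0)" for x
 proof -
  have "\<zeta> \<bullet> f x = f ?g \<bullet> f x" by (simp only: f\<zeta>)
  also have "\<dots> = ?g \<bullet> x" using f by (simp add: orthogonal_transformation_def)
  finally show ?thesis by (simp add: inner_axis' inner_real_def)
 qed
 have detf: "(det (\<chi> i. f (y i)))\<^sup>2 = (det (\<chi> i. y i))\<^sup>2" for y :: "'m => real^'m"
 proof -
  have "(\<chi> i. f (y i)) = (\<chi> i. y i) ** transpose (matrix f)"
  proof -
   have "f (y i) = matrix f *v y i" for i using lf by (simp add: matrix_vector_mul)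
   then show ?thesis
    by (simp add: vec_eq_iff matrix_matrix_mult_def transpose_def matrix_vector_mult_def mult.commute)
  qed
  moreover have "\<bar>det (matrix f)\<bar> = 1" using f by (metis orthogonal_transformation_det)
  ultimately show ?thesis
   by (simp add: det_mul power_mult_distrib) (metis mult.right_neutral one_power2 power2_abs)
 qed
 define F where "F = (%y::'m => real^'m. ennreal ((det (\<chi> i. y i))\<^sup>2 * (\<Prod>i\<in>UNIV. exp (- (norm (y i))\<^sup>2) * max 0 (\<zeta> \<bullet> y i) ^ k i)))"
 have Fm: "F \<in> borel_measurable ?M" unfolding F_def by measurable
 let ?p = "%y. \<Prod>i\<in>UNIV. exp (- (norm (y i))\<^sup>2) * max 0 (y i $ k0) ^ k i"
 let ?f = "%y. (det (\<chi> i. y i))\<^sup>2 * ?p y"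
 let ?h = "norm \<zeta> ^ (\<Sum>i\<in>UNIV. k i)"
 have "(\<integral>\<^sup>+y. F y \<partial>?M) = (\<integral>\<^sup>+y. (\<Prod>i\<in>(UNIV::'m set). 1) * F (\<lambda>i\<in>UNIV. f (y i)) \<partial>?M)"
 proof (rule PiM_change_of_variables[OF ps ps, where w="%_ _. 1" and \<phi>="%_. f"])
  fix g :: "real^'m => ennreal" assume [measurable]: "g \<in> borel_measurable lborel"
  show "(\<integral>\<^sup>+x. g x \<partial>lborel) = (\<integral>\<^sup>+x. 1 * g (f x) \<partial>lborel)"
   using isometry_nn_integral[OF lf nf] by simp
 qed (use Fm in auto)
 also have "\<dots> = (\<integral>\<^sup>+y. ennreal ?h * ennreal (?f y) \<partial>?M)"
 proof (rule nn_integral_cong)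
  fix y :: "'m => real^'m"
  have "max 0 (norm \<zeta> * t) = norm \<zeta> * max 0 t" for t
   by (auto simp: max_def mult_le_0_iff zero_le_mult_iff)
  then have "(\<Prod>i\<in>UNIV. exp (- (norm (f (y i)))\<^sup>2) * max 0 (\<zeta> \<bullet> f (y i)) ^ k i)
    = norm \<zeta> ^ (\<Sum>i\<in>UNIV. k i) * ?p y"
   by (simp only: nf \<zeta>f power_mult_distrib prod.distrib power_sum) (simp only: mult_ac)
  moreover have "(\<lambda>i\<in>UNIV. f (y i)) = (%i. f (y i))" by (simp add: restrict_def)
  ultimately show "(\<Prod>i\<in>(UNIV::'m set). 1) * F (\<lambda>i\<in>UNIV. f (y i))
   = ennreal ?h * ennreal (?f y)"
   by (simp add: F_def detf mult_ac flip: ennreal_mult')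
 qed
 also have "\<dots> = ennreal ?h * (\<integral>\<^sup>+y. ennreal (?f y) \<partial>?M)"
 proof (rule nn_integral_cmult)
  have [measurable]: "(%v::real^'m. v $ i) \<in> borel_measurable borel" for i
   by (intro borel_measurable_continuous_onI continuous_intros)
  show "(%y. ennreal (?f y)) \<in> borel_measurable ?M"
   by measurable
 qed
 finally show ?thesis
  unfolding det_square_moment_axis[OF k] F_def by (simp add: mult.assoc flip: ennreal_mult')
qed

section \<open>Isometries and the measure of spherical caps\<close>

lemma isometry_inner:
 fixes T :: "'b::real_inner => 'a::real_inner"
 assumes "linear T" "\<And>x. norm (T x) = norm x"
 shows "T x \<bullet> T y = x \<bullet> y"
 unfolding dot_norm linear_add[OF assms(1), symmetric] assms(2) ..

text \<open>Any isometry f is corrected by the reflection in the hyperplane orthogonal to w = f u -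
  v, which exchanges the equally long vectors f u and v. For w = 0 the map R is the
  identity.\<close>

lemma ex_isometry_to_unit:
 fixes u :: "'b::euclidean_space" and v :: "'a::euclidean_space"
 assumes dim: "DIM('b) = DIM('a)" and uv: "norm u = norm v"
 shows "\<exists>T::'b => 'a. linear T \<and> (\<forall>x. norm (T x) = norm x) \<and> T u = v"
proof -
 obtain f :: "'b => 'a" where f: "linear f" "\<And>x. norm (f x) = norm x"
  using isomorphisms_UNIV_UNIV[OF dim] by metis
 define w where "w = f u - v"
 define R where "R x = x - (2 * (x \<bullet> w) / (w \<bullet> w)) *\<^sub>R w" for x
 have lin: "linear R"
  unfolding R_def
  by (intro linearI) (simp_all add: inner_add_left algebra_simps add_divide_distrib scaleR_add_left)
 have nR: "norm (R x) = norm x" for x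
 proof -
  have "R x \<bullet> R x = x \<bullet> x"
  proof (cases "w = 0")
   case False
   then have "w \<bullet> w \<noteq> 0" by simp
   then show ?thesis
    by (simp add: R_def inner_diff_left inner_diff_right inner_commute field_simps power2_eq_square)
  qed (simp add: R_def)
  then show ?thesis by (simp add: norm_eq_sqrt_inner)
 qed
 have "R (f u) = v"
 proof (cases "w = 0")
  case False
  have "f u \<bullet> f u = v \<bullet> v" using f(2)[of u] uv by (metis dot_square_norm)
  then have "w \<bullet> w = 2 * (f u \<bullet> w)"
   by (simp add: w_def inner_diff_left inner_diff_right inner_commute)
  moreover have "w \<bullet> w \<noteq> 0" using False by simp
  ultimately have "2 * (f u \<bullet> w) / (w \<bullet> w) = 1" by simp
  then show ?thesis by (simp only: R_def scaleR_one) (simp add: w_def)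
 qed (simp add: R_def w_def)
 then show ?thesis
  using lin nR f by (intro exI[of _ "R \<circ> f"]) (auto intro: linear_compose)
qed

lemma isometry_measurable:
 fixes T :: "'b::euclidean_space => 'a::euclidean_space"
 shows "linear T ==> T \<in> borel_measurable borel"
 by (simp add: borel_measurable_continuous_onI linear_continuous_on linear_conv_bounded_linear)

lemma emeasure_cone_slab:
 fixes t \<rho> :: real
 assumes "t \<ge> 0" "\<rho> \<ge> 0"
 shows "emeasure lborel {p :: real \<times> 'e::euclidean_space. 0 \<le> fst p \<and> fst p \<le> t \<and> norm (snd p) \<le> fst p * \<rho>}
  = ennreal (unit_ball_vol DIM('e) * \<rho> ^ DIM('e) * t ^ (DIM('e) + 1) / (DIM('e) + 1))"
proof -
 let ?d = "DIM('e)"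
 let ?S = "{p :: real \<times> 'e. 0 \<le> fst p \<and> fst p \<le> t \<and> norm (snd p) \<le> fst p * \<rho>}"
 have [measurable]: "?S \<in> sets borel"
  by (intro borel_closed closed_Collect_conj closed_Collect_le continuous_intros)
 let ?f = "\<integral>\<^sup>+c. (\<integral>\<^sup>+y. indicator ?S (c, y) \<partial>lborel) \<partial>lborel"
 have "emeasure lborel ?S = ?f"
 proof -
  have "emeasure lborel ?S = (\<integral>\<^sup>+p. indicator ?S p \<partial>(lborel \<Otimes>\<^sub>M lborel))"
   by (simp add: lborel_prod)
  also have "\<dots> = ?f"
   by (subst lborel.nn_integral_fst[symmetric]) (auto simp: lborel_prod)
  finally show ?thesis .
 qed
 also have "\<dots> = (\<integral>\<^sup>+c. ennreal (unit_ball_vol ?d * \<rho> ^ ?d * c ^ ?d) * indicator {0..t} c \<partial>lborel)"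
 proof (rule nn_integral_cong)
  fix c :: real
  show "(\<integral>\<^sup>+y. indicator ?S (c, y) \<partial>lborel) = ennreal (unit_ball_vol ?d * \<rho> ^ ?d * c ^ ?d) * indicator {0..t} c"
  proof (cases "c \<in> {0..t}")
   case True
   then have "(%y. indicator ?S (c, y) :: ennreal) = indicator (cball 0 (c * \<rho>))"
    by (auto simp: indicator_def fun_eq_iff)
   moreover have "0 \<le> c * \<rho>" using True assms by auto
   ultimately show ?thesis
    using True by (simp add: emeasure_cball power_mult_distrib mult_ac)
  next
   case False
   then have "(%y. indicator ?S (c, y) :: ennreal) = (%_. 0)"
    by (auto simp: indicator_def fun_eq_iff)
   then show ?thesis using False by simp
  qed
 qed
 also have "\<dots> = ennreal (unit_ball_vol ?d * \<rho> ^ ?d * t ^ (?d + 1) / (?d + 1) - unit_ball_vol ?d * \<rho> ^ ?d * 0 ^ (?d + 1) / (?d + 1))"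
 proof (rule nn_integral_FTC_Icc)
  fix c :: real
  show "((%c. unit_ball_vol ?d * \<rho> ^ ?d * c ^ (?d + 1) / (?d + 1)) has_real_derivative unit_ball_vol ?d * \<rho> ^ ?d * c ^ ?d) (at c)"
   by (auto intro!: derivative_eq_intros simp del: power_Suc)
 qed (use assms in auto)
 finally show ?thesis by simp
qed

lemma emeasure_sphere_measure:
 assumes [measurable]: "A \<in> sets borel"
 shows "emeasure (sphere_measure :: 'a::euclidean_space measure) (A \<inter> sphere 0 1)
  = of_nat DIM('a) * emeasure lborel {x. x \<noteq> 0 \<and> norm x \<le> 1 \<and> x /\<^sub>R norm x \<in> A}"
proof -
 have AS: "A \<inter> sphere 0 1 \<in> sets (sphere_measure :: 'a measure)"
  by (auto simp: sets_restrict_space)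
 have B: "{x. x \<noteq> 0 \<and> norm x \<le> 1 \<and> x /\<^sub>R norm x \<in> A} \<in> sets lborel" by measurable
 let ?f = "emeasure (sphere_measure :: 'a measure) (A \<inter> sphere 0 1)"
 let ?g = "\<integral>\<^sup>+x. indicator A x \<partial>sphere_measure"
 have "?f = ?g"
 proof -
  have "?f = (\<integral>\<^sup>+x. indicator (A \<inter> sphere 0 1) x \<partial>sphere_measure)"
   using AS by (rule nn_integral_indicator[symmetric])
  also have "\<dots> = ?g"
   by (rule nn_integral_cong) (auto simp: indicator_def)
  finally show ?thesis .
 qed
 also have "\<dots> = (\<integral>\<^sup>+x. indicator A (x /\<^sub>R norm x) * (of_nat DIM('a) * indicator (cball 0 1 - {0}) x) \<partial>lborel)"
  by (rule nn_integral_sphere_measure) (rule measurable_restrict_space1, measurable)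
 also have "\<dots> = (\<integral>\<^sup>+x. of_nat DIM('a) * indicator {x. x \<noteq> 0 \<and> norm x \<le> 1 \<and> x /\<^sub>R norm x \<in> A} x \<partial>lborel)"
  by (intro nn_integral_cong) (auto simp: indicator_def)
 finally show ?thesis using B by (simp add: nn_integral_cmult_indicator)
qed

text \<open>In coordinates with first axis along a, the condition |p| \<le> |a| * fst p is a
  circular cone of slope \<rho>. Its part in the unit ball lies between its parts up to the heights
  1 / |a| and 1, whose volumes are explicit.\<close>

lemma cap_emeasure_bounds:
 fixes a :: "'a::euclidean_space"
 assumes dim: "DIM('a) = DIM('e::euclidean_space) + 1" and a: "norm a \<ge> 1"
 defines "\<rho> \<equiv> sqrt ((norm a)\<^sup>2 - 1)"
 shows "emeasure sphere_measure ({z. a \<bullet> z \<ge> 1} \<inter> sphere 0 1) \<le> ennreal (unit_ball_vol DIM('e) * \<rho> ^ DIM('e))"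
  and "ennreal (unit_ball_vol DIM('e) * \<rho> ^ DIM('e) / norm a ^ DIM('a)) \<le> emeasure sphere_measure ({z. a \<bullet> z \<ge> 1} \<inter> sphere 0 1)"
proof -
 let ?d = "DIM('e)"
 have a0: "norm a > 0" using a by linarith
 have \<rho>: "\<rho> \<ge> 0" "\<rho>\<^sup>2 = (norm a)\<^sup>2 - 1" using a by (auto simp: \<rho>_def)
 obtain T :: "real \<times> 'e => 'a" where T: "linear T" "\<And>x. norm (T x) = norm x" and Ta: "T (1, 0) = a /\<^sub>R norm a"
  using ex_isometry_to_unit[of "(1::real, 0::'e)" "a /\<^sub>R norm a"] dim a0 by (auto simp: norm_Pair)
 have [measurable]: "T \<in> borel_measurable borel" by (rule isometry_measurable[OF T(1)])
 let ?h = "%p. norm a * fst p"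
 have aT: "a \<bullet> T p = ?h p" for p
 proof -
  have "a = norm a *\<^sub>R T (1, 0)" using Ta a0 by simp
  then have "a \<bullet> T p = norm a * (T (1, 0) \<bullet> T p)" by (metis inner_scaleR_left)
  then show ?thesis by (simp add: isometry_inner[OF T] inner_prod_def)
 qed
 have T0: "T p = 0 \<longleftrightarrow> p = 0" for p using T(2) by (metis norm_eq_zero)
 define S where "S = {x::'a. x \<noteq> 0 \<and> norm x \<le> 1 \<and> x /\<^sub>R norm x \<in> {z. a \<bullet> z \<ge> 1}}"
 have [measurable]: "S \<in> sets borel" unfolding S_def by measurable
 have "emeasure lborel S = (\<integral>\<^sup>+p. indicator S (T p) \<partial>lborel)"
  using isometry_nn_integral[OF T, of "indicator S"] dim by simp
 also have "\<dots> = (\<integral>\<^sup>+p. indicator (T -` S) p \<partial>lborel)" by (simp add: indicator_def)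
 also have "\<dots> = emeasure lborel (T -` S)" by (rule nn_integral_indicator) (simp add: measurable_sets_borel[of T borel])
 finally have eS: "emeasure lborel S = emeasure lborel (T -` S)" .
 have TS: "p \<in> T -` S \<longleftrightarrow> p \<noteq> 0 \<and> norm p \<le> 1 \<and> norm a * fst p \<ge> norm p" for p
  by (auto simp: S_def T0 T(2) aT field_simps)
 have key: "?h p \<ge> norm p \<longleftrightarrow> fst p \<ge> 0 \<and> norm (snd p) \<le> fst p * \<rho>" for p :: "real \<times> 'e"
 proof -
  have n: "(norm p)\<^sup>2 = (fst p)\<^sup>2 + (norm (snd p))\<^sup>2"
   by (metis norm_Pair prod.collapse real_norm_def power2_abs real_sqrt_pow2 sum_power2_ge_zero)
  have "norm p \<le> norm a * fst p \<longleftrightarrow> fst p \<ge> 0 \<and> (norm p)\<^sup>2 \<le> (?h p)\<^sup>2"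
  proof
   assume *: "norm p \<le> ?h p"
   then have "0 \<le> ?h p" using norm_ge_zero order_trans by blast
   then have "0 \<le> fst p" using a0 by (simp add: zero_le_mult_iff)
   then show "fst p \<ge> 0 \<and> (norm p)\<^sup>2 \<le> (?h p)\<^sup>2" using * by (auto intro: power_mono)
  next
   assume "fst p \<ge> 0 \<and> (norm p)\<^sup>2 \<le> (?h p)\<^sup>2"
   then show "norm p \<le> ?h p" by (intro power2_le_imp_le[of "norm p"]) auto
  qed
  also have "(norm p)\<^sup>2 \<le> (?h p)\<^sup>2 \<longleftrightarrow> (norm (snd p))\<^sup>2 \<le> (fst p * \<rho>)\<^sup>2"
   by (simp add: n power_mult_distrib \<rho>(2) algebra_simps)
  also have "fst p \<ge> 0 \<and> (norm (snd p))\<^sup>2 \<le> (fst p * \<rho>)\<^sup>2 \<longleftrightarrow> fst p \<ge> 0 \<and> norm (snd p) \<le> fst p * \<rho>"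
  proof (intro conj_cong refl iffI)
   assume "0 \<le> fst p" "(norm (snd p))\<^sup>2 \<le> (fst p * \<rho>)\<^sup>2"
   then show "norm (snd p) \<le> fst p * \<rho>" using \<rho>(1) by (intro power2_le_imp_le[of "norm (snd p)"]) auto
  qed (auto intro: power_mono)
  finally show ?thesis .
 qed
 define C where "C t = {p :: real \<times> 'e. 0 \<le> fst p \<and> fst p \<le> t \<and> norm (snd p) \<le> fst p * \<rho>}" for t
 have [measurable]: "C t \<in> sets borel" for t unfolding C_def
  by (intro borel_closed closed_Collect_conj closed_Collect_le continuous_intros)
 have fn: "\<bar>fst p\<bar> \<le> norm p" for p :: "real \<times> 'e" using norm_fst_le[of "fst p" "snd p"] by simp
 have up: "T -` S \<subseteq> C 1"
 proof
  fix p assume "p \<in> T -` S"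
  moreover have "fst p \<le> norm p" using fn[of p] by linarith
  ultimately show "p \<in> C 1" unfolding TS key by (auto simp: C_def)
 qed
 have lo: "C (1 / norm a) - {0} \<subseteq> T -` S"
 proof
  fix p assume p: "p \<in> C (1 / norm a) - {0}"
  then have "norm p \<le> ?h p" by (auto simp: C_def key)
  moreover have "?h p \<le> 1" using p a0 by (auto simp: C_def field_simps)
  ultimately show "p \<in> T -` S" using p unfolding TS by auto
 qed
 let ?f = "emeasure sphere_measure ({z. a \<bullet> z \<ge> 1} \<inter> sphere 0 1)"
 let ?g = "of_nat DIM('a) * emeasure lborel (T -` S)"
 have em: "?f = ?g"
  using eS unfolding S_def by (subst emeasure_sphere_measure) auto
 have n: "(of_nat DIM('a) :: ennreal) = ennreal (real ?d + 1)"
  by (simp only: ennreal_of_nat_eq_real_of_nat dim of_nat_add of_nat_1)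
 let ?q = "ennreal (unit_ball_vol ?d * \<rho> ^ ?d)"
 have "?g \<le> of_nat DIM('a) * emeasure lborel (C 1)"
  by (intro mult_left_mono emeasure_mono up) auto
 also have "\<dots> = ?q"
  unfolding C_def n using \<rho>(1)
  by (subst emeasure_cone_slab, simp, simp, subst ennreal_mult'[symmetric]) (auto simp: add.commute)
 finally show "?f \<le> ?q"
  by (simp only: em)
 let ?p = "ennreal (unit_ball_vol ?d * \<rho> ^ ?d / norm a ^ DIM('a))"
 have "?p = of_nat DIM('a) * emeasure lborel (C (1 / norm a))"
  unfolding C_def n using \<rho>(1) a0
  by (subst emeasure_cone_slab, simp, simp, subst ennreal_mult'[symmetric]) (auto simp: power_divide dim add.commute)
 also have "emeasure lborel (C (1 / norm a)) = emeasure lborel (C (1 / norm a) - {0})"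
  by (intro emeasure_eq_AE) (auto intro: AE_mp[OF AE_lborel_singleton[of 0]])
 also have "of_nat DIM('a) * emeasure lborel (C (1 / norm a) - {0}) \<le> ?g"
  by (intro mult_left_mono emeasure_mono lo) (auto simp: measurable_sets_borel[of T borel])
 finally show "?p \<le> ?f"
  by (simp only: em)
qed

section \<open>Simplicial cones\<close>

lemma infdist_hyperplane:
 fixes a :: "'a::euclidean_space"
 assumes "a \<noteq> 0"
 shows "infdist y {z. a \<bullet> z = b} = \<bar>a \<bullet> y - b\<bar> / norm a"
proof (rule antisym)
 have a: "a \<bullet> a \<noteq> 0" "norm a > 0" using assms by auto
 define z where "z = y - ((a \<bullet> y - b) / (a \<bullet> a)) *\<^sub>R a"
 have z: "a \<bullet> z = b" using a by (simp add: z_def inner_diff_right)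
 let ?f = "\<bar>a \<bullet> y - b\<bar> / norm a"
 let ?g = "infdist y {z. a \<bullet> z = b}"
 have "?g \<le> dist y z" using z by (intro infdist_le) simp
 also have "dist y z = ?f"
  using a by (simp add: z_def dist_norm abs_mult dot_square_norm power2_eq_square)
 finally show "?g \<le> ?f" .
 have "?f \<le> dist y x" if "a \<bullet> x = b" for x
 proof -
  have "\<bar>a \<bullet> y - b\<bar> = \<bar>a \<bullet> (y - x)\<bar>" using that by (simp add: inner_diff_right)
  also have "\<dots> \<le> norm a * norm (y - x)" by (rule Cauchy_Schwarz_ineq2)
  finally show ?thesis using a by (simp add: dist_norm field_simps)
 qed
 moreover have "{z. a \<bullet> z = b} \<noteq> {}" using z by auto
 ultimately show "?f \<le> ?g"
  by (subst infdist_notempty) (auto intro!: cINF_greatest)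
qed

text \<open>
 The vector \<open>a\<close> with \<open>aff A = {z | a \<bullet> z = 1}\<close>, written in terms of distances to \<open>aff A\<close>
 so that it depends measurably on the points of \<open>A\<close>.
\<close>

definition plane_normal :: "'a::euclidean_space set => 'a" where
 "plane_normal A = (\<Sum>b\<in>Basis. (((infdist (- b) (affine hull A))\<^sup>2 - (infdist b (affine hull A))\<^sup>2)
   / (4 * (infdist 0 (affine hull A))\<^sup>2)) *\<^sub>R b)"

lemma plane_normal_eq:
 fixes a :: "'a::euclidean_space"
 assumes "affine hull A = {z. a \<bullet> z = 1}" "a \<noteq> 0"
 shows "plane_normal A = a"
proof -
 have a: "norm a > 0" using assms by simp
 \<comment> \<open>Polarization: the distance of x is |a \<bullet> x - 1| / |a|, and (a \<bullet> b
   + 1)^2 - (a \<bullet> b - 1)^2 = 4 (a \<bullet> b).\<close>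
 have "((infdist (- b) (affine hull A))\<^sup>2 - (infdist b (affine hull A))\<^sup>2) / (4 * (infdist 0 (affine hull A))\<^sup>2) = a \<bullet> b" for b
  using a unfolding assms(1) infdist_hyperplane[OF assms(2)]
  by (simp add: power_divide field_simps) (simp add: power2_eq_square algebra_simps)
 then show ?thesis unfolding plane_normal_def by (simp add: euclidean_representation)
qed

text \<open>The absolute determinant of n vectors, expressed by a volume so that it depends on the
  set without an enumeration and is measurable in the points.\<close>

definition simplex_det :: "'a::euclidean_space set => real" where
 "simplex_det A = fact DIM('a) * measure lborel (convex hull (insert 0 A))"

lemma simplex_det_nonneg: "simplex_det A \<ge> 0"
 by (simp add: simplex_det_def)

definition simplicial_cone :: "'a::real_vector set => 'a set" where
 "simplicial_cone A = {(\<Sum>x\<in>A. c x *\<^sub>R x) | c. \<forall>x\<in>A. 0 \<le> c x}"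

lemma simplicial_cone_scale:
 assumes "t > 0"
 shows "t *\<^sub>R y \<in> simplicial_cone A \<longleftrightarrow> y \<in> simplicial_cone A"
proof -
 have *: "t *\<^sub>R y \<in> simplicial_cone A" if t: "t > 0" and y: "y \<in> simplicial_cone A" for t y
 proof -
  obtain c where "y = (\<Sum>x\<in>A. c x *\<^sub>R x)" "\<forall>x\<in>A. 0 \<le> c x"
   using y by (auto simp: simplicial_cone_def)
  then show ?thesis unfolding simplicial_cone_def using t
   by (intro CollectI exI[of _ "%x. t * c x"]) (auto simp: scaleR_sum_right)
 qed
 show ?thesis using *[of t y] *[of "inverse t" "t *\<^sub>R y"] assms by auto
qed

lemma closed_simplicial_cone:
 fixes A :: "'a::euclidean_space set"
 assumes "finite A"
 shows "closed (simplicial_cone A)"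
proof -
 let ?f = "simplicial_cone A"
 let ?g = "%c. \<Sum>x\<in>A. c x *\<^sub>R x"
 have "?f = convex_cone hull A"
 proof (rule antisym)
  show "convex_cone hull A \<subseteq> simplicial_cone A"
  proof (rule hull_minimal)
   show "A \<subseteq> simplicial_cone A"
   proof
    fix y assume "y \<in> A"
    then show "y \<in> simplicial_cone A" unfolding simplicial_cone_def using assms
     by (intro CollectI exI[of _ "%x. if x = y then 1 else 0"]) (auto simp: if_distrib[of "%c. c *\<^sub>R _"] cong: if_cong)
   qed
   have "convex ?f \<and> cone ?f"
    unfolding convex_cone
   proof (intro conjI ballI allI impI)
    fix x y assume "x \<in> simplicial_cone A" "y \<in> simplicial_cone A"
    then obtain c d where "x = ?g c" "\<forall>x\<in>A. 0 \<le> c x" "y = ?g d" "\<forall>x\<in>A. 0 \<le> d x"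
     by (auto simp: simplicial_cone_def)
    then show "x + y \<in> simplicial_cone A" unfolding simplicial_cone_def
     by (intro CollectI exI[of _ "%x. c x + d x"]) (auto simp: scaleR_add_left sum.distrib)
   next
    fix x and t :: real assume "x \<in> simplicial_cone A" "0 \<le> t"
    then obtain c where "x = ?g c" "\<forall>x\<in>A. 0 \<le> c x"
     by (auto simp: simplicial_cone_def)
    then show "t *\<^sub>R x \<in> simplicial_cone A" unfolding simplicial_cone_def using \<open>0 \<le> t\<close>
     by (intro CollectI exI[of _ "%x. t * c x"]) (auto simp: scaleR_sum_right)
   qed
   moreover have "0 \<in> simplicial_cone A"
    unfolding simplicial_cone_def by (intro CollectI exI[of _ "%_. 0"]) auto
   ultimately show "convex_cone ?f"
    by (auto simp: convex_cone_def cone_def conic_def)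
  qed
  show "simplicial_cone A \<subseteq> convex_cone hull A"
  proof
   fix y assume "y \<in> simplicial_cone A"
   then obtain c where y: "y = ?g c" and c: "\<forall>x\<in>A. 0 \<le> c x"
    by (auto simp: simplicial_cone_def)
   have "(\<Sum>x\<in>B. c x *\<^sub>R x) \<in> convex_cone hull A" if "finite B" "B \<subseteq> A" for B
    using that
   proof (induction B rule: finite_induct)
    case (insert b B)
    then have "c b *\<^sub>R b \<in> convex_cone hull A"
     using c by (intro convex_cone_hull_mul hull_inc) auto
    with insert show ?case by (simp add: convex_cone_hull_add)
   qed (simp add: convex_cone_hull_contains_0)
   then show "y \<in> convex_cone hull A" using assms y by blast
  qed
 qed
 then show ?thesis using assms
  by (simp add: closed_convex_cone_hull)
qed

lemma borel_simplicial_cone [measurable]: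
 fixes A :: "'a::euclidean_space set"
 assumes "finite A"
 shows "simplicial_cone A \<in> sets borel"
 using closed_simplicial_cone[OF assms] by (rule borel_closed)

text \<open>Write \<open>exp (- r)\<close> as the integral of \<open>exp (- t)\<close> over \<open>t \<ge> r\<close> and rescale the sublevel sets.\<close>

lemma nn_integral_exp_gauge:
 fixes C :: "'a::euclidean_space set" and \<phi> :: "'a => real"
 assumes [measurable]: "C \<in> sets borel" "\<phi> \<in> borel_measurable borel"
  and C: "\<And>t y. t > 0 ==> t *\<^sub>R y \<in> C \<longleftrightarrow> y \<in> C"
  and \<phi>: "\<And>t y. t > 0 ==> \<phi> (t *\<^sub>R y) = t * \<phi> y"
  and nonneg: "\<And>y. y \<in> C ==> \<phi> y \<ge> 0"
 shows "(\<integral>\<^sup>+y. ennreal (exp (- \<phi> y)) * indicator C y \<partial>lborel)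
  = fact DIM('a) * emeasure lborel {y \<in> C. \<phi> y \<le> 1}"
proof -
 let ?n = "DIM('a)"
 let ?V = "emeasure lborel {y \<in> C. \<phi> y \<le> 1}"
 let ?f = "%t. \<integral>\<^sup>+y. ennreal (exp (- t)) * indicator {0<..} t * indicator {\<phi> y..} t * indicator C y \<partial>lborel"
 let ?g = "%t. t powr (real (?n + 1) - 1) * exp (- (1 * t powr 1))"
 let ?h = "%y. \<integral>\<^sup>+t. ennreal (exp (- t)) * indicator {0<..} t * indicator {\<phi> y..} t * indicator C y \<partial>lborel"
 let ?p = "%y. \<integral>\<^sup>+t. ennreal (exp (- t)) * indicator {0<..} t * indicator {\<phi> y..} t \<partial>lborel"
 let ?q = "\<integral>\<^sup>+t. ennreal (?g t) * indicator {0<..} t \<partial>lborel"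
 let ?r = "%y. \<integral>\<^sup>+t. ennreal (exp (- t)) * indicator {\<phi> y..} t \<partial>lborel"
 have "(\<integral>\<^sup>+y. ennreal (exp (- \<phi> y)) * indicator C y \<partial>lborel)
  = (\<integral>\<^sup>+y. ?h y \<partial>lborel)"
 proof (rule nn_integral_cong)
  fix y
  have "ennreal (exp (- \<phi> y)) = ?p y"
   if y: "y \<in> C"
  proof -
   have "?r y = ennreal (0 - (- exp (- \<phi> y)))"
   proof (rule nn_integral_FTC_atLeast)
    show "((%t::real. - exp (- t)) \<longlongrightarrow> 0) at_top"
     using tendsto_minus[OF filterlim_compose[OF exp_at_bot filterlim_uminus_at_bot_at_top]] by simp
   qed (auto intro!: derivative_eq_intros)
   moreover have "?r y
    = ?p y"
   proof (rule nn_integral_cong_AE, rule AE_mp[OF AE_lborel_singleton[of 0]], rule AE_I2, rule impI)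
    fix t :: real assume "t \<noteq> 0"
    then show "ennreal (exp (- t)) * indicator {\<phi> y..} t = ennreal (exp (- t)) * indicator {0<..} t * indicator {\<phi> y..} t"
     using nonneg[OF y] by (cases "\<phi> y \<le> t") (auto simp: indicator_def)
   qed
   ultimately show ?thesis by simp
  qed
  then show "ennreal (exp (- \<phi> y)) * indicator C y
   = ?h y"
   by (auto simp: indicator_def)
 qed
 also have "\<dots> = (\<integral>\<^sup>+t. ?f t \<partial>lborel)"
 proof (rule lborel_pair.Fubini'[symmetric])
  have "(%(y, t). ennreal (exp (- t)) * indicator {0<..} t * (if \<phi> y \<le> t then 1 else 0) * indicator C y) \<in> borel_measurable (lborel \<Otimes>\<^sub>M lborel)"
   by measurable
  then show "(%(y, t). ennreal (exp (- t)) * indicator {0<..} t * indicator {\<phi> y..} t * indicator C y) \<in> borel_measurable (lborel \<Otimes>\<^sub>M lborel)"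
   by (simp add: indicator_def of_bool_def)
 qed
 also have "\<dots> = (\<integral>\<^sup>+t. ennreal (?g t) * indicator {0<..} t * ?V \<partial>lborel)"
 proof (rule nn_integral_cong)
  fix t :: real
  show "?f t
   = ennreal (?g t) * indicator {0<..} t * ?V"
  proof (cases "t > 0")
   case t: True
   have "(\<integral>\<^sup>+y. indicator {y \<in> C. \<phi> y \<le> t} y \<partial>lborel)
    = ennreal (t ^ ?n) * (\<integral>\<^sup>+y. indicator {y \<in> C. \<phi> y \<le> t} (t *\<^sub>R y) \<partial>(lborel :: 'a measure))"
    by (rule nn_integral_lborel_scale[OF _ t]) measurable
   also have "(%y. indicator {y \<in> C. \<phi> y \<le> t} (t *\<^sub>R y) :: ennreal) = indicator {y \<in> C. \<phi> y \<le> 1}"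
    using t by (auto simp: fun_eq_iff indicator_def C \<phi>)
   finally have V: "emeasure lborel {y \<in> C. \<phi> y \<le> t} = ennreal (t ^ ?n) * ?V" by simp
   have "?f t
    = (\<integral>\<^sup>+y. ennreal (exp (- t)) * indicator {y \<in> C. \<phi> y \<le> t} y \<partial>lborel)"
    using t by (intro nn_integral_cong) (auto simp: indicator_def)
   also have "\<dots> = ennreal (exp (- t)) * emeasure lborel {y \<in> C. \<phi> y \<le> t}"
    by (rule nn_integral_cmult_indicator) measurable
   also have "\<dots> = ennreal (?g t) * indicator {0<..} t * ?V"
    using t by (simp add: V powr_realpow mult_ac ennreal_mult')
   finally show ?thesis .
  qed simp
 qed
 also have "\<dots> = ?q * ?V"
  by (rule nn_integral_multc) measurable
 also have "?q = fact ?n"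
  using Gamma_fact[of ?n, where 'a=real]
  by (subst nn_integral_powr_exp_powr) (auto simp: add.commute ennreal_fact)
 finally show ?thesis .
qed

lemma basis_span:
 fixes A :: "'a::euclidean_space set"
 assumes "independent A" "card A = DIM('a)"
 shows "finite A" "span A = UNIV" "A \<noteq> {}" "0 \<notin> A"
proof -
 show f: "finite A" using assms(2) by (metis card.infinite DIM_positive less_numeral_extra(3))
 show "span A = UNIV" using assms f card_eq_dim[of A UNIV] by auto
 show "A \<noteq> {}" using assms(2) DIM_positive[where 'a='a] by auto
 show "0 \<notin> A" using assms(1) dependent_zero by blast
qed

lemma affine_hull_basis:
 fixes A :: "'a::euclidean_space set"
 assumes A: "independent A" "card A = DIM('a)" and a: "\<And>x. x \<in> A ==> a \<bullet> x = 1"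
 shows "affine hull A = {z. a \<bullet> z = 1}" "a \<noteq> 0"
proof -
 note bs = basis_span[OF A]
 show "a \<noteq> 0" using a bs(3) by fastforce
 show "affine hull A = {z. a \<bullet> z = 1}"
 proof (rule antisym)
  show "affine hull A \<subseteq> {z. a \<bullet> z = 1}"
   using a by (intro hull_minimal affine_hyperplane) auto
  show "{z. a \<bullet> z = 1} \<subseteq> affine hull A"
  proof
   fix z assume "z \<in> {z. a \<bullet> z = 1}"
   then have z: "a \<bullet> z = 1" by simp
   have "z \<in> span A" using bs by simp
   then obtain u where u: "z = (\<Sum>x\<in>A. u x *\<^sub>R x)"
    using span_finite[OF bs(1)] by auto
   then have "(\<Sum>x\<in>A. u x) = 1" using z a by (simp add: inner_sum_right)
   then show "z \<in> affine hull A" using u bs(1) by (auto simp: affine_hull_finite)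
  qed
 qed
qed

lemma plane_normal_basis:
 fixes A :: "'a::euclidean_space set"
 assumes "independent A" "card A = DIM('a)" "\<And>x. x \<in> A ==> a \<bullet> x = 1"
 shows "plane_normal A = a"
 using plane_normal_eq[OF affine_hull_basis[OF assms]] .

lemma ex_normal_basis:
 fixes A :: "'a::euclidean_space set"
 assumes "independent A"
 shows "\<exists>a. \<forall>x\<in>A. a \<bullet> x = 1"
proof -
 obtain g :: "'a => real" where g: "linear g" "\<forall>x\<in>A. g x = 1"
  using linear_independent_extend[OF assms, of "%_. 1"] by auto
 have "(\<Sum>b\<in>Basis. g b *\<^sub>R b) \<bullet> x = g x" for x
 proof -
  have "g x = g (\<Sum>b\<in>Basis. (x \<bullet> b) *\<^sub>R b)" by (simp add: euclidean_representation)
  also have "\<dots> = (\<Sum>b\<in>Basis. (x \<bullet> b) * g b)" using g(1) by (simp add: linear_sum linear_scale)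
  also have "\<dots> = (\<Sum>b\<in>Basis. g b * (b \<bullet> x))" by (simp add: inner_commute mult.commute)
  finally show ?thesis by (simp add: inner_sum_left)
 qed
 then show ?thesis using g(2) by metis
qed

lemma plane_normal_inner:
 fixes A :: "'a::euclidean_space set"
 assumes A: "independent A" "card A = DIM('a)"
 shows "\<And>x. x \<in> A ==> plane_normal A \<bullet> x = 1" "affine hull A = {z. plane_normal A \<bullet> z = 1}" "plane_normal A \<noteq> 0"
proof -
 obtain a where a: "\<And>x. x \<in> A ==> a \<bullet> x = 1" using ex_normal_basis[OF A(1)] by blast
 have e: "plane_normal A = a" by (rule plane_normal_basis[OF A a])
 show "\<And>x. x \<in> A ==> plane_normal A \<bullet> x = 1" "affine hull A = {z. plane_normal A \<bullet> z = 1}" "plane_normal A \<noteq> 0"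
  unfolding e using a affine_hull_basis[OF A a] by auto
qed

lemma in_simplicial_cone_iff:
 assumes "independent A" "finite A"
 shows "(\<Sum>x\<in>A. c x *\<^sub>R x) \<in> simplicial_cone A \<longleftrightarrow> (\<forall>x\<in>A. 0 \<le> c x)"
proof
 assume "(\<Sum>x\<in>A. c x *\<^sub>R x) \<in> simplicial_cone A"
 then obtain d where d: "(\<Sum>x\<in>A. c x *\<^sub>R x) = (\<Sum>x\<in>A. d x *\<^sub>R x)" "\<forall>x\<in>A. 0 \<le> d x"
  by (auto simp: simplicial_cone_def)
 then have "(\<Sum>x\<in>A. (c x - d x) *\<^sub>R x) = 0" by (simp add: scaleR_diff_left sum_subtractf)
 then have "c x - d x = 0" if "x \<in> A" for x
  using independentD[OF assms(1,2) subset_refl _ that, of "%x. c x - d x"] by simp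
 then show "\<forall>x\<in>A. 0 \<le> c x" using d(2) by auto
qed (auto simp: simplicial_cone_def)

lemma convex_hull_insert_0_basis:
 fixes A :: "'a::euclidean_space set"
 assumes A: "independent A" "card A = DIM('a)" and a: "\<And>x. x \<in> A ==> a \<bullet> x = 1"
 shows "convex hull (insert 0 A) = {y \<in> simplicial_cone A. a \<bullet> y \<le> 1}"
proof -
 note bs = basis_span[OF A]
 let ?f = "%u. \<Sum>x\<in>A. u x *\<^sub>R x"
 have ai: "a \<bullet> ?f u = sum u A" for u using a by (simp add: inner_sum_right)
 show ?thesis
 proof (rule antisym; rule subsetI)
  fix y assume "y \<in> convex hull (insert 0 A)"
  then obtain u where "\<forall>x\<in>insert 0 A. 0 \<le> u x" "sum u (insert 0 A) = 1" "(\<Sum>x\<in>insert 0 A. u x *\<^sub>R x) = y"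
   using bs(1) by (auto simp: convex_hull_finite)
  then have "?f u = y" "sum u A \<le> 1" "\<forall>x\<in>A. 0 \<le> u x"
   using bs(1,4) by auto
  then show "y \<in> {y \<in> simplicial_cone A. a \<bullet> y \<le> 1}"
   using ai[of u] by (auto simp: simplicial_cone_def)
 next
  fix y assume "y \<in> {y \<in> simplicial_cone A. a \<bullet> y \<le> 1}"
  then obtain c where c: "y = ?f c" "\<forall>x\<in>A. 0 \<le> c x" "sum c A \<le> 1"
   using ai by (auto simp: simplicial_cone_def)
  define u where "u x = (if x = 0 then 1 - sum c A else c x)" for x
  have "sum u A = sum c A" "?f u = y"
   unfolding c(1) u_def using bs(4) by (auto intro!: sum.cong)
  then have "\<forall>x\<in>insert 0 A. 0 \<le> u x" "sum u (insert 0 A) = 1" "(\<Sum>x\<in>insert 0 A. u x *\<^sub>R x) = y"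
   using bs(1,4) c by (auto simp: u_def)
  then show "y \<in> convex hull (insert 0 A)"
   unfolding convex_hull_finite[OF finite.insertI[OF bs(1)]] by blast
 qed
qed

lemma emeasure_convex_hull_insert_0:
 fixes A :: "'a::euclidean_space set"
 assumes "finite A"
 shows "fact DIM('a) * emeasure lborel (convex hull (insert 0 A)) = ennreal (simplex_det A)"
proof -
 have "compact (convex hull (insert 0 A))" using assms by (intro compact_convex_hull finite_imp_compact) simp
 then have "emeasure lborel (convex hull (insert 0 A)) < \<infinity>" by (rule emeasure_compact_finite)
 then show ?thesis unfolding simplex_det_def
  by (simp add: emeasure_eq_ennreal_measure ennreal_mult' ennreal_fact less_top)
qed

text \<open>The gauge is the linear form given by a, whose unit sublevel set in the cone is the
  simplex with vertices 0 and A.\<close>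

lemma nn_integral_cone_exp:
 fixes A :: "'a::euclidean_space set"
 assumes A: "independent A" "card A = DIM('a)" and a: "\<And>x. x \<in> A ==> a \<bullet> x = 1"
 shows "(\<integral>\<^sup>+y. ennreal (exp (- (a \<bullet> y))) * indicator (simplicial_cone A) y \<partial>lborel) = ennreal (simplex_det A)"
proof -
 note bs = basis_span[OF A]
 have "(\<integral>\<^sup>+y. ennreal (exp (- (a \<bullet> y))) * indicator (simplicial_cone A) y \<partial>lborel)
  = fact DIM('a) * emeasure lborel {y \<in> simplicial_cone A. a \<bullet> y \<le> 1}"
 proof (rule nn_integral_exp_gauge)
  fix y assume "y \<in> simplicial_cone A"
  then show "0 \<le> a \<bullet> y" using a by (auto simp: simplicial_cone_def inner_sum_right intro!: sum_nonneg)
 qed (use bs in \<open>auto simp: borel_simplicial_cone simplicial_cone_scale\<close>)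
 then show ?thesis
  using emeasure_convex_hull_insert_0[OF bs(1)] convex_hull_insert_0_basis[OF A a] by simp
qed

lemma nn_integral_exp_Ici: "(\<integral>\<^sup>+t. ennreal (exp (- t)) * indicator {0::real..} t \<partial>lborel) = 1"
proof -
 have "(\<integral>\<^sup>+t. ennreal (exp (- t)) * indicator {0::real..} t \<partial>lborel) = ennreal (0 - (- exp (- 0)))"
 proof (rule nn_integral_FTC_atLeast)
  show "((%t::real. - exp (- t)) \<longlongrightarrow> 0) at_top"
   using tendsto_minus[OF filterlim_compose[OF exp_at_bot filterlim_uminus_at_bot_at_top]] by simp
 qed (auto intro!: derivative_eq_intros)
 then show ?thesis by simp
qed

lemma basis_coordinates_nn_integral:
 fixes A :: "'a::euclidean_space set"
 assumes A: "independent A" "card A = DIM('a)"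
 shows "\<exists>K. \<forall>F\<in>borel_measurable borel. (\<integral>\<^sup>+c. F (\<Sum>x\<in>A. c x *\<^sub>R x) \<partial>PiM A (%_. lborel)) = K * (\<integral>\<^sup>+x. F x \<partial>lborel)"
proof (rule translation_invariant_nn_integral)
 note bs = basis_span[OF A]
 note [simp] = bs(1)
 interpret product_sigma_finite "%_::'a. lborel :: real measure" ..
 interpret finite_product_sigma_finite "%_::'a. lborel :: real measure" A by standard simp
 let ?h = "%_. lborel"
 show [measurable]: "(%c. \<Sum>x\<in>A. c x *\<^sub>R x) \<in> borel_measurable (PiM A ?h)" by measurable
 show "sigma_finite_measure (PiM A (%_. lborel :: real measure))" by (rule sigma_finite_measure_axioms)
 fix F :: "'a => ennreal" and y assume [measurable]: "F \<in> borel_measurable borel"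
 have "y \<in> span A" using bs by simp
 then obtain e where e: "y = (\<Sum>x\<in>A. e x *\<^sub>R x)"
  using span_finite[OF bs(1)] by auto
 let ?f = "\<integral>\<^sup>+c. F ((\<Sum>x\<in>A. c x *\<^sub>R x) + y) \<partial>PiM A ?h"
 let ?g = "\<integral>\<^sup>+c. F (\<Sum>x\<in>A. c x *\<^sub>R x) \<partial>PiM A ?h"
 have "?g = (\<integral>\<^sup>+c. (\<Prod>x\<in>A. 1) * F (\<Sum>z\<in>A. (\<lambda>x\<in>A. c x + e x) z *\<^sub>R z) \<partial>PiM A ?h)"
 proof (rule PiM_change_of_variables[where w="%_ _. 1" and \<phi>="%x t. t + e x"])
  fix x and g :: "real => ennreal" assume "x \<in> A" "g \<in> borel_measurable lborel"
  then show "(\<integral>\<^sup>+t. g t \<partial>lborel) = (\<integral>\<^sup>+t. 1 * g (t + e x) \<partial>lborel)"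
   using nn_integral_lborel_shift[of g "e x"] by simp
 qed (auto intro: product_sigma_finite_axioms)
 also have "\<dots> = ?f"
  by (intro nn_integral_cong) (simp add: e scaleR_add_left sum.distrib)
 finally show "?f = ?g" by simp
qed

text \<open>In the coordinates of A, the integral of exp (- (a \<bullet> y)) over the cone is a
  product of integrals equal to 1; computed directly it is \<open>simplex_det A\<close>. This fixes
  the constant of the coordinate change as the reciprocal of \<open>simplex_det A\<close>.\<close>

lemma nn_integral_simplicial_cone:
 fixes A :: "'a::euclidean_space set"
 assumes A: "independent A" "card A = DIM('a)"
 shows "simplex_det A > 0"
  and "F \<in> borel_measurable borel ==> (\<integral>\<^sup>+y. F y * indicator (simplicial_cone A) y \<partial>lborel)
   = ennreal (simplex_det A) * (\<integral>\<^sup>+c. F (\<Sum>x\<in>A. c x *\<^sub>R x) * (\<Prod>x\<in>A. indicator {0..} (c x)) \<partial>PiM A (%_. lborel))"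
proof -
 note bs = basis_span[OF A]
 note [simp] = bs(1)
 have cone[measurable]: "simplicial_cone A \<in> sets borel" by (rule borel_simplicial_cone[OF bs(1)])
 obtain a where a: "\<And>x. x \<in> A ==> a \<bullet> x = 1" using ex_normal_basis[OF A(1)] by blast
 interpret product_sigma_finite "%_::'a. lborel :: real measure" ..
 interpret finite_product_sigma_finite "%_::'a. lborel :: real measure" A by standard simp
 define L where "L c = (\<Sum>x\<in>A. c x *\<^sub>R x)" for c
 let ?f = "%_. lborel"
 have [measurable]: "L \<in> borel_measurable (PiM A ?f)" unfolding L_def by measurable
 let ?h = "%F. \<integral>\<^sup>+c. F (L c) \<partial>PiM A ?f"
 obtain K where K: "\<And>F. F \<in> borel_measurable borel ==>
   ?h F = K * (\<integral>\<^sup>+x. F x \<partial>lborel)"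
  using basis_coordinates_nn_integral[OF A] by (auto simp: L_def)
 let ?g = "simplicial_cone A"
 have ind: "indicator ?g (L c) = (\<Prod>x\<in>A. indicator {0..} (c x) :: ennreal)" for c
  using in_simplicial_cone_iff[OF A(1) bs(1), of c] by (auto simp: L_def indicator_def prod_zero_iff)
 have aL: "a \<bullet> L c = sum c A" for c using a by (simp add: L_def inner_sum_right)
 let ?p = "\<integral>\<^sup>+c. ennreal (exp (- (a \<bullet> L c))) * indicator ?g (L c) \<partial>PiM A ?f"
 let ?r = "simplex_det A"
 have "?p = K * ennreal ?r"
  using K[of "%y. ennreal (exp (- (a \<bullet> y))) * indicator ?g y"] nn_integral_cone_exp[OF A a] by simp
 also have "?p
   = (\<integral>\<^sup>+c. (\<Prod>x\<in>A. ennreal (exp (- c x)) * indicator {0..} (c x)) \<partial>PiM A ?f)"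
  by (intro nn_integral_cong) (simp add: ind aL prod.distrib prod_ennreal exp_sum flip: sum_negf)
 also have "\<dots> = (\<Prod>x\<in>A. \<integral>\<^sup>+t. ennreal (exp (- t)) * indicator {0..} t \<partial>lborel)"
  by (rule product_nn_integral_prod) auto
 also have "\<dots> = 1" by (simp add: nn_integral_exp_Ici)
 finally have K1: "K * ennreal ?r = 1" by simp
 then show "simplex_det A > 0"
  by (metis ennreal_neg linorder_not_less mult_zero_right zero_neq_one)
 assume [measurable]: "F \<in> borel_measurable borel"
 let ?q = "%F. \<integral>\<^sup>+y. F y * indicator ?g y \<partial>lborel"
 let ?u = "%F. \<integral>\<^sup>+c. F (L c) * indicator ?g (L c) \<partial>PiM A ?f"
 have "?u F
  = K * ?q F"
  by (rule K) measurable
 then have "ennreal ?r * ?u F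
  = (K * ennreal ?r) * ?q F"
  by (simp add: mult_ac)
 then show "?q F
   = ennreal ?r * (\<integral>\<^sup>+c. F (\<Sum>x\<in>A. c x *\<^sub>R x) * (\<Prod>x\<in>A. indicator {0..} (c x)) \<partial>PiM A ?f)"
  unfolding K1 ind by (simp add: L_def)
qed

lemma prod_indicator_vec:
 "(\<integral>\<^sup>+l. (\<Prod>i\<in>UNIV. ennreal (exp (- (l $ i))) * indicator {0..} (l $ i)) \<partial>(lborel :: (real^'m::finite) measure)) = 1"
proof -
 interpret product_sigma_finite "%_::'m. lborel :: real measure" ..
 have [measurable]: "(%y::real^'m. y $ i) \<in> borel_measurable borel" for i
  by (intro borel_measurable_continuous_onI continuous_intros)
 have "(\<integral>\<^sup>+l. (\<Prod>i\<in>UNIV. ennreal (exp (- (l $ i))) * indicator {0..} (l $ i)) \<partial>(lborel :: (real^'m::finite) measure))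
  = (\<integral>\<^sup>+l. (\<Prod>i\<in>UNIV. ennreal (exp (- (l i))) * indicator {0..} (l i)) \<partial>PiM UNIV (%_::'m. lborel))"
  by (subst nn_integral_vec_PiM) auto
 also have "\<dots> = (\<Prod>i\<in>(UNIV::'m set). \<integral>\<^sup>+t. ennreal (exp (- t)) * indicator {0..} t \<partial>lborel)"
  by (rule product_nn_integral_prod) auto
 finally show ?thesis by (simp add: nn_integral_exp_Ici)
qed

text \<open>Up to the isometry T the vertices are (1, 0) and the points (c i, p i). The heights c i
  amount to a shear along the first axis, which leaves volume unchanged, so only the determinant of
  the p i remains.\<close>

lemma chart_basis:
 fixes T :: "real \<times> (real, 'm::{finite,wellorder}) vec => 'a::euclidean_space"
 assumes T: "linear T" "\<And>x. norm (T x) = norm x" and dim: "DIM('a) = CARD('m) + 1"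
  and det: "det (\<chi> i. p i) \<noteq> 0"
 shows "independent (insert (T (1, 0)) (range (%i. T (c i, p i))))"
  and "card (insert (T (1, 0)) (range (%i. T (c i, p i)))) = DIM('a)"
  and "simplex_det (insert (T (1, 0)) (range (%i. T (c i, p i)))) = \<bar>det (\<chi> i. p i)\<bar>"
proof -
 define v where "v = T (1, 0)"
 define x where "x i = T (c i, p i)" for i
 define A where "A = insert v (range x)"
 define P where "P = (\<chi> i. p i)"
 let ?h = "Finite_Cartesian_Product.transpose P"
 let ?u = "%l. \<Sum>i\<in>UNIV. (l $ i) *\<^sub>R p i"
 have Pt: "Finite_Cartesian_Product.transpose P *v l = ?u l" for l
 proof -
  have "column i ?h = p i" for i by (simp add: P_def vec_eq_iff row_def)
  then show ?thesis by (simp add: matrix_mult_sum scalar_mult_eq_scaleR)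
 qed
 have detPt: "det ?h \<noteq> 0" using det by (simp add: P_def)
 then have inv: "invertible ?h" by (simp add: invertible_det_nz)
 have surjP: "\<exists>l. q = ?u l" for q
 proof -
  have "surj ((*v) ?h)"
   using inv by (metis invertible_def matrix_right_invertible_surjective)
  then show ?thesis using Pt by (metis surjD)
 qed
 let ?q = "%l. \<Sum>i\<in>UNIV. (l $ i) *\<^sub>R x i"
 let ?v = "%l. \<Sum>i\<in>UNIV. l $ i * c i"
 have Tc: "t *\<^sub>R v + ?q l = T (t + ?v l, \<Sum>i\<in>UNIV. (l $ i) *\<^sub>R p i)" for t l
 proof -
  have "T (t + ?v l, \<Sum>i\<in>UNIV. (l $ i) *\<^sub>R p i) = T (t *\<^sub>R (1, 0) + (\<Sum>i\<in>UNIV. (l $ i) *\<^sub>R (c i, p i)))"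
   by (rule arg_cong[where f=T]) (simp add: prod_eq_iff fst_sum snd_sum)
  then show ?thesis
   by (simp only: linear_add[OF T(1)] linear_scale[OF T(1)] linear_sum[OF T(1)] v_def x_def)
 qed
 have "surj T"
 proof -
  have "inj T" using T by (metis linear_injective_0 norm_eq_zero)
  then have "dim (range T) = DIM('a)"
   using dim_image_eq[OF T(1), of UNIV] dim by simp
  then have "span (range T) = UNIV" using dim_eq_full by blast
  then show ?thesis using T(1) by (metis linear_subspace_image span_eq_iff subspace_UNIV)
 qed
 have fin: "finite A" unfolding A_def by simp
 have span: "z \<in> span A" for z
 proof -
  obtain t q where z: "z = T (t, q)" using \<open>surj T\<close> by (metis surjD surj_pair)
  obtain l where l: "q = ?u l" using surjP by blast
  have "z = (t - (?v l)) *\<^sub>R v + ?q l"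
   by (simp add: Tc z l)
  moreover have "v \<in> span A" "x i \<in> span A" for i by (auto simp: A_def intro: span_base)
  ultimately show ?thesis by (simp add: span_add span_sum span_scale)
 qed
 have le: "card A \<le> DIM('a)"
 proof -
  have "card A \<le> Suc (card (range x))" unfolding A_def by (rule card_insert_le_m1) auto
  also have "card (range x) \<le> CARD('m)" by (rule card_image_le) simp
  finally show ?thesis using dim by simp
 qed
 have ind: "independent A"
  using span le fin by (intro card_le_dim_spanning[of A UNIV]) auto
 have card: "card A = DIM('a)"
  using basis_card_eq_dim[of A UNIV] ind span by auto
 let ?w = "%range. insert (T (1, 0)) (range (%i. T (c i, p i)))"
 show "independent (?w range)"
  and "card (?w range) = DIM('a)"
  using ind card by (simp_all add: A_def v_def x_def)
 have "v \<notin> range x" and injx: "inj x"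
 proof -
  have "card A = (if v \<in> range x then card (range x) else Suc (card (range x)))"
   unfolding A_def by (simp add: card_insert_if)
  moreover have "card (range x) \<le> CARD('m)" by (rule card_image_le) simp
  ultimately show "v \<notin> range x" "inj x"
   using card dim by (auto split: if_splits intro: eq_card_imp_inj_on)
 qed
 have sumA: "(\<Sum>z\<in>A. u z *\<^sub>R z) = u v *\<^sub>R v + (\<Sum>i\<in>UNIV. u (x i) *\<^sub>R x i)" for u
  unfolding A_def using \<open>v \<notin> range x\<close> injx by (simp add: sum.reindex)
 have cone: "t *\<^sub>R v + ?q l \<in> simplicial_cone A \<longleftrightarrow> 0 \<le> t \<and> (\<forall>i. 0 \<le> l $ i)" for t l
 proof -
  define u where "u z = (if z = v then t else l $ (inv x z))" for z
  have "u (x i) = l $ i" for i using \<open>v \<notin> range x\<close> injx by (auto simp: u_def)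
  moreover have "u v = t" by (simp add: u_def)
  ultimately show ?thesis
   using in_simplicial_cone_iff[OF ind fin, of u] unfolding sumA by (auto simp: A_def)
 qed
 obtain a where a: "\<And>x. x \<in> A ==> a \<bullet> x = 1" using ex_normal_basis[OF ind] by blast
 define F where "F y = ennreal (exp (- (a \<bullet> y))) * indicator (simplicial_cone A) y" for y
 have [measurable]: "simplicial_cone A \<in> sets borel" by (rule borel_simplicial_cone[OF fin])
 have [measurable]: "F \<in> borel_measurable borel" unfolding F_def by measurable
 have [measurable]: "T \<in> borel_measurable borel" by (rule isometry_measurable[OF T(1)])
 have [measurable]: "(%y::(real,'m) vec. y $ i) \<in> borel_measurable borel" for i
  by (intro borel_measurable_continuous_onI continuous_intros)
 have [measurable]: "(%l. Finite_Cartesian_Product.transpose P *v l) \<in> borel_measurable borel"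
  by (rule isometry_measurable[OF matrix_vector_mul_linear])
 let ?r = "%l. \<Prod>i\<in>UNIV. ennreal (exp (- (l $ i))) * indicator {0..} (l $ i)"
 let ?f = "%l. \<integral>\<^sup>+t. ennreal (exp (- t)) * indicator {0..} t * ?r l \<partial>lborel"
 let ?g = "%t. \<integral>\<^sup>+l. F (T (t, Finite_Cartesian_Product.transpose P *v l)) \<partial>lborel"
 let ?p = "%l. \<integral>\<^sup>+t. F (T (t, Finite_Cartesian_Product.transpose P *v l)) \<partial>lborel"
 let ?a = "\<integral>\<^sup>+t. ?g t \<partial>lborel"
 have "ennreal (simplex_det A) = (\<integral>\<^sup>+y. F y \<partial>lborel)"
  unfolding F_def by (rule nn_integral_cone_exp[OF ind card a, symmetric])
 also have "\<dots> = (\<integral>\<^sup>+z. F (T z) \<partial>lborel)"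
  using dim by (intro isometry_nn_integral[OF T, symmetric]) auto
 also have "\<dots> = (\<integral>\<^sup>+t. (\<integral>\<^sup>+q. F (T (t, q)) \<partial>lborel) \<partial>lborel)"
  unfolding lborel_prod[symmetric] by (subst lborel.nn_integral_fst[symmetric]) (auto simp: lborel_prod)
 also have "\<dots> = (\<integral>\<^sup>+t. ennreal \<bar>det P\<bar> * ?g t \<partial>lborel)"
 proof (rule nn_integral_cong)
  fix t
  have "det ?h = det P" by (rule det_transpose)
  moreover have "(%q. F (T (t, q))) \<in> borel_measurable borel" by measurable
  ultimately show "(\<integral>\<^sup>+q. F (T (t, q)) \<partial>lborel) = ennreal \<bar>det P\<bar> * ?g t"
   using nn_integral_matrix_vector_mult[OF detPt, of "%q. F (T (t, q))"] by (simp only:)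
 qed
 also have "\<dots> = ennreal \<bar>det P\<bar> * ?a"
  by (rule nn_integral_cmult) measurable
 also have "?a
  = (\<integral>\<^sup>+l. ?p l \<partial>lborel)"
  by (rule lborel_pair.Fubini') measurable
 also have "\<dots> = (\<integral>\<^sup>+l. ?f l \<partial>(lborel :: (real,'m) vec measure))"
 proof (rule nn_integral_cong)
  fix l :: "(real, 'm) vec"
  \<comment> \<open>This is the shear: for fixed l the first coordinate is translated by
    \<open>?v l\<close>.\<close>
  have "?p l
   = (\<integral>\<^sup>+t. F (T (t + ?v l, Finite_Cartesian_Product.transpose P *v l)) \<partial>lborel)"
   by (rule nn_integral_lborel_shift[symmetric]) measurable
  also have "\<dots> = ?f l"
  proof (rule nn_integral_cong)
   fix t :: real
   have "a \<bullet> (t *\<^sub>R v + ?q l) = t + (\<Sum>i\<in>UNIV. l $ i)"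
    using a by (simp add: inner_add_right inner_sum_right A_def)
   moreover have "exp (- (t + (\<Sum>i\<in>UNIV. l $ i))) = exp (- t) * (\<Prod>i\<in>UNIV. exp (- (l $ i)))"
    by (simp add: exp_sum[symmetric] sum_negf exp_add[symmetric])
   moreover have "indicator (simplicial_cone A) (t *\<^sub>R v + ?q l)
     = (indicator {0..} t * (\<Prod>i\<in>UNIV. indicator {0..} (l $ i)) :: ennreal)"
    by (auto simp: cone indicator_def prod_zero_iff)
   ultimately show "F (T (t + ?v l, Finite_Cartesian_Product.transpose P *v l))
    = ennreal (exp (- t)) * indicator {0..} t * ?r l"
    unfolding Pt Tc[symmetric] F_def
    by (simp add: ennreal_mult' prod_ennreal[symmetric] prod.distrib mult_ac)
  qed
  finally show "?p l
   = ?f l" .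
 qed
 also have "\<dots> = (\<integral>\<^sup>+l. ?r l \<partial>(lborel :: (real,'m) vec measure))"
  by (intro nn_integral_cong, subst nn_integral_multc) (auto simp: nn_integral_exp_Ici)
 also have "\<dots> = 1" by (rule prod_indicator_vec)
 finally have "ennreal (simplex_det A) = ennreal \<bar>det P\<bar>" by simp
 then have "simplex_det A = \<bar>det P\<bar>" by (simp add: simplex_det_nonneg)
 then show "simplex_det (?w range) = \<bar>det (\<chi> i. p i)\<bar>"
  by (simp add: A_def v_def x_def P_def)
qed

lemma simplex_det_degenerate:
 fixes A :: "'a::euclidean_space set"
 assumes "w \<noteq> 0" "\<And>x. x \<in> A ==> w \<bullet> x = 0"
 shows "simplex_det A = 0"
proof -
 have "convex hull (insert 0 A) \<subseteq> {x. w \<bullet> x = 0}"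
  using assms(2) by (intro hull_minimal convex_hyperplane) auto
 then have "emeasure lborel (convex hull (insert 0 A)) \<le> emeasure lborel {x. w \<bullet> x = 0}"
  by (intro emeasure_mono) (auto simp: borel_closed closed_hyperplane)
 also have "\<dots> = 0" using hyperplane_null_sets[OF assms(1)] by (rule null_setsD1)
 finally show ?thesis by (simp add: simplex_det_def measure_def)
qed

lemma chart_degenerate:
 fixes T :: "real \<times> (real, 'm::{finite,wellorder}) vec => 'a::euclidean_space"
 assumes T: "linear T" "\<And>x. norm (T x) = norm x"
  and det: "det (\<chi> i. p i) = 0"
 shows "simplex_det (insert (T (1, 0)) (range (%i. T (c i, p i)))) = 0"
proof -
 have "\<exists>w. w \<noteq> 0 \<and> (\<chi> i. p i) *v w = 0"
  using det by (metis invertible_det_nz invertible_left_inverse matrix_left_invertible_ker)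
 then obtain w where w: "w \<noteq> 0" "(\<chi> i. p i) *v w = 0" by blast
 have pw: "p i \<bullet> w = 0" for i
  using w(2) by (metis matrix_vector_mul_component vec_lambda_beta zero_index)
 show ?thesis
 proof (rule simplex_det_degenerate[of "T (0, w)"])
  show "T (0, w) \<noteq> 0" using T(2)[of "(0, w)"] w(1) by (auto simp: norm_Pair)
 qed (auto simp: isometry_inner[OF T] inner_prod_def pw inner_commute[of w])
qed

section \<open>Measurability of convex and affine hulls\<close>

text \<open>Strict separation from finitely many points is an open condition on the functional u, so
  u can be taken from a countable dense set. Countability is what makes hulls measurable in their
  vertices.\<close>

lemma not_in_convex_hull_iff:
 fixes x :: "'i => 'a::euclidean_space"
 assumes "finite J" and D: "\<And>X. open X ==> X \<noteq> {} ==> \<exists>d\<in>D. d \<in> (X::'a set)"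
 shows "y \<notin> convex hull (x ` J) \<longleftrightarrow> (\<exists>u\<in>D. \<forall>j\<in>J. u \<bullet> x j < u \<bullet> y)"
proof
 assume "y \<notin> convex hull (x ` J)"
 moreover have "closed (convex hull (x ` J))"
  using assms by (intro compact_imp_closed compact_convex_hull finite_imp_compact) auto
 ultimately obtain a b where ab: "a \<bullet> y < b" "\<And>z. z \<in> convex hull (x ` J) ==> b < a \<bullet> z"
  using separating_hyperplane_closed_point[of "convex hull (x ` J)" y] by auto
 define X where "X = (\<Inter>j\<in>J. {u. u \<bullet> x j < u \<bullet> y})"
 have "open X" unfolding X_def using assms(1)
  by (intro open_INT ballI open_Collect_less continuous_intros) auto
 moreover have "- a \<in> X" unfolding X_def using ab by (force intro: hull_inc)
 ultimately obtain u where "u \<in> D" "u \<in> X" using D[of X] by blast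
 then show "\<exists>u\<in>D. \<forall>j\<in>J. u \<bullet> x j < u \<bullet> y" unfolding X_def by auto
next
 assume "\<exists>u\<in>D. \<forall>j\<in>J. u \<bullet> x j < u \<bullet> y"
 then obtain u where "\<forall>j\<in>J. u \<bullet> x j < u \<bullet> y" by blast
 then have "convex hull (x ` J) \<subseteq> {z. u \<bullet> z < u \<bullet> y}"
  by (intro hull_minimal convex_halfspace_lt) auto
 then show "y \<notin> convex hull (x ` J)" by auto
qed

text \<open>Parameter and point together range over a set cut out by countably many measurable
  conditions; the hulls are its sections.\<close>

lemma measurable_emeasure_convex_hull:
 fixes x :: "'i => 'w => 'a::euclidean_space"
 assumes [simp]: "finite J" and [measurable]: "\<And>j. j \<in> J ==> x j \<in> borel_measurable M"
 shows "(%w. emeasure lborel (convex hull ((%j. x j w) ` J))) \<in> borel_measurable M"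
proof -
 obtain D :: "'a set" where D: "countable D" "\<And>X. open X ==> X \<noteq> {} ==> \<exists>d\<in>D. d \<in> X"
  using countable_dense_exists[where 'a='a] by metis
 let ?g = "M \<Otimes>\<^sub>M lborel"
 have [measurable]: "Measurable.pred ?g (%p. \<exists>u\<in>D. \<forall>j\<in>J. u \<bullet> x j (fst p) < u \<bullet> snd p)"
  using D(1) by measurable
 let ?h = "%p. \<exists>u\<in>D. \<forall>j\<in>J. u \<bullet> x j (fst p) < u \<bullet> snd p"
 let ?f = "%w. Pair w -` {p \<in> space ?g. \<not> (?h p)}"
 have "{p \<in> space ?g. \<not> (?h p)} \<in> sets ?g"
  by measurable
 then have "(%w. emeasure lborel (?f w)) \<in> borel_measurable M"
  by (rule lborel.measurable_emeasure_Pair)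
 also have "?this \<longleftrightarrow> ?thesis"
 proof (rule measurable_cong)
  fix w assume "w \<in> space M"
  have iff: "y \<in> convex hull ((%j. x j w) ` J) \<longleftrightarrow> \<not> (\<exists>u\<in>D. \<forall>j\<in>J. u \<bullet> x j w < u \<bullet> y)" for y
   using not_in_convex_hull_iff[OF assms(1) D(2), where x="%j. x j w"] by blast
  from \<open>w \<in> space M\<close> have "?f w = convex hull ((%j. x j w) ` J)"
   unfolding set_eq_iff iff by (auto simp: space_pair_measure)
  then show "emeasure lborel (?f w)
   = emeasure lborel (convex hull ((%j. x j w) ` J))" by simp
 qed
 finally show ?thesis .
qed

lemma measurable_emeasure_convex_hull_insert:
 fixes x :: "'i => 'w => 'a::euclidean_space"
 assumes [simp]: "finite J" and x: "\<And>j. j \<in> J ==> x j \<in> borel_measurable M" and q: "q \<in> borel_measurable M"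
 shows "(%w. emeasure lborel (convex hull (insert (q w) ((%j. x j w) ` J)))) \<in> borel_measurable M"
proof -
 have "(%w. emeasure lborel (convex hull ((%j. (case j of None => q | Some j => x j) w) ` insert None (Some ` J)))) \<in> borel_measurable M"
  using x q by (intro measurable_emeasure_convex_hull) auto
 then show ?thesis by (simp add: image_image)
qed

lemma measurable_simplex_det:
 fixes x :: "'i => 'w => 'a::euclidean_space"
 assumes "finite J" "\<And>j. j \<in> J ==> x j \<in> borel_measurable M"
 shows "(%w. simplex_det ((%j. x j w) ` J)) \<in> borel_measurable M"
 unfolding simplex_det_def measure_def
 using measurable_emeasure_convex_hull_insert[OF assms, where q="%_. 0"] by measurable

text \<open>Coefficients are indexed by J instead of by points, so coinciding points are allowed and
  the description is uniform in the positions of the points.\<close>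

lemma affine_hull_image_eq:
 fixes x :: "'i => 'a::real_vector"
 assumes J: "finite J" "j0 \<in> J"
 shows "affine hull (x ` J) = {x j0 + (\<Sum>j\<in>J. g j *\<^sub>R (x j - x j0)) | g. True}"
proof -
 let ?g = "%g. \<Sum>j\<in>J. g j *\<^sub>R (x j - x j0)"
 define W where "W = {?g g | g. True}"
 have mem: "x j - x j0 \<in> W" if "j \<in> J" for j
  unfolding W_def using that J(1)
  by (intro CollectI exI[of _ "%i. if i = j then 1 else 0"]) (auto simp: if_distrib[of "%c. c *\<^sub>R _"] cong: if_cong)
 have sub: "subspace W"
 proof (rule subspaceI)
  show "0 \<in> W" unfolding W_def by (intro CollectI exI[of _ "%_. 0"]) auto
  fix a b and c :: real assume "a \<in> W" "b \<in> W"
  then obtain g h where "a = ?g g" "b = ?g h"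
   by (auto simp: W_def)
  then have "a + b = (\<Sum>j\<in>J. (g j + h j) *\<^sub>R (x j - x j0))" "c *\<^sub>R a = (\<Sum>j\<in>J. (c * g j) *\<^sub>R (x j - x j0))"
   by (simp_all add: scaleR_add_left sum.distrib scaleR_sum_right)
  then show "a + b \<in> W" and "c *\<^sub>R a \<in> W" by (auto simp only: W_def mem_Collect_eq)
 qed
 let ?f = "(%z. - x j0 + z) ` (x ` J)"
 have "affine hull (x ` J) = (+) (x j0) ` span ?f"
  using J by (intro affine_hull_span_gen) (auto intro: hull_inc)
 also have "span ?f = W"
 proof (rule antisym)
  show "span ?f \<subseteq> W"
   using mem sub by (intro span_minimal) auto
  show "W \<subseteq> span ?f"
  proof
   fix w assume "w \<in> W"
   then obtain g where "w = (\<Sum>j\<in>J. g j *\<^sub>R (- x j0 + x j))" by (auto simp: W_def)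
   then show "w \<in> span ?f"
    by (auto intro!: span_sum span_scale intro: span_base)
  qed
 qed
 finally show ?thesis unfolding W_def by auto
qed

text \<open>Rounding the coefficients of a point of the affine hull to rationals moves it
  arbitrarily little, so countably many candidates decide a strict inequality.\<close>

lemma infdist_affine_hull_less_iff:
 fixes x :: "'i => 'a::euclidean_space"
 assumes J: "finite J" "j0 \<in> J"
 shows "infdist y (affine hull (x ` J)) < c \<longleftrightarrow>
  (\<exists>g\<in>Pi\<^sub>E J (%_. \<rat>). norm (y - (x j0 + (\<Sum>j\<in>J. g j *\<^sub>R (x j - x j0)))) < c)"
proof
 let ?f = "%g. \<Sum>j\<in>J. g j *\<^sub>R (x j - x j0)"
 assume "\<exists>g\<in>Pi\<^sub>E J (%_. \<rat>). norm (y - (x j0 + ?f g)) < c"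
 then obtain g where g: "norm (y - (x j0 + ?f g)) < c" by blast
 have "x j0 + ?f g \<in> affine hull (x ` J)"
  unfolding affine_hull_image_eq[OF J] by blast
 from infdist_le[OF this, of y] show "infdist y (affine hull (x ` J)) < c"
  using g by (simp add: dist_norm)
next
 assume less: "infdist y (affine hull (x ` J)) < c"
 have ne: "affine hull (x ` J) \<noteq> {}" using J by auto
 from less obtain a where a: "a \<in> affine hull (x ` J)" "dist y a < c"
  unfolding infdist_notempty[OF ne] using cINF_less_iff[of "affine hull (x ` J)" "dist y" c] ne
  by (auto intro!: bdd_belowI[of _ 0])
 then obtain g where g: "a = x j0 + (\<Sum>j\<in>J. g j *\<^sub>R (x j - x j0))"
  unfolding affine_hull_image_eq[OF J] by auto
 \<comment> \<open>The summand 1 keeps B positive when all points coincide.\<close>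
 define B where "B = (\<Sum>j\<in>J. norm (x j - x j0)) + 1"
 have B: "B > 0" by (auto simp: B_def intro!: add_nonneg_pos sum_nonneg)
 define \<eta> where "\<eta> = (c - dist y a) / B"
 have \<eta>: "\<eta> > 0" using a B by (simp add: \<eta>_def)
 have "\<exists>q\<in>\<rat>. \<bar>q - g j\<bar> < \<eta>" for j
 proof -
  obtain q where "q \<in> \<rat>" "g j - \<eta> < q" "q < g j + \<eta>"
   using Rats_dense_in_real[of "g j - \<eta>" "g j + \<eta>"] \<eta> by auto
  then show ?thesis by (intro bexI[of _ q]) auto
 qed
 then obtain h where h: "\<And>j. h j \<in> \<rat>" "\<And>j. \<bar>h j - g j\<bar> < \<eta>" by metis
 let ?h = "restrict h J"
 let ?g = "y - (x j0 + (\<Sum>j\<in>J. ?h j *\<^sub>R (x j - x j0)))"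
 let ?p = "%h g. \<Sum>j\<in>J. (h j - g j) *\<^sub>R (x j - x j0)"
 have "norm ?g \<le> norm (y - a) + norm (?p h g)"
 proof -
  have "?g = (y - a) - (?p h g)"
   by (simp add: g scaleR_diff_left sum_subtractf)
  then show ?thesis by (simp only: norm_triangle_ineq4)
 qed
 also have "norm (?p h g) \<le> (\<Sum>j\<in>J. \<eta> * norm (x j - x j0))"
 proof (rule sum_norm_le)
  fix j
  show "norm ((h j - g j) *\<^sub>R (x j - x j0)) \<le> \<eta> * norm (x j - x j0)"
   using mult_right_mono[OF less_imp_le[OF h(2)[of j]] norm_ge_zero] by simp
 qed
 also have "\<dots> < \<eta> * B" using \<eta> by (simp add: B_def sum_distrib_left[symmetric] algebra_simps)
 also have "\<eta> * B = c - dist y a" using B by (simp add: \<eta>_def)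
 finally have "norm ?g < c" by (simp add: dist_norm)
 moreover have "?h \<in> Pi\<^sub>E J (%_. \<rat>)" using h(1) by auto
 ultimately show "\<exists>g\<in>Pi\<^sub>E J (%_. \<rat>). norm (y - (x j0 + (\<Sum>j\<in>J. g j *\<^sub>R (x j - x j0)))) < c" by blast
qed

lemma measurable_infdist_affine_hull:
 fixes x :: "'i => 'w => 'a::euclidean_space"
 assumes J: "finite J" and x[measurable]: "\<And>j. j \<in> J ==> x j \<in> borel_measurable M"
  and y[measurable]: "y \<in> borel_measurable M"
 shows "(%w. infdist (y w) (affine hull ((%j. x j w) ` J))) \<in> borel_measurable M"
proof (cases "J = {}")
 case True
 then show ?thesis by (simp add: infdist_def)
next
 case False
 then obtain j0 where j0: "j0 \<in> J" by blast
 note [measurable] = x[OF j0]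
 have "countable (Pi\<^sub>E J (%_. \<rat> :: real set))" using J by (intro countable_PiE) (auto simp: countable_rat)
 then have "Measurable.pred M (%w. \<exists>g\<in>Pi\<^sub>E J (%_. \<rat>). norm (y w - (x j0 w + (\<Sum>j\<in>J. g j *\<^sub>R (x j w - x j0 w)))) < c)" for c
  by measurable
 then show ?thesis
  unfolding borel_measurable_iff_less infdist_affine_hull_less_iff[OF J j0] pred_def by simp
qed

lemma measurable_plane_normal:
 fixes x :: "'i => 'w => 'a::euclidean_space"
 assumes "finite J" "\<And>j. j \<in> J ==> x j \<in> borel_measurable M"
 shows "(%w. plane_normal ((%j. x j w) ` J)) \<in> borel_measurable M"
proof -
 have [measurable]: "(%w. infdist b (affine hull ((%j. x j w) ` J))) \<in> borel_measurable M" for b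
  using measurable_infdist_affine_hull[OF assms, where y="%_. b"] by simp
 show ?thesis unfolding plane_normal_def by measurable
qed

lemma measurable_insert_range:
 fixes x :: "'m::finite => 'w => 'a::euclidean_space"
 assumes vx: "v \<in> borel_measurable M" "\<And>i. x i \<in> borel_measurable M"
 shows "(%w. simplex_det (insert (v w) (range (%i. x i w)))) \<in> borel_measurable M" (is ?det)
  and "(%w. plane_normal (insert (v w) (range (%i. x i w)))) \<in> borel_measurable M" (is ?normal)
proof -
 define z where "z i = (case i of None => v | Some i => x i)" for i
 have z: "insert (v w) (range (%i. x i w)) = (%i. z i w) ` UNIV" for w
  unfolding z_def by (auto simp: UNIV_option_conv image_image)
 have zm: "z i \<in> borel_measurable M" for i using vx by (cases i) (auto simp: z_def)
 show ?det unfolding z by (rule measurable_simplex_det) (auto intro: zm)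
 show ?normal unfolding z by (rule measurable_plane_normal) (auto intro: zm)
qed

section \<open>Random simplices on the sphere\<close>

lemma norm_chord_point: "norm (chord_point s (y::'e::euclidean_space)) = 1"
proof (cases "s = 0 \<and> y = 0")
 case False
 define q where "q = (norm y)\<^sup>2 + s\<^sup>2"
 have q: "q > 0" using False by (auto simp: q_def add_pos_nonneg add_nonneg_pos)
 let ?f = "(((norm y)\<^sup>2 - s\<^sup>2) / q)\<^sup>2 + (2 * s / q)\<^sup>2 * (norm y)\<^sup>2"
 let ?g = "((norm y)\<^sup>2 - s\<^sup>2)\<^sup>2 + 4 * s\<^sup>2 * (norm y)\<^sup>2"
 have "?f = ?g / q\<^sup>2"
  by (simp add: power_divide add_divide_distrib power_mult_distrib)
 also have "?g = q\<^sup>2"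
  by (simp add: q_def power2_eq_square algebra_simps)
 finally have "?f = 1" using q by simp
 then show ?thesis using False
  by (simp add: chord_point_def norm_Pair power_mult_distrib power_divide flip: q_def)
qed (simp add: chord_point_def norm_Pair)

lemma snd_chord_point: "snd (chord_point s y) = (2 * s / ((norm y)\<^sup>2 + s\<^sup>2)) *\<^sub>R y"
 by (simp add: chord_point_def)

lemma det_scaleR_rows:
 fixes y :: "'m::finite => real^'m"
 shows "det (\<chi> i. c i *\<^sub>R y i) = (\<Prod>i\<in>UNIV. c i) * det (\<chi> i. y i)"
 using det_rows_mul[of c y] by (simp add: scalar_mult_eq_scaleR)

text \<open>The chord direction (- s, y) is orthogonal to (1, z) exactly when s = z \<bullet> y.
  Choosing the slopes this way puts all chord endpoints into the hyperplane through the base vertex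
  with normal T (1, z), so z parametrises the facet plane independently of the directions.\<close>

lemma chord_simplex:
 fixes T :: "real \<times> (real, 'm::{finite,wellorder}) vec => 'a::euclidean_space" and z :: "(real, 'm) vec"
 assumes T: "linear T" "\<And>x. norm (T x) = norm x" and dim: "DIM('a) = CARD('m) + 1"
  and det: "det (\<chi> i. y i) \<noteq> 0" and pos: "\<And>i. z \<bullet> y i > 0"
 defines "A \<equiv> insert (T (1, 0)) (range (%i. T (chord_point (z \<bullet> y i) (y i))))"
 shows "plane_normal A = T (1, z)"
  and "simplex_det A = (\<Prod>i\<in>UNIV. 2 * (z \<bullet> y i) / ((norm (y i))\<^sup>2 + (z \<bullet> y i)\<^sup>2)) * \<bar>det (\<chi> i. y i)\<bar>"
  and "(norm (T (1, 0) - T (chord_point (z \<bullet> y i) (y i))))\<^sup>2 = 4 * (z \<bullet> y i)\<^sup>2 / ((norm (y i))\<^sup>2 + (z \<bullet> y i)\<^sup>2)"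
proof -
 let ?f = "%i. z \<bullet> y i"
 let ?h = "%i. (norm (y i))\<^sup>2 + (?f i)\<^sup>2"
 define q where "q i = ?h i" for i
 have q: "q i > 0" for i using pos[of i] by (auto simp: q_def add_nonneg_pos)
 define p where "p i = (2 * ?f i / q i) *\<^sub>R y i" for i
 define c where "c i = ((norm (y i))\<^sup>2 - (?f i)\<^sup>2) / q i" for i
 let ?g = "%i. chord_point (?f i) (y i)"
 have cp: "?g i = (c i, p i)" for i
  using pos[of i] by (simp add: chord_point_def c_def p_def q_def)
 have detp: "det (\<chi> i. p i) = (\<Prod>i\<in>UNIV. 2 * ?f i / q i) * det (\<chi> i. y i)"
  unfolding p_def by (rule det_scaleR_rows)
 have pr: "(\<Prod>i\<in>UNIV. 2 * ?f i / q i) > 0"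
  using pos q by (intro prod_pos) auto
 have detp0: "det (\<chi> i. p i) \<noteq> 0" using det pr detp by (metis mult_eq_0_iff less_irrefl)
 have A: "A = insert (T (1, 0)) (range (%i. T (c i, p i)))" by (simp add: A_def cp)
 note cb = chart_basis[OF T dim detp0, of c, folded A]
 show "plane_normal A = T (1, z)"
 proof (rule plane_normal_basis[OF cb(1,2)])
  fix x assume "x \<in> A"
  then consider "x = T (1, 0)" | i where "x = T (c i, p i)" by (auto simp: A)
  then show "T (1, z) \<bullet> x = 1"
  proof cases
   case (2 i)
   have "c i + z \<bullet> p i = ((norm (y i))\<^sup>2 - (?f i)\<^sup>2 + 2 * ?f i * ?f i) / q i"
    by (simp add: c_def p_def add_divide_distrib)
   also have "(norm (y i))\<^sup>2 - (?f i)\<^sup>2 + 2 * ?f i * ?f i = q i"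
    by (simp add: q_def power2_eq_square)
   finally show ?thesis using 2 q[of i] by (simp add: isometry_inner[OF T] inner_prod_def)
  qed (simp add: isometry_inner[OF T] inner_prod_def)
 qed
 show "simplex_det A = (\<Prod>i\<in>UNIV. 2 * ?f i / ?h i) * \<bar>det (\<chi> i. y i)\<bar>"
  using cb(3) pr by (simp add: detp abs_mult q_def)
 let ?p = "%i. (1, 0) - chord_point (?f i) (y i)"
 have "T (1, 0) - T (?g i) = T (?p i)"
  by (rule linear_diff[OF T(1), symmetric])
 then have "(norm (T (1, 0) - T (?g i)))\<^sup>2 = (norm (?p i))\<^sup>2"
  by (simp add: T(2))
 also have "\<dots> = 2 - 2 * c i"
 proof -
  have "(norm (?p i))\<^sup>2 = (norm (1::real, 0::(real,'m) vec))\<^sup>2 + (norm (?g i))\<^sup>2 - 2 * ((1, 0) \<bullet> chord_point (?f i) (y i))"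
   by (simp add: dot_square_norm[symmetric] inner_diff_left inner_diff_right inner_commute)
  then show ?thesis by (simp add: norm_chord_point norm_Pair) (simp add: cp inner_prod_def)
 qed
 also have "\<dots> = 4 * (?f i)\<^sup>2 / q i"
 proof -
  have "2 - 2 * c i = (2 * q i - 2 * ((norm (y i))\<^sup>2 - (?f i)\<^sup>2)) / q i"
   using q[of i] by (simp add: c_def diff_divide_distrib)
  then show ?thesis by (simp add: q_def)
 qed
 finally show "(norm (T (1, 0) - T (?g i)))\<^sup>2 = 4 * (?f i)\<^sup>2 / ?h i"
  by (simp add: q_def)
qed

lemma chord_simplex_degenerate:
 fixes T :: "real \<times> (real, 'm::{finite,wellorder}) vec => 'a::euclidean_space"
 assumes T: "linear T" "\<And>x. norm (T x) = norm x" and det: "det (\<chi> i. y i) = 0"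
 shows "simplex_det (insert (T (1, 0)) (range (%i. T (chord_point (s i) (y i))))) = 0"
proof -
 have "det (\<chi> i. snd (chord_point (s i) (y i))) = 0"
  unfolding snd_chord_point det_scaleR_rows det by simp
 from chart_degenerate[OF T this, of "%i. fst (chord_point (s i) (y i))"] show ?thesis by simp
qed

text \<open>The density is a function on the whole space with global positive bounds, so bounds and
  Borel measurability carry no side conditions. The argument \<open>tang\<close> passes the index
  type of tangential coordinates to the locale.\<close>

locale sphere_sample =
 fixes F :: "'a::euclidean_space => real" and lo hi :: real and tang :: "'m::{finite,wellorder} itself"
 assumes dim: "DIM('a) = CARD('m) + 1"
  and F_measurable [measurable]: "F \<in> borel_measurable borel"
  and F_cont: "continuous_on (sphere 0 1) F"
  and lo_pos: "0 < lo" and F_lo: "\<And>x. lo \<le> F x" and F_hi: "\<And>x. F x \<le> hi"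
  and F_int: "(\<integral>\<^sup>+x. ennreal (F x) \<partial>sphere_measure) = 1"
begin

definition P :: "'a measure" where "P = density sphere_measure (%x. ennreal (F x))"

lemma F_pos: "F x > 0" using lo_pos F_lo[of x] by linarith

lemma F_nonneg: "F x \<ge> 0" using F_pos[of x] by linarith

lemma space_P [simp]: "space P = sphere 0 1"
 by (simp add: P_def)

lemma sets_P [simp, measurable_cong]: "sets P = sets (restrict_space borel (sphere 0 1))"
 by (simp add: P_def)

lemma measurable_P: "g \<in> borel_measurable borel ==> g \<in> borel_measurable P"
 by (simp add: measurable_restrict_space1 cong: measurable_cong_sets)

lemma nn_integral_P:
 fixes g :: "'a => ennreal"
 assumes "g \<in> borel_measurable P"
 shows "(\<integral>\<^sup>+x. g x \<partial>P) = (\<integral>\<^sup>+x. ennreal (F x) * g x \<partial>sphere_measure)"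
 unfolding P_def
proof (rule nn_integral_density)
 show "(%x. ennreal (F x)) \<in> borel_measurable sphere_measure"
  by (rule measurable_sphere_measure) measurable
 show "g \<in> borel_measurable sphere_measure" using assms by (simp add: P_def)
qed

lemma prob_space_P: "prob_space P"
proof (rule prob_spaceI)
 have "emeasure P (space P) = (\<integral>\<^sup>+x. 1 \<partial>P)" by simp
 also have "\<dots> = 1" by (subst nn_integral_P) (auto simp: F_int)
 finally show "emeasure P (space P) = 1" .
qed

sublocale P: prob_space P by (rule prob_space_P)

sublocale PP: product_prob_space "%_. P" UNIV ..

lemma measurable_into_P:
 fixes f :: "'w => 'a"
 assumes "f \<in> borel_measurable M" "\<And>w. w \<in> space M ==> norm (f w) = 1"
 shows "f \<in> measurable M P"
proof -
 have "f \<in> measurable M (restrict_space borel (sphere 0 1))"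
  using assms by (intro measurable_restrict_space2) auto
 then show ?thesis by (simp cong: measurable_cong_sets)
qed

lemma measurable_sample_component:
 "(%x. x i) \<in> borel_measurable (PiM (UNIV :: 'm set) (%_. P))"
 by (rule measurable_compose[OF measurable_component_singleton[of i] measurable_P]) auto

lemma measurable_pair_sample:
 "fst \<in> borel_measurable (P \<Otimes>\<^sub>M PiM (UNIV :: 'm set) (%_. P))"
 "(%p. snd p i) \<in> borel_measurable (P \<Otimes>\<^sub>M PiM (UNIV :: 'm set) (%_. P))"
 using measurable_compose[OF measurable_fst measurable_P[of "%x. x"]]
  measurable_compose[OF measurable_snd measurable_sample_component] by auto

text \<open>Each sample point gets chord coordinates of its own. For fixed directions y the slopes
  are substituted by s = Y z, with Jacobian |det Y|; the assumption \<open>vanish\<close> disposes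
  of the directions with singular Y.\<close>

lemma nn_integral_P_vec:
 fixes T :: "real \<times> (real, 'm) vec => 'a" and m :: "'m => nat"
 assumes T: "linear T" "\<And>x. norm (T x) = norm x" and m: "\<And>i. m i > 0"
  and G: "G \<in> borel_measurable (PiM (UNIV :: 'm set) (%_. P))"
  and vanish: "\<And>s y. det (\<chi> i. y i) = 0 ==> G (%i. T (chord_point (s i) (y i))) = 0"
 shows "(\<integral>\<^sup>+x. G x \<partial>PiM (UNIV :: 'm set) (%_. P))
  = (\<integral>\<^sup>+y. (\<integral>\<^sup>+z. ennreal (\<bar>det (\<chi> i. y i)\<bar> * (\<Prod>i\<in>UNIV. chord_weight (m i) (z \<bullet> y i) (y i) * F (T (chord_point (z \<bullet> y i) (y i)))))
    * G (%i. T (chord_point (z \<bullet> y i) (y i))) \<partial>lborel) \<partial>PiM (UNIV :: 'm set) (%_. lborel))"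
proof -
 have [measurable]: "T \<in> borel_measurable borel" by (rule isometry_measurable[OF T(1)])
 have psP: "product_sigma_finite (%_::'m. P)" by unfold_locales
 have psl: "product_sigma_finite (%_::'m. lborel :: (real \<times> (real, 'm) vec) measure)" ..
 define \<phi> :: "real \<times> (real, 'm) vec => 'a" where "\<phi> p = T (chord_point (fst p) (snd p))" for p
 define w where "w i p = ennreal (chord_weight (m i) (fst p) (snd p) * F (\<phi> p))" for i p
 have \<phi>m: "\<phi> \<in> borel_measurable borel" unfolding \<phi>_def by measurable
 then have \<phi>P: "\<phi> \<in> measurable lborel P"
  by (intro measurable_into_P) (auto simp: \<phi>_def T norm_chord_point)
 note [measurable] = \<phi>m
 have wm[measurable]: "w i \<in> borel_measurable borel" for i unfolding w_def by measurable
 let ?g = "%z y. \<Prod>i\<in>UNIV. chord_weight (m i) (z \<bullet> y i) (y i) * F (T (chord_point (z \<bullet> y i) (y i)))"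
 let ?r = "%y. \<chi> i. y i"
 let ?f = "%y. \<integral>\<^sup>+z. ennreal (\<bar>det (?r y)\<bar> * ?g z y) * G (%i. T (chord_point (z \<bullet> y i) (y i))) \<partial>lborel"
 let ?h = "%_. lborel"
 let ?p = "%y. \<integral>\<^sup>+s. (\<Prod>i\<in>UNIV. w i (s i, y i)) * G (%i. \<phi> (s i, y i)) \<partial>PiM UNIV ?h"
 let ?q = "lborel :: (real, 'm) vec measure"
 let ?u = "%z y. %i. z \<bullet> y i"
 let ?v = "%g. \<integral>\<^sup>+x. ennreal (F x) * g x \<partial>sphere_measure"
 have "(\<integral>\<^sup>+x. G x \<partial>PiM UNIV (%_. P)) = (\<integral>\<^sup>+x. (\<Prod>i\<in>UNIV. w i (x i)) * G (\<lambda>i\<in>UNIV. \<phi> (x i)) \<partial>PiM UNIV ?h)"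
 proof (rule PiM_change_of_variables[OF psP psl, where w=w and \<phi>="%_. \<phi>"])
  fix i and g :: "'a => ennreal" assume g: "g \<in> borel_measurable P"
  \<comment> \<open>Extension by zero turns a function measurable on the sphere into a Borel
    function on the whole space.\<close>
  define g' where "g' x = (if x \<in> sphere 0 1 then g x else 0)" for x
  have g': "g' \<in> borel_measurable borel"
  proof -
   have "g \<in> borel_measurable (restrict_space borel (sphere 0 1))" using g by (simp cong: measurable_cong_sets)
   then have "(%x. g x * indicator (sphere 0 1) x) \<in> borel_measurable borel"
    by (subst (asm) borel_measurable_restrict_space_iff_ennreal) auto
   moreover have "(%x. g x * indicator (sphere 0 1) x) = g'" by (auto simp: g'_def indicator_def fun_eq_iff)
   ultimately show ?thesis by simp
  qed
  have "(\<integral>\<^sup>+x. g x \<partial>P) = ?v g" by (rule nn_integral_P[OF g])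
  also have "\<dots> = ?v g'"
   by (intro nn_integral_cong) (auto simp: g'_def)
  also have "\<dots> = (\<integral>\<^sup>+p. ennreal (chord_weight (m i) (fst p) (snd p)) * (ennreal (F (\<phi> p)) * g' (\<phi> p)) \<partial>lborel)"
   unfolding \<phi>_def using g' dim by (intro nn_integral_sphere_chord[OF T _ m]) auto
  also have "\<dots> = (\<integral>\<^sup>+p. w i p * g (\<phi> p) \<partial>lborel)"
  proof (rule nn_integral_cong)
   fix p
   have "g' (\<phi> p) = g (\<phi> p)" by (simp add: g'_def \<phi>_def T norm_chord_point)
   then show "ennreal (chord_weight (m i) (fst p) (snd p)) * (ennreal (F (\<phi> p)) * g' (\<phi> p)) = w i p * g (\<phi> p)"
    by (simp add: w_def ennreal_mult chord_weight_nonneg[OF m] F_nonneg mult.assoc)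
  qed
  finally show "(\<integral>\<^sup>+x. g x \<partial>P) = (\<integral>\<^sup>+p. w i p * g (\<phi> p) \<partial>lborel)" .
 qed (use G \<phi>P in auto)
 also have "\<dots> = (\<integral>\<^sup>+x. (\<Prod>i\<in>UNIV. w i (x i)) * G (%i. \<phi> (x i)) \<partial>PiM UNIV (%_. lborel \<Otimes>\<^sub>M lborel))"
  by (simp add: lborel_prod restrict_def)
 also have "\<dots> = (\<integral>\<^sup>+y. ?p y \<partial>PiM UNIV ?h)"
 proof -
  have "(%x. \<lambda>i\<in>UNIV. \<phi> (x i)) \<in> measurable (PiM (UNIV::'m set) ?h) (PiM UNIV (%_. P))"
   by (intro measurable_restrict measurable_compose[OF _ \<phi>P] measurable_component_singleton) auto
  from measurable_compose[OF this G]
  have [measurable]: "(%x. G (%i. \<phi> (x i))) \<in> borel_measurable (PiM (UNIV::'m set) ?h)"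
   by (simp add: restrict_def)
  show ?thesis
   by (subst PiM_pair_nn_integral) (auto simp: lborel_prod restrict_def intro: product_sigma_finite.intro lborel.sigma_finite_measure_axioms)
 qed
 also have "\<dots> = (\<integral>\<^sup>+y. ?f y \<partial>PiM (UNIV :: 'm set) ?h)"
 proof (rule nn_integral_cong)
  fix y :: "'m => (real, 'm) vec"
  define H where "H s = (\<Prod>i\<in>UNIV. w i (s i, y i)) * G (%i. \<phi> (s i, y i))" for s
  show "?p y
   = ?f y"
  proof (cases "det (?r y) = 0")
   case True
   then show ?thesis using vanish[OF True] by (simp add: \<phi>_def)
  next
   case False
   have [measurable]: "(%s::(real, 'm) vec. s $ i) \<in> borel_measurable borel" for i
    by (intro borel_measurable_continuous_onI continuous_intros)
   have "(%s. \<lambda>i\<in>UNIV. \<phi> (s $ i, y i)) \<in> measurable (borel :: (real, 'm) vec measure) (PiM UNIV (%_. P))"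
    by (intro measurable_restrict measurable_into_P) (measurable, simp add: \<phi>_def T norm_chord_point)
   from measurable_compose[OF this G]
   have [measurable]: "(%s::(real, 'm) vec. G (%i. \<phi> (s $ i, y i))) \<in> borel_measurable borel"
    by (simp add: restrict_def)
   have Hm: "(%s::(real, 'm) vec. H (%i. s $ i)) \<in> borel_measurable borel"
    unfolding H_def by measurable
   have "(\<integral>\<^sup>+s. H s \<partial>PiM UNIV ?h) = (\<integral>\<^sup>+s. H (%i. s $ i) \<partial>?q)"
    by (subst nn_integral_vec_PiM[OF Hm]) (simp add: vec_lambda_inverse)
   also have "\<dots> = ennreal \<bar>det (?r y)\<bar> * (\<integral>\<^sup>+z. H (%i. (?r y *v z) $ i) \<partial>?q)"
    by (rule nn_integral_matrix_vector_mult[OF False Hm])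
   also have "(%z. H (%i. (?r y *v z) $ i)) = (%z. H (?u z y))"
    by (simp add: matrix_vector_mul_component inner_commute)
   also have "ennreal \<bar>det (?r y)\<bar> * (\<integral>\<^sup>+z. H (?u z y) \<partial>?q)
    = (\<integral>\<^sup>+z. ennreal \<bar>det (?r y)\<bar> * H (?u z y) \<partial>?q)"
   proof (rule nn_integral_cmult[symmetric])
    have [measurable]: "(%z. ?r y *v z) \<in> borel_measurable (borel :: (real, 'm) vec measure)"
     by (rule isometry_measurable[OF matrix_vector_mul_linear])
    have "(%z. H (%i. (?r y *v z) $ i)) \<in> borel_measurable borel"
     by (rule measurable_compose[OF _ Hm]) measurable
    then show "(%z. H (?u z y)) \<in> borel_measurable lborel"
     by (simp add: matrix_vector_mul_component inner_commute)
   qed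
   also have "\<dots> = ?f y"
   proof (rule nn_integral_cong)
    fix z :: "(real, 'm) vec"
    have "(\<Prod>i\<in>UNIV. w i (z \<bullet> y i, y i)) = ennreal (?g z y)"
     unfolding w_def \<phi>_def by (subst prod_ennreal) (auto simp: chord_weight_nonneg[OF m] F_nonneg)
    then show "ennreal \<bar>det (?r y)\<bar> * H (?u z y)
     = ennreal (\<bar>det (?r y)\<bar> * ?g z y)
      * G (%i. T (chord_point (z \<bullet> y i) (y i)))"
     by (simp add: H_def \<phi>_def ennreal_mult' mult.assoc)
   qed
   finally show ?thesis by (simp add: H_def)
  qed
 qed
 finally show ?thesis .
qed

end

text \<open>The logarithm is squeezed by - p / (1 - p) \<le> ln (1 - p) \<le> - p. Dropping n
  factors changes nothing in the limit since p tends to 0.\<close>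

lemma one_minus_power_tendsto_exp:
 fixes p :: "nat => real"
 assumes p: "\<And>N. 0 \<le> p N" and lim: "(%N. real N * p N) \<longlonglongrightarrow> L"
 shows "(%N. (1 - p N) ^ (N - n)) \<longlonglongrightarrow> exp (- L)"
proof -
 have p0: "p \<longlonglongrightarrow> 0"
 proof -
  have "(%N. (real N * p N) * (1 / real N)) \<longlonglongrightarrow> L * 0"
   by (intro tendsto_mult lim lim_1_over_n)
  moreover have "\<forall>\<^sub>F N in sequentially. real N * p N * (1 / real N) = p N"
   using eventually_gt_at_top[of 0] by eventually_elim simp
  ultimately show ?thesis by (simp add: tendsto_cong)
 qed
 have ev1: "\<forall>\<^sub>F N in sequentially. p N < 1 / 2"
  using p0 by (rule order_tendstoD) simp
 have limn: "(%N. real (N - n) * p N) \<longlonglongrightarrow> L"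
 proof -
  have "(%N. real N * p N - real n * p N) \<longlonglongrightarrow> L - real n * 0"
   by (intro tendsto_intros lim p0)
  moreover have "\<forall>\<^sub>F N in sequentially. real N * p N - real n * p N = real (N - n) * p N"
   using eventually_ge_at_top[of n] by eventually_elim (simp add: of_nat_diff algebra_simps)
  ultimately show ?thesis by (simp add: tendsto_cong)
 qed
 let ?f = "%N. real (N - n) * ln (1 - p N)"
 have "(%N. real (N - n) * ln (1 - p N)) \<longlonglongrightarrow> - L"
 proof (rule tendsto_sandwich)
  show "\<forall>\<^sub>F N in sequentially. - (real (N - n) * p N) / (1 - p N) \<le> real (N - n) * ln (1 - p N)"
   using ev1
  proof eventually_elim
   case (elim N)
   have "ln (inverse (1 - p N)) \<le> inverse (1 - p N) - 1" using elim by (intro ln_le_minus_one) auto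
   then have "1 - inverse (1 - p N) \<le> ln (1 - p N)" using elim by (simp add: ln_inverse)
   moreover have "1 - inverse (1 - p N) = - p N / (1 - p N)" using elim by (simp add: field_simps)
   ultimately have "real (N - n) * (- p N / (1 - p N)) \<le> ?f N"
    by (intro mult_left_mono) auto
   then show ?case by simp
  qed
  show "\<forall>\<^sub>F N in sequentially. real (N - n) * ln (1 - p N) \<le> - (real (N - n) * p N)"
   using ev1
  proof eventually_elim
   case (elim N)
   have "ln (1 - p N) \<le> (1 - p N) - 1" using elim by (intro ln_le_minus_one) auto
   then have "?f N \<le> real (N - n) * (- p N)" by (intro mult_left_mono) auto
   then show ?case by simp
  qed
  show "(%N. - (real (N - n) * p N) / (1 - p N)) \<longlonglongrightarrow> - L"
   using tendsto_divide[OF tendsto_minus[OF limn] tendsto_diff[OF tendsto_const[of 1] p0]] by simp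
  show "(%N. - (real (N - n) * p N)) \<longlonglongrightarrow> - L" by (intro tendsto_minus limn)
 qed
 then have "(%N. exp (?f N)) \<longlonglongrightarrow> exp (- L)" by (rule tendsto_exp)
 moreover have "\<forall>\<^sub>F N in sequentially. exp (?f N) = (1 - p N) ^ (N - n)"
  using ev1 by eventually_elim (simp add: exp_of_nat_mult)
 ultimately show ?thesis by (simp add: tendsto_cong)
qed

section \<open>The probability of caps under the density\<close>

context sphere_sample
begin

text \<open>The chance that one further sample point leaves a candidate facet with normal a
  intact.\<close>

definition below :: "'a => real" where "below a = measure P {z \<in> sphere 0 1. a \<bullet> z < 1}"

lemma cap_sets: "{z. a \<bullet> z \<ge> 1} \<inter> sphere 0 1 \<in> sets P"
 by (auto simp: sets_restrict_space borel_closed closed_halfspace_ge)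

lemma below_eq: "below a = 1 - measure P ({z. a \<bullet> z \<ge> 1} \<inter> sphere 0 1)"
proof -
 have "{z \<in> sphere 0 1. a \<bullet> z < 1} = space P - ({z. a \<bullet> z \<ge> 1} \<inter> sphere 0 1)" by auto
 then show ?thesis using P.prob_compl[OF cap_sets] by (simp add: below_def)
qed

lemma below_bounds: "0 \<le> below a" "below a \<le> 1"
 by (simp_all add: below_def)

text \<open>The density bounds are asked on the cap only. The global lower bound yields exponential
  decay, and the extreme values on a shrinking neighbourhood yield the exact limit.\<close>

lemma cap_bounds:
 assumes a: "norm a \<ge> 1"
  and F: "\<And>z. z \<in> sphere 0 1 ==> a \<bullet> z \<ge> 1 ==> l \<le> F z \<and> F z \<le> u" and l: "0 \<le> l" and u: "0 \<le> u"
 shows "l * (unit_ball_vol CARD('m) * sqrt ((norm a)\<^sup>2 - 1) ^ CARD('m) / norm a ^ DIM('a)) \<le> 1 - below a"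
  and "1 - below a \<le> u * (unit_ball_vol CARD('m) * sqrt ((norm a)\<^sup>2 - 1) ^ CARD('m))"
proof -
 let ?C = "{z. a \<bullet> z \<ge> 1} \<inter> sphere 0 1"
 have C: "?C \<in> sets (sphere_measure :: 'a measure)"
  using cap_sets[of a] by (simp add: P_def)
 have e: "ennreal (1 - below a) = emeasure P ?C"
  by (simp add: below_eq P.emeasure_eq_measure)
 let ?f = "\<integral>\<^sup>+z. ennreal (F z) * indicator ?C z \<partial>sphere_measure"
 have eI: "emeasure P ?C = ?f"
 proof -
  have "emeasure P ?C = (\<integral>\<^sup>+z. indicator ?C z \<partial>P)" using cap_sets[of a] by simp
  also have "\<dots> = ?f"
   by (rule nn_integral_P) (intro borel_measurable_indicator cap_sets)
  finally show ?thesis .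
 qed
 have dim': "DIM('a) = DIM((real, 'm) vec) + 1" using dim by simp
 note cb = cap_emeasure_bounds[OF dim' a]
 have \<rho>: "0 \<le> (norm a)\<^sup>2 - 1" using a by simp
 let ?g = "unit_ball_vol CARD('m) * sqrt ((norm a)\<^sup>2 - 1) ^ CARD('m) / norm a ^ DIM('a)"
 have "ennreal (l * ?g)
   = ennreal l * ennreal ?g"
  using l by (rule ennreal_mult')
 also have "\<dots> \<le> ennreal l * emeasure sphere_measure ?C"
  using cb(2) by (intro mult_left_mono) auto
 also have "\<dots> = (\<integral>\<^sup>+z. ennreal l * indicator ?C z \<partial>sphere_measure)"
  using C by (simp add: nn_integral_cmult_indicator)
 also have "\<dots> \<le> ?f"
  using F by (intro nn_integral_mono) (auto simp: indicator_def intro!: ennreal_leI)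
 finally show "l * ?g \<le> 1 - below a"
  using below_bounds[of a] unfolding eI[symmetric] e[symmetric] by (subst (asm) ennreal_le_iff) auto
 let ?h = "unit_ball_vol CARD('m) * sqrt ((norm a)\<^sup>2 - 1) ^ CARD('m)"
 have "ennreal (1 - below a) = ?f"
  by (simp only: e eI)
 also have "\<dots> \<le> (\<integral>\<^sup>+z. ennreal u * indicator ?C z \<partial>sphere_measure)"
  using F by (intro nn_integral_mono) (auto simp: indicator_def intro!: ennreal_leI)
 also have "\<dots> = ennreal u * emeasure sphere_measure ?C"
  using C by (simp add: nn_integral_cmult_indicator)
 also have "\<dots> \<le> ennreal u * ennreal ?h"
  using cb(1) by (intro mult_left_mono) auto
 also have "\<dots> = ennreal (u * ?h)"
  using u by (rule ennreal_mult'[symmetric])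
 finally show "1 - below a \<le> u * ?h"
  using u \<rho> by (subst (asm) ennreal_le_iff) auto
qed

text \<open>The lower cap bound combined with 1 - x \<le> exp (- x). The factor 2^n replaces
  |a|^n.\<close>

lemma below_le_exp:
 assumes "1 \<le> norm a" "norm a \<le> 2"
 shows "below a ^ k \<le> exp (- (real k * (lo * unit_ball_vol CARD('m) / 2 ^ DIM('a) * sqrt ((norm a)\<^sup>2 - 1) ^ CARD('m))))"
proof -
 let ?b = "lo * unit_ball_vol CARD('m) / 2 ^ DIM('a) * sqrt ((norm a)\<^sup>2 - 1) ^ CARD('m)"
 define X where "X = unit_ball_vol CARD('m) * sqrt ((norm a)\<^sup>2 - 1) ^ CARD('m)"
 have "0 \<le> (norm a)\<^sup>2 - 1" using assms(1) by simp
 then have X: "0 \<le> lo * X"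
  unfolding X_def using lo_pos by (intro mult_nonneg_nonneg zero_le_power) auto
 have "norm a ^ DIM('a) \<le> 2 ^ DIM('a)" using assms by (intro power_mono) auto
 moreover have "0 < norm a ^ DIM('a)" using assms(1) by (intro zero_less_power) linarith
 ultimately have "lo * X / 2 ^ DIM('a) \<le> lo * X / norm a ^ DIM('a)"
  using X by (intro divide_left_mono) auto
 also have "lo * X / norm a ^ DIM('a) \<le> 1 - below a"
  using cap_bounds(1)[OF assms(1), of lo hi] F_lo F_hi lo_pos order_trans[OF F_nonneg F_hi]
  by (simp add: X_def)
 also have "lo * X / 2 ^ DIM('a) = ?b" by (simp add: X_def)
 finally have "below a \<le> 1 - ?b" by simp
 also have "1 - ?b \<le> exp (- ?b)" using exp_ge_add_one_self[of "- ?b"] by simp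
 finally have "below a ^ k \<le> exp (- ?b) ^ k" using below_bounds by (intro power_mono)
 then show ?thesis by (simp add: exp_of_nat_mult[symmetric])
qed

text \<open>A tangential part of size \<epsilon> = N^(-1/d) gives a cap of measure of order 1/N: its
  slope is \<epsilon> |\<zeta>| and N \<epsilon>^d = 1. On the cap the density lies between its
  extremes on compact neighbourhoods that shrink to the base point.\<close>

lemma below_tendsto:
 fixes T :: "real \<times> (real, 'm) vec => 'a" and \<zeta> :: "(real, 'm) vec"
 assumes T: "linear T" "\<And>x. norm (T x) = norm x"
 shows "(%N. below (T (1, (real N powr (- 1 / CARD('m))) *\<^sub>R \<zeta>)) ^ (N - n))
  \<longlonglongrightarrow> exp (- (F (T (1, 0)) * unit_ball_vol CARD('m) * norm \<zeta> ^ CARD('m)))"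
proof -
 let ?d = "CARD('m)"
 define v where "v = T (1, 0)"
 define \<epsilon> where "\<epsilon> N = real N powr (- 1 / ?d)" for N
 define a where "a N = T (1, \<epsilon> N *\<^sub>R \<zeta>)" for N
 have \<epsilon>0: "\<epsilon> \<longlonglongrightarrow> 0"
  unfolding \<epsilon>_def using tendsto_neg_powr[OF _ filterlim_real_sequentially, of "- 1 / ?d"] by simp
 have \<epsilon>nn: "\<epsilon> N \<ge> 0" for N by (simp add: \<epsilon>_def)
 have \<epsilon>d: "real N * \<epsilon> N ^ ?d = 1" if "N > 0" for N
 proof -
  have "\<epsilon> N ^ ?d = real N powr (- 1)"
   using that unfolding \<epsilon>_def by (subst powr_realpow[symmetric]) (auto simp: powr_powr)
  then show ?thesis using that by (simp add: powr_minus)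
 qed
 have v1: "norm v = 1" by (simp add: v_def T norm_Pair)
 let ?f = "%N. \<epsilon> N * norm \<zeta>"
 have na: "(norm (a N))\<^sup>2 = 1 + (?f N)\<^sup>2" for N
  by (simp add: a_def T norm_Pair power_mult_distrib)
 have na1: "norm (a N) \<ge> 1" for N
 proof -
  have "1\<^sup>2 \<le> (norm (a N))\<^sup>2" unfolding na by simp
  then show ?thesis by (rule power2_le_imp_le) simp
 qed
 have \<rho>: "sqrt ((norm (a N))\<^sup>2 - 1) = ?f N" for N
  using \<epsilon>nn[of N] by (simp add: na)
 \<comment> \<open>On the sphere |z - a|^2 = 1 - 2 (a \<bullet> z) + |a|^2, which on the cap is at
   most |a|^2 - 1.\<close>
 have near: "dist z v \<le> 2 * \<epsilon> N * norm \<zeta>" if z: "z \<in> sphere 0 1" "a N \<bullet> z \<ge> 1" for z N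
 proof -
  have "(norm (z - a N))\<^sup>2 = (norm z)\<^sup>2 - 2 * (a N \<bullet> z) + (norm (a N))\<^sup>2"
   by (simp add: dot_square_norm[symmetric] inner_diff_left inner_diff_right inner_commute)
  also have "\<dots> \<le> (?f N)\<^sup>2" using z by (simp add: na)
  finally have 1: "norm (z - a N) \<le> ?f N" by (rule power2_le_imp_le) (simp add: \<epsilon>nn)
  have "a N - v = T (0, \<epsilon> N *\<^sub>R \<zeta>)"
   using linear_diff[OF T(1), of "(1, \<epsilon> N *\<^sub>R \<zeta>)" "(1, 0)"] by (simp add: a_def v_def)
  then have 2: "norm (a N - v) = ?f N" using \<epsilon>nn[of N] by (simp add: T norm_Pair)
  have "dist z v \<le> norm (z - a N) + norm (a N - v)"
   using norm_triangle_ineq[of "z - a N" "a N - v"] by (simp add: dist_norm)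
  then show ?thesis using 1 2 by simp
 qed
 define B where "B N = cball v (2 * \<epsilon> N * norm \<zeta>) \<inter> sphere 0 1" for N
 have B: "compact (B N)" "v \<in> B N" for N using \<epsilon>nn[of N] v1 by (auto simp: B_def compact_Int_closed)
 have contB: "continuous_on (B N) F" for N
  by (rule continuous_on_subset[OF F_cont]) (auto simp: B_def)
 obtain zu where zu: "\<And>N. zu N \<in> B N" "\<And>N z. z \<in> B N ==> F z \<le> F (zu N)"
  using continuous_attains_sup[OF B(1) _ contB] B(2) by (metis empty_iff)
 obtain zl where zl: "\<And>N. zl N \<in> B N" "\<And>N z. z \<in> B N ==> F (zl N) \<le> F z"
  using continuous_attains_inf[OF B(1) _ contB] B(2) by (metis empty_iff)
 let ?q = "%N. 2 * \<epsilon> N * norm \<zeta>"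
 have limF: "(%N. F (w N)) \<longlonglongrightarrow> F v" if w: "\<And>N. w N \<in> B N" for w
 proof -
  have "?q \<longlonglongrightarrow> 2 * 0 * norm \<zeta>" by (intro tendsto_intros \<epsilon>0)
  then have lim0: "?q \<longlonglongrightarrow> 0" by simp
  have "(%N. dist (w N) v) \<longlonglongrightarrow> 0"
   by (rule tendsto_sandwich[OF _ _ tendsto_const lim0]) (use w in \<open>auto simp: B_def dist_commute\<close>)
  then have "w \<longlonglongrightarrow> v" by (rule iffD2[OF tendsto_dist_iff])
  then show ?thesis using w v1
   by (intro continuous_on_tendsto_compose[OF F_cont]) (auto simp: B_def)
 qed
 define p where "p N = 1 - below (a N)" for N
 have p: "0 \<le> p N" for N using below_bounds by (simp add: p_def)
 let ?g = "F v * unit_ball_vol ?d * norm \<zeta> ^ ?d"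
 let ?h = "%N. F (zl N) * unit_ball_vol ?d * norm \<zeta> ^ ?d / norm (a N) ^ DIM('a)"
 let ?p = "%N. real N * (F (zl N) * (unit_ball_vol ?d * ?f N ^ ?d / norm (a N) ^ DIM('a)))"
 have "(%N. real N * p N) \<longlonglongrightarrow> ?g"
 proof (rule tendsto_sandwich)
  have capB: "z \<in> B N" if "z \<in> sphere 0 1" "a N \<bullet> z \<ge> 1" for z N
   using near[OF that] that by (auto simp: B_def dist_commute)
  show "\<forall>\<^sub>F N in sequentially. F (zl N) * unit_ball_vol ?d * norm \<zeta> ^ ?d / norm (a N) ^ DIM('a) \<le> real N * p N"
   using eventually_gt_at_top[of 0]
  proof eventually_elim
   case (elim N)
   have "F (zl N) * (unit_ball_vol ?d * sqrt ((norm (a N))\<^sup>2 - 1) ^ ?d / norm (a N) ^ DIM('a)) \<le> p N"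
    unfolding p_def 
    by (rule cap_bounds(1)[where l="F (zl N)" and u="F (zu N)", OF na1 _ F_nonneg F_nonneg])
     (use zl(2) zu(2) capB in auto)
   then have "?p N \<le> real N * p N"
    unfolding \<rho> by (intro mult_left_mono) auto
   also have "?p N
    = (real N * \<epsilon> N ^ ?d) * (F (zl N) * unit_ball_vol ?d * norm \<zeta> ^ ?d / norm (a N) ^ DIM('a))"
    by (simp add: power_mult_distrib)
   finally show ?case by (simp only: \<epsilon>d[OF elim] mult_1)
  qed
  show "\<forall>\<^sub>F N in sequentially. real N * p N \<le> F (zu N) * unit_ball_vol ?d * norm \<zeta> ^ ?d"
   using eventually_gt_at_top[of 0]
  proof eventually_elim
   case (elim N)
   have "p N \<le> F (zu N) * (unit_ball_vol ?d * sqrt ((norm (a N))\<^sup>2 - 1) ^ ?d)"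
    unfolding p_def 
    by (rule cap_bounds(2)[where l="F (zl N)" and u="F (zu N)", OF na1 _ F_nonneg F_nonneg])
     (use zl(2) zu(2) capB in auto)
   then have "real N * p N \<le> real N * (F (zu N) * (unit_ball_vol ?d * ?f N ^ ?d))"
    unfolding \<rho> by (intro mult_left_mono) auto
   also have "\<dots> = (real N * \<epsilon> N ^ ?d) * (F (zu N) * unit_ball_vol ?d * norm \<zeta> ^ ?d)"
    by (simp add: power_mult_distrib)
   finally show ?case by (simp only: \<epsilon>d[OF elim] mult_1)
  qed
  have "(%N. sqrt (1 + (?f N)\<^sup>2)) \<longlonglongrightarrow> sqrt (1 + (0 * norm \<zeta>)\<^sup>2)"
   by (intro tendsto_intros \<epsilon>0)
  moreover have "norm (a N) = sqrt (1 + (?f N)\<^sup>2)" for N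
   by (metis na norm_ge_zero real_sqrt_unique)
  ultimately have na_lim: "(%N. norm (a N)) \<longlonglongrightarrow> 1" by simp
  have "?h \<longlonglongrightarrow> F v * unit_ball_vol ?d * norm \<zeta> ^ ?d / 1 ^ DIM('a)"
   by (intro tendsto_intros limF zl na_lim) auto
  then show "?h \<longlonglongrightarrow> ?g"
   by simp
  show "(%N. F (zu N) * unit_ball_vol ?d * norm \<zeta> ^ ?d) \<longlonglongrightarrow> ?g"
   by (intro tendsto_intros limF zu)
 qed
 from one_minus_power_tendsto_exp[OF p this, of n]
 show ?thesis by (simp add: p_def a_def \<epsilon>_def v_def)
qed

end

section \<open>Scaling limits of simplex functionals\<close>

context sphere_sample
begin

text \<open>The part of the rescaled integrand that does not depend on N. The exponent d + 2 k i of
  the slope collects d - 1 powers from the chord weight, one from the simplex volume and 2 k i from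
  the squared distance to the base vertex; the Gamma argument is half the exponent m = 2 (n + k i)
  used in the weight.\<close>

definition limit_kernel :: "('m => nat) => nat => ('m => (real, 'm) vec) => (real, 'm) vec => real" where
 "limit_kernel k j y \<zeta> = (det (\<chi> i. y i))\<^sup>2 *
   (\<Prod>i\<in>UNIV. 4 / Gamma (real (DIM('a) + k i)) * 2 ^ (CARD('m) + 2 * k i) *
    (exp (- (norm (y i))\<^sup>2) * max 0 (\<zeta> \<bullet> y i) ^ (CARD('m) + 2 * k i))) * norm \<zeta> ^ (2 * j)"

text \<open>The integral of \<open>limit_kernel\<close> over the directions y at a unit vector
  \<zeta>.\<close>

definition limit_const :: "('m => nat) => real" where
 "limit_const k = (\<Prod>i\<in>UNIV. 4 / Gamma (real (DIM('a) + k i)) * 2 ^ (CARD('m) + 2 * k i)) *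
   ((\<Prod>i\<in>UNIV. half_gauss_moment CARD('m) (CARD('m) + 2 * k i)) * fact (CARD('m) - 1) *
   (\<Sum>i\<in>UNIV. real (CARD('m) + 2 * k i + 1)))"

text \<open>With \<epsilon> = N^(-1/d), the substitution z = \<epsilon> \<zeta> contributes
  \<epsilon>^d, each of the d chord factors \<epsilon>^(d + 2 k i), and the depth \<epsilon>^(2 j).
  Dividing the total exponent by d gives this rate, as n = d + 1.\<close>

definition rate :: "('m => nat) => nat => real" where
 "rate k j = real DIM('a) + 2 * real (j + (\<Sum>i\<in>UNIV. k i)) / real CARD('m)"

lemma Gamma_DIM_pos: "Gamma (real (DIM('a) + i)) > 0"
 by (intro Gamma_real_pos) (simp add: dim)

lemma limit_kernel_nonneg: "limit_kernel k j y \<zeta> \<ge> 0"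
 unfolding limit_kernel_def
 by (intro mult_nonneg_nonneg prod_nonneg ballI zero_le_power2 zero_le_power divide_nonneg_pos Gamma_DIM_pos) auto

lemma limit_const_nonneg: "limit_const k \<ge> 0"
 unfolding limit_const_def
 by (intro mult_nonneg_nonneg prod_nonneg sum_nonneg ballI zero_le_power divide_nonneg_pos Gamma_DIM_pos
   less_imp_le[OF half_gauss_moment_pos]) auto

lemma limit_kernel_measurable [measurable]:
 "(%p. limit_kernel k j (fst p) (snd p)) \<in> borel_measurable (PiM (UNIV :: 'm set) (%_. lborel) \<Otimes>\<^sub>M lborel)"
 unfolding limit_kernel_def by measurable

text \<open>Integrating y out first turns the determinant into a power of |\<zeta>|, after which the
  integral over \<zeta> is radial. The exponents, together with the dimension d, add up to d times
  the rate, so Gamma is evaluated at the rate itself.\<close>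

lemma limit_kernel_integral:
 assumes c: "c > 0"
 shows "(\<integral>\<^sup>+y. (\<integral>\<^sup>+\<zeta>. ennreal (limit_kernel k j y \<zeta> * exp (- (c * norm \<zeta> ^ CARD('m)))) \<partial>lborel) \<partial>PiM (UNIV :: 'm set) (%_. lborel))
  = ennreal (limit_const k * unit_ball_vol CARD('m) * Gamma (rate k j) / c powr rate k j)"
proof -
 let ?d = "CARD('m)"
 interpret L: product_sigma_finite "%_::'m. lborel :: (real, 'm) vec measure" ..
 interpret FL: finite_product_sigma_finite "%_::'m. lborel :: (real, 'm) vec measure" UNIV by standard simp
 let ?q = "UNIV :: 'm set"
 interpret pair: pair_sigma_finite "PiM ?q (%_. lborel :: (real, 'm) vec measure)" "lborel :: (real, 'm) vec measure" ..
 define e where "e i = ?d + 2 * k i" for i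
 define g where "g i = 4 / Gamma (real (DIM('a) + k i)) * 2 ^ e i" for i
 have g: "g i \<ge> 0" for i unfolding g_def by (intro mult_nonneg_nonneg divide_nonneg_pos Gamma_DIM_pos) auto
 define D where "D y \<zeta> = (det (\<chi> i. y i))\<^sup>2 * (\<Prod>i\<in>UNIV. exp (- (norm (y i))\<^sup>2) * max 0 (\<zeta> \<bullet> y i) ^ e i)"
  for y :: "'m => (real, 'm) vec" and \<zeta>
 define M where "M = (\<Prod>i\<in>UNIV. half_gauss_moment ?d (e i)) * fact (?d - 1) * (\<Sum>i\<in>UNIV. real (e i + 1))"
 have M: "M \<ge> 0" unfolding M_def
  by (intro mult_nonneg_nonneg prod_nonneg sum_nonneg ballI less_imp_le[OF half_gauss_moment_pos]) auto
 have lk: "limit_kernel k j y \<zeta> = (prod g UNIV * norm \<zeta> ^ (2 * j)) * D y \<zeta>" for y \<zeta>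
  unfolding limit_kernel_def D_def g_def e_def prod.distrib by (simp only: mult_ac)
 have e0: "e i > 0" for i by (simp add: e_def)
 have sume: "2 * j + sum e UNIV = ?d * ?d + 2 * (j + sum k UNIV)"
  by (simp add: e_def sum.distrib sum_distrib_left)
 let ?p = "%_. lborel"
 let ?u = "%y \<zeta>. limit_kernel k j y \<zeta> * exp (- (c * norm \<zeta> ^ ?d))"
 let ?f = "%\<zeta>. \<integral>\<^sup>+y. ennreal (?u y \<zeta>) \<partial>PiM ?q ?p"
 let ?g = "%\<zeta>. prod g UNIV * norm \<zeta> ^ (2 * j) * exp (- (c * norm \<zeta> ^ ?d))"
 let ?h = "%\<zeta>. norm \<zeta> ^ (2 * j + sum e UNIV) * exp (- (c * norm \<zeta> ^ DIM((real, 'm) vec)))"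
 let ?r = "prod g UNIV * M"
 let ?v = "unit_ball_vol ?d * Gamma (rate k j) / c powr rate k j"
 let ?w = "2 * j + sum e UNIV + ?d"
 have "(\<integral>\<^sup>+y. (\<integral>\<^sup>+\<zeta>. ennreal (?u y \<zeta>) \<partial>lborel) \<partial>PiM ?q ?p)
  = (\<integral>\<^sup>+\<zeta>. ?f \<zeta> \<partial>lborel)"
 proof (rule pair.Fubini'[symmetric])
  have "(%p. ennreal (limit_kernel k j (fst p) (snd p) * exp (- (c * norm (snd p) ^ ?d)))) \<in> borel_measurable (PiM ?q ?p \<Otimes>\<^sub>M lborel)"
   by measurable
  then show "(%(y, \<zeta>). ennreal (?u y \<zeta>)) \<in> borel_measurable (PiM ?q ?p \<Otimes>\<^sub>M lborel)"
   by (simp add: case_prod_unfold)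
 qed
 also have "\<dots> = (\<integral>\<^sup>+\<zeta>. ennreal ?r * ennreal (?h \<zeta>) \<partial>(lborel :: (real, 'm) vec measure))"
 proof (rule nn_integral_cong)
  fix \<zeta> :: "(real, 'm) vec"
  have [measurable]: "(%y. D y \<zeta>) \<in> borel_measurable (PiM ?q ?p)"
   unfolding D_def by measurable
  have G0: "0 \<le> ?g \<zeta>"
   using g by (intro mult_nonneg_nonneg prod_nonneg) auto
  have "?f \<zeta>
   = (\<integral>\<^sup>+y. ennreal (?g \<zeta>) * ennreal (D y \<zeta>) \<partial>PiM ?q ?p)"
   by (intro nn_integral_cong, subst ennreal_mult'[OF G0, symmetric]) (simp only: lk mult_ac)
  also have "\<dots> = ennreal (?g \<zeta>) * (\<integral>\<^sup>+y. ennreal (D y \<zeta>) \<partial>PiM ?q ?p)"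
   by (rule nn_integral_cmult) measurable
  also have "(\<integral>\<^sup>+y. ennreal (D y \<zeta>) \<partial>PiM ?q ?p) = ennreal (norm \<zeta> ^ sum e UNIV * M)"
   unfolding D_def by (subst det_square_moment[OF e0]) (simp add: M_def mult.assoc)
  also have "ennreal (?g \<zeta>) * ennreal (norm \<zeta> ^ sum e UNIV * M)
    = ennreal ?r * ennreal (?h \<zeta>)"
  proof -
   have "0 \<le> ?r" using g M by (intro mult_nonneg_nonneg prod_nonneg) auto
   then show ?thesis
    by (subst (1 2) ennreal_mult'[symmetric]) (use G0 in \<open>simp_all only: power_add DIM_cart DIM_real mult_1_left mult_1_right mult_ac\<close>)
  qed
  finally show "?f \<zeta>
   = ennreal ?r * ennreal (?h \<zeta>)" .
 qed
 also have "\<dots> = ennreal ?r * ennreal (unit_ball_vol ?d * Gamma (?w / ?d) / c powr (?w / ?d))"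
  by (subst nn_integral_cmult, measurable, subst nn_integral_radial_exp[OF c]) simp
 also have "real ?w / ?d = rate k j"
  unfolding sume rate_def by (simp add: dim add_divide_distrib)
 also have "ennreal ?r * ennreal ?v
  = ennreal (prod g UNIV * M * ?v)"
  using g M by (intro ennreal_mult'[symmetric] mult_nonneg_nonneg prod_nonneg) auto
 also have "?r = limit_const k"
  by (simp add: limit_const_def g_def M_def e_def)
 finally show ?thesis by (simp add: mult.assoc)
qed

text \<open>The last factor is the probability that the other N - n points are below the plane; for
  N = DIM('a) it is 1, and in that form the functional is used before the other points are
  integrated out. The upper cutoff confines the normals to the range of the decay estimate, and the
  lower one makes the value nonnegative for arbitrary arguments.\<close>

definition simplex_functional :: "('m => nat) => nat => nat => 'a => ('m => 'a) => real" where
 "simplex_functional k j N v x =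
   simplex_det (insert v (range x)) * (1 - 1 / (norm (plane_normal (insert v (range x))))\<^sup>2) ^ j *
   (\<Prod>i\<in>UNIV. ((norm (v - x i))\<^sup>2) ^ k i) *
   (if 1 \<le> norm (plane_normal (insert v (range x))) \<and> norm (plane_normal (insert v (range x))) < 2 then 1 else 0) *
   below (plane_normal (insert v (range x))) ^ (N - DIM('a))"

lemma below_measurable [measurable]: "below \<in> borel_measurable borel"
proof -
 let ?f = "borel \<Otimes>\<^sub>M P"
 have "{p \<in> space ?f. fst p \<bullet> snd p < 1} \<in> sets ?f"
 proof -
  have [measurable]: "(%x. x) \<in> borel_measurable P" by (rule measurable_P) simp
  show ?thesis by measurable
 qed
 then have "(%a. emeasure P (Pair a -` {p \<in> space ?f. fst p \<bullet> snd p < 1})) \<in> borel_measurable (borel :: 'a measure)"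
  by (rule P.measurable_emeasure_Pair)
 moreover have "Pair a -` {p \<in> space ?f. fst p \<bullet> snd p < 1} = {z \<in> sphere 0 1. a \<bullet> z < 1}" for a :: 'a
  by (auto simp: space_pair_measure)
 ultimately show ?thesis unfolding below_def measure_def by simp
qed

lemma simplex_functional_nonneg: "simplex_functional k j N v x \<ge> 0"
proof -
 have "0 \<le> 1 - 1 / r\<^sup>2" if "1 \<le> r" for r :: real
  using divide_le_eq_1_pos[of "r\<^sup>2" 1] one_le_power[OF that, of 2] by linarith
 then show ?thesis unfolding simplex_functional_def
  by (auto intro!: mult_nonneg_nonneg prod_nonneg simplex_det_nonneg below_bounds zero_le_power simp del: le_divide_eq_1 divide_le_eq_1 diff_ge_0_iff_ge)
qed

lemma simplex_functional_measurable:
 fixes x :: "'m => 'w => 'a"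
 assumes [measurable]: "v \<in> borel_measurable M" "\<And>i. x i \<in> borel_measurable M"
 shows "(%w. simplex_functional k j N (v w) (%i. x i w)) \<in> borel_measurable M"
proof -
 note [measurable] = measurable_insert_range[OF assms]
 show ?thesis unfolding simplex_functional_def by measurable
qed

text \<open>An exact identity in which all powers of N cancel. The exponent m = 2 (n + k i) of the
  weight is chosen so that |y|^m meets the same power of |y|^2 + s^2 in the denominator and leaves a
  ratio of at most 1. If the determinant vanishes or some slope is not positive, both sides are
  0.\<close>

lemma simplex_functional_chord:
 fixes T :: "real \<times> (real, 'm) vec => 'a" and \<zeta> :: "(real, 'm) vec"
 assumes T: "linear T" "\<And>x. norm (T x) = norm x" and N: "N > 0"
 defines "\<epsilon> \<equiv> real N powr (- 1 / CARD('m))"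
 shows "real N powr rate k j * (\<epsilon> ^ CARD('m) * (\<bar>det (\<chi> i. y i)\<bar> *
    (\<Prod>i\<in>UNIV. chord_weight (2 * (DIM('a) + k i)) ((\<epsilon> *\<^sub>R \<zeta>) \<bullet> y i) (y i) * F (T (chord_point ((\<epsilon> *\<^sub>R \<zeta>) \<bullet> y i) (y i)))) *
    simplex_functional k j N (T (1, 0)) (%i. T (chord_point ((\<epsilon> *\<^sub>R \<zeta>) \<bullet> y i) (y i)))))
  = limit_kernel k j y \<zeta> *
    (\<Prod>i\<in>UNIV. ((norm (y i))\<^sup>2 / ((norm (y i))\<^sup>2 + (\<epsilon> * (\<zeta> \<bullet> y i))\<^sup>2)) ^ (DIM('a) + k i) * F (T (chord_point (\<epsilon> * (\<zeta> \<bullet> y i)) (y i)))) *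
    (1 / (1 + (\<epsilon> * norm \<zeta>)\<^sup>2)) ^ j * (if norm (T (1, \<epsilon> *\<^sub>R \<zeta>)) < 2 then 1 else 0) * below (T (1, \<epsilon> *\<^sub>R \<zeta>)) ^ (N - DIM('a))"
proof -
 let ?d = "CARD('m)" and ?n = "DIM('a)"
 have \<epsilon>: "\<epsilon> > 0" using N by (simp add: \<epsilon>_def)
 define t where "t i = \<zeta> \<bullet> y i" for i
 let ?u = "%\<epsilon>. 1 + (\<epsilon> * norm \<zeta>)\<^sup>2"
 let ?f = "%\<epsilon>. \<epsilon>\<^sup>2 * (norm \<zeta>)\<^sup>2 * (1 / ?u \<epsilon>)"
 let ?g = "\<Sum>i\<in>UNIV. ?d + 2 * k i"
 let ?q = "%i. 2 * (?n + k i)"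
 let ?c = "%\<epsilon> i. (\<epsilon> *\<^sub>R \<zeta>) \<bullet> y i"
 let ?h = "%\<epsilon>. \<Prod>i\<in>UNIV. chord_weight (?q i) (?c \<epsilon> i) (y i) * F (T (chord_point (?c \<epsilon> i) (y i)))"
 let ?p = "%i s Q. (norm (y i) ^ (?q i) * ((2 * s i) ^ (?d - 1) * (2 * s i) * (4 * (s i)\<^sup>2) ^ k i)) / (Q i ^ ?d * Q i * Q i ^ k i)"
 let ?r = "\<chi> i. y i"
 let ?v = "%s Q. \<Prod>i\<in>UNIV. (4 * (s i)\<^sup>2 / Q i) ^ k i"
 let ?w = "%\<epsilon>. \<epsilon> ^ ?d * (\<epsilon> ^ ?g * (\<epsilon>\<^sup>2) ^ j)"
 let ?a = "%i. ?d + 2 * k i"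
 let ?b = "%i s Q. chord_weight (?q i) (s i) (y i) * (2 * s i / Q i) * ((4 * (s i)\<^sup>2 / Q i) ^ k i)"
 let ?e = "(norm \<zeta>)\<^sup>2"
 show ?thesis
 proof (cases "det ?r = 0 \<or> (\<exists>i. t i \<le> 0)")
  case True
  then show ?thesis
  proof
   assume "det ?r = 0"
   then show ?thesis by (simp add: limit_kernel_def)
  next
   assume "\<exists>i. t i \<le> 0"
   then obtain i where i: "t i \<le> 0" by blast
   then have "chord_weight (?q i) (?c \<epsilon> i) (y i) = 0"
    using \<epsilon> by (auto simp: chord_weight_def t_def zero_less_mult_iff)
   then have 1: "?h \<epsilon> = 0"
    by (intro prod_zero bexI[of _ i]) auto
   have "max 0 (\<zeta> \<bullet> y i) ^ (?a i) = 0" using i by (simp add: t_def)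
   then have "limit_kernel k j y \<zeta> = 0"
    unfolding limit_kernel_def by (auto simp: prod_zero_iff)
   then show ?thesis unfolding 1 by simp
  qed
 next
  case False
  then have det: "det ?r \<noteq> 0" and t: "t i > 0" for i by (auto simp: not_le)
  define s where "s i = \<epsilon> * t i" for i
  have s: "s i > 0" for i using \<epsilon> t by (simp add: s_def)
  have zs: "?c \<epsilon> i = s i" for i by (simp add: s_def t_def)
  define Q where "Q i = (norm (y i))\<^sup>2 + (s i)\<^sup>2" for i
  have Q: "Q i > 0" for i using s[of i] by (auto simp: Q_def add_nonneg_pos)
  have pos: "\<And>i. (\<epsilon> *\<^sub>R \<zeta>) \<bullet> y i > 0" unfolding zs by (rule s)
  define A where "A = insert (T (1, 0)) (range (%i. T (chord_point (s i) (y i))))"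
  define a where "a = T (1, \<epsilon> *\<^sub>R \<zeta>)"
  note cs = chord_simplex[OF T dim det pos, unfolded zs, folded A_def a_def Q_def]
  have na: "(norm a)\<^sup>2 = ?u \<epsilon>"
   using \<epsilon> by (simp add: a_def T norm_Pair power_mult_distrib)
  have na1: "norm a \<ge> 1"
  proof -
   have "1\<^sup>2 \<le> (norm a)\<^sup>2" unfolding na by simp
   then show ?thesis by (rule power2_le_imp_le) simp
  qed
  have r: "1 - 1 / (norm a)\<^sup>2 = ?f \<epsilon>"
  proof -
   have "?u \<epsilon> > 0" by (simp add: add_pos_nonneg)
   then show ?thesis unfolding na by (simp add: field_simps power_mult_distrib)
  qed
  have nd: "?n = ?d + 1" by (rule dim)
  have dd: "DIM((real, 'm) vec) = ?d" by simp
  define h where "h i = F (T (chord_point (s i) (y i)))" for i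
  define rt where "rt i = (norm (y i))\<^sup>2 / Q i" for i
  define g where "g i = 4 / Gamma (real (?n + k i)) * 2 ^ (?a i) * (exp (- (norm (y i))\<^sup>2) * max 0 (t i) ^ (?a i))" for i
  have per: "?b i s Q
   = \<epsilon> ^ (?a i) * g i * rt i ^ (?n + k i)" for i
  proof -
   have "(2 * s i) ^ (?d - 1) * (2 * s i) * (4 * (s i)\<^sup>2) ^ k i = (2 * s i) ^ (?a i)"
   proof -
    have "4 * (s i)\<^sup>2 = (2 * s i)\<^sup>2" by (simp add: power_mult_distrib)
    then have "(4 * (s i)\<^sup>2) ^ k i = (2 * s i) ^ (2 * k i)" by (simp only: power_mult)
    moreover have "(2 * s i) ^ (?d - 1) * (2 * s i) = (2 * s i) ^ ?d"
     by (metis power_minus_mult zero_less_card_finite)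
    ultimately show ?thesis by (simp only: power_add)
   qed
   moreover have "norm (y i) ^ (?q i) = ((norm (y i))\<^sup>2) ^ (?n + k i)" by (rule power_mult)
   moreover have "Q i ^ ?d * Q i * Q i ^ k i = Q i ^ (?n + k i)" by (simp add: nd power_add)
   moreover have "(2 * s i) ^ (?a i) = \<epsilon> ^ (?a i) * (2 ^ (?a i) * max 0 (t i) ^ (?a i))"
    using t[of i] by (simp add: s_def power_mult_distrib max_def)
   ultimately have "?p i s Q
    = rt i ^ (?n + k i) * (\<epsilon> ^ (?a i) * (2 ^ (?a i) * max 0 (t i) ^ (?a i)))"
    by (simp only: rt_def power_divide) simp
   moreover have "chord_weight (?q i) (s i) (y i) = 4 / Gamma (real (?n + k i)) * norm (y i) ^ (?q i) * exp (- (norm (y i))\<^sup>2) * (2 * s i) ^ (?d - 1) / Q i ^ ?d"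
   proof -
    have "real (?q i) / 2 = real (?n + k i)" by simp
    then show ?thesis unfolding chord_weight_def Q_def dd using s[of i] by (simp only: if_True)
   qed
   then have "?b i s Q
    = 4 / Gamma (real (?n + k i)) * exp (- (norm (y i))\<^sup>2) * ?p i s Q"
    by (simp only: power_divide times_divide_eq_left times_divide_eq_right divide_divide_eq_left) (simp only: mult_ac)
   ultimately show ?thesis by (simp only: g_def) (simp only: mult_ac)
  qed
  have prodper: "(\<Prod>i\<in>UNIV. chord_weight (?q i) (s i) (y i)) * (\<Prod>i\<in>UNIV. 2 * s i / Q i) * ?v s Q
   = \<epsilon> ^ ?g * prod g UNIV * (\<Prod>i\<in>UNIV. rt i ^ (?n + k i))"
   by (simp only: prod.distrib[symmetric] per power_sum)
  have sf: "simplex_functional k j N (T (1, 0)) (%i. T (chord_point (s i) (y i)))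
   = ((\<Prod>i\<in>UNIV. 2 * s i / Q i) * \<bar>det ?r\<bar>) * ?f \<epsilon> ^ j *
    ?v s Q * (if norm a < 2 then 1 else 0) * below a ^ (N - ?n)"
   unfolding simplex_functional_def A_def[symmetric] cs(1,2,3) r using na1 by simp
  have lk: "limit_kernel k j y \<zeta> = \<bar>det ?r\<bar> * \<bar>det ?r\<bar> * prod g UNIV * ?e ^ j"
   by (simp add: limit_kernel_def g_def t_def power2_eq_square abs_mult_self_eq power_mult)
  have pw: "real N powr rate k j * ?w \<epsilon> = 1"
  proof -
   have "?w \<epsilon> = \<epsilon> ^ (?d + ?g + 2 * j)"
    by (simp add: power_add power_mult)
   also have "\<dots> = \<epsilon> powr real (?d + ?g + 2 * j)"
    using \<epsilon> by (rule powr_realpow[symmetric])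
   also have "real (?d + ?g + 2 * j) = real ?d * rate k j"
    by (simp add: rate_def nd sum.distrib sum_distrib_left field_simps)
   also have "\<epsilon> powr (real ?d * rate k j) = real N powr (- rate k j)"
    unfolding \<epsilon>_def by (simp add: powr_powr)
   finally show ?thesis using N by (simp flip: powr_add)
  qed
  define d0 where "d0 = \<bar>det ?r\<bar>"
  define W where "W = (\<Prod>i\<in>UNIV. chord_weight (?q i) (s i) (y i))"
  define S2 where "S2 = (\<Prod>i\<in>UNIV. 2 * s i / Q i)"
  define S4 where "S4 = ?v s Q"
  define Ru where "Ru = (\<Prod>i\<in>UNIV. rt i ^ (?n + k i))"
  define I where "I = (if norm a < 2 then 1 else (0::real))"
  have "real N powr rate k j * (\<epsilon> ^ ?d * (d0 * (W * prod h UNIV) * ((S2 * d0) * ?f \<epsilon> ^ j * S4 * I * below a ^ (N - ?n))))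
   = real N powr rate k j * (\<epsilon> ^ ?d * (d0 * d0 * prod h UNIV * ?f \<epsilon> ^ j * I * below a ^ (N - ?n) * (W * S2 * S4)))"
   by (simp only: mult_ac)
  also have "W * S2 * S4 = \<epsilon> ^ ?g * prod g UNIV * Ru"
   unfolding W_def S2_def S4_def Ru_def by (rule prodper)
  also have "real N powr rate k j * (\<epsilon> ^ ?d * (d0 * d0 * prod h UNIV * ?f \<epsilon> ^ j * I * below a ^ (N - ?n) * (\<epsilon> ^ ?g * prod g UNIV * Ru)))
    = (real N powr rate k j * ?w \<epsilon>) *
     (d0 * d0 * prod g UNIV * ?e ^ j * (Ru * prod h UNIV) * (1 / ?u \<epsilon>) ^ j * I * below a ^ (N - ?n))"
   by (simp only: power_mult_distrib) (simp only: mult_ac)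
  finally have fin: "real N powr rate k j * (\<epsilon> ^ ?d * (d0 * (W * prod h UNIV) * ((S2 * d0) * ?f \<epsilon> ^ j * S4 * I * below a ^ (N - ?n))))
   = d0 * d0 * prod g UNIV * ?e ^ j * (Ru * prod h UNIV) * (1 / ?u \<epsilon>) ^ j * I * below a ^ (N - ?n)"
   unfolding pw by simp
  have "(\<Prod>i\<in>UNIV. ((norm (y i))\<^sup>2 / ((norm (y i))\<^sup>2 + (\<epsilon> * (\<zeta> \<bullet> y i))\<^sup>2)) ^ (?n + k i) * F (T (chord_point (\<epsilon> * (\<zeta> \<bullet> y i)) (y i)))) = Ru * prod h UNIV"
   by (simp add: Ru_def rt_def h_def Q_def s_def t_def prod.distrib)
  moreover have "?h \<epsilon> = W * prod h UNIV"
   unfolding zs by (simp add: W_def h_def prod.distrib)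
  ultimately show ?thesis
   using fin unfolding zs sf lk d0_def[symmetric] S2_def[symmetric] S4_def[symmetric] I_def[symmetric] a_def[symmetric] by simp
 qed
qed

end

context sphere_sample
begin

lemma hi_pos: "hi > 0" using F_pos F_hi[of undefined] by (meson less_le_trans)

text \<open>The cofactor of \<open>limit_kernel\<close> in the exact identity. It carries all
  dependence on N and on the density, and it is both bounded and convergent.\<close>

definition scaled_factor :: "('m => nat) => nat => (real \<times> (real, 'm) vec => 'a) => nat => ('m => (real, 'm) vec) => (real, 'm) vec => real" where
 "scaled_factor k j T N y \<zeta> = (let \<epsilon> = real N powr (- 1 / CARD('m)) in
    (\<Prod>i\<in>UNIV. ((norm (y i))\<^sup>2 / ((norm (y i))\<^sup>2 + (\<epsilon> * (\<zeta> \<bullet> y i))\<^sup>2)) ^ (DIM('a) + k i) * F (T (chord_point (\<epsilon> * (\<zeta> \<bullet> y i)) (y i)))) *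
    (1 / (1 + (\<epsilon> * norm \<zeta>)\<^sup>2)) ^ j * (if norm (T (1, \<epsilon> *\<^sub>R \<zeta>)) < 2 then 1 else 0) * below (T (1, \<epsilon> *\<^sub>R \<zeta>)) ^ (N - DIM('a)))"

text \<open>Half the decay rate of \<open>below_le_exp\<close>: for N \<ge> 2 n at least N / 2
  further points remain.\<close>

definition decay :: real where "decay = lo * unit_ball_vol CARD('m) / 2 ^ (DIM('a) + 1)"

lemma decay_pos: "decay > 0"
 unfolding decay_def using lo_pos by simp

lemma square_ratio_bounds: "0 \<le> (a::real)\<^sup>2 / (a\<^sup>2 + b\<^sup>2)" "a\<^sup>2 / (a\<^sup>2 + b\<^sup>2) \<le> 1"
 by (simp, cases "a\<^sup>2 + b\<^sup>2 = 0") (auto simp: divide_le_eq not_sum_power2_lt_zero)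

lemma scaled_factor_nonneg: "scaled_factor k j T N y \<zeta> \<ge> 0"
 unfolding scaled_factor_def Let_def
 by (intro mult_nonneg_nonneg prod_nonneg ballI zero_le_power square_ratio_bounds F_nonneg below_bounds) (auto intro!: add_nonneg_nonneg)

context
 fixes T :: "real \<times> (real, 'm) vec => 'a"
 assumes T: "linear T" "\<And>x. norm (T x) = norm x"
begin

lemma scaled_factor_measurable [measurable]:
 "(%p. scaled_factor k j T N (fst p) (snd p)) \<in> borel_measurable (PiM (UNIV :: 'm set) (%_. lborel) \<Otimes>\<^sub>M lborel)"
proof -
 have [measurable]: "T \<in> borel_measurable borel" by (rule isometry_measurable[OF T(1)])
 show ?thesis unfolding scaled_factor_def Let_def by measurable
qed

lemma scaled_factor_le:
 assumes N: "N \<ge> 2 * DIM('a)"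
 shows "scaled_factor k j T N y \<zeta> \<le> hi ^ CARD('m) * exp (- (decay * norm \<zeta> ^ CARD('m)))"
proof -
 define \<epsilon> where "\<epsilon> = real N powr (- 1 / CARD('m))"
 define a where "a = T (1, \<epsilon> *\<^sub>R \<zeta>)"
 have N0: "N > 0" using N DIM_positive[where 'a='a] by linarith
 have \<epsilon>: "\<epsilon> > 0" using N0 by (simp add: \<epsilon>_def)
 have \<epsilon>d: "\<epsilon> ^ CARD('m) = 1 / real N"
 proof -
  have "\<epsilon> ^ CARD('m) = \<epsilon> powr real CARD('m)" using \<epsilon> by (simp add: powr_realpow)
  also have "\<dots> = real N powr (-1)" unfolding \<epsilon>_def by (simp add: powr_powr)
  finally show ?thesis using N0 by (simp add: powr_minus_divide)
 qed
 let ?h = "1 + (\<epsilon> * norm \<zeta>)\<^sup>2"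
 have na: "(norm a)\<^sup>2 = ?h"
  using \<epsilon> by (simp add: a_def T norm_Pair power_mult_distrib)
 have na1: "1 \<le> norm a"
 proof -
  have "1\<^sup>2 \<le> (norm a)\<^sup>2" unfolding na by simp
  then show ?thesis by (rule power2_le_imp_le) simp
 qed
 let ?g = "norm \<zeta> ^ CARD('m) / real N"
 let ?q = "- (decay * norm \<zeta> ^ CARD('m))"
 let ?r = "(if norm a < 2 then 1 else 0) * below a ^ (N - DIM('a))"
 let ?u = "real (N - DIM('a)) * ?g"
 have A: "?r \<le> exp ?q"
 proof (cases "norm a < 2")
  case True
  have "below a ^ (N - DIM('a)) \<le> exp (- (real (N - DIM('a)) * (lo * unit_ball_vol CARD('m) / 2 ^ DIM('a) * sqrt ((norm a)\<^sup>2 - 1) ^ CARD('m))))"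
   using na1 True by (intro below_le_exp) auto
  also have "\<dots> \<le> exp ?q"
  proof -
   have "sqrt ((norm a)\<^sup>2 - 1) = \<epsilon> * norm \<zeta>" unfolding na using \<epsilon> by simp
   then have e: "sqrt ((norm a)\<^sup>2 - 1) ^ CARD('m) = ?g"
    by (simp add: power_mult_distrib \<epsilon>d)
   have "real N / 2 \<le> real (N - DIM('a))" using N by linarith
   then have "real N / 2 * ?g \<le> ?u"
    by (intro mult_right_mono) auto
   then have "norm \<zeta> ^ CARD('m) / 2 \<le> ?u"
    using N0 by simp
   then have "lo * unit_ball_vol CARD('m) / 2 ^ DIM('a) * (norm \<zeta> ^ CARD('m) / 2) \<le> lo * unit_ball_vol CARD('m) / 2 ^ DIM('a) * ?u"
    using lo_pos by (intro mult_left_mono) auto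
   then show ?thesis unfolding e decay_def by (simp add: mult_ac)
  qed
  finally show ?thesis using True by simp
 qed simp
 let ?p = "%i. (norm (y i))\<^sup>2 / ((norm (y i))\<^sup>2 + (\<epsilon> * (\<zeta> \<bullet> y i))\<^sup>2)"
 let ?f = "\<Prod>i\<in>UNIV. ?p i ^ (DIM('a) + k i) * F (T (chord_point (\<epsilon> * (\<zeta> \<bullet> y i)) (y i)))"
 have "scaled_factor k j T N y \<zeta> =
   ?f *
    (1 / ?h) ^ j * ?r"
  by (simp only: scaled_factor_def Let_def \<epsilon>_def a_def mult.assoc)
 also have "\<dots> \<le> hi ^ CARD('m) * 1 * exp ?q"
 proof (intro mult_mono A)
  have "?f
    \<le> (\<Prod>i\<in>(UNIV::'m set). 1 * hi)"
  proof (intro prod_mono conjI mult_mono)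
   fix i
   show "?p i ^ (DIM('a) + k i) \<le> 1"
    by (intro power_le_one square_ratio_bounds)
  qed (use hi_pos in \<open>auto intro!: F_hi F_nonneg mult_nonneg_nonneg\<close>)
  then show "?f \<le> hi ^ CARD('m)"
   by simp
  show "(1 / ?h) ^ j \<le> 1"
   by (intro power_le_one) (auto simp: divide_le_eq_1 add_pos_nonneg intro!: add_nonneg_nonneg)
 qed (use hi_pos in \<open>auto intro!: mult_nonneg_nonneg zero_le_power below_bounds add_nonneg_nonneg\<close>)
 finally show ?thesis by simp
qed

text \<open>Nonzero directions keep the denominators away from 0, so the ratios tend to 1 and the
  chord points to the base point. Only the cap factor retains a dependence on \<zeta>.\<close>

lemma scaled_factor_tendsto:
 assumes y: "\<And>i. y i \<noteq> 0"
 shows "(%N. scaled_factor k j T N y \<zeta>) \<longlonglongrightarrow> F (T (1, 0)) ^ CARD('m) * exp (- (F (T (1, 0)) * unit_ball_vol CARD('m) * norm \<zeta> ^ CARD('m)))"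
proof -
 define \<epsilon> where "\<epsilon> N = real N powr (- 1 / CARD('m))" for N
 have \<epsilon>: "\<epsilon> \<longlonglongrightarrow> 0"
  unfolding \<epsilon>_def by (rule tendsto_neg_powr[OF _ filterlim_real_sequentially]) simp
 have bl: "bounded_linear T" using T(1) linear_conv_bounded_linear by blast
 let ?g = "%y i. (norm (y i))\<^sup>2 + (0 * (\<zeta> \<bullet> y i))\<^sup>2"
 have yq: "?g y i \<noteq> 0" for i using y[of i] by simp
 let ?f = "%N y i. \<epsilon> N * (\<zeta> \<bullet> y i)"
 let ?p = "%y i N. (norm (y i))\<^sup>2 + (?f N y i)\<^sup>2"
 have ratio: "(%N. (norm (y i))\<^sup>2 / ?p y i N) \<longlonglongrightarrow> 1" for i
 proof -
  have "(%N. (norm (y i))\<^sup>2 / ?p y i N) \<longlonglongrightarrow> (norm (y i))\<^sup>2 / ?g y i"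
   by (intro tendsto_intros \<epsilon> yq)
  then show ?thesis using y[of i] by simp
 qed
 have pt: "(%N. chord_point (?f N y i) (y i)) \<longlonglongrightarrow> (1, 0)" for i
 proof -
  have "(%N. (((norm (y i))\<^sup>2 - (?f N y i)\<^sup>2) / ?p y i N,
    (2 * ?f N y i / ?p y i N) *\<^sub>R y i))
   \<longlonglongrightarrow> (((norm (y i))\<^sup>2 - (0 * (\<zeta> \<bullet> y i))\<^sup>2) / ?g y i,
    (2 * (0 * (\<zeta> \<bullet> y i)) / ?g y i) *\<^sub>R y i)"
   by (intro tendsto_intros \<epsilon> yq)
  then show ?thesis using y[of i] by (simp add: chord_point_def)
 qed
 have Fl: "(%N. F (T (chord_point (?f N y i) (y i)))) \<longlonglongrightarrow> F (T (1, 0))" for i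
 proof (rule continuous_on_tendsto_compose[OF F_cont])
  show "(%N. T (chord_point (?f N y i) (y i))) \<longlonglongrightarrow> T (1, 0)"
   by (rule bounded_linear.tendsto[OF bl pt])
 qed (auto simp: T norm_Pair norm_chord_point)
 let ?r = "%N. (1 / (1 + (\<epsilon> N * norm \<zeta>)\<^sup>2)) ^ j"
 have q: "?r \<longlonglongrightarrow> 1"
 proof -
  have "?r \<longlonglongrightarrow> (1 / (1 + (0 * norm \<zeta>)\<^sup>2)) ^ j"
   by (intro tendsto_intros \<epsilon>) simp
  then show ?thesis by simp
 qed
 let ?h = "%N. T (1, \<epsilon> N *\<^sub>R \<zeta>)"
 have ind: "(%N. if norm (?h N) < 2 then 1 else (0::real)) \<longlonglongrightarrow> 1"
 proof -
  have "(%N. norm (?h N)) \<longlonglongrightarrow> norm (T (1, 0 *\<^sub>R \<zeta>))"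
   by (intro tendsto_norm bounded_linear.tendsto[OF bl] tendsto_intros \<epsilon>)
  moreover have "norm (T (1, 0 *\<^sub>R \<zeta>)) < 2" by (simp add: T norm_Pair)
  ultimately have "eventually (%N. norm (?h N) < 2) sequentially" by (rule order_tendstoD)
  then show ?thesis by (intro tendsto_eventually) (auto elim: eventually_mono)
 qed
 let ?q = "- (F (T (1, 0)) * unit_ball_vol CARD('m) * norm \<zeta> ^ CARD('m))"
 have "(%N. scaled_factor k j T N y \<zeta>) \<longlonglongrightarrow> (\<Prod>i\<in>(UNIV::'m set). 1 ^ (DIM('a) + k i) * F (T (1, 0))) * 1 * 1 * exp ?q"
  unfolding scaled_factor_def Let_def \<epsilon>_def[symmetric]
 proof (intro tendsto_mult tendsto_prod tendsto_power ratio Fl q ind)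
  show "(%N. below (?h N) ^ (N - DIM('a))) \<longlonglongrightarrow> exp ?q"
   unfolding \<epsilon>_def by (rule below_tendsto[OF T])
 qed
 then show ?thesis by simp
qed

lemma scaled_integral:
 assumes N: "N > 0"
 shows "ennreal (real N powr rate k j) * (\<integral>\<^sup>+x. ennreal (simplex_functional k j N (T (1, 0)) x) \<partial>PiM (UNIV :: 'm set) (%_. P))
  = (\<integral>\<^sup>+y. (\<integral>\<^sup>+\<zeta>. ennreal (limit_kernel k j y \<zeta> * scaled_factor k j T N y \<zeta>) \<partial>lborel) \<partial>PiM (UNIV :: 'm set) (%_. lborel))"
proof -
 define \<epsilon> where "\<epsilon> = real N powr (- 1 / CARD('m))"
 have \<epsilon>: "\<epsilon> > 0" using N by (simp add: \<epsilon>_def)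
 have [measurable]: "T \<in> borel_measurable borel" by (rule isometry_measurable[OF T(1)])
 let ?G = "%x. ennreal (simplex_functional k j N (T (1, 0)) x)"
 let ?q = "UNIV :: 'm set"
 have Gm: "?G \<in> borel_measurable (PiM ?q (%_. P))"
 proof -
  have "(%x. x i) \<in> borel_measurable (PiM ?q (%_. P))" for i
   by (rule measurable_compose[OF measurable_component_singleton[of i] measurable_P]) auto
  from simplex_functional_measurable[OF _ this, of "%_. T (1, 0)"] show ?thesis by simp
 qed
 define H where "H y z = ennreal (\<bar>det (\<chi> i. y i)\<bar> * (\<Prod>i\<in>UNIV. chord_weight (2 * (DIM('a) + k i)) (z \<bullet> y i) (y i) * F (T (chord_point (z \<bullet> y i) (y i)))))
    * ?G (%i. T (chord_point (z \<bullet> y i) (y i)))" for y z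
 have Hm: "H y \<in> borel_measurable borel" for y
 proof -
  have [measurable]: "(%z. simplex_functional k j N (T (1, 0)) (%i. T (chord_point (z \<bullet> y i) (y i)))) \<in> borel_measurable borel"
   by (rule simplex_functional_measurable) measurable
  show ?thesis unfolding H_def by measurable
 qed
 let ?h = "%y \<zeta>. limit_kernel k j y \<zeta> * scaled_factor k j T N y \<zeta>"
 let ?f = "%y. \<integral>\<^sup>+\<zeta>. ennreal (?h y \<zeta>) \<partial>lborel"
 let ?w = "%\<zeta>. \<epsilon> *\<^sub>R \<zeta>"
 let ?g = "%y. \<integral>\<^sup>+\<zeta>. H y (?w \<zeta>) \<partial>lborel"
 let ?p = "real N powr rate k j"
 let ?r = "\<epsilon> ^ CARD('m)"
 let ?u = "%_. lborel"
 let ?v = "%d0 \<zeta> y. real N powr rate k j * (\<epsilon> ^ CARD('m) * (d0 * simplex_functional k j N (T (1, 0)) (%i. T (chord_point (?w \<zeta> \<bullet> y i) (y i)))))"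
 have "(\<integral>\<^sup>+x. ?G x \<partial>PiM ?q (%_. P)) = (\<integral>\<^sup>+y. (\<integral>\<^sup>+z. H y z \<partial>lborel) \<partial>PiM ?q ?u)"
  unfolding H_def
 proof (rule nn_integral_P_vec[OF T _ Gm])
  fix s :: "'m => real" and y :: "'m => (real, 'm) vec" assume "det (\<chi> i. y i) = 0"
  then show "?G (%i. T (chord_point (s i) (y i))) = 0"
   using chord_simplex_degenerate[OF T] by (simp add: simplex_functional_def)
 qed simp
 also have "\<dots> = (\<integral>\<^sup>+y. ennreal ?r * ?g y \<partial>PiM ?q ?u)"
 using nn_integral_lborel_scale[OF Hm \<epsilon>] by (intro nn_integral_cong) simp
 also have "ennreal ?p * \<dots> = (\<integral>\<^sup>+y. ?f y \<partial>PiM ?q ?u)"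
 proof -
  have inner: "ennreal ?p * (ennreal ?r * ?g y)
   = ?f y" for y
  proof -
   have [measurable]: "(%\<zeta>. H y (?w \<zeta>)) \<in> borel_measurable lborel"
    by (rule measurable_compose[OF _ Hm]) measurable
   have "ennreal ?p * (ennreal ?r * H y (?w \<zeta>)) = ennreal (?h y \<zeta>)" for \<zeta>
   proof -
    define d0 where "d0 = \<bar>det (\<chi> i. y i)\<bar> * (\<Prod>i\<in>UNIV. chord_weight (2 * (DIM('a) + k i)) (?w \<zeta> \<bullet> y i) (y i) * F (T (chord_point (?w \<zeta> \<bullet> y i) (y i))))"
    have d0: "d0 \<ge> 0" unfolding d0_def
     by (intro mult_nonneg_nonneg prod_nonneg ballI chord_weight_nonneg F_nonneg) auto
    have "ennreal ?p * (ennreal ?r * H y (?w \<zeta>))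
     = ennreal (?v d0 \<zeta> y)"
     unfolding H_def d0_def[symmetric] using \<epsilon> d0 by (simp add: ennreal_mult' simplex_functional_nonneg)
    also have "?v d0 \<zeta> y
     = ?h y \<zeta>"
     using simplex_functional_chord[OF T N, of k j y \<zeta>] unfolding \<epsilon>_def[symmetric] d0_def[symmetric]
     unfolding scaled_factor_def Let_def \<epsilon>_def[symmetric] by (simp only: mult.assoc)
    finally show ?thesis .
   qed
   then show ?thesis
    by (subst nn_integral_cmult[symmetric], measurable)+
  qed
  have "(%y. \<integral>\<^sup>+\<zeta>. ennreal (?h y \<zeta>) \<partial>lborel) \<in> borel_measurable (PiM ?q ?u)"
  proof (rule lborel.borel_measurable_nn_integral)
   have "(%p. ennreal (limit_kernel k j (fst p) (snd p) * scaled_factor k j T N (fst p) (snd p))) \<in> borel_measurable (PiM ?q ?u \<Otimes>\<^sub>M lborel)"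
    by measurable
   then show "(%(y, \<zeta>). ennreal (?h y \<zeta>)) \<in> borel_measurable (PiM ?q ?u \<Otimes>\<^sub>M lborel)"
    by (simp add: case_prod_unfold)
  qed
  \<comment> \<open>Measurability in y of the integral of H is obtained by dividing
    \<open>inner\<close>: up to a constant it is the integral of the jointly measurable kernel and
    cofactor.\<close>
  then have "(%y. inverse (ennreal ?p) * ?f y) \<in> borel_measurable (PiM ?q ?u)"
   by measurable
  moreover have "inverse (ennreal ?p) * ?f y
   = ennreal ?r * ?g y" for y
  proof -
   have "inverse (ennreal ?p) * ennreal ?p = 1"
    using N by (simp add: inverse_ennreal flip: ennreal_mult')
   then show ?thesis unfolding inner[symmetric] by (simp add: mult.assoc[symmetric])
  qed
  ultimately have "(%y. ennreal ?r * ?g y) \<in> borel_measurable (PiM ?q ?u)"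
   by simp
  then show ?thesis by (subst nn_integral_cmult[symmetric]) (simp_all add: inner)
 qed
 finally show ?thesis .
qed

end

definition local_value :: "('m => nat) => nat => real => real" where
 "local_value k j c = limit_const k * unit_ball_vol CARD('m) * Gamma (rate k j) / c powr rate k j"

context
 fixes v :: 'a
 assumes v: "norm v = 1"
begin

lemma ex_tangent_isometry: "\<exists>T :: real \<times> (real, 'm) vec => 'a. linear T \<and> (\<forall>x. norm (T x) = norm x) \<and> T (1, 0) = v"
 by (rule ex_isometry_to_unit) (use v dim in \<open>simp_all add: norm_Pair\<close>)

text \<open>The bound does not depend on v and therefore dominates in the later integration over the
  base vertex.\<close>

lemma scaled_integral_le:
 assumes N: "N \<ge> 2 * DIM('a)"
 shows "ennreal (real N powr rate k j) * (\<integral>\<^sup>+x. ennreal (simplex_functional k j N v x) \<partial>PiM (UNIV :: 'm set) (%_. P))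
  \<le> ennreal (hi ^ CARD('m) * local_value k j decay)"
proof -
 obtain T :: "real \<times> (real, 'm) vec => 'a" where T: "linear T" "\<And>x. norm (T x) = norm x" and Tv: "T (1, 0) = v"
  using ex_tangent_isometry by blast
 have N0: "N > 0" using N DIM_positive[where 'a='a] by linarith
 let ?f = "%y \<zeta>. limit_kernel k j y \<zeta> * exp (- (decay * norm \<zeta> ^ CARD('m)))"
 let ?g = "UNIV :: 'm set"
 let ?h = "%_. lborel"
 have "ennreal (real N powr rate k j) * (\<integral>\<^sup>+x. ennreal (simplex_functional k j N v x) \<partial>PiM ?g (%_. P))
  \<le> (\<integral>\<^sup>+y. (\<integral>\<^sup>+\<zeta>. ennreal (hi ^ CARD('m)) * ennreal (?f y \<zeta>) \<partial>lborel) \<partial>PiM ?g ?h)"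
  unfolding Tv[symmetric] scaled_integral[OF T N0]
 proof (intro nn_integral_mono)
  fix y :: "'m => (real, 'm) vec" and \<zeta>
  have "limit_kernel k j y \<zeta> * scaled_factor k j T N y \<zeta> \<le> limit_kernel k j y \<zeta> * (hi ^ CARD('m) * exp (- (decay * norm \<zeta> ^ CARD('m))))"
   by (intro mult_left_mono scaled_factor_le[OF T N] limit_kernel_nonneg)
  also have "\<dots> = hi ^ CARD('m) * ?f y \<zeta>" by simp
  finally show "ennreal (limit_kernel k j y \<zeta> * scaled_factor k j T N y \<zeta>) \<le> ennreal (hi ^ CARD('m)) * ennreal (?f y \<zeta>)"
   using hi_pos by (subst ennreal_mult'[symmetric]) (auto intro: ennreal_leI)
 qed
 also have "\<dots> = ennreal (hi ^ CARD('m)) * (\<integral>\<^sup>+y. (\<integral>\<^sup>+\<zeta>. ennreal (?f y \<zeta>) \<partial>lborel) \<partial>PiM ?g ?h)"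
 proof -
  have 1: "(%p. ennreal (limit_kernel k j (fst p) (snd p) * exp (- (decay * norm (snd p) ^ CARD('m))))) \<in> borel_measurable (PiM ?g ?h \<Otimes>\<^sub>M lborel)"
   by measurable
  have 2: "(%\<zeta>. ennreal (?f y \<zeta>)) \<in> borel_measurable lborel" for y
   using measurable_compose[OF measurable_Pair1' 1, of y] by (simp add: space_PiM)
  have 3: "(%y. \<integral>\<^sup>+\<zeta>. ennreal (?f y \<zeta>) \<partial>lborel) \<in> borel_measurable (PiM ?g ?h)"
   by (rule lborel.borel_measurable_nn_integral) (use 1 in \<open>simp add: case_prod_unfold\<close>)
  show ?thesis by (simp only: nn_integral_cmult[OF 2] nn_integral_cmult[OF 3])
 qed
 also have "\<dots> = ennreal (hi ^ CARD('m) * local_value k j decay)"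
  unfolding limit_kernel_integral[OF decay_pos] local_value_def
  using hi_pos by (subst ennreal_mult'[symmetric]) auto
 finally show ?thesis .
qed

text \<open>Dominated convergence jointly in y and \<zeta>. The isometry T depends on v, but the
  limit only sees the value F v.\<close>

lemma scaled_integral_tendsto:
 "(%N. ennreal (real N powr rate k j) * (\<integral>\<^sup>+x. ennreal (simplex_functional k j N v x) \<partial>PiM (UNIV :: 'm set) (%_. P)))
  \<longlonglongrightarrow> ennreal (F v ^ CARD('m) * local_value k j (F v * unit_ball_vol CARD('m)))"
proof -
 obtain T :: "real \<times> (real, 'm) vec => 'a" where T: "linear T" "\<And>x. norm (T x) = norm x" and Tv: "T (1, 0) = v"
  using ex_tangent_isometry by blast
 let ?M = "PiM (UNIV :: 'm set) (%_. lborel :: (real, 'm) vec measure) \<Otimes>\<^sub>M (lborel :: (real, 'm) vec measure)"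
 let ?n = "DIM('a)"
 note [measurable] = scaled_factor_measurable[OF T]
 let ?h = "%p N. limit_kernel k j (fst p) (snd p) * scaled_factor k j T (N + 2 * ?n) (fst p) (snd p)"
 \<comment> \<open>The shift by 2 n puts every index into the range of the domination bound.\<close>
 define u where "u N p = ennreal (?h p N)" for N p
 define w where "w c p = ennreal (limit_kernel k j (fst p) (snd p) * exp (- (c * norm (snd p) ^ CARD('m))))" for c p
 have um [measurable]: "u N \<in> borel_measurable ?M" for N unfolding u_def by measurable
 have wm [measurable]: "w c \<in> borel_measurable ?M" for c unfolding w_def by measurable
 have wi: "(\<integral>\<^sup>+p. w c p \<partial>?M) = ennreal (local_value k j c)" if "c > 0" for c
  unfolding lborel.nn_integral_fst[OF wm, symmetric] unfolding w_def fst_conv snd_conv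
  using limit_kernel_integral[OF that, of k j] by (simp add: local_value_def)
 define c where "c = F v * unit_ball_vol CARD('m)"
 have c: "c > 0" using F_pos by (simp add: c_def)
 have cm: "(\<integral>\<^sup>+p. ennreal A * w c p \<partial>?M) = ennreal (A * local_value k j c)" if "c > 0" "A \<ge> 0" for A c
  using that by (simp add: nn_integral_cmult wi ennreal_mult')
 let ?f = "%N. \<integral>\<^sup>+x. ennreal (simplex_functional k j (N + 2 * ?n) v x) \<partial>PiM (UNIV :: 'm set) (%_. P)"
 let ?g = "\<integral>\<^sup>+p. ennreal (F v ^ CARD('m)) * w c p \<partial>?M"
 let ?p = "ennreal (F v ^ CARD('m) * local_value k j c)"
 have "(%N. \<integral>\<^sup>+p. u N p \<partial>?M) \<longlonglongrightarrow> ?g"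
 proof (rule nn_integral_dominated_convergence)
  show "AE p in ?M. u N p \<le> ennreal (hi ^ CARD('m)) * w decay p" for N
  proof (rule AE_I2)
   fix p
   have "?h p N \<le> limit_kernel k j (fst p) (snd p) * (hi ^ CARD('m) * exp (- (decay * norm (snd p) ^ CARD('m))))"
    by (intro mult_left_mono scaled_factor_le[OF T] limit_kernel_nonneg) simp
   also have "\<dots> = hi ^ CARD('m) * (limit_kernel k j (fst p) (snd p) * exp (- (decay * norm (snd p) ^ CARD('m))))" by simp
   finally show "u N p \<le> ennreal (hi ^ CARD('m)) * w decay p"
    unfolding u_def w_def using hi_pos by (subst ennreal_mult'[symmetric]) (auto intro: ennreal_leI)
  qed
  show "(\<integral>\<^sup>+p. ennreal (hi ^ CARD('m)) * w decay p \<partial>?M) < \<infinity>"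
   by (subst cm[OF decay_pos]) (use hi_pos in auto)
  show "AE p in ?M. (%N. u N p) \<longlonglongrightarrow> ennreal (F v ^ CARD('m)) * w c p"
  proof (rule AE_I2)
   fix p :: "('m => (real, 'm) vec) \<times> (real, 'm) vec"
   obtain y \<zeta> where p: "p = (y, \<zeta>)" by (cases p)
   show "(%N. u N p) \<longlonglongrightarrow> ennreal (F v ^ CARD('m)) * w c p"
   proof (cases "\<exists>i. y i = 0")
    \<comment> \<open>Here the cofactor may miss its usual limit, but a zero row makes the
      determinant and hence the kernel vanish.\<close>
    case True
    then obtain i where "y i = 0" by blast
    then have "det (\<chi> i. y i) = 0" by (intro det_zero_row(1)[of i]) (simp add: row_def vec_eq_iff)
    then show ?thesis by (simp add: p u_def w_def limit_kernel_def)
   next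
    case False
    then have "(%N. limit_kernel k j y \<zeta> * scaled_factor k j T (N + 2 * ?n) y \<zeta>) \<longlonglongrightarrow> limit_kernel k j y \<zeta> * (F (T (1, 0)) ^ CARD('m) * exp (- (F (T (1, 0)) * unit_ball_vol CARD('m) * norm \<zeta> ^ CARD('m))))"
     by (intro tendsto_mult_left LIMSEQ_ignore_initial_segment scaled_factor_tendsto[OF T]) auto
    then have "(%N. u N p) \<longlonglongrightarrow> ennreal (F v ^ CARD('m) * (limit_kernel k j y \<zeta> * exp (- (c * norm \<zeta> ^ CARD('m)))))"
     unfolding u_def p fst_conv snd_conv Tv c_def[symmetric] by (intro tendsto_ennrealI) (simp add: mult.left_commute)
    then show ?thesis
     unfolding w_def p fst_conv snd_conv by (subst ennreal_mult'[symmetric]) (use F_nonneg in auto)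
   qed
  qed
 qed measurable
 moreover have "?g = ?p"
  by (rule cm[OF c]) (simp add: F_nonneg)
 moreover have "(\<integral>\<^sup>+p. u N p \<partial>?M) = ennreal (real (N + 2 * ?n) powr rate k j) * ?f N" for N
  unfolding lborel.nn_integral_fst[OF um, symmetric] unfolding u_def fst_conv snd_conv
  using scaled_integral[OF T, of "N + 2 * ?n" k j, symmetric] DIM_positive[where 'a='a] unfolding Tv by simp
 ultimately have "(%N. ennreal (real (N + 2 * ?n) powr rate k j) * ?f N)
  \<longlonglongrightarrow> ?p"
  by (simp only:)
 then show ?thesis unfolding c_def by (rule LIMSEQ_offset)
qed

end

end

section \<open>Values of the limit constants\<close>

lemma Gamma_half_duplication:
 fixes d :: nat
 shows "2 ^ d * Gamma ((real d + 1) / 2) * Gamma (real d / 2 + 1) = sqrt pi * fact d"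
proof -
 define z where "z = (real d + 1) / 2"
 have z: "z > 0" by (simp add: z_def add_nonneg_pos)
 have "complex_of_real x \<notin> \<int>\<^sub>\<le>\<^sub>0" if "x > 0" for x
  using that by (auto simp: nonpos_Ints_def complex_eq_iff)
 from Gamma_legendre_duplication[of "complex_of_real z"] this[OF z] this[of "z + 1 / 2"] z
 have "Gamma (complex_of_real z) * Gamma (complex_of_real (z + 1 / 2)) =
  exp (complex_of_real ((1 - 2 * z) * ln 2)) * complex_of_real (sqrt pi) * Gamma (complex_of_real (2 * z))"
  by simp
 then have "complex_of_real (Gamma z * Gamma (z + 1 / 2)) = complex_of_real (exp ((1 - 2 * z) * ln 2) * sqrt pi * Gamma (2 * z))"
  unfolding Gamma_complex_of_real exp_of_real of_real_mult[symmetric] .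
 then have "Gamma z * Gamma (z + 1 / 2) = exp ((1 - 2 * z) * ln 2) * sqrt pi * Gamma (2 * z)"
  by (simp only: of_real_eq_iff)
 moreover have "exp ((1 - 2 * z) * ln 2) = 1 / 2 ^ d"
 proof -
  have "1 - 2 * z = - real d" by (simp add: z_def field_simps)
  then have "exp ((1 - 2 * z) * ln 2) = 2 powr (- real d)" by (simp add: powr_def)
  then show ?thesis by (simp add: powr_minus_divide powr_realpow)
 qed
 moreover have "Gamma (2 * z) = fact d"
 proof -
  have "2 * z = 1 + real d" by (simp add: z_def)
  then show ?thesis by (simp add: Gamma_fact)
 qed
 moreover have "z + 1 / 2 = real d / 2 + 1" by (simp add: z_def field_simps)
 ultimately have "Gamma z * Gamma (real d / 2 + 1) = 1 / 2 ^ d * sqrt pi * fact d" by simp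
 then show ?thesis unfolding z_def[symmetric] by (simp add: field_simps)
qed

text \<open>For one row, the normalisation of the weight, the power of 2 and the Gaussian moment
  combine by Legendre duplication to the volume of the unit ball. A squared distance in that row
  doubles the result.\<close>

lemma half_gauss_moment_volume:
 assumes d: "d > 0"
 shows "4 / Gamma (real (d + 1)) * 2 ^ d * half_gauss_moment d d = unit_ball_vol d"
  and "4 / Gamma (real (d + 1 + 1)) * 2 ^ (d + 2) * half_gauss_moment d (d + 2) = 2 * unit_ball_vol d"
proof -
 have G: "Gamma (real d / 2 + 1) > 0" by (intro Gamma_real_pos) auto
 have f: "Gamma (real (d + 1)) = fact d" "Gamma (real (d + 1 + 1)) = (real d + 1) * fact d"
  using Gamma_fact[of d, where 'a=real] Gamma_fact[of "d + 1", where 'a=real] by (simp_all add: add_ac)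
 let ?h = "sqrt pi * sqrt pi ^ (d - 1)"
 have p: "?h = pi powr (real d / 2)"
 proof -
  have "?h = sqrt pi ^ d" using d by (metis power_eq_if less_not_refl)
  also have "\<dots> = sqrt pi powr real d" by (simp add: powr_realpow)
  also have "\<dots> = pi powr (real d / 2)" by (simp add: powr_half_sqrt[symmetric] powr_powr)
  finally show ?thesis .
 qed
 let ?f = "4 / Gamma (real (d + 1)) * 2 ^ d * half_gauss_moment d d"
 have "2 ^ d * Gamma ((real d + 1) / 2) = sqrt pi * fact d / Gamma (real d / 2 + 1)"
  using Gamma_half_duplication[of d] G by (simp add: eq_divide_eq less_imp_neq[THEN not_sym])
 then have "?f = ?h / Gamma (real d / 2 + 1)"
  unfolding half_gauss_moment_def f by (simp add: field_simps)
 then show 1: "?f = unit_ball_vol d"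
  unfolding p unit_ball_vol_def .
 let ?g = "4 / Gamma (real (d + 1 + 1)) * 2 ^ (d + 2) * half_gauss_moment d (d + 2)"
 have "Gamma ((real (d + 2) + 1) / 2) = (real d + 1) / 2 * Gamma ((real d + 1) / 2)"
 proof -
  have "(real (d + 2) + 1) / 2 = (real d + 1) / 2 + 1" by (simp add: field_simps)
  then show ?thesis by (simp only:) (rule Gamma_plus1, auto simp: nonpos_Ints_def)
 qed
 then have "half_gauss_moment d (d + 2) = (real d + 1) / 2 * half_gauss_moment d d"
  unfolding half_gauss_moment_def by simp
 then have "?g
  = 2 * ?f"
 proof -
  have "4 / ((r + 1) * x) * (p * 4) * ((r + 1) / 2 * h) = 2 * (4 / x * p * h)" if "r + 1 \<noteq> 0" for r x p h :: real
   using that by (simp add: divide_simps)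
  from this[of "real d"] show ?thesis
   unfolding f \<open>half_gauss_moment d (d + 2) = _\<close> by (simp add: power_add add_nonneg_eq_0_iff)
 qed
 then show "?g = 2 * unit_ball_vol d"
  unfolding 1 .
qed

context sphere_sample
begin

lemma limit_const_0: "limit_const (%_. 0) = unit_ball_vol CARD('m) ^ CARD('m) * fact DIM('a)"
proof -
 let ?d = "CARD('m)"
 let ?f = "4 / Gamma (real (?d + 1)) * 2 ^ ?d * half_gauss_moment ?d ?d"
 let ?g = "fact (?d - 1) * (real ?d * real (?d + 1))"
 have "limit_const (%_. 0) = ?f ^ ?d * ?g"
  by (simp add: limit_const_def dim power_mult_distrib power_divide)
 also have "?f = unit_ball_vol ?d"
  by (rule half_gauss_moment_volume) simp
 also have "?g = fact DIM('a)"
  unfolding dim by (subst (2) fact_reduce) (auto simp: fact_reduce[of ?d])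
 finally show ?thesis .
qed

text \<open>Compared with k = 0, one row has exponent d + 2: its own factor doubles, and the sum of
  all exponents plus one grows from d (d + 1) to d (d + 1) + 2.\<close>

lemma limit_const_1:
 "limit_const (%i. if i = i0 then 1 else 0) = limit_const (%_. 0) * (2 * (real CARD('m) ^ 2 + real CARD('m) + 2) / (real CARD('m) * (real CARD('m) + 1)))"
proof -
 let ?d = "CARD('m)"
 let ?k = "%i. if i = i0 then 1 else 0 :: nat"
 define c where "c i = 4 / Gamma (real (DIM('a) + ?k i)) * 2 ^ (?d + 2 * ?k i) * half_gauss_moment ?d (?d + 2 * ?k i)" for i
 have c: "c i = (if i = i0 then 2 else 1) * unit_ball_vol ?d" for i
  using half_gauss_moment_volume[of ?d] unfolding c_def dim by simp
 let ?f = "real ?d * (real ?d + 1) + 2"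
 let ?g = "\<Sum>i\<in>UNIV. real (?d + 2 * ?k i + 1)"
 have "limit_const ?k = prod c UNIV * (fact (?d - 1) * ?g)"
  unfolding limit_const_def c_def prod.distrib by (simp only: mult_ac)
 also have "prod c UNIV = 2 * unit_ball_vol ?d ^ ?d"
  unfolding c by (simp add: prod.distrib prod.If_cases)
 also have "?g = ?f"
 proof -
  have "real (?d + 2 * ?k i + 1) = real ?d + 1 + (if i = i0 then 2 else 0)" for i by simp
  then show ?thesis by (simp only: sum.distrib) (simp add: algebra_simps)
 qed
 finally have "limit_const ?k = 2 * unit_ball_vol ?d ^ ?d * (fact (?d - 1) * ?f)" .
 moreover have "fact DIM('a) = fact (?d - 1) * (real ?d * (real ?d + 1))"
  unfolding dim by (subst fact_reduce) (auto simp: fact_reduce[of ?d])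
 moreover have "real ?d * (real ?d + 1) \<noteq> 0" by (simp add: add_nonneg_eq_0_iff)
 moreover have "real ?d ^ 2 + real ?d + 2 = ?f" by (simp add: power2_eq_square algebra_simps)
 ultimately show ?thesis unfolding limit_const_0 by simp
qed

definition density_moment :: "real => real" where
 "density_moment r = (\<integral>x. F x powr r \<partial>sphere_measure)"

lemma density_power_bounded: "\<exists>B. \<forall>x. F x powr r \<le> B"
proof (intro exI allI)
 fix x show "F x powr r \<le> max (hi powr r) (lo powr r)"
 proof (cases "r \<ge> 0")
  case True then show ?thesis using F_hi[of x] F_nonneg[of x] by (intro max.coboundedI1 powr_mono2) auto
 next
  case False then show ?thesis using F_lo[of x] lo_pos by (intro max.coboundedI2 powr_mono2') auto
 qed
qed

lemma density_moment_nn: "(\<integral>\<^sup>+x. ennreal (F x powr r) \<partial>sphere_measure) = ennreal (density_moment r)"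
 unfolding density_moment_def
proof (rule nn_integral_eq_integral)
 obtain B where B: "\<And>x. F x powr r \<le> B" using density_power_bounded by blast
 interpret S: finite_measure "sphere_measure :: 'a measure" by (rule finite_sphere_measure)
 show "integrable sphere_measure (%x. F x powr r)"
  by (rule S.integrable_const_bound[of _ B]) (auto intro!: measurable_sphere_measure B)
qed simp

lemma rate_pos: "rate k j > 0"
 unfolding rate_def by (intro add_pos_nonneg divide_nonneg_nonneg mult_nonneg_nonneg of_nat_0_le_iff) auto

definition sample_moment :: "('m => nat) => nat => nat => ennreal" where
 "sample_moment k j N = (\<integral>\<^sup>+v. (\<integral>\<^sup>+x. ennreal (simplex_functional k j N v x) \<partial>PiM (UNIV :: 'm set) (%_. P)) \<partial>P)"

lemma simplex_functional_joint:
 "(%p. ennreal (simplex_functional k j N (fst p) (snd p))) \<in> borel_measurable (P \<Otimes>\<^sub>M PiM (UNIV :: 'm set) (%_. P))"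
 using simplex_functional_measurable[OF measurable_pair_sample] by simp

text \<open>The density enters once for the base vertex, d times for the other vertices, and to the
  power minus the rate through the radial integral. The total exponent n minus the rate is -2
  q.\<close>

lemma sample_moment_tendsto:
 defines "q k j \<equiv> real (j + (\<Sum>i\<in>UNIV. k i)) / real CARD('m)"
 shows "(%N. ennreal (real N powr rate k j) * sample_moment k j N) \<longlonglongrightarrow>
  ennreal (limit_const k * unit_ball_vol CARD('m) powr (1 - rate k j) * Gamma (rate k j) * density_moment (- 2 * q k j))"
proof -
 let ?V = "%N v. ennreal (real N powr rate k j) * (\<integral>\<^sup>+x. ennreal (simplex_functional k j N v x) \<partial>PiM (UNIV :: 'm set) (%_. P))"
 have sf: "sigma_finite_measure (PiM (UNIV :: 'm set) (%_. P))"
  by (intro prob_space_imp_sigma_finite prob_space_PiM prob_space_P)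
 have m: "(%v. \<integral>\<^sup>+x. ennreal (simplex_functional k j N v x) \<partial>PiM (UNIV :: 'm set) (%_. P)) \<in> borel_measurable P" for N
  by (rule sigma_finite_measure.borel_measurable_nn_integral[OF sf]) (use simplex_functional_joint in \<open>simp add: case_prod_unfold\<close>)
 let ?\<kappa> = "unit_ball_vol CARD('m)"
 let ?f = "%v. F v ^ CARD('m) * local_value k j (F v * ?\<kappa>)"
 let ?g = "\<integral>\<^sup>+v. ennreal (?f v) \<partial>P"
 let ?h = "%N. N + 2 * DIM('a)"
 have "(%N. \<integral>\<^sup>+v. ?V (?h N) v \<partial>P) \<longlonglongrightarrow> ?g"
 proof (rule nn_integral_dominated_convergence)
  show "?V (?h N) \<in> borel_measurable P" for N using m by measurable
  show "(%v. ennreal (?f v)) \<in> borel_measurable P"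
   unfolding local_value_def by (rule measurable_P) measurable
  show "AE v in P. ?V (?h N) v \<le> ennreal (hi ^ CARD('m) * local_value k j decay)" for N
   by (rule AE_I2, rule scaled_integral_le) auto
  show "AE v in P. (%N. ?V (?h N) v) \<longlonglongrightarrow> ennreal (?f v)"
  proof (rule AE_I2)
   fix v assume "v \<in> space P"
   then have "norm v = 1" using \<open>v \<in> space P\<close> by simp
   from LIMSEQ_ignore_initial_segment[OF scaled_integral_tendsto[OF this], of "2 * DIM('a)"]
   show "(%N. ?V (?h N) v) \<longlonglongrightarrow> ennreal (?f v)" .
  qed
  show "(\<integral>\<^sup>+v. ennreal (hi ^ CARD('m) * local_value k j decay) \<partial>P) < \<infinity>"
   using P.emeasure_space_1 by simp
 qed simp
 moreover have "(\<integral>\<^sup>+v. ?V N v \<partial>P) = ennreal (real N powr rate k j) * sample_moment k j N" for N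
  unfolding sample_moment_def by (rule nn_integral_cmult[OF m])
 ultimately have "(%N. ennreal (real (?h N) powr rate k j) * sample_moment k j (?h N)) \<longlonglongrightarrow> ?g"
  by (simp only:)
 then have 1: "(%N. ennreal (real N powr rate k j) * sample_moment k j N) \<longlonglongrightarrow> ?g"
  by (rule LIMSEQ_offset)
 define c where "c = limit_const k * ?\<kappa> powr (1 - rate k j) * Gamma (rate k j)"
 have c: "c \<ge> 0" unfolding c_def using rate_pos limit_const_nonneg by (intro mult_nonneg_nonneg Gamma_real_nonneg) auto
 let ?p = "%v. F v ^ DIM('a) / F v powr rate k j"
 have "?g
   = (\<integral>\<^sup>+v. ennreal (F v) * ennreal (?f v) \<partial>sphere_measure)"
  unfolding local_value_def by (rule nn_integral_P, rule measurable_P) measurable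
 also have "\<dots> = (\<integral>\<^sup>+v. ennreal c * ennreal (F v powr (- 2 * q k j)) \<partial>sphere_measure)"
 proof (rule nn_integral_cong)
  fix v :: 'a
  have Fv: "F v > 0" by (rule F_pos)
  have kp: "?\<kappa> > 0" by simp
  have "F v * ?f v = limit_const k * Gamma (rate k j) * ?p v * (?\<kappa> / ?\<kappa> powr rate k j)"
   using Fv kp unfolding local_value_def dim by (simp add: powr_mult)
  also have "?p v = F v powr (- 2 * q k j)"
  proof -
   have "?p v = F v powr (real DIM('a) - rate k j)"
    using Fv by (simp add: powr_diff powr_realpow)
   moreover have "real DIM('a) - rate k j = - 2 * q k j" by (simp only: rate_def q_def)
   ultimately show ?thesis by (simp only:)
  qed
  also have "?\<kappa> / ?\<kappa> powr rate k j = ?\<kappa> powr (1 - rate k j)" by (simp add: powr_diff)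
  finally have "F v * ?f v = c * F v powr (- 2 * q k j)"
   by (simp add: c_def mult_ac)
  then show "ennreal (F v) * ennreal (?f v) = ennreal c * ennreal (F v powr (- 2 * q k j))"
   using c F_nonneg[of v] by (simp flip: ennreal_mult')
 qed
 also have "\<dots> = ennreal c * ennreal (density_moment (- 2 * q k j))"
  unfolding density_moment_nn[symmetric] by (rule nn_integral_cmult) (auto intro!: measurable_sphere_measure)
 also have "\<dots> = ennreal (c * density_moment (- 2 * q k j))" using c by (simp add: ennreal_mult')
 finally show ?thesis using 1 by (simp add: c_def)
qed

lemma unit_ball_vol_powr: "unit_ball_vol CARD('m) ^ CARD('m) * unit_ball_vol CARD('m) powr (1 - (real DIM('a) + r)) = unit_ball_vol CARD('m) powr (- r)"
proof -
 have "unit_ball_vol CARD('m) ^ CARD('m) = unit_ball_vol CARD('m) powr real CARD('m)" by (simp add: powr_realpow)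
 then show ?thesis by (simp add: dim flip: powr_add)
qed

text \<open>The limit of the scaled first depth moment. It already holds the Gamma and density
  factors of the final answer; its n! is later divided out by the count of candidate facets.\<close>

definition base_value :: real where
 "base_value = fact DIM('a) * unit_ball_vol CARD('m) powr (- 2 / CARD('m)) * Gamma (real DIM('a) + 2 / CARD('m)) * density_moment (- 2 / CARD('m))"

lemma rate_one: "rate (%_. 0) 1 = real DIM('a) + 2 / CARD('m)" "rate (%i. if i = i0 then 1 else 0) 0 = real DIM('a) + 2 / CARD('m)"
 "rate (%_. 0) 2 = real DIM('a) + 4 / CARD('m)"
 by (simp_all add: rate_def)

lemma base_value_eq:
 "limit_const (%_. 0) * unit_ball_vol CARD('m) powr (1 - (real DIM('a) + 2 / CARD('m))) * Gamma (real DIM('a) + 2 / CARD('m)) * density_moment (- 2 / CARD('m)) = base_value"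
 using unit_ball_vol_powr[of "2 / CARD('m)"] unfolding limit_const_0 base_value_def by (simp add: mult_ac)

lemma height_moment_tendsto:
 "(%N. ennreal (real N powr (real DIM('a) + 2 / CARD('m))) * sample_moment (%_. 0) 1 N) \<longlonglongrightarrow> ennreal base_value"
 using sample_moment_tendsto[of "%_. 0" 1] base_value_eq unfolding rate_one by simp

lemma distance_moment_tendsto:
 "(%N. ennreal (real N powr (real DIM('a) + 2 / CARD('m))) * sample_moment (%i. if i = i0 then 1 else 0) 0 N)
  \<longlonglongrightarrow> ennreal (base_value * (2 * (real CARD('m) ^ 2 + real CARD('m) + 2) / (real CARD('m) * (real CARD('m) + 1))))"
proof -
 have q: "- 2 * (real (0 + (\<Sum>i\<in>(UNIV::'m set). if i = i0 then 1 else 0)) / real CARD('m)) = - 2 / CARD('m)" by simp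
 have e: "limit_const (%_. 0) * R * A * B * C = (limit_const (%_. 0) * A * B * C) * R" for R A B C :: real by simp
 show ?thesis
  using sample_moment_tendsto[of "%i. if i = i0 then 1 else 0" 0]
  unfolding rate_one q limit_const_1 e base_value_eq .
qed

text \<open>The squared depth has rate n + 4/d, so at the scale n + 2/d it is smaller by N^(-2/d).
  This makes the quadratic remainders negligible.\<close>

lemma square_moment_tendsto:
 "(%N. ennreal (real N powr (real DIM('a) + 2 / CARD('m))) * sample_moment (%_. 0) 2 N) \<longlonglongrightarrow> 0"
proof -
 let ?h = "- 2 / CARD('m)"
 have r: "(%N. ennreal (real N powr ?h)) \<longlonglongrightarrow> 0"
  using tendsto_ennrealI[OF tendsto_neg_powr[OF _ filterlim_real_sequentially, of "?h"]] by simp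
 let ?g = "%_. 0"
 let ?f = "%N. ennreal (real N powr rate ?g 2) * sample_moment ?g 2 N"
 have "(%N. ennreal (real N powr ?h) * ?f N) \<longlonglongrightarrow> 0 * ennreal (limit_const ?g * unit_ball_vol CARD('m) powr (1 - rate ?g 2) * Gamma (rate ?g 2) *
   density_moment (- 2 * (real (2 + (\<Sum>i\<in>(UNIV::'m set). 0)) / real CARD('m))))"
  by (intro tendsto_mult_ennreal r sample_moment_tendsto) auto
 moreover have "eventually (%N. ennreal (real N powr ?h) * ?f N
   = ennreal (real N powr (real DIM('a) + 2 / CARD('m))) * sample_moment ?g 2 N) sequentially"
 by (intro eventually_sequentiallyI) (simp add: mult.assoc[symmetric] ennreal_mult'[symmetric] powr_add[symmetric] rate_one add.commute)
 ultimately show ?thesis by (auto intro: Lim_transform_eventually)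
qed

end

section \<open>The ball in a simplicial cone\<close>

lemma nn_integral_power_exp_Ici:
 assumes t: "t > 0"
 shows "(\<integral>\<^sup>+c. ennreal (c ^ k * exp (- (t * c))) * indicator {0..} c \<partial>lborel) = ennreal (fact k / t ^ (k + 1))"
proof -
 let ?f = "real (k + 1) / 1"
 have "(\<integral>\<^sup>+c. ennreal (c ^ k * exp (- (t * c))) * indicator {0..} c \<partial>lborel)
  = (\<integral>\<^sup>+c. ennreal (c powr (real (k + 1) - 1) * exp (- (t * c powr 1))) * indicator {0<..} c \<partial>lborel)"
 proof (rule nn_integral_cong_AE)
  show "AE c in lborel. ennreal (c ^ k * exp (- (t * c))) * indicator {0..} c = ennreal (c powr (real (k + 1) - 1) * exp (- (t * c powr 1))) * indicator {0<..} c"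
   using AE_lborel_singleton[of "0::real"]
  proof eventually_elim
   case (elim c)
   then show ?case by (auto simp: indicator_def powr_realpow)
  qed
 qed
 also have "\<dots> = ennreal (Gamma ?f / (1 * t powr ?f))"
  by (rule nn_integral_powr_exp_powr) (use t in auto)
 also have "Gamma ?f / (1 * t powr ?f) = fact k / t ^ (k + 1)"
 proof -
  have "Gamma ?f = fact k" using Gamma_fact[of k, where 'a=real] by (simp add: add.commute)
  moreover have "t powr ?f = t ^ (k + 1)" using powr_realpow[OF t, of "k + 1"] by (simp only: div_by_1)
  ultimately show ?thesis by simp
 qed
 finally show ?thesis .
qed

lemma nn_integral_orthant_exp:
 fixes A :: "'i set" and k :: "'i => nat"
 assumes A: "finite A" and t: "t > 0"
 shows "(\<integral>\<^sup>+c. ennreal ((\<Prod>x\<in>A. c x ^ k x) * exp (- (t * (\<Sum>x\<in>A. c x)))) * (\<Prod>x\<in>A. indicator {0..} (c x)) \<partial>PiM A (%_. lborel))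
  = ennreal ((\<Prod>x\<in>A. fact (k x)) / t ^ (card A + (\<Sum>x\<in>A. k x)))"
proof -
 interpret product_sigma_finite "%_::'i. lborel :: real measure" ..
 let ?f = "%c. \<Prod>x\<in>A. ennreal (c x ^ k x * exp (- (t * c x))) * indicator {0..} (c x)"
 let ?g = "%c. (\<Prod>x\<in>A. c x ^ k x) * exp (- (t * (\<Sum>x\<in>A. c x)))"
 let ?h = "%c. \<Prod>x\<in>A. indicator {0..} (c x)"
 let ?p = "\<Prod>x\<in>A. fact (k x) / t ^ (k x + 1)"
 have "(\<integral>\<^sup>+c. ennreal (?g c) * ?h c \<partial>PiM A (%_. lborel))
  = (\<integral>\<^sup>+c. ?f c \<partial>PiM A (%_. lborel))"
 proof (rule nn_integral_cong)
  fix c :: "'i => real"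
  show "ennreal (?g c) * ?h c = ?f c"
  proof (cases "\<forall>x\<in>A. c x \<ge> 0")
   case True
   then have "?f c = ennreal (\<Prod>x\<in>A. c x ^ k x * exp (- (t * c x)))"
    by (subst prod_ennreal[symmetric]) (auto intro!: prod.cong)
   moreover have "(\<Prod>x\<in>A. c x ^ k x * exp (- (t * c x))) = ?g c"
    using A by (simp add: prod.distrib exp_sum sum_distrib_left flip: sum_negf)
   ultimately show ?thesis using True by simp
  next
   case False
   then obtain x where "x \<in> A" "c x < 0" by force
   then have 0: "?h c = (0::ennreal)" "?f c = 0"
    using A by (auto intro!: prod_zero bexI[of _ x])
   show ?thesis unfolding 0 by simp
  qed
 qed
 also have "\<dots> = (\<Prod>x\<in>A. \<integral>\<^sup>+c. ennreal (c ^ k x * exp (- (t * c))) * indicator {0..} c \<partial>lborel)"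
  using A by (intro product_nn_integral_prod) measurable
 also have "\<dots> = ennreal ?p"
  using t by (simp only: nn_integral_power_exp_Ici, subst prod_ennreal) auto
 also have "?p = (\<Prod>x\<in>A. fact (k x)) / t ^ (card A + (\<Sum>x\<in>A. k x))"
  unfolding prod_dividef power_add prod.distrib power_sum power_one_right prod_constant by (simp only: mult.commute)
 finally show ?thesis .
qed

text \<open>The factor \<open>1/s\<close> is removed by writing \<open>exp (- s) / s\<close> as the integral of \<open>exp (- t s)\<close> over \<open>t \<ge> 1\<close>.\<close>

lemma nn_integral_orthant_pair:
 fixes A :: "'i set"
 assumes A: "finite A" and xy: "x \<in> A" "y \<in> A" "x \<noteq> y"
 shows "(\<integral>\<^sup>+c. ennreal (c x * c y * exp (- (\<Sum>x\<in>A. c x)) / (\<Sum>x\<in>A. c x)) * (\<Prod>x\<in>A. indicator {0..} (c x)) \<partial>PiM A (%_. lborel))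
  = ennreal (1 / (real (card A) + 1))"
proof -
 let ?M = "PiM A (%_. lborel :: real measure)"
 let ?O = "%c. (\<Prod>x\<in>A. indicator {0..} (c x)) :: ennreal"
 let ?s = "%c. \<Sum>x\<in>A. c x :: real"
 interpret P: product_sigma_finite "%_::'i. lborel :: real measure" ..
 interpret F: finite_product_sigma_finite "%_::'i. lborel :: real measure" A by standard (rule A)
 interpret pair: pair_sigma_finite ?M "lborel :: real measure" ..
 have [measurable]: "(%c. c z) \<in> borel_measurable ?M" if "z \<in> A" for z
  using measurable_component_singleton[OF that, of "%_. lborel"] by simp
 note [measurable] = xy(1,2)
 have Om [measurable]: "?O \<in> borel_measurable ?M" by measurable
 have sm [measurable]: "?s \<in> borel_measurable ?M" by measurable
 let ?f = "%(c::'i => real) x y. \<integral>\<^sup>+t. ennreal (c x * c y * exp (- (t * ?s c))) * ?O c * indicator {1..} t \<partial>lborel"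
 let ?p = "%(c::'i => real). \<integral>\<^sup>+t. ennreal (exp (- (t * ?s c))) * indicator {1..} t \<partial>lborel"
 have inner: "ennreal (c x * c y * exp (- ?s c) / ?s c) * ?O c
  = ?f c x y" for c
 proof (cases "(\<forall>z\<in>A. c z \<ge> 0) \<and> ?s c > 0")
  case True
  then have pos: "?s c > 0" and cxy: "c x \<ge> 0" "c y \<ge> 0" and O: "?O c = 1" using xy by auto
  have "?p c = ennreal (0 - (- exp (- (1 * ?s c)) / ?s c))"
  proof (rule nn_integral_FTC_atLeast)
   have "((%t. - exp (- (t * ?s c)) / ?s c) \<longlongrightarrow> - 0 / ?s c) at_top"
   proof (intro tendsto_intros filterlim_compose[OF exp_at_bot])
    show "filterlim (%t. - (t * ?s c)) at_bot at_top"
     using pos by (intro filterlim_uminus_at_bot_at_top[THEN filterlim_compose] filterlim_at_top_mult_tendsto_pos[OF tendsto_const] filterlim_ident)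
   qed (use pos in auto)
   then show "((%t. - exp (- (t * ?s c)) / ?s c) \<longlongrightarrow> 0) at_top" by simp
  qed (use pos in \<open>auto intro!: derivative_eq_intros\<close>)
  then have I: "?p c = ennreal (exp (- ?s c) / ?s c)" by simp
  have "?f c x y
   = (\<integral>\<^sup>+t. ennreal (c x * c y) * (ennreal (exp (- (t * ?s c))) * indicator {1..} t) \<partial>lborel)"
   using cxy by (intro nn_integral_cong) (simp add: O ennreal_mult' mult.assoc)
  also have "\<dots> = ennreal (c x * c y) * ennreal (exp (- ?s c) / ?s c)"
   by (subst nn_integral_cmult) (auto simp: I)
  also have "\<dots> = ennreal (c x * c y * exp (- ?s c) / ?s c)" using cxy by (simp flip: ennreal_mult')
  finally show ?thesis unfolding O mult_1_right by (rule sym)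
 next
  case False
  then consider z where "z \<in> A" "c z < 0" | "\<forall>z\<in>A. c z \<ge> 0" "?s c \<le> 0" by (meson not_le)
  then show ?thesis
  proof cases
   case 1
   then have O: "?O c = 0" using A by (intro prod_zero bexI[of _ z]) auto
   show ?thesis unfolding O by simp
  next
   \<comment> \<open>All coefficients vanish here, so c x = 0 and both integrands are 0, whatever
     the quotient by the sum.\<close>
   case 2
   then have "?s c = 0" by (intro antisym sum_nonneg) auto
   then have "c x = 0" using 2 A xy sum_nonneg_eq_0_iff[of A c] by auto
   then show ?thesis by simp
  qed
 qed
 have Hm: "(%p. ennreal (fst p x * fst p y * exp (- (snd p * ?s (fst p)))) * ?O (fst p) * indicator {1..} (snd p)) \<in> borel_measurable (?M \<Otimes>\<^sub>M lborel)"
  by measurable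
 define k where "k z = (if z \<in> {x, y} then 1 else 0 :: nat)" for z
 have kp: "(\<Prod>z\<in>A. c z ^ k z) = c x * c y" for c :: "'i => real"
 proof -
  have "(\<Prod>z\<in>A. c z ^ k z) = (\<Prod>z\<in>{x, y}. c z ^ k z)"
   using A xy by (intro prod.mono_neutral_right) (auto simp: k_def)
  then show ?thesis using xy by (simp add: k_def)
 qed
 have ks: "sum k A = 2"
 proof -
  have "sum k A = sum k {x, y}" using A xy by (intro sum.mono_neutral_right) (auto simp: k_def)
  then show ?thesis using xy by (simp add: k_def)
 qed
 have kf: "(\<Prod>z\<in>A. fact (k z)) = (1::real)" by (intro prod.neutral) (auto simp: k_def)
 let ?r = "%t. real (card A + 1) * t ^ (card A + 1)"
 let ?q = "%m t. real (m + 1) * (- (inverse t ^ Suc (Suc 0)) * inverse t ^ (m + 1 - Suc 0))"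
 have deriv: "((%t. - 1 / ?r t) has_real_derivative 1 / t ^ (card A + 2)) (at t)" if "1 \<le> t" for t :: real
 proof -
  define m where "m = card A"
  have "((%t. - 1 / real (m + 1) * inverse t ^ (m + 1)) has_real_derivative - 1 / real (m + 1) * ?q m t) (at t)"
   using that by (intro DERIV_cmult DERIV_power DERIV_inverse) auto
  moreover have "- 1 / real (m + 1) * ?q m t = 1 / t ^ (m + 2)"
  proof -
   have "- 1 / r * (r * (- x * y)) = x * y" if "r \<noteq> 0" for r x y :: real using that by simp
   from this[of "real (m + 1)"] show ?thesis by (simp add: power_inverse divide_inverse power_add)
  qed
  moreover have "(%t. - 1 / real (m + 1) * inverse t ^ (m + 1)) = (%t. - 1 / (real (m + 1) * t ^ (m + 1)))"
   by (simp add: fun_eq_iff power_inverse divide_inverse)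
  ultimately show ?thesis unfolding m_def by simp
 qed
 let ?h = "%x y t. \<integral>\<^sup>+c. ennreal (c x * c y * exp (- (t * ?s c))) * ?O c * indicator {1..} t \<partial>?M"
 have "(\<integral>\<^sup>+c. ennreal (c x * c y * exp (- ?s c) / ?s c) * ?O c \<partial>?M)
  = (\<integral>\<^sup>+c. ?f c x y \<partial>?M)"
  by (simp only: inner)
 also have "\<dots> = (\<integral>\<^sup>+t. ?h x y t \<partial>lborel)"
  by (rule pair.Fubini'[symmetric]) (use Hm in \<open>simp add: case_prod_unfold\<close>)
 also have "\<dots> = (\<integral>\<^sup>+t. ennreal (1 / t ^ (card A + 2)) * indicator {1..} t \<partial>lborel)"
 proof (rule nn_integral_cong)
  fix t :: real
  show "?h x y t = ennreal (1 / t ^ (card A + 2)) * indicator {1..} t"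
  proof (cases "t \<ge> 1")
   case True
   \<comment> \<open>The exponent of 1/t is one per variable and one more for each of x and y, hence
     card A + 2; its integral over t \<ge> 1 is 1 / (card A + 1).\<close>
   then show ?thesis using nn_integral_orthant_exp[OF A, of t k] by (simp add: kp ks kf)
  qed simp
 qed
 also have "\<dots> = ennreal (0 - (- 1 / (real (card A + 1) * 1 ^ (card A + 1))))"
 proof (rule nn_integral_FTC_atLeast[where F="%t. - 1 / ?r t"])
  fix t :: real assume "1 \<le> t"
  then show "((%t. - 1 / ?r t) has_real_derivative 1 / t ^ (card A + 2)) (at t)"
   by (rule deriv)
  show "0 \<le> 1 / t ^ (card A + 2)" using \<open>1 \<le> t\<close> by simp
 next
  have "filterlim (%t::real. real (card A + 1) * t ^ (card A + 1)) at_top at_top"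
   by (intro filterlim_tendsto_pos_mult_at_top[OF tendsto_const] filterlim_pow_at_top filterlim_ident) auto
  then show "((%t::real. - 1 / ?r t) \<longlongrightarrow> 0) at_top"
   by (rule real_tendsto_divide_at_top[OF tendsto_const])
 qed simp
 finally show ?thesis by (simp add: add.commute)
qed

text \<open>Here s is the sum of the coefficients, b the norm of the conic combination and u = s -
  b. The correction (s^2 - b^2) / (2 s) = u - u^2 / (2 s) is used in place of u because s^2 - b^2 is
  a quadratic form in the coefficients. The loss is controlled by u \<le> z s. The constant 18 is (4
  + 32) / 2, from s exp (- s) \<le> 4 exp (- s/4) and s^2 exp (- s/2) \<le> 32 exp (- s/4).\<close>

lemma exp_remainder_le:
 fixes s b z :: real
 assumes s: "s > 0" and b: "s / 2 \<le> b" "b \<le> s" and z: "s\<^sup>2 - b\<^sup>2 \<le> z * s\<^sup>2" "0 \<le> z"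
 shows "exp (- b) \<le> exp (- s) + (s\<^sup>2 - b\<^sup>2) * exp (- s) / s / 2 + 18 * z\<^sup>2 * exp (- (s / 4))"
  and "exp (- s) + (s\<^sup>2 - b\<^sup>2) * exp (- s) / s / 2 \<le> exp (- b)"
proof -
 define u where "u = s - b"
 have u0: "0 \<le> u" "u \<le> s / 2" using b by (auto simp: u_def)
 let ?f = "s\<^sup>2 - b\<^sup>2"
 let ?g = "u - u\<^sup>2 / (2 * s)"
 have uq: "?f / s / 2 = ?g"
  using s by (simp add: u_def power2_eq_square field_simps)
 have uz: "u \<le> z * s"
 proof -
  have "u * s \<le> u * (s + b)" using u0 b s by (intro mult_left_mono) auto
  also have "\<dots> = ?f" by (simp add: u_def power2_eq_square algebra_simps)
  finally have "u * s \<le> (z * s) * s" using z by (simp add: power2_eq_square)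
  then show ?thesis using s by simp
 qed
 have eb: "exp (- b) = exp (- s) * exp u" by (simp add: u_def flip: exp_add)
 have lower: "1 + u \<le> exp u" by (rule exp_ge_add_one_self)
 have "exp (- s) * (1 + ?g) \<le> exp (- s) * exp u"
  using lower s by (intro mult_left_mono) (auto intro: order_trans[OF _ lower])
 then show "exp (- s) + ?f * exp (- s) / s / 2 \<le> exp (- b)"
  unfolding eb uq[symmetric] by (simp add: algebra_simps)
 have upper: "exp u \<le> 1 + u + u\<^sup>2 / 2 * exp u"
 proof (cases "u = 0")
  case False
  obtain t where t: "\<bar>t\<bar> \<le> \<bar>u\<bar>" "exp u = (\<Sum>m<2. u ^ m / fact m) + exp t / fact 2 * u ^ 2"
   using Maclaurin_exp_le[of u 2] by blast
  have "exp t / 2 * u\<^sup>2 \<le> exp u / 2 * u\<^sup>2" using t(1) u0 by (intro mult_right_mono) auto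
  then show ?thesis using t(2) by (simp add: numeral_2_eq_2 mult.commute)
 qed simp
 have u2: "u\<^sup>2 \<le> z\<^sup>2 * s\<^sup>2"
  using power_mono[OF uz u0(1), of 2] by (simp add: power_mult_distrib)
 have x1: "s / 4 \<le> exp (s / 4)" using exp_ge_add_one_self[of "s / 4"] by linarith
 have x2: "(s / 4)\<^sup>2 / 2 \<le> exp (s / 4)"
  using exp_lower_Taylor_quadratic[of "s / 4"] s by simp
 have e1: "exp (- s) * s \<le> 4 * exp (- (s / 4))"
 proof -
  have "exp (- s) * (s / 4) \<le> exp (- s) * exp (s / 4)" using x1 by (intro mult_left_mono) auto
  also have "\<dots> = exp (- s + s / 4)" by (simp only: exp_add)
  also have "\<dots> \<le> exp (- (s / 4))" using s by simp
  finally show ?thesis by simp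
 qed
 have e2: "exp (- (s / 2)) * s\<^sup>2 \<le> 32 * exp (- (s / 4))"
 proof -
  have "exp (- (s / 2)) * ((s / 4)\<^sup>2 / 2) \<le> exp (- (s / 2)) * exp (s / 4)" using x2 by (intro mult_left_mono) auto
  also have "\<dots> = exp (- (s / 2) + s / 4)" by (simp only: exp_add)
  also have "\<dots> = exp (- (s / 4))" by simp
  finally show ?thesis by (simp add: power_divide)
 qed
 let ?h = "exp (- (s / 2)) * (z\<^sup>2 * s\<^sup>2 / 2)"
 let ?p = "exp (- s) * (z\<^sup>2 * s\<^sup>2 / (2 * s))"
 have "exp (- s) * exp u \<le> exp (- s) * (1 + u + u\<^sup>2 / 2 * exp u)" using upper by (intro mult_left_mono) auto
 also have "\<dots> = exp (- s) * (1 + ?g) + exp (- s) * (u\<^sup>2 / (2 * s)) + exp (- b) * (u\<^sup>2 / 2)"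
  unfolding eb by (simp add: algebra_simps)
 also have "exp (- b) * (u\<^sup>2 / 2) \<le> ?h"
  using b u2 by (intro mult_mono) auto
 also have "?h = z\<^sup>2 / 2 * (exp (- (s / 2)) * s\<^sup>2)" by simp
 also have "\<dots> \<le> z\<^sup>2 / 2 * (32 * exp (- (s / 4)))" using e2 by (intro mult_left_mono) auto
 also have "exp (- s) * (u\<^sup>2 / (2 * s)) \<le> ?p"
  using u2 s by (intro mult_left_mono divide_right_mono) auto
 also have "?p = z\<^sup>2 / 2 * (exp (- s) * s)" using s by (simp add: power2_eq_square)
 also have "\<dots> \<le> z\<^sup>2 / 2 * (4 * exp (- (s / 4)))" using e1 by (intro mult_left_mono) auto
 finally show "exp (- b) \<le> exp (- s) + ?f * exp (- s) / s / 2 + 18 * z\<^sup>2 * exp (- (s / 4))"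
  unfolding eb uq[symmetric] by (simp add: algebra_simps)
qed

text \<open>For unit vectors 1 - x \<bullet> y = |x - y|^2 / 2, which expresses the defect in the
  triangle inequality by pairwise distances.\<close>

lemma norm_conic_combination:
 fixes A :: "'a::real_inner set"
 assumes A: "\<And>x. x \<in> A ==> norm x = 1"
 shows "(\<Sum>x\<in>A. c x)\<^sup>2 - (norm (\<Sum>x\<in>A. c x *\<^sub>R x))\<^sup>2 = (\<Sum>x\<in>A. \<Sum>y\<in>A. c x * c y * (norm (x - y))\<^sup>2) / 2"
proof -
 have "(norm (\<Sum>x\<in>A. c x *\<^sub>R x))\<^sup>2 = (\<Sum>x\<in>A. \<Sum>y\<in>A. c x * c y * (x \<bullet> y))"
  by (simp add: power2_norm_eq_inner inner_sum_left inner_sum_right sum_distrib_left inner_commute mult_ac)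
 moreover have "(\<Sum>x\<in>A. c x)\<^sup>2 = (\<Sum>x\<in>A. \<Sum>y\<in>A. c x * c y)"
  by (simp add: power2_eq_square sum_product)
 moreover have t: "c x * c y - c x * c y * (x \<bullet> y) = c x * c y * (norm (x - y))\<^sup>2 / 2" if "x \<in> A" "y \<in> A" for x y
 proof -
  have "x \<bullet> y = 1 - (norm (x - y))\<^sup>2 / 2"
   using A[OF that(1)] A[OF that(2)] dot_norm_neg[of x y] by (simp add: field_simps)
  then show ?thesis by (simp only:) (simp add: algebra_simps)
 qed
 ultimately show ?thesis
  by (simp only: sum_subtractf[symmetric] sum_divide_distrib) (intro sum.cong refl t)
qed

context
 fixes A :: "'a::euclidean_space set"
 assumes A: "independent A" "card A = DIM('a)" and unit: "\<And>x. x \<in> A ==> norm x = 1"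
  and small: "norm (plane_normal A) \<le> 2"
begin

text \<open>Taking the Euclidean norm as gauge measures the part of the cone in the ball instead of
  the simplex. The integral is then written in the coordinates of A.\<close>

lemma ball_cone_integral:
 "ennreal (fact DIM('a) * measure lborel (cball 0 1 \<inter> simplicial_cone A)) = ennreal (simplex_det A) *
  (\<integral>\<^sup>+c. ennreal (exp (- norm (\<Sum>x\<in>A. c x *\<^sub>R x))) * (\<Prod>x\<in>A. indicator {0..} (c x)) \<partial>PiM A (%_. lborel))"
proof -
 have fA: "finite A" by (rule basis_span[OF A])
 let ?f = "cball 0 1 \<inter> simplicial_cone A"
 have "ennreal (fact DIM('a) * measure lborel ?f) = fact DIM('a) * emeasure lborel {y \<in> simplicial_cone A. norm y \<le> 1}"
 proof -
  have e: "{y \<in> simplicial_cone A. norm y \<le> 1} = ?f" by auto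
  have "emeasure lborel ?f < \<infinity>"
   by (intro emeasure_bounded_finite bounded_Int) auto
  then have "emeasure lborel ?f = ennreal (measure lborel ?f)"
   by (intro emeasure_eq_ennreal_measure) auto
  then show ?thesis unfolding e by (simp add: ennreal_mult' ennreal_fact)
 qed
 also have "\<dots> = (\<integral>\<^sup>+y. ennreal (exp (- norm y)) * indicator (simplicial_cone A) y \<partial>lborel)"
  by (rule nn_integral_exp_gauge[symmetric]) (use fA in \<open>auto simp: simplicial_cone_scale\<close>)
 also have "\<dots> = ennreal (simplex_det A) *
  (\<integral>\<^sup>+c. ennreal (exp (- norm (\<Sum>x\<in>A. c x *\<^sub>R x))) * (\<Prod>x\<in>A. indicator {0..} (c x)) \<partial>PiM A (%_. lborel))"
  by (rule nn_integral_simplicial_cone(2)[OF A]) measurable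
 finally show ?thesis .
qed

text \<open>The plane normal a takes the value s on the combination, so Cauchy-Schwarz gives s \<le>
  |a| b. The bound 2 on |a| turns this into s / 2 \<le> b.\<close>

lemma conic_combination_bounds:
 assumes c: "\<And>x. x \<in> A ==> c x \<ge> 0"
 defines "s \<equiv> \<Sum>x\<in>A. c x" and "b \<equiv> norm (\<Sum>x\<in>A. c x *\<^sub>R x)"
 shows "s / 2 \<le> b" "b \<le> s" "s\<^sup>2 - b\<^sup>2 \<le> (1 - 1 / (norm (plane_normal A))\<^sup>2) * s\<^sup>2"
proof -
 define a where "a = plane_normal A"
 have a0: "norm a > 0" using plane_normal_inner(3)[OF A] by (simp add: a_def)
 have s0: "s \<ge> 0" unfolding s_def by (intro sum_nonneg c)
 show "b \<le> s" unfolding b_def s_def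
  by (rule order_trans[OF norm_sum]) (simp add: unit c cong: sum.cong)
 have "s = a \<bullet> (\<Sum>x\<in>A. c x *\<^sub>R x)"
  unfolding s_def a_def by (simp add: inner_sum_right plane_normal_inner(1)[OF A] cong: sum.cong)
 also have "\<dots> \<le> norm a * b" unfolding b_def by (rule norm_cauchy_schwarz)
 finally have sb: "s \<le> norm a * b" .
 also have "\<dots> \<le> 2 * b" using small by (intro mult_right_mono) (auto simp: a_def b_def)
 finally show "s / 2 \<le> b" by simp
 have "s\<^sup>2 \<le> (norm a)\<^sup>2 * b\<^sup>2" using power_mono[OF sb s0, of 2] by (simp add: power_mult_distrib)
 then have "s\<^sup>2 / (norm a)\<^sup>2 \<le> b\<^sup>2" using a0 by (simp add: divide_le_eq mult.commute)
 then show "s\<^sup>2 - b\<^sup>2 \<le> (1 - 1 / (norm (plane_normal A))\<^sup>2) * s\<^sup>2"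
  unfolding a_def[symmetric] by (simp add: left_diff_distrib)
qed

text \<open>Diagonal pairs have distance 0 and every other pair contributes 1 / (n + 1). The 4 is
  the 2 of the expansion times the 2 of the distance identity.\<close>

lemma orthant_distance_integral:
 "(\<integral>\<^sup>+c. ennreal (((\<Sum>x\<in>A. c x)\<^sup>2 - (norm (\<Sum>x\<in>A. c x *\<^sub>R x))\<^sup>2) * exp (- (\<Sum>x\<in>A. c x)) / (\<Sum>x\<in>A. c x) / 2) * (\<Prod>x\<in>A. indicator {0..} (c x)) \<partial>PiM A (%_. lborel))
  = ennreal ((\<Sum>x\<in>A. \<Sum>y\<in>A. (norm (x - y))\<^sup>2) / (4 * (real DIM('a) + 1)))"
proof -
 have fA: "finite A" by (rule basis_span[OF A])
 have [measurable]: "(%c. c z) \<in> borel_measurable (PiM A (%_. lborel :: real measure))" if "z \<in> A" for z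
  using measurable_component_singleton[OF that, of "%_. lborel"] by simp
 let ?v = "%(c::'a => real). \<Sum>x\<in>A. c x"
 define w where "w c = exp (- (?v c)) / ?v c" for c :: "'a => real"
 let ?O = "%c. (\<Prod>x\<in>A. indicator {0..} (c x)) :: ennreal"
 let ?h = "real DIM('a) + 1"
 let ?f = "\<Sum>x\<in>A. \<Sum>y\<in>A. (norm (x - y))\<^sup>2 / 4 * (1 / ?h)"
 let ?g = "%_. lborel"
 let ?p = "%(c::'a => real). ((?v c)\<^sup>2 - (norm (\<Sum>x\<in>A. c x *\<^sub>R x))\<^sup>2) * exp (- (?v c)) / ?v c / 2"
 let ?q = "%(c::'a => real) x y. ennreal (c x * c y * exp (- (?v c)) / ?v c) * ?O c"
 let ?r = "%(c::'a => real). \<Sum>x\<in>A. \<Sum>y\<in>A. (norm (x - y))\<^sup>2 / 4 * (c x * c y * w c)"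
 let ?u = "%(x::'a) y. (norm (x - y))\<^sup>2 / 4"
 have "(\<integral>\<^sup>+c. ennreal (?p c) * ?O c \<partial>PiM A ?g)
  = (\<integral>\<^sup>+c. (\<Sum>x\<in>A. \<Sum>y\<in>A. ennreal (?u x y) * ?q c x y) \<partial>PiM A ?g)"
 proof (rule nn_integral_cong)
  fix c :: "'a => real"
  show "ennreal (?p c) * ?O c
   = (\<Sum>x\<in>A. \<Sum>y\<in>A. ennreal (?u x y) * ?q c x y)"
  proof (cases "\<forall>x\<in>A. c x \<ge> 0")
   case True
   then have O: "?O c = 1" by simp
   have w: "w c \<ge> 0" unfolding w_def using True by (intro divide_nonneg_nonneg sum_nonneg) auto
   have "?p c
    = (\<Sum>x\<in>A. \<Sum>y\<in>A. c x * c y * (norm (x - y))\<^sup>2) / 4 * w c"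
    by (subst norm_conic_combination[OF unit]) (simp_all add: w_def)
   also have "\<dots> = ?r c"
    by (simp add: sum_divide_distrib sum_distrib_right sum_distrib_left mult_ac)
   finally have e: "?p c
    = ?r c" .
   have n: "0 \<le> (norm (x - y))\<^sup>2 / 4 * (c x * c y * w c)" if "x \<in> A" "y \<in> A" for x y
    using True w that by simp
   have "ennreal (?r c) = (\<Sum>x\<in>A. \<Sum>y\<in>A. ennreal ((norm (x - y))\<^sup>2 / 4 * (c x * c y * w c)))"
    using n by (subst sum_ennreal[symmetric], simp add: sum_nonneg, intro sum.cong refl, subst sum_ennreal[symmetric]) auto
   also have "\<dots> = (\<Sum>x\<in>A. \<Sum>y\<in>A. ennreal (?u x y) * ennreal (c x * c y * w c))"
    by (intro sum.cong refl ennreal_mult') auto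
   finally show ?thesis unfolding e O mult_1_right unfolding w_def times_divide_eq_right .
  next
   case False
   then obtain x where "x \<in> A" "c x < 0" by force
   then have O: "?O c = 0" using fA by (intro prod_zero bexI[of _ x]) auto
   show ?thesis unfolding O by simp
  qed
 qed
 also have "\<dots> = (\<Sum>x\<in>A. \<Sum>y\<in>A. ennreal ((norm (x - y))\<^sup>2 / 4 * (1 / ?h)))"
 proof (subst nn_integral_sum, measurable, intro sum.cong refl, subst nn_integral_sum, measurable, intro sum.cong refl)
  fix x y assume xy: "x \<in> A" "y \<in> A"
  show "(\<integral>\<^sup>+c. ennreal (?u x y) * ?q c x y \<partial>PiM A ?g)
   = ennreal ((norm (x - y))\<^sup>2 / 4 * (1 / ?h))"
  proof (cases "x = y")
   case False
   note [measurable] = xy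
   have "(\<integral>\<^sup>+c. ennreal (?u x y) * ?q c x y \<partial>PiM A ?g)
    = ennreal (?u x y) * ennreal (1 / (real (card A) + 1))"
    unfolding nn_integral_orthant_pair[OF fA xy False, symmetric] by (rule nn_integral_cmult) measurable
   then show ?thesis unfolding A(2) by (subst ennreal_mult') auto
  qed simp
 qed
 also have "\<dots> = ennreal ?f"
  by (simp add: sum_ennreal sum_nonneg)
 also have "?f = (\<Sum>x\<in>A. \<Sum>y\<in>A. (norm (x - y))\<^sup>2) / (4 * ?h)"
  by (simp add: sum_divide_distrib)
 finally show ?thesis .
qed

text \<open>The pointwise expansion integrated over the orthant: exp (- s) gives 1, the correction
  gives Q, and exp (- s/4) gives 4^n.\<close>

lemma cone_estimate:
 defines "Q \<equiv> (\<Sum>x\<in>A. \<Sum>y\<in>A. (norm (x - y))\<^sup>2) / (4 * (real DIM('a) + 1))"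
  and "z \<equiv> 1 - 1 / (norm (plane_normal A))\<^sup>2"
  and "V \<equiv> fact DIM('a) * measure lborel (cball 0 1 \<inter> simplicial_cone A)"
 shows "V \<le> simplex_det A * (1 + Q + 18 * 4 ^ DIM('a) * z\<^sup>2)" and "simplex_det A * (1 + Q) \<le> V"
proof -
 have fA: "finite A" and A0: "A \<noteq> {}" using basis_span[OF A] by auto
 let ?s = "%c. \<Sum>x\<in>A. c x :: real" and ?b = "%c. norm (\<Sum>x\<in>A. c x *\<^sub>R x)"
 let ?O = "%c. (\<Prod>x\<in>A. indicator {0..} (c x)) :: ennreal"
 let ?M = "PiM A (%_. lborel :: real measure)"
 have [measurable]: "(%c. c z) \<in> borel_measurable ?M" if "z \<in> A" for z
  using measurable_component_singleton[OF that, of "%_. lborel"] by simp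
 have Q0: "Q \<ge> 0" unfolding Q_def by (intro divide_nonneg_nonneg sum_nonneg) auto
 have z0: "z \<ge> 0"
 proof -
  obtain x where x: "x \<in> A" using A0 by blast
  have "1 \<le> norm (plane_normal A) * norm x"
   using norm_cauchy_schwarz[of "plane_normal A" x] plane_normal_inner(1)[OF A x] by simp
  then have "1 \<le> norm (plane_normal A)" using unit[OF x] by simp
  from one_le_power[OF this, of 2] show ?thesis by (auto simp: z_def divide_le_eq)
 qed
 have e1: "(\<integral>\<^sup>+c. ennreal (exp (- ?s c)) * ?O c \<partial>?M) = 1"
  using nn_integral_orthant_exp[OF fA, of 1 "%_. 0"] by simp
 have e2: "(\<integral>\<^sup>+c. ennreal (exp (- (?s c / 4))) * ?O c \<partial>?M) = ennreal (4 ^ DIM('a))"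
  using nn_integral_orthant_exp[OF fA, of "1/4" "%_. 0"] by (simp add: A(2) power_divide)
 let ?q = "%c. ((?s c)\<^sup>2 - (?b c)\<^sup>2) * exp (- ?s c) / ?s c / 2"
 note e3 = orthant_distance_integral[folded Q_def]
 define k where "k = 18 * z\<^sup>2"
 have k: "k \<ge> 0" by (simp add: k_def)
 let ?g = "\<integral>\<^sup>+c. ennreal (exp (- ?b c)) * ?O c \<partial>?M"
 have V: "ennreal V = ennreal (simplex_det A) * ?g"
  unfolding V_def by (rule ball_cone_integral)
 let ?f = "%c. exp (- ?s c) + ?q c + k * exp (- (?s c / 4))"
 let ?r = "%c. exp (- ?s c) + ?q c"
 have bounds: "exp (- ?b c) \<le> ?f c" "?r c \<le> exp (- ?b c)" "?q c \<ge> 0"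
  if c: "\<forall>x\<in>A. c x \<ge> 0" for c
 proof -
  note cb = conic_combination_bounds[of c, OF bspec[OF c], folded z_def]
  have s0: "?s c \<ge> 0" using c by (intro sum_nonneg) auto
  show "?q c \<ge> 0"
   using s0 cb(2) by (intro divide_nonneg_nonneg mult_nonneg_nonneg) (auto intro!: power_mono)
  show "exp (- ?b c) \<le> ?f c" "?r c \<le> exp (- ?b c)"
  proof (atomize (full), cases "?s c = 0")
   case True
   then have b: "?b c = 0" using cb(2) by (intro antisym) auto
   show "exp (- ?b c) \<le> ?f c \<and> ?r c \<le> exp (- ?b c)"
    unfolding b True using k by simp
  next
   case False
   then show "exp (- ?b c) \<le> ?f c \<and> ?r c \<le> exp (- ?b c)"
    using exp_remainder_le[OF _ cb z0] s0 unfolding k_def by simp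
  qed
 qed
 have O: "?O c = 0 \<or> (\<forall>x\<in>A. c x \<ge> 0) \<and> ?O c = 1" for c :: "'a => real"
 proof (cases "\<forall>x\<in>A. c x \<ge> 0")
  case False
  then obtain x where "x \<in> A" "c x < 0" by force
  then have "?O c = 0" using fA by (intro prod_zero bexI[of _ x]) auto
  then show ?thesis by blast
 qed simp
 let ?h = "%z. 1 + Q + 18 * 4 ^ DIM('a) * z\<^sup>2"
 have "?g \<le> (\<integral>\<^sup>+c. ennreal (exp (- ?s c)) * ?O c + ennreal (?q c) * ?O c + ennreal k * (ennreal (exp (- (?s c / 4))) * ?O c) \<partial>?M)"
 proof (rule nn_integral_mono)
  fix c :: "'a => real"
  from O[of c] show "ennreal (exp (- ?b c)) * ?O c \<le> ennreal (exp (- ?s c)) * ?O c + ennreal (?q c) * ?O c + ennreal k * (ennreal (exp (- (?s c / 4))) * ?O c)"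
  proof
   assume c: "(\<forall>x\<in>A. c x \<ge> 0) \<and> ?O c = 1"
   have "ennreal (exp (- ?b c)) \<le> ennreal (?f c)"
    using bounds[of c] c by (intro ennreal_leI) blast
   also have "\<dots> = ennreal (exp (- ?s c)) + ennreal (?q c) + ennreal k * ennreal (exp (- (?s c / 4)))"
   proof -
    have "ennreal (a + q + k * e) = ennreal a + ennreal q + ennreal k * ennreal e" if "a \<ge> 0" "q \<ge> 0" "e \<ge> 0" for a q e
     using that k by (simp add: ennreal_plus ennreal_mult)
    then show ?thesis using bounds(3)[of c] c by simp
   qed
   finally show ?thesis using c by (simp only: mult_1_right)
  next
   assume O0: "?O c = 0"
   show ?thesis unfolding O0 by simp
  qed
 qed
 also have "\<dots> = 1 + ennreal Q + ennreal k * ennreal (4 ^ DIM('a))"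
  by (subst nn_integral_add, measurable, subst nn_integral_add, measurable, subst nn_integral_cmult, measurable) (simp only: e1 e2 e3)
 also have "\<dots> = ennreal (?h z)"
  using Q0 k by (simp add: k_def ennreal_mult'[symmetric] ennreal_plus[symmetric] mult_ac del: ennreal_plus flip: ennreal_1)
 finally have "ennreal V \<le> ennreal (simplex_det A) * ennreal (?h z)"
  unfolding V by (rule mult_left_mono) simp
 also have "\<dots> = ennreal (simplex_det A * ?h z)"
  by (rule ennreal_mult'[symmetric]) (rule simplex_det_nonneg)
 finally show "V \<le> simplex_det A * ?h z"
  using Q0 by (subst (asm) ennreal_le_iff) (auto intro!: mult_nonneg_nonneg simplex_det_nonneg add_nonneg_nonneg)
 let ?p = "ennreal (simplex_det A) * (1 + ennreal Q)"
 have "1 + ennreal Q = (\<integral>\<^sup>+c. ennreal (exp (- ?s c)) * ?O c + ennreal (?q c) * ?O c \<partial>?M)"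
  by (subst nn_integral_add, measurable) (simp only: e1 e3)
 also have "\<dots> \<le> ?g"
 proof (rule nn_integral_mono)
  fix c :: "'a => real"
  from O[of c] show "ennreal (exp (- ?s c)) * ?O c + ennreal (?q c) * ?O c \<le> ennreal (exp (- ?b c)) * ?O c"
  proof
   assume c: "(\<forall>x\<in>A. c x \<ge> 0) \<and> ?O c = 1"
   have "ennreal (exp (- ?s c)) + ennreal (?q c) = ennreal (?r c)"
   proof -
    have "ennreal a + ennreal q = ennreal (a + q)" if "a \<ge> 0" "q \<ge> 0" for a q
     using that by (simp add: ennreal_plus)
    then show ?thesis using bounds(3)[of c] c by simp
   qed
   also have "\<dots> \<le> ennreal (exp (- ?b c))"
    using bounds[of c] c by (intro ennreal_leI) blast
   finally show ?thesis using c by (simp only: mult_1_right)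
  next
   assume O0: "?O c = 0"
   show ?thesis unfolding O0 by simp
  qed
 qed
 finally have "?p \<le> ennreal V"
  unfolding V by (rule mult_left_mono) simp
 also have "?p = ennreal (simplex_det A * (1 + Q))"
  using Q0 simplex_det_nonneg[of A] by (simp add: ennreal_mult' ennreal_plus)
 finally show "simplex_det A * (1 + Q) \<le> V"
  by (subst (asm) ennreal_le_iff) (auto simp: V_def)
qed

end

text \<open>For z = 1 - 1/r^2 the power is r^p. Normals of length r between 1 and 2 keep z between 0
  and 3/4, where the second derivative is bounded.\<close>

lemma powr_second_order:
 fixes p :: real
 shows "\<exists>C\<ge>0. \<forall>z\<in>{0..3/4}. \<bar>(1 - z) powr (- p / 2) - (1 + p / 2 * z)\<bar> \<le> C * z\<^sup>2"
proof -
 define D where "D t = (p / 2) * (p / 2 + 1) * (1 - t) powr (- p / 2 - 2)" for t :: real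
 have "continuous_on {0..3/4} D" unfolding D_def by (intro continuous_intros) auto
 then have "bounded (D ` {0..3/4})" by (intro compact_imp_bounded compact_continuous_image) auto
 then obtain B where B: "B > 0" "\<And>t. t \<in> {0..3/4} ==> \<bar>D t\<bar> \<le> B" unfolding bounded_pos by auto
 let ?f = "%t. p / 2 * (1 - t) powr (- p / 2 - 1)"
 show ?thesis
 proof (intro exI[of _ "B"] conjI ballI)
  fix z :: real assume z: "z \<in> {0..3/4}"
  show "\<bar>(1 - z) powr (- p / 2) - (1 + p / 2 * z)\<bar> \<le> B * z\<^sup>2"
  proof (cases "z = 0")
   case False
   then have z0: "z > 0" using z by simp
   define f where "f m = (if m = 0 then (%t. (1 - t) powr (- p / 2)) else if m = 1 then ?f else D)" for m :: nat
   have "\<exists>t>0. t \<le> z \<and> f 0 z = (\<Sum>m<2. f m 0 / fact m * z ^ m) + f 2 t / fact 2 * z ^ 2"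
   proof (rule Maclaurin2[OF z0 refl], intro allI impI)
    fix m t assume mt: "m < (2::nat) \<and> 0 \<le> t \<and> t \<le> z"
    then have t: "1 - t > 0" using z by auto
    consider "m = 0" | "m = 1" using mt by linarith
    then show "(f m has_real_derivative f (Suc m) t) (at t)"
    proof cases
     case 1
     then show ?thesis unfolding f_def using t by (auto intro!: derivative_eq_intros)
    next
     case 2
     have "(?f has_real_derivative D t) (at t)"
      unfolding D_def using t by (auto intro!: derivative_eq_intros simp: algebra_simps)
     then show ?thesis using 2 by (simp add: f_def)
    qed
   qed
   then obtain t where t: "0 < t" "t \<le> z" "f 0 z = (\<Sum>m<2. f m 0 / fact m * z ^ m) + f 2 t / fact 2 * z ^ 2" by blast
   then have "(1 - z) powr (- p / 2) - (1 + p / 2 * z) = D t / 2 * z\<^sup>2"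
    by (simp add: f_def numeral_2_eq_2)
   also have "\<bar>\<dots>\<bar> = \<bar>D t\<bar> / 2 * z\<^sup>2" by (simp add: abs_mult)
   also have "\<dots> \<le> B * z\<^sup>2"
   proof -
    have "\<bar>D t\<bar> \<le> B" using t z by (intro B) auto
    then have "\<bar>D t\<bar> / 2 \<le> B" using B(1) by linarith
    then show ?thesis by (rule mult_right_mono) simp
   qed
   finally show ?thesis .
  qed simp
 qed (use B in simp)
qed

section \<open>Pyramids and facet volumes\<close>

text \<open>Translation invariance leaves an unknown constant. The Gaussian exp (- |x|^2) integrates
  to the same power of sqrt pi in every orthonormal system, so the constant is 1.\<close>

lemma orthonormal_coordinates_nn_integral:
 fixes B :: "'a::euclidean_space set"
 assumes B: "pairwise orthogonal B" "\<And>b. b \<in> B ==> norm b = 1" "card B = DIM('a)"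
  and F: "F \<in> borel_measurable borel"
 shows "(\<integral>\<^sup>+c. F (\<Sum>b\<in>B. c b *\<^sub>R b) \<partial>PiM B (%_. lborel)) = (\<integral>\<^sup>+x. F x \<partial>lborel)"
proof -
 interpret product_sigma_finite "%_::'a. lborel :: real measure" ..
 define g where "g = (\<integral>\<^sup>+t. ennreal (exp (- t\<^sup>2)) \<partial>(lborel :: real measure))"
 have "has_bochner_integral lborel (%t::real. exp (- t\<^sup>2)) (sqrt pi)"
  using has_bochner_integral_even_function[OF gaussian_moment_0] by simp
 then have g: "g = ennreal (sqrt pi)"
  unfolding g_def by (simp add: has_bochner_integral_iff nn_integral_eq_integral)
 let ?g = "%_. lborel"
 let ?h = "%C c. norm (\<Sum>b\<in>C. c b *\<^sub>R b)"
 let ?f = "%C. \<integral>\<^sup>+c. ennreal (exp (- (?h C c)\<^sup>2)) \<partial>PiM C ?g"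
 have gauss: "?f C = g ^ card C"
  if C: "pairwise orthogonal C" "\<And>b. b \<in> C ==> norm b = 1" "finite C" for C :: "'a set"
 proof -
  have "?f C
   = (\<integral>\<^sup>+c. (\<Prod>b\<in>C. ennreal (exp (- (c b)\<^sup>2))) \<partial>PiM C ?g)"
  proof (rule nn_integral_cong)
   fix c :: "'a => real"
   have "(?h C c)\<^sup>2 = (\<Sum>b\<in>C. (norm (c b *\<^sub>R b))\<^sup>2)"
    using C by (intro norm_sum_Pythagorean) (auto simp: pairwise_def orthogonal_def)
   also have "\<dots> = (\<Sum>b\<in>C. (c b)\<^sup>2)" using C(2) by (intro sum.cong) (auto simp: power_mult_distrib)
   finally show "ennreal (exp (- (?h C c)\<^sup>2)) = (\<Prod>b\<in>C. ennreal (exp (- (c b)\<^sup>2)))"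
    using C(3) by (simp add: prod_ennreal exp_sum flip: sum_negf)
  qed
  also have "\<dots> = (\<Prod>b\<in>C. g)" unfolding g_def using C(3) by (intro product_nn_integral_prod) auto
  finally show ?thesis by simp
 qed
 have fB: "finite B" using B(3) DIM_positive[where 'a='a] by (metis card.infinite less_irrefl)
 have "independent B" using B(1) B(2)[of 0] by (intro pairwise_orthogonal_independent) auto
 from basis_coordinates_nn_integral[OF this B(3)] obtain K
  where K: "\<And>F. F \<in> borel_measurable borel ==> (\<integral>\<^sup>+c. F (\<Sum>b\<in>B. c b *\<^sub>R b) \<partial>PiM B ?g) = K * (\<integral>\<^sup>+x. F x \<partial>lborel)" by blast
 have Basis: "(\<integral>\<^sup>+x. G x \<partial>lborel) = (\<integral>\<^sup>+c. G (\<Sum>b\<in>Basis. c b *\<^sub>R b) \<partial>PiM (Basis :: 'a set) ?g)" if "G \<in> borel_measurable borel" for G :: "'a => ennreal"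
  using that by (subst lborel_eq) (simp add: nn_integral_distr)
 have "(\<integral>\<^sup>+x. ennreal (exp (- (norm x)\<^sup>2)) \<partial>(lborel :: 'a measure)) = g ^ DIM('a)"
  by (subst Basis) (auto intro!: gauss simp: pairwise_def orthogonal_def inner_not_same_Basis)
 then have "g ^ DIM('a) = K * g ^ DIM('a)"
  using K[of "%x. ennreal (exp (- (norm x)\<^sup>2))"] gauss[OF B(1,2) fB] B(3) by simp
 moreover have "g ^ DIM('a) * inverse (g ^ DIM('a)) = 1"
  by (simp add: g ennreal_power inverse_ennreal flip: ennreal_mult')
 ultimately have "K = 1" by (metis mult.assoc mult_1_right)
 then show ?thesis using K[OF F] by simp
qed

lemma direction_basis:
 fixes A :: "'a::euclidean_space set"
 shows "pairwise orthogonal (direction_basis A)" "\<And>b. b \<in> direction_basis A ==> norm b = 1"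
  "span (direction_basis A) = span {x - y | x y. x \<in> A \<and> y \<in> A}"
proof -
 let ?S = "span {x - y | x y. x \<in> A \<and> y \<in> A}"
 have "subspace ?S" by (rule subspace_span)
 then have "\<exists>B. pairwise orthogonal B \<and> (\<forall>b\<in>B. norm b = 1) \<and> span B = ?S"
  by (rule orthonormal_basis_subspace) blast
 from someI_ex[OF this]
 show "pairwise orthogonal (direction_basis A)" "\<And>b. b \<in> direction_basis A ==> norm b = 1" "span (direction_basis A) = ?S"
  unfolding direction_basis_def by blast+
qed

text \<open>The integral formula is stated for every unit normal u, because the pyramid computation
  orients the normal towards its apex.\<close>

lemma hyperplane_coordinates:
 fixes A :: "'a::euclidean_space set"
 assumes A: "affine A" "aff_dim A = int DIM('a) - 1"
 defines "B \<equiv> direction_basis A" and "a0 \<equiv> SOME a. a \<in> A"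
 obtains u where "norm u = 1" "\<And>b. b \<in> B ==> u \<bullet> b = 0" "finite B" "card B = DIM('a) - 1"
  "A = {z. u \<bullet> z = u \<bullet> a0}" "a0 \<in> A" "\<And>z. z \<in> A ==> \<exists>e. z = a0 + (\<Sum>b\<in>B. e b *\<^sub>R b)"
  "\<And>u F. norm u = 1 ==> (\<And>b. b \<in> B ==> u \<bullet> b = 0) ==> F \<in> borel_measurable borel ==> (\<integral>\<^sup>+x. F x \<partial>lborel) = (\<integral>\<^sup>+t. (\<integral>\<^sup>+c. F (a0 + (\<Sum>b\<in>B. c b *\<^sub>R b) + t *\<^sub>R u) \<partial>PiM B (%_. lborel)) \<partial>lborel)"
proof -
 note B = direction_basis[where A=A, folded B_def]
 have "A \<noteq> {}" using A(2) DIM_positive[where 'a='a] by force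
 then have a0: "a0 \<in> A" unfolding a0_def by (simp add: some_in_eq)
 have indB: "independent B" using B(1) B(2)[of 0] by (intro pairwise_orthogonal_independent) auto
 then have fB: "finite B" by (rule independent_imp_finite)
 let ?f = "(%x. x - a0) ` A"
 have diffs: "{x - y | x y. x \<in> A \<and> y \<in> A} = ?f"
 proof (intro equalityI subsetI)
  fix w assume "w \<in> {x - y | x y. x \<in> A \<and> y \<in> A}"
  then obtain x y where xy: "x \<in> A" "y \<in> A" "w = x - y" by blast
  have "a0 + (x - y) \<in> A"
   using mem_affine_3_minus[OF A(1) a0 xy(1,2), of 1] by (simp add: algebra_simps)
  then show "w \<in> (%x. x - a0) ` A" using xy by (intro image_eqI[of _ _ "a0 + (x - y)"]) auto
 qed (use a0 in blast)
 have sub: "subspace ?f"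
  using affine_diffs_subspace[OF A(1) a0] by (simp add: image_comp algebra_simps)
 have spanB: "span B = ?f" unfolding B(3) diffs using sub by (simp add: span_eq_iff)
 have dimB: "card B = DIM('a) - 1"
 proof -
  have "int (dim ?f) = aff_dim A"
   using aff_dim_dim_affine_diffs[OF A(1) a0] by simp
  then have "dim (span B) = DIM('a) - 1" using A(2) unfolding spanB by linarith
  then show ?thesis using dim_span_eq_card_independent[OF indB] by simp
 qed
 have "dim (span B) < DIM('a)" using dimB dim_span_eq_card_independent[OF indB] DIM_positive[where 'a='a] by linarith
 then obtain v where v: "v \<noteq> 0" "\<And>y. y \<in> span B ==> orthogonal v y"
  using orthogonal_to_subspace_exists[of B] by (metis dim_span)
 define u where "u = v /\<^sub>R norm v"
 have u1: "norm u = 1" using v by (simp add: u_def)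
 have uB: "u \<bullet> b = 0" if "b \<in> span B" for b using v(2)[OF that] by (simp add: u_def orthogonal_def)
 have uB': "u \<bullet> b = 0" if "b \<in> B" for b using uB span_base that by blast
 have AH: "A = {z. u \<bullet> z = u \<bullet> a0}"
 proof -
  have "A \<subseteq> {z. u \<bullet> z = u \<bullet> a0}"
  proof
   fix z assume "z \<in> A"
   then have "z - a0 \<in> span B" unfolding spanB by blast
   from uB[OF this] show "z \<in> {z. u \<bullet> z = u \<bullet> a0}" by (simp add: inner_diff_right)
  qed
  moreover have "aff_dim {z. u \<bullet> z = u \<bullet> a0} = int DIM('a) - 1" using u1 by (subst aff_dim_hyperplane) auto
  ultimately show ?thesis
   using A \<open>A \<noteq> {}\<close> by (intro affine_dim_equal) (auto simp: affine_hyperplane)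
 qed
 let ?g = "%_. lborel"
 have coords: "(\<integral>\<^sup>+x. F x \<partial>lborel) = (\<integral>\<^sup>+t. (\<integral>\<^sup>+c. F (a0 + (\<Sum>b\<in>B. c b *\<^sub>R b) + t *\<^sub>R u) \<partial>PiM B ?g) \<partial>lborel)"
  if u1: "norm u = 1" and uB': "\<And>b. b \<in> B ==> u \<bullet> b = 0" and [measurable]: "F \<in> borel_measurable borel" for u F
 proof -
  have uN: "u \<notin> B" using uB' u1 by (metis norm_eq_zero inner_eq_zero_iff zero_neq_one)
  interpret product_sigma_finite "%_::'a. lborel :: real measure" ..
  let ?C = "insert u B"
  have "(\<integral>\<^sup>+x. F x \<partial>lborel) = (\<integral>\<^sup>+x. F (x + a0) \<partial>lborel)" by (rule nn_integral_lborel_shift[symmetric]) fact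
  also have "\<dots> = (\<integral>\<^sup>+c. F ((\<Sum>b\<in>?C. c b *\<^sub>R b) + a0) \<partial>PiM ?C ?g)"
  proof (rule orthonormal_coordinates_nn_integral[symmetric])
   show "pairwise orthogonal ?C" using B(1) uB' by (auto simp: pairwise_insert orthogonal_def inner_commute)
   show "card ?C = DIM('a)" using fB uN dimB DIM_positive[where 'a='a] by simp
  qed (use u1 B in auto)
  also have "\<dots> = (\<integral>\<^sup>+t. (\<integral>\<^sup>+c. F ((\<Sum>b\<in>?C. (c(u := t)) b *\<^sub>R b) + a0) \<partial>PiM B ?g) \<partial>lborel)"
  proof (rule product_nn_integral_insert_rev[OF fB uN])
   have "finite ?C" using fB by simp
   then show "(%c. F ((\<Sum>b\<in>?C. c b *\<^sub>R b) + a0)) \<in> borel_measurable (PiM ?C ?g)" by measurable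
  qed
  also have "\<dots> = (\<integral>\<^sup>+t. (\<integral>\<^sup>+c. F (a0 + (\<Sum>b\<in>B. c b *\<^sub>R b) + t *\<^sub>R u) \<partial>PiM B ?g) \<partial>lborel)"
  proof -
   have "(\<Sum>b\<in>?C. (c(u := t)) b *\<^sub>R b) + a0 = a0 + (\<Sum>b\<in>B. c b *\<^sub>R b) + t *\<^sub>R u" for c t
   proof -
    have "(\<Sum>b\<in>B. (c(u := t)) b *\<^sub>R b) = (\<Sum>b\<in>B. c b *\<^sub>R b)" using uN by (intro sum.cong) auto
    then show ?thesis using fB uN by simp
   qed
   then show ?thesis by (simp only:)
  qed
  finally show ?thesis .
 qed
 have coeffs: "\<exists>e. z = a0 + (\<Sum>b\<in>B. e b *\<^sub>R b)" if "z \<in> A" for z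
 proof -
  have "z - a0 \<in> span B" unfolding spanB using that by blast
  then obtain e where "z - a0 = (\<Sum>b\<in>B. e b *\<^sub>R b)" using span_finite[OF fB] by auto
  then show ?thesis by (intro exI[of _ e]) (simp add: algebra_simps)
 qed
 show thesis by (rule that[OF u1 uB' fB dimB AH a0 coeffs coords])
qed

lemma nn_integral_PiM_affine:
 fixes B :: "'i set" and e :: "'i => real"
 assumes B: "finite B" and \<mu>: "\<mu> > 0" and G: "G \<in> borel_measurable (PiM B (%_. lborel :: real measure))"
 shows "(\<integral>\<^sup>+c. G c \<partial>PiM B (%_. lborel)) = ennreal (\<mu> ^ card B) * (\<integral>\<^sup>+c. G (\<lambda>b\<in>B. \<mu> * c b + e b) \<partial>PiM B (%_. lborel))"
proof -
 have p: "product_sigma_finite (%_::'i. lborel :: real measure)" ..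
 let ?f = "%_. lborel"
 have m: "(%c. \<lambda>b\<in>B. \<mu> * c b + e b) \<in> measurable (PiM B (%_. lborel :: real measure)) (PiM B ?f)"
  by measurable
 let ?g = "%g b. \<integral>\<^sup>+t. ennreal \<mu> * g (\<mu> * t + e b) \<partial>lborel"
 have "(\<integral>\<^sup>+c. G c \<partial>PiM B ?f) = (\<integral>\<^sup>+c. (\<Prod>b\<in>B. ennreal \<mu>) * G (\<lambda>b\<in>B. \<mu> * c b + e b) \<partial>PiM B ?f)"
 proof (rule PiM_change_of_variables[OF p p B _ _ _ G, where w="%_ _. ennreal \<mu>" and \<phi>="%b t. \<mu> * t + e b"])
  fix b and g :: "real => ennreal" assume "g \<in> borel_measurable lborel"
  then have g [measurable]: "g \<in> borel_measurable borel" by simp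
  have "(\<integral>\<^sup>+t. g t \<partial>lborel) = (\<integral>\<^sup>+t. g (t + e b) \<partial>lborel)" by (rule nn_integral_lborel_shift[symmetric]) (rule g)
  also have "\<dots> = ennreal (\<mu> ^ DIM(real)) * (\<integral>\<^sup>+t. g (\<mu> *\<^sub>R t + e b) \<partial>lborel)"
   by (rule nn_integral_lborel_scale[OF _ \<mu>]) measurable
  also have "\<dots> = ?g g b" by (subst nn_integral_cmult) auto
  finally show "(\<integral>\<^sup>+t. g t \<partial>lborel) = ?g g b" .
 qed auto
 also have "\<dots> = ennreal (\<mu> ^ card B) * (\<integral>\<^sup>+c. G (\<lambda>b\<in>B. \<mu> * c b + e b) \<partial>PiM B ?f)"
  using \<mu> measurable_compose[OF m G] by (subst nn_integral_cmult) (auto simp: ennreal_power)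
 finally show ?thesis .
qed

lemma nn_integral_height_power:
 assumes \<tau>: "\<tau> > 0" and k: "k + 1 = n"
 shows "(\<integral>\<^sup>+t. ennreal ((1 - t / \<tau>) ^ k) * indicator {0..\<tau>} t \<partial>lborel) = ennreal (\<tau> / n)"
proof -
 let ?f = "%t. 1 - t / \<tau>"
 have "(\<integral>\<^sup>+t. ennreal (?f t ^ k) * indicator {0..\<tau>} t \<partial>lborel) = ennreal (- \<tau> / n * (1 - \<tau> / \<tau>) ^ n - (- \<tau> / n * (1 - 0 / \<tau>) ^ n))"
 proof (rule nn_integral_FTC_Icc[where F="%t. - \<tau> / n * ?f t ^ n"])
  fix t assume t: "t \<in> {0..\<tau>}"
  have "((%t. - \<tau> / n * ?f t ^ n) has_real_derivative - \<tau> / n * (real n * (- (1 / \<tau>) * ?f t ^ (n - Suc 0)))) (at t)"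
   using \<tau> by (intro DERIV_cmult DERIV_power) (auto intro!: derivative_eq_intros)
  moreover have "- \<tau> / n * (real n * (- (1 / \<tau>) * ?f t ^ (n - Suc 0))) = ?f t ^ k"
   using \<tau> k by (auto simp: field_simps)
  ultimately show "((%t. - \<tau> / n * ?f t ^ n) has_real_derivative (?f t) ^ k) (at t)"
   by simp
 qed (use \<tau> in \<open>auto intro!: zero_le_power simp: divide_le_eq\<close>)
 then show ?thesis using \<tau> k by (auto simp: zero_power)
qed

lemma convex_hull_insert_apex:
 assumes "convex F" "F \<noteq> {}"
 shows "convex hull (insert q F) = {(1 - l) *\<^sub>R f + l *\<^sub>R q | f l. f \<in> F \<and> 0 \<le> l \<and> l \<le> 1}"
proof (intro equalityI subsetI)
 have F: "convex hull F = F" using assms(1) by (rule hull_same)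
 fix x assume "x \<in> convex hull (insert q F)"
 then obtain u v b where "0 \<le> u" "0 \<le> v" "b \<in> F" "u + v = 1" "x = u *\<^sub>R q + v *\<^sub>R b"
  unfolding convex_hull_insert[OF assms(2)] F by blast
 moreover from this have "v = 1 - u" by simp
 ultimately show "x \<in> {(1 - l) *\<^sub>R f + l *\<^sub>R q | f l. f \<in> F \<and> 0 \<le> l \<and> l \<le> 1}"
  by (intro CollectI exI[of _ b] exI[of _ u]) (simp add: add.commute)
next
 fix x assume "x \<in> {(1 - l) *\<^sub>R f + l *\<^sub>R q | f l. f \<in> F \<and> 0 \<le> l \<and> l \<le> 1}"
 then obtain f l where "x = (1 - l) *\<^sub>R f + l *\<^sub>R q" "f \<in> F" "0 \<le> l" "l \<le> 1" by blast
 moreover from this have "f \<in> convex hull (insert q F)" "q \<in> convex hull (insert q F)" by (simp_all add: hull_inc)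
 ultimately show "x \<in> convex hull (insert q F)"
  using convexD[OF convex_convex_hull, of f "insert q F" q "1 - l" l] by simp
qed

text \<open>The slice at height t is a copy of F shrunk by 1 - t/\<tau> towards the foot of the
  apex, so its measure scales with the power n - 1 of that factor.\<close>

lemma pyramid_emeasure:
 fixes F :: "'a::euclidean_space set"
 assumes F: "compact F" "convex F" "aff_dim F = int DIM('a) - 1" and q: "infdist q (affine hull F) > 0"
 shows "emeasure lborel (convex hull (insert q F)) = ennreal (infdist q (affine hull F) / DIM('a)) * emeasure (affine_lborel (affine hull F)) F"
proof -
 let ?A = "affine hull F"
 define B where "B = direction_basis ?A"
 define a0 where "a0 = (SOME a. a \<in> ?A)"
 have A: "affine ?A" "aff_dim ?A = int DIM('a) - 1" using F by (simp_all add: affine_affine_hull)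
 have F0: "F \<noteq> {}" using F(3) DIM_positive[where 'a='a] by force
 let ?h = "%e. \<Sum>b\<in>B. e b *\<^sub>R b"
 let ?p = "%_. lborel"
 obtain u0 where u0: "norm u0 = 1" "\<And>b. b \<in> B ==> u0 \<bullet> b = 0" and fB: "finite B" and cB: "card B = DIM('a) - 1"
  and AH: "?A = {z. u0 \<bullet> z = u0 \<bullet> a0}" and a0: "a0 \<in> ?A"
  and coeffs: "\<And>z. z \<in> ?A ==> \<exists>e. z = a0 + ?h e"
  and coords: "\<And>u G. norm u = 1 ==> (\<And>b. b \<in> B ==> u \<bullet> b = 0) ==> G \<in> borel_measurable borel ==> (\<integral>\<^sup>+x. G x \<partial>lborel) = (\<integral>\<^sup>+t. (\<integral>\<^sup>+c. G (a0 + (\<Sum>b\<in>B. c b *\<^sub>R b) + t *\<^sub>R u) \<partial>PiM B ?p) \<partial>lborel)"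
  using hyperplane_coordinates[OF A, folded B_def a0_def] by blast
 define \<tau> where "\<tau> = \<bar>u0 \<bullet> (q - a0)\<bar>"
 define u where "u = sgn (u0 \<bullet> (q - a0)) *\<^sub>R u0"
 have dist: "infdist q ?A = \<tau>"
  unfolding AH \<tau>_def using u0(1) by (subst infdist_hyperplane) (auto simp: inner_diff_right)
 have \<tau>: "\<tau> > 0" using q unfolding dist .
 then have s: "u0 \<bullet> (q - a0) \<noteq> 0" by (auto simp: \<tau>_def)
 have u1: "norm u = 1" using s u0(1) by (simp add: u_def abs_sgn_eq)
 have uB: "u \<bullet> b = 0" if "b \<in> B" for b using u0(2)[OF that] by (simp add: u_def)
 have uA: "u \<bullet> z = u \<bullet> a0" if "z \<in> ?A" for z
 proof -
  have "u0 \<bullet> z = u0 \<bullet> a0" using that AH by blast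
  then show ?thesis by (simp add: u_def)
 qed
 have uq: "u \<bullet> q = u \<bullet> a0 + \<tau>"
 proof -
  have "u \<bullet> (q - a0) = \<tau>"
   unfolding u_def \<tau>_def inner_scaleR_left by (subst abs_sgn) (rule mult.commute)
  then show ?thesis by (simp add: inner_diff_right)
 qed
 have uu: "u \<bullet> u = 1" using u1 by (simp add: dot_square_norm)
 have "q - \<tau> *\<^sub>R u \<in> ?A"
 proof -
  have "u \<bullet> (q - \<tau> *\<^sub>R u) = u \<bullet> a0" by (simp add: inner_diff_right uq uu)
  then show ?thesis using s unfolding AH u_def by (simp add: sgn_zero_iff)
 qed
 \<comment> \<open>The coordinates of the foot of the perpendicular from the apex.\<close>
 then obtain e where e: "q - \<tau> *\<^sub>R u = a0 + ?h e" using coeffs by blast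
 define pyr where "pyr = convex hull (insert q F)"
 have pyr: "pyr = {(1 - l) *\<^sub>R f + l *\<^sub>R q | f l. f \<in> F \<and> 0 \<le> l \<and> l \<le> 1}"
  unfolding pyr_def by (rule convex_hull_insert_apex[OF F(2) F0])
 have "compact pyr" unfolding pyr_def using F(1) by (intro compact_convex_hull compact_insert)
 then have pm [measurable]: "pyr \<in> sets borel" by (intro borel_closed compact_imp_closed)
 have Fm [measurable]: "F \<in> sets borel" using F(1) by (intro borel_closed compact_imp_closed)
 let ?z = "%c. a0 + (\<Sum>b\<in>B. c b *\<^sub>R b)"
 have zA: "?z c \<in> ?A" for c
  unfolding AH by (simp add: inner_add_right inner_sum_right u0(2))
 have zm [measurable]: "?z \<in> borel_measurable (PiM B ?p)" using fB by measurable
 let ?r = "%l. u \<bullet> a0 + l * \<tau>"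
 have height: "(1 - l) * (u \<bullet> f) + l * (u \<bullet> q) = ?r l" if "f \<in> F" for f l
  using uA[of f] hull_inc[OF that] uq by (simp add: algebra_simps)
 define m where "m = (\<integral>\<^sup>+c. indicator F (?z c) \<partial>PiM B ?p)"
 have m: "m = emeasure (affine_lborel ?A) F"
 proof -
  have "emeasure (affine_lborel ?A) F = (\<integral>\<^sup>+x. indicator F x \<partial>affine_lborel ?A)"
   by (rule nn_integral_indicator[symmetric]) (simp add: affine_lborel_def)
  also have "\<dots> = m"
   unfolding affine_lborel_def B_def[symmetric] a0_def[symmetric] m_def by (subst nn_integral_distr) auto
  finally show ?thesis by simp
 qed
 let ?f = "%t. \<integral>\<^sup>+c. indicator pyr (?z c + t *\<^sub>R u) \<partial>PiM B ?p"
 let ?g = "%l c e t. ?z (\<lambda>b\<in>B. (1 - l) * c b + l * e b) + t *\<^sub>R u"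
 let ?q = "%l' f. (1 - l') *\<^sub>R f + l' *\<^sub>R q"
 let ?u = "%l c. (1 - l) *\<^sub>R ?z c + l *\<^sub>R q"
 have slice: "?f t = ennreal ((1 - t / \<tau>) ^ (DIM('a) - 1)) * m"
  if t: "0 \<le> t" "t < \<tau>" for t
 proof -
  define l where "l = t / \<tau>"
  have l: "0 \<le> l" "l < 1" "t = l * \<tau>" using t \<tau> by (auto simp: l_def)
  have "(%c. indicator pyr (?z c + t *\<^sub>R u) :: ennreal) \<in> borel_measurable (PiM B ?p)" by measurable
  from nn_integral_PiM_affine[OF fB _ this, of "1 - l" "%b. l * e b"] l
  have "?f t
   = ennreal ((1 - l) ^ card B) * (\<integral>\<^sup>+c. indicator pyr (?g l c e t) \<partial>PiM B ?p)"
   by simp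
  also have "(\<integral>\<^sup>+c. indicator pyr (?g l c e t) \<partial>PiM B ?p) = m"
   unfolding m_def
  proof (rule nn_integral_cong)
   fix c
   have x: "?g l c e t = ?u l c"
   proof -
    have "?z (\<lambda>b\<in>B. (1 - l) * c b + l * e b) = a0 + ((1 - l) *\<^sub>R (\<Sum>b\<in>B. c b *\<^sub>R b) + l *\<^sub>R (?h e))"
     by (simp add: scaleR_add_left sum.distrib scaleR_sum_right)
    moreover have "?h e = q - \<tau> *\<^sub>R u - a0" using e by (simp add: algebra_simps)
    ultimately show ?thesis by (simp add: l(3) algebra_simps)
   qed
   have "(1 - l) *\<^sub>R ?z c + l *\<^sub>R q \<in> pyr \<longleftrightarrow> ?z c \<in> F"
   proof
    assume "?z c \<in> F"
    then show "(1 - l) *\<^sub>R ?z c + l *\<^sub>R q \<in> pyr" unfolding pyr using l by (intro CollectI exI[of _ "?z c"] exI[of _ l]) auto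
   next
    assume "(1 - l) *\<^sub>R ?z c + l *\<^sub>R q \<in> pyr"
    then obtain f l' where f: "?u l c = ?q l' f" "f \<in> F" unfolding pyr by blast
    have "u \<bullet> ?u l c = ?r l"
     using uA[OF zA[of c]] uq by (simp only: inner_add_right[of u "_ *\<^sub>R _"] inner_scaleR_right) (simp add: algebra_simps)
    moreover have "u \<bullet> ?q l' f = ?r l'"
     using height[OF f(2), of l'] by (simp only: inner_add_right inner_scaleR_right)
    ultimately have "l * \<tau> = l' * \<tau>" unfolding f(1) by linarith
    then have "l' = l" using \<tau> by simp
    then have "(1 - l) *\<^sub>R ?z c = (1 - l) *\<^sub>R f" using f(1) by (simp only: add_right_cancel)
    then show "?z c \<in> F" using l f(2) by (simp only: scaleR_cancel_left) simp
   qed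
   then show "indicator pyr (?g l c e t) = (indicator F (?z c) :: ennreal)"
    unfolding x by (simp only: indicator_def)
  qed
  finally show ?thesis unfolding cB l_def .
 qed
 have outside: "?f t = 0" if t: "\<not> (0 \<le> t \<and> t \<le> \<tau>)" for t
 proof -
  have "?z c + t *\<^sub>R u \<notin> pyr" for c
  proof
   assume "?z c + t *\<^sub>R u \<in> pyr"
   then obtain f l where f: "?z c + t *\<^sub>R u = ?q l f" "f \<in> F" "0 \<le> l" "l \<le> 1" unfolding pyr by blast
   have "u \<bullet> (?z c + t *\<^sub>R u) = u \<bullet> a0 + t"
    using uA[OF zA[of c]] uu by (simp only: inner_add_right[of u "_ + _"] inner_scaleR_right mult_1_right)
   moreover have "u \<bullet> ?q l f = ?r l"
    using height[OF f(2), of l] by (simp only: inner_add_right inner_scaleR_right)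
   ultimately have "t = l * \<tau>" unfolding f(1) by linarith
   then show False using t f(3,4) \<tau> by (simp add: mult_left_le_one_le)
  qed
  then show ?thesis by simp
 qed
 have "emeasure lborel pyr = (\<integral>\<^sup>+x. indicator pyr x \<partial>lborel)" by simp
 also have "\<dots> = (\<integral>\<^sup>+t. ?f t \<partial>lborel)"
  by (rule coords[OF u1 uB]) measurable
 also have "\<dots> = (\<integral>\<^sup>+t. ennreal ((1 - t / \<tau>) ^ (DIM('a) - 1)) * indicator {0..\<tau>} t * m \<partial>lborel)"
 proof (rule nn_integral_cong_AE)
  show "AE t in lborel. ?f t = ennreal ((1 - t / \<tau>) ^ (DIM('a) - 1)) * indicator {0..\<tau>} t * m"
   \<comment> \<open>At t = \<tau> the slice shrinks to the apex and the rescaling degenerates; this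
     single height is a null set.\<close>
   using AE_lborel_singleton[of \<tau>]
  proof eventually_elim
   case (elim t)
   show ?case
   proof (cases "0 \<le> t \<and> t \<le> \<tau>")
    case True
    then show ?thesis using elim slice[of t] by simp
   next
    case False
    show ?thesis unfolding outside[OF False] using False by (auto simp: indicator_def)
   qed
  qed
 qed
 also have "\<dots> = ennreal (\<tau> / DIM('a)) * m"
  using nn_integral_height_power[OF \<tau>, of "DIM('a) - 1" "DIM('a)"] DIM_positive[where 'a='a]
  by (subst nn_integral_multc) auto
 finally show ?thesis unfolding dist m pyr_def .
qed

lemma ex_hyperplane_of_aff_dim:
 fixes S :: "'a::euclidean_space set"
 assumes "aff_dim S = int DIM('a) - 1"
 shows "\<exists>a b. a \<noteq> 0 \<and> affine hull S = {x. a \<bullet> x = b}"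
 using assms aff_dim_eq_hyperplane[of S] DIM_positive[where 'a='a] by (simp add: of_nat_diff Suc_leI)

lemma measure_lowdim:
 fixes S :: "'a::euclidean_space set"
 assumes "aff_dim S < int DIM('a)"
 shows "measure lborel (convex hull S) = 0"
proof -
 obtain a b where a: "a \<noteq> 0" "S \<subseteq> {x. a \<bullet> x = b}"
  using aff_lowdim_subset_hyperplane[OF assms] by blast
 have "convex hull S \<subseteq> {x. a \<bullet> x = b}" using a(2) convex_hyperplane by (rule hull_minimal)
 moreover have "{x. a \<bullet> x = b} \<in> null_sets lborel" by (rule hyperplane_null_sets[OF a(1)])
 ultimately have "emeasure lborel (convex hull S) = 0 \<or> convex hull S \<notin> sets lborel"
  by (metis emeasure_mono null_setsD1 null_setsD2 le_zero_eq)
 then show ?thesis by (auto simp: measure_def emeasure_notin_sets)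
qed

text \<open>If q lies in the affine hull, the pyramid is flat and both sides are 0.\<close>

lemma facet_volume_pyramid:
 fixes F :: "'a::euclidean_space set"
 assumes F: "compact F" "convex F" "aff_dim F = int DIM('a) - 1"
 shows "DIM('a) * measure lborel (convex hull (insert q F)) = infdist q (affine hull F) * facet_volume F"
proof (cases "infdist q (affine hull F) > 0")
 case True
 then show ?thesis
  unfolding facet_volume_def measure_def pyramid_emeasure[OF F True] by (simp add: enn2real_mult)
next
 case False
 then have d0: "infdist q (affine hull F) = 0" using infdist_nonneg[of q "affine hull F"] by linarith
 have "affine hull F \<noteq> {}" using F(3) DIM_positive[where 'a='a] by force
 with d0 have "q \<in> affine hull F"
  by (simp add: in_closed_iff_infdist_zero[OF closed_affine_hull])
 then have "aff_dim (insert q F) < int DIM('a)" using F(3) by (simp add: aff_dim_insert)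
 from measure_lowdim[OF this] show ?thesis using d0 by simp
qed

lemma facet_volume_nonneg: "facet_volume F \<ge> 0"
 by (simp add: facet_volume_def)

text \<open>Some unit vector has distance at least 1 from the hyperplane. The pyramid over F with
  this apex stays in the ball, and its volume bounds that of F.\<close>

lemma facet_volume_le:
 fixes F :: "'a::euclidean_space set"
 assumes F: "compact F" "convex F" "aff_dim F = int DIM('a) - 1" and sub: "F \<subseteq> cball 0 1"
 shows "facet_volume F \<le> DIM('a) * measure lborel (cball 0 1 :: 'a set)"
proof -
 obtain a b where a: "a \<noteq> 0" "affine hull F = {x. a \<bullet> x = b}"
  using ex_hyperplane_of_aff_dim[OF F(3)] by blast
 \<comment> \<open>The sign puts q on the side of the origin away from the hyperplane, so the
   distances 1 and |b| / |a| add up.\<close>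
 define q where "q = (if b \<ge> 0 then - 1 else 1) *\<^sub>R (a /\<^sub>R norm a)"
 have "\<bar>a \<bullet> q - b\<bar> = norm a + \<bar>b\<bar>"
 proof -
  have "a \<bullet> (a /\<^sub>R norm a) = norm a" using a(1) by (simp add: dot_square_norm power2_eq_square)
  then have "a \<bullet> q = - norm a \<and> b \<ge> 0 \<or> a \<bullet> q = norm a \<and> b < 0" unfolding q_def inner_scaleR_right by simp
  then show ?thesis using norm_ge_zero[of a] by linarith
 qed
 then have d: "infdist q (affine hull F) \<ge> 1"
  unfolding a(2) infdist_hyperplane[OF a(1)] using a(1) by (simp add: divide_simps)
 have "facet_volume F \<le> infdist q (affine hull F) * facet_volume F"
  using mult_right_mono[OF d facet_volume_nonneg[of F]] by simp
 also have "\<dots> = DIM('a) * measure lborel (convex hull (insert q F))" by (rule facet_volume_pyramid[OF F, symmetric])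
 also have "\<dots> \<le> DIM('a) * measure lborel (cball 0 1 :: 'a set)"
 proof (intro mult_left_mono measure_mono_fmeasurable)
  have "norm q = 1" using a(1) by (simp add: q_def)
  then show "convex hull (insert q F) \<subseteq> cball 0 1" using sub by (intro hull_minimal) auto
  show "convex hull (insert q F) \<in> sets lborel"
   using F(1) by (simp add: borel_closed compact_imp_closed compact_convex_hull)
  show "cball 0 1 \<in> fmeasurable (lborel :: 'a measure)"
   by (intro fmeasurableI emeasure_bounded_finite) auto
 qed auto
 finally show ?thesis .
qed

text \<open>The volumes of the pyramids over a polytope \<open>convex hull A\<close> with apices \<open>0\<close> and the standard basis
 vectors determine its facet volume by a formula that is measurable in the vertices and that
 vanishes unless the polytope is a hypersurface piece.\<close>

definition hull_facet_volume :: "'a::euclidean_space set => real" where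
 "hull_facet_volume A = DIM('a) * (\<Sum>q\<in>insert 0 Basis. measure lborel (convex hull (insert q A))) /
   (\<Sum>q\<in>insert 0 Basis. infdist q (affine hull A))"

text \<open>Each pyramid volume is a distance times the facet volume; summing over the apices avoids
  choosing one off the hyperplane. The distances do not all vanish, since 0 and the basis vectors
  have no common hyperplane.\<close>

lemma facet_volume_convex_hull:
 fixes A :: "'a::euclidean_space set"
 assumes A: "finite A" "aff_dim A = int DIM('a) - 1"
 shows "facet_volume (convex hull A) = hull_facet_volume A"
proof -
 let ?I = "insert 0 Basis :: 'a set"
 let ?f = "\<Sum>q\<in>?I. infdist q (affine hull A)"
 have "\<exists>q\<in>?I. infdist q (affine hull A) \<noteq> 0"
 proof (rule ccontr)
  assume "\<not> ?thesis"
  moreover have "affine hull A \<noteq> {}" using A(2) DIM_positive[where 'a='a] by force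
  ultimately have "?I \<subseteq> affine hull A" using in_closed_iff_infdist_zero[OF closed_affine_hull] by blast
  then have "affine hull ?I \<subseteq> affine hull A" by (simp add: hull_minimal affine_affine_hull)
  moreover have "affine hull ?I = UNIV" by (simp add: affine_hull_span_0 hull_inc span_insert_0)
  ultimately have "affine hull A = UNIV" by blast
  then have "aff_dim A = int DIM('a)" by (simp add: affine_hull_UNIV aff_dim_eq_full)
  then show False using A(2) by simp
 qed
 then have pos: "?f \<noteq> 0"
  by (subst sum_nonneg_eq_0_iff) (auto simp: infdist_nonneg)
 have c: "compact (convex hull A)" using A(1) by (simp add: compact_convex_hull finite_imp_compact)
 have "DIM('a) * measure lborel (convex hull (insert q A)) = infdist q (affine hull A) * facet_volume (convex hull A)" for q
  using facet_volume_pyramid[OF c convex_convex_hull, of q] A(2) by (simp add: affine_hull_convex_hull aff_dim_convex_hull hull_insert[of convex q A, symmetric])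
 then have "DIM('a) * (\<Sum>q\<in>?I. measure lborel (convex hull (insert q A))) = ?f * facet_volume (convex hull A)"
  unfolding sum_distrib_left sum_distrib_right by (intro sum.cong refl)
 then show ?thesis unfolding hull_facet_volume_def using pos by simp
qed

text \<open>In full dimension all distances are 0 and so is the quotient, by the convention on
  division. In lower dimension even the pyramids are flat.\<close>

lemma hull_facet_volume_eq_0:
 fixes A :: "'a::euclidean_space set"
 assumes "aff_dim A \<noteq> int DIM('a) - 1"
 shows "hull_facet_volume A = 0"
proof (cases "aff_dim A = int DIM('a)")
 case True
 then have "affine hull A = UNIV" by (simp add: aff_dim_eq_full)
 then show ?thesis by (simp add: hull_facet_volume_def)
next
 case False
 then have lt: "aff_dim A < int DIM('a) - 1" using assms aff_dim_le_DIM[of A] by linarith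
 have "measure lborel (convex hull (insert q A)) = 0" for q
  by (rule measure_lowdim) (use lt in \<open>simp add: aff_dim_insert\<close>)
 then show ?thesis by (simp add: hull_facet_volume_def)
qed

lemma measurable_hull_facet_volume:
 fixes x :: "'i => 'w => 'a::euclidean_space"
 assumes J: "finite J" "\<And>j. j \<in> J ==> x j \<in> borel_measurable M"
 shows "(%w. hull_facet_volume ((%j. x j w) ` J)) \<in> borel_measurable M"
proof -
 have [measurable]: "(%w. emeasure lborel (convex hull (insert q ((%j. x j w) ` J)))) \<in> borel_measurable M" for q
  by (rule measurable_emeasure_convex_hull_insert[OF J]) auto
 have [measurable]: "(%w. infdist q (affine hull ((%j. x j w) ` J))) \<in> borel_measurable M" for q
  by (rule measurable_infdist_affine_hull[OF J]) auto
 show ?thesis unfolding hull_facet_volume_def measure_def by measurable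
qed

text \<open>Lying strictly on one side of a hyperplane, phrased through distances: the distance of a
  midpoint is the mean of the distances exactly when the endpoints are not separated. No normal is
  chosen, so measurability reduces to that of \<open>infdist\<close>.\<close>

definition one_sided :: "'a::euclidean_space set => 'a set => bool" where
 "one_sided H S \<longleftrightarrow> (\<forall>x\<in>S. infdist x H > 0) \<and>
   (\<forall>x\<in>S. \<forall>y\<in>S. infdist ((1 / 2) *\<^sub>R (x + y)) H = (infdist x H + infdist y H) / 2)"

lemma one_sided_hyperplane:
 fixes a :: "'a::euclidean_space"
 assumes a: "a \<noteq> 0"
 shows "one_sided {z. a \<bullet> z = b} S \<longleftrightarrow> (\<forall>x\<in>S. a \<bullet> x < b) \<or> (\<forall>x\<in>S. a \<bullet> x > b)"
proof -
 have d: "infdist x {z. a \<bullet> z = b} = \<bar>a \<bullet> x - b\<bar> / norm a" for x by (rule infdist_hyperplane[OF a])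
 let ?g = "%a x y. \<bar>a \<bullet> x - b\<bar> + \<bar>a \<bullet> y - b\<bar>"
 let ?h = "%a x. a \<bullet> x - b"
 have mid: "infdist ((1 / 2) *\<^sub>R (x + y)) {z. a \<bullet> z = b} = (infdist x {z. a \<bullet> z = b} + infdist y {z. a \<bullet> z = b}) / 2
  \<longleftrightarrow> \<bar>?h a x + ?h a y\<bar> = ?g a x y" for x y
 proof -
  have e: "a \<bullet> ((1 / 2) *\<^sub>R (x + y)) - b = (?h a x + ?h a y) / 2"
   by (simp add: inner_add_right field_simps)
  then have "\<bar>a \<bullet> ((1 / 2) *\<^sub>R (x + y)) - b\<bar> = \<bar>?h a x + ?h a y\<bar> / 2"
   unfolding e by (simp only: abs_divide abs_numeral)
  then show ?thesis unfolding d using a by (simp add: add_divide_distrib[symmetric] divide_simps)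
 qed
 have pos: "infdist x {z. a \<bullet> z = b} > 0 \<longleftrightarrow> a \<bullet> x \<noteq> b" for x
  unfolding d using a by auto
 let ?f = "%a. \<forall>x\<in>S. \<forall>y\<in>S. \<bar>?h a x + ?h a y\<bar> = \<bar>a \<bullet> x - b\<bar> + \<bar>a \<bullet> y - b\<bar>"
 show ?thesis unfolding one_sided_def mid pos
 proof (intro iffI)
  assume h: "(\<forall>x\<in>S. a \<bullet> x \<noteq> b) \<and> ?f a"
  show "(\<forall>x\<in>S. a \<bullet> x < b) \<or> (\<forall>x\<in>S. a \<bullet> x > b)"
  proof (rule ccontr)
   assume "\<not> ?thesis"
   then obtain x y where xy: "x \<in> S" "y \<in> S" "a \<bullet> x \<ge> b" "a \<bullet> y \<le> b" by (meson not_less)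
   then have "a \<bullet> x > b" "a \<bullet> y < b" using h by force+
   moreover have "\<bar>?h a x + ?h a y\<bar> = ?g a x y" using h xy by blast
   ultimately show False by linarith
  qed
 next
  assume h: "(\<forall>x\<in>S. a \<bullet> x < b) \<or> (\<forall>x\<in>S. a \<bullet> x > b)"
  show "(\<forall>x\<in>S. a \<bullet> x \<noteq> b) \<and> ?f a"
  proof (intro conjI ballI)
   show "a \<bullet> x \<noteq> b" if "x \<in> S" for x using h that by force
  next
   fix x y assume "x \<in> S" "y \<in> S"
   then have "a \<bullet> x < b \<and> a \<bullet> y < b \<or> a \<bullet> x > b \<and> a \<bullet> y > b" using h by blast
   then show "\<bar>?h a x + ?h a y\<bar> = ?g a x y" by linarith
  qed
 qed
qed

context
 fixes X :: "'i => 'a::euclidean_space" and I :: "'i set"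
 assumes I: "finite I"
begin

text \<open>A one-sided hyperplane supports the hull. The face that it cuts out is spanned by sample
  points on the hyperplane, and strictness leaves only those with index in J.\<close>

lemma facetsI:
 assumes J: "J \<subseteq> I" "aff_dim (X ` J) = int DIM('a) - 1" and os: "one_sided (affine hull (X ` J)) (X ` (I - J))"
 shows "convex hull (X ` J) \<in> facets (convex hull (X ` I))"
proof -
 obtain a b where a: "a \<noteq> 0" "affine hull (X ` J) = {x. a \<bullet> x = b}"
  using ex_hyperplane_of_aff_dim[OF J(2)] by blast
 let ?f = "convex hull (X ` J) face_of convex hull (X ` I)"
 have key: "?f"
  if a: "affine hull (X ` J) = {x. a \<bullet> x = b}" and side: "\<And>i. i \<in> I - J ==> a \<bullet> X i < b" for a b
 proof -
  have onH: "a \<bullet> X j = b" if "j \<in> J" for j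
   using a hull_inc[of "X j" "X ` J" affine] that by blast
  have le: "a \<bullet> x \<le> b" if "x \<in> convex hull (X ` I)" for x
  proof -
   have "X ` I \<subseteq> {x. a \<bullet> x \<le> b}" using onH side J(1) by (force simp: less_imp_le)
   then have "convex hull (X ` I) \<subseteq> {x. a \<bullet> x \<le> b}" by (intro hull_minimal convex_halfspace_le)
   then show ?thesis using that by blast
  qed
  define F where "F = convex hull (X ` I) \<inter> {x. a \<bullet> x = b}"
  have face: "F face_of convex hull (X ` I)"
   unfolding F_def by (intro face_of_Int_supporting_hyperplane_le convex_convex_hull le)
  have "compact (X ` I)" using I by (simp add: finite_imp_compact)
  then obtain S where S: "S \<subseteq> X ` I" "F = convex hull S" using face by (rule face_of_convex_hull_subset)
  have "S \<subseteq> X ` J"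
  proof
   fix x assume x: "x \<in> S"
   then obtain i where i: "i \<in> I" "x = X i" using S(1) by blast
   have "x \<in> F" unfolding S(2) using x by (rule hull_inc)
   then have "a \<bullet> X i = b" by (simp add: F_def i)
   then have "i \<in> J" using side[of i] i(1) by auto
   then show "x \<in> X ` J" using i(2) by blast
  qed
  then have "F \<subseteq> convex hull (X ` J)" unfolding S(2) by (rule hull_mono)
  moreover have "convex hull (X ` J) \<subseteq> F"
  proof -
   have "convex hull (X ` J) \<subseteq> {x. a \<bullet> x = b}" using onH by (intro hull_minimal convex_hyperplane) auto
   moreover have "convex hull (X ` J) \<subseteq> convex hull (X ` I)" using J(1) by (intro hull_mono) auto
   ultimately show ?thesis unfolding F_def by blast
  qed
  ultimately show ?thesis using face by (simp add: set_eq_subset[symmetric])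
 qed
 have "?f"
 proof -
  from os have "(\<forall>x\<in>X ` (I - J). a \<bullet> x < b) \<or> (\<forall>x\<in>X ` (I - J). a \<bullet> x > b)"
   unfolding a(2) one_sided_hyperplane[OF a(1)] .
  then show ?thesis
  proof
   assume "\<forall>x\<in>X ` (I - J). a \<bullet> x < b"
   then show ?thesis using key[OF a(2)] by blast
  next
   assume h: "\<forall>x\<in>X ` (I - J). a \<bullet> x > b"
   have "affine hull (X ` J) = {x. (- a) \<bullet> x = - b}" using a(2) by simp
   from key[OF this] h show ?thesis by simp
  qed
 qed
 then show ?thesis unfolding facets_def using J(2) by (simp add: aff_dim_convex_hull)
qed

text \<open>If two sample points lay on opposite sides of the hyperplane, their segment would cross
  it in a point of F, and the face property would put the endpoints into F.\<close>

lemma facetsE: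
 assumes F: "F \<in> facets (convex hull (X ` I))"
 defines "J \<equiv> {j \<in> I. X j \<in> F}"
 shows "F = convex hull (X ` J)" "aff_dim (X ` J) = int DIM('a) - 1" "one_sided (affine hull (X ` J)) (X ` (I - J))"
proof -
 have face: "F face_of convex hull (X ` I)" and ad: "aff_dim F = int DIM('a) - 1"
  using F by (auto simp: facets_def)
 have cF: "convex F" using face by (rule face_of_imp_convex)
 have "compact (X ` I)" using I by (simp add: finite_imp_compact)
 then obtain S where S: "S \<subseteq> X ` I" "F = convex hull S" using face by (rule face_of_convex_hull_subset)
 have "S \<subseteq> X ` J" using S hull_subset[of S convex] by (auto simp: J_def)
 then have "F \<subseteq> convex hull (X ` J)" unfolding S(2) by (rule hull_mono)
 moreover have "convex hull (X ` J) \<subseteq> F" using cF by (intro hull_minimal) (auto simp: J_def)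
 ultimately show FJ: "F = convex hull (X ` J)" by blast
 then show adJ: "aff_dim (X ` J) = int DIM('a) - 1" using ad by (simp add: aff_dim_convex_hull)
 have aff: "affine hull (X ` J) = affine hull F" unfolding FJ by (simp add: affine_hull_convex_hull)
 obtain a b where a: "a \<noteq> 0" "affine hull (X ` J) = {x. a \<bullet> x = b}"
  using ex_hyperplane_of_aff_dim[OF adJ] by blast
 have QF: "convex hull (X ` I) \<inter> {x. a \<bullet> x = b} = F"
  using face_of_imp_eq_affine_Int[OF convex_convex_hull face] aff a(2) by blast
 have inQ: "X i \<in> convex hull (X ` I)" if "i \<in> I" for i using that by (intro hull_inc) blast
 have nz: "a \<bullet> X i \<noteq> b" if "i \<in> I - J" for i
  using QF inQ[of i] that by (auto simp: J_def)
 have same: False if i: "i \<in> I - J" and k: "k \<in> I - J" and side: "a \<bullet> X i < b" "a \<bullet> X k > b" for i k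
 proof -
  define l where "l = (b - a \<bullet> X i) / (a \<bullet> X k - a \<bullet> X i)"
  have l: "0 < l" "l < 1" using side by (auto simp: l_def)
  define z where "z = (1 - l) *\<^sub>R X i + l *\<^sub>R X k"
  have "l * (a \<bullet> X k - a \<bullet> X i) = b - a \<bullet> X i" using side by (simp add: l_def)
  then have "a \<bullet> z = b" by (simp add: z_def inner_add_right algebra_simps)
  moreover have "X i \<noteq> X k" using side by auto
  then have zo: "z \<in> open_segment (X i) (X k)" unfolding in_segment z_def using l by blast
  moreover have "z \<in> convex hull (X ` I)"
   unfolding z_def using l inQ i k by (intro convexD[OF convex_convex_hull]) auto
  ultimately have "z \<in> F" using QF by blast
  then have "X i \<in> F" using face zo inQ i k unfolding face_of_def by blast
  then show False using i by (simp add: J_def)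
 qed
 show "one_sided (affine hull (X ` J)) (X ` (I - J))"
 proof (rule ccontr)
  assume "\<not> ?thesis"
  then obtain i k where "i \<in> I - J" "\<not> a \<bullet> X i < b" "k \<in> I - J" "\<not> a \<bullet> X k > b"
   unfolding a(2) one_sided_hyperplane[OF a(1)] by blast
  then show False using same[of k i] nz[of i] nz[of k] by linarith
 qed
qed

text \<open>Facets correspond to the index sets of the sample points that they contain. The sum may
  run over all index sets, because the other terms vanish through one-sidedness or
  \<open>hull_facet_volume\<close>. The formula holds for every configuration and each term is
  measurable.\<close>

lemma Lp_surface_area_convex_hull:
 "Lp_surface_area p (convex hull (X ` I)) =
  (\<Sum>J\<in>Pow I. (if one_sided (affine hull (X ` J)) (X ` (I - J)) then 1 else 0) *
   ((if p = 1 then 1 else infdist 0 (affine hull (X ` J)) powr (1 - p)) * hull_facet_volume (X ` J)))"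
proof -
 define G where "G = {J \<in> Pow I. aff_dim (X ` J) = int DIM('a) - 1 \<and> one_sided (affine hull (X ` J)) (X ` (I - J))}"
 let ?h = "%I. convex hull (X ` I)"
 have bij: "bij_betw (%J. convex hull (X ` J)) G (facets (?h I))"
 proof (rule bij_betwI[where g="%F. {j \<in> I. X j \<in> F}"])
  show "(%J. convex hull (X ` J)) \<in> G \<rightarrow> facets (?h I)"
   using facetsI by (auto simp: G_def)
  show "(%F. {j \<in> I. X j \<in> F}) \<in> facets (?h I) \<rightarrow> G"
   using facetsE(2,3) by (auto simp: G_def)
  show "{j \<in> I. X j \<in> convex hull (X ` J)} = J" if "J \<in> G" for J
  proof (intro equalityI subsetI)
   fix j assume j: "j \<in> {j \<in> I. X j \<in> convex hull (X ` J)}"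
   show "j \<in> J"
   proof (rule ccontr)
    assume "j \<notin> J"
    then have "infdist (X j) (affine hull (X ` J)) > 0" using that j by (auto simp: G_def one_sided_def)
    moreover have "X j \<in> affine hull (X ` J)" using j convex_hull_subset_affine_hull by blast
    ultimately show False by simp
   qed
  next
   fix j assume "j \<in> J"
   then show "j \<in> {j \<in> I. X j \<in> convex hull (X ` J)}" using that by (auto simp: G_def hull_inc)
  qed
  show "convex hull (X ` {j \<in> I. X j \<in> F}) = F" if "F \<in> facets (?h I)" for F
   using facetsE(1)[OF that] by simp
 qed
 have fin: "finite (X ` J)" if "J \<in> G" for J using that I finite_subset by (auto simp: G_def)
 let ?f = "%J. (if p = 1 then 1 else infdist 0 (affine hull (X ` J)) powr (1 - p)) * hull_facet_volume (X ` J)"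
 let ?g = "%J I. if one_sided (affine hull (X ` J)) (X ` (I - J)) then 1 else 0"
 have "Lp_surface_area p (?h I) = (\<Sum>J\<in>G. (if p = 1 then 1 else infdist 0 (affine hull (?h J)) powr (1 - p)) * facet_volume (?h J))"
  unfolding Lp_surface_area_def by (rule sum.reindex_bij_betw[OF bij, symmetric])
 also have "\<dots> = (\<Sum>J\<in>G. ?g J I *
   ?f J)"
  using facet_volume_convex_hull fin by (intro sum.cong refl) (auto simp: G_def affine_hull_convex_hull)
 also have "\<dots> = (\<Sum>J\<in>Pow I. ?g J I *
   ?f J)"
 proof (rule sum.mono_neutral_left)
  show "\<forall>J\<in>Pow I - G. ?g J I *
   ?f J = 0"
   using hull_facet_volume_eq_0 by (auto simp: G_def)
 qed (use I in \<open>auto simp: G_def\<close>)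
 finally show ?thesis .
qed

end

section \<open>Points in general position\<close>

text \<open>Linear spans are used for fewer than n points, so that hyperplanes through n points also
  miss the origin. Affine hulls are used for n points, so that no such hyperplane contains a further
  point.\<close>

definition general_position :: "('i => 'a::euclidean_space) => 'i set => bool" where
 "general_position X I \<longleftrightarrow> (\<forall>K\<subseteq>I. \<forall>j\<in>I - K. (card K < DIM('a) \<longrightarrow> X j \<notin> span (X ` K)) \<and>
   (card K = DIM('a) \<longrightarrow> X j \<notin> affine hull (X ` K)))"

definition below_plane :: "('i => 'a::euclidean_space) => 'i set => 'i set => bool" where
 "below_plane X I J \<longleftrightarrow> (\<forall>i\<in>I - J. plane_normal (X ` J) \<bullet> X i < 1)"

definition facet_term :: "real => 'a::euclidean_space set => real" where
 "facet_term p A = (if p = 1 then 1 else infdist 0 (affine hull A) powr (1 - p)) * hull_facet_volume A"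

lemma infdist_0_hyperplane:
 fixes a :: "'a::euclidean_space"
 shows "a \<noteq> 0 ==> infdist 0 {z. a \<bullet> z = 1} = 1 / norm a"
 by (simp add: infdist_hyperplane)

context
 fixes X :: "'i => 'a::euclidean_space" and I :: "'i set"
 assumes I: "finite I" and gp: "general_position X I"
begin

lemma general_position_independent:
 assumes J: "J \<subseteq> I" "card J \<le> DIM('a)"
 shows "inj_on X J" "independent (X ` J)"
proof -
 have "finite J" using J(1) I finite_subset by blast
 then have "J \<subseteq> I ==> card J \<le> DIM('a) ==> inj_on X J \<and> independent (X ` J)"
 proof (induction J rule: finite_induct)
  case (insert j J)
  then have "card J < DIM('a)" "j \<in> I - J" "J \<subseteq> I" by auto
  then have sp: "X j \<notin> span (X ` J)" using gp unfolding general_position_def by blast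
  have IH: "inj_on X J" "independent (X ` J)" using insert.IH \<open>J \<subseteq> I\<close> \<open>card J < DIM('a)\<close> by auto
  have "X j \<notin> X ` J" using sp span_base[of "X j" "X ` J"] by blast
  then show ?case using IH sp insert.hyps by (simp add: independent_insertI image_iff)
 qed (simp add: independent_empty)
 then show "inj_on X J" "independent (X ` J)" using J by blast+
qed

lemma general_position_basis:
 assumes J: "J \<subseteq> I" "card J = DIM('a)"
 shows "independent (X ` J)" "card (X ` J) = DIM('a)"
 using general_position_independent[of J] J by (auto simp: card_image)

text \<open>More than n points already have full affine dimension, so every facet is a simplex with
  exactly n vertices.\<close>

lemma general_position_aff_dim:
 assumes J: "J \<subseteq> I"
 shows "aff_dim (X ` J) = int DIM('a) - 1 \<longleftrightarrow> card J = DIM('a)"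
proof -
 have fJ: "finite J" using J I finite_subset by blast
 have dim: "aff_dim (X ` K) = int DIM('a) - 1" if K: "K \<subseteq> I" "card K = DIM('a)" for K
 proof -
  note b = general_position_basis[OF K]
  note p = plane_normal_inner[OF b]
  have "aff_dim (X ` K) = aff_dim {z. plane_normal (X ` K) \<bullet> z = 1}" unfolding p(2)[symmetric] by simp
  then show ?thesis using p(3) by simp
 qed
 consider "card J < DIM('a)" | "card J = DIM('a)" | "card J > DIM('a)" by linarith
 then show ?thesis
 proof cases
  case 1
  have "aff_dim (X ` J) \<le> int (card (X ` J)) - 1" using fJ by (intro aff_dim_le_card) auto
  also have "\<dots> < int DIM('a) - 1" using card_image_le[OF fJ, of X] 1 by linarith
  finally show ?thesis using 1 by simp
 next
  case 2
  then show ?thesis using dim[OF J] by simp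
 next
  case 3
  then obtain K where K: "K \<subseteq> J" "card K = DIM('a)" by (meson less_imp_le_nat obtain_subset_with_card_n)
  then have "K \<noteq> J" using 3 by auto
  then obtain j where j: "j \<in> J - K" using K by blast
  have "X j \<notin> affine hull (X ` K)" using gp K J j unfolding general_position_def by blast
  then have "aff_dim (insert (X j) (X ` K)) = int DIM('a)" using dim[of K] K J by (simp add: aff_dim_insert)
  moreover have "aff_dim (insert (X j) (X ` K)) \<le> aff_dim (X ` J)" using j K by (intro aff_dim_subset) auto
  ultimately show ?thesis using 3 by simp
 qed
qed

text \<open>With the origin in the hull, the other points cannot all lie beyond the
  hyperplane.\<close>

lemma general_position_one_sided:
 assumes J: "J \<subseteq> I" "card J = DIM('a)" and 0: "0 \<in> convex hull (X ` I)"
 shows "one_sided (affine hull (X ` J)) (X ` (I - J)) \<longleftrightarrow> below_plane X I J"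
proof -
 note b = general_position_basis[OF J]
 note p = plane_normal_inner[OF b]
 have "\<not> (\<forall>x\<in>X ` (I - J). plane_normal (X ` J) \<bullet> x > 1)"
 proof
  assume h: "\<forall>x\<in>X ` (I - J). plane_normal (X ` J) \<bullet> x > 1"
  have "X ` I \<subseteq> {z. plane_normal (X ` J) \<bullet> z \<ge> 1}"
  proof
   fix x assume "x \<in> X ` I"
   then have "x \<in> X ` J \<or> x \<in> X ` (I - J)" by blast
   then have "plane_normal (X ` J) \<bullet> x = 1 \<or> plane_normal (X ` J) \<bullet> x > 1" using h p(1) by blast
   then show "x \<in> {z. plane_normal (X ` J) \<bullet> z \<ge> 1}" by auto
  qed
  then have "convex hull (X ` I) \<subseteq> {z. plane_normal (X ` J) \<bullet> z \<ge> 1}" by (intro hull_minimal convex_halfspace_ge)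
  then show False using 0 by auto
 qed
 then show ?thesis unfolding p(2) one_sided_hyperplane[OF p(3)] below_plane_def by blast
qed

end

lemma facet_term_nonneg: "facet_term p A \<ge> 0"
 unfolding facet_term_def hull_facet_volume_def
 by (intro mult_nonneg_nonneg divide_nonneg_nonneg sum_nonneg) (auto simp: infdist_nonneg)

text \<open>With r the length of the normal, the distance is 1/r, and the pyramid with apex 0 gives
  the facet volume as r times \<open>simplex_det A\<close> / (n - 1)!. The powers r^(p - 1) and r
  combine.\<close>

lemma facet_term_basis:
 fixes A :: "'a::euclidean_space set"
 assumes A: "independent A" "card A = DIM('a)"
 shows "facet_term p A = norm (plane_normal A) powr p * simplex_det A / fact (DIM('a) - 1)"
proof -
 note bs = basis_span[OF A]
 note pn = plane_normal_inner[OF A]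
 define r where "r = norm (plane_normal A)"
 have r: "r > 0" using pn(3) by (simp add: r_def)
 have d: "infdist 0 (affine hull A) = 1 / r" unfolding pn(2) infdist_0_hyperplane[OF pn(3)] r_def ..
 have ad: "aff_dim A = int DIM('a) - 1"
 proof -
  have "aff_dim A = aff_dim {z. plane_normal A \<bullet> z = 1}" unfolding pn(2)[symmetric] by simp
  then show ?thesis using pn(3) by simp
 qed
 let ?f = "DIM('a) * measure lborel (convex hull (insert 0 A))"
 have "DIM('a) * measure lborel (convex hull (insert 0 (convex hull A))) = infdist 0 (affine hull (convex hull A)) * facet_volume (convex hull A)"
  using bs(1) ad by (intro facet_volume_pyramid) (auto simp: compact_convex_hull finite_imp_compact aff_dim_convex_hull)
 then have "?f = 1 / r * hull_facet_volume A"
  by (simp add: affine_hull_convex_hull hull_insert[of convex 0 A, symmetric] d facet_volume_convex_hull[OF bs(1) ad])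
 moreover have "simplex_det A / fact (DIM('a) - 1) = ?f"
  using fact_reduce[of "DIM('a)", where 'a=real] DIM_positive[where 'a='a] by (simp add: simplex_det_def)
 ultimately have v: "hull_facet_volume A = r * (simplex_det A / fact (DIM('a) - 1))" using r by simp
 have "(if p = 1 then 1 else (1 / r) powr (1 - p)) * r = r powr p"
 proof (cases "p = 1")
  case False
  have "(1 / r) powr (1 - p) * r = r powr (p - 1) * r powr 1" using r by (simp add: powr_divide powr_minus_divide[symmetric])
  also have "\<dots> = r powr p" using r by (simp only: powr_add[symmetric]) simp
  finally show ?thesis using False by simp
 qed (use r in simp)
 then show ?thesis unfolding facet_term_def d v r_def[symmetric] by (metis (no_types) mult.assoc times_divide_eq_right)
qed

text \<open>A hyperplane spanned by points of the unit ball has distance at most 1 from the origin,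
  and p \<le> 1 keeps the power of this distance at most 1.\<close>

lemma facet_term_le:
 fixes A :: "'a::euclidean_space set"
 assumes A: "finite A" "aff_dim A = int DIM('a) - 1" "A \<subseteq> cball 0 1" and p: "p \<le> 1"
 shows "facet_term p A \<le> DIM('a) * measure lborel (cball 0 1 :: 'a set)"
proof -
 obtain x where x: "x \<in> A" using A(2) DIM_positive[where 'a='a] by force
 have "infdist 0 (affine hull A) \<le> dist 0 x" using x by (intro infdist_le hull_inc)
 also have "\<dots> \<le> 1" using x A(3) by auto
 finally have "(if p = 1 then 1 else infdist 0 (affine hull A) powr (1 - p)) \<le> 1"
  using p infdist_nonneg[of 0 "affine hull A"] by (auto intro!: powr_le1)
 moreover have "hull_facet_volume A \<le> DIM('a) * measure lborel (cball 0 1 :: 'a set)"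
  unfolding facet_volume_convex_hull[OF A(1,2), symmetric] using A
  by (intro facet_volume_le hull_minimal) (auto simp: compact_convex_hull finite_imp_compact aff_dim_convex_hull)
 moreover have "hull_facet_volume A \<ge> 0"
  unfolding facet_volume_convex_hull[OF A(1,2), symmetric] by (rule facet_volume_nonneg)
 ultimately show ?thesis unfolding facet_term_def
  using mult_mono[of "if p = 1 then 1 else infdist 0 (affine hull A) powr (1 - p)" 1 "hull_facet_volume A"] by simp
qed

context
 fixes X :: "'i => 'a::euclidean_space" and I :: "'i set"
 assumes I: "finite I" and gp: "general_position X I"
begin

lemma Lp_surface_area_general_position:
 "Lp_surface_area p (convex hull (X ` I)) = (\<Sum>J | J \<subseteq> I \<and> card J = DIM('a).
   (if one_sided (affine hull (X ` J)) (X ` (I - J)) then 1 else 0) * facet_term p (X ` J))"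
 unfolding Lp_surface_area_convex_hull[OF I] facet_term_def
proof (rule sum.mono_neutral_right)
 let ?f = "%J. (if p = 1 then 1 else infdist 0 (affine hull (X ` J)) powr (1 - p)) * hull_facet_volume (X ` J)"
 let ?g = "%J. if one_sided (affine hull (X ` J)) (X ` (I - J)) then 1 else 0"
 show "\<forall>J\<in>Pow I - {J. J \<subseteq> I \<and> card J = DIM('a)}. ?g J *
   ?f J = 0"
 proof
  fix J assume "J \<in> Pow I - {J. J \<subseteq> I \<and> card J = DIM('a)}"
  then have "aff_dim (X ` J) \<noteq> int DIM('a) - 1" using general_position_aff_dim[OF I gp, of J] by blast
  from hull_facet_volume_eq_0[OF this] show "?g J *
   ?f J = 0" by simp
 qed
qed (use I in auto)

text \<open>The ray through y leaves the polytope in some facet, and the cone over that facet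
  contains y.\<close>

lemma cone_cover:
 assumes 0: "0 \<in> interior (convex hull (X ` I))" and y: "y \<noteq> 0"
 shows "\<exists>J\<subseteq>I. card J = DIM('a) \<and> below_plane X I J \<and> y \<in> simplicial_cone (X ` J)"
proof -
 let ?Q = "convex hull (X ` I)"
 have bQ: "bounded ?Q" using I by (simp add: finite_imp_bounded bounded_convex_hull)
 obtain t where t: "0 < t" "0 + t *\<^sub>R y \<in> frontier ?Q" using ray_to_frontier[OF bQ 0 y] by blast
 have "polyhedron ?Q" using I by (intro polytope_imp_polyhedron polytope_convex_hull) auto
 then have "rel_frontier ?Q = \<Union> {F. F facet_of ?Q}" by (rule rel_frontier_of_polyhedron)
 moreover have "rel_frontier ?Q = frontier ?Q" using 0 by (intro rel_frontier_nonempty_interior) auto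
 ultimately obtain F where F: "F facet_of ?Q" "t *\<^sub>R y \<in> F" using t(2) by auto
 have "aff_dim ?Q = int DIM('a)" using 0 by (intro aff_dim_nonempty_interior) auto
 then have "F \<in> facets ?Q" using F(1) by (simp add: facets_def facet_of_def)
 note E = facetsE[OF I this]
 define J where "J = {j \<in> I. X j \<in> F}"
 have J: "J \<subseteq> I" by (auto simp: J_def)
 have cJ: "card J = DIM('a)" using general_position_aff_dim[OF I gp J] E(2) by (simp add: J_def)
 have "0 \<in> ?Q" using 0 interior_subset by blast
 then have "below_plane X I J" using general_position_one_sided[OF I gp J cJ] E(3) by (simp add: J_def)
 moreover have "y \<in> simplicial_cone (X ` J)"
 proof -
  have "finite (X ` J)" using J I finite_subset by blast
  moreover have "t *\<^sub>R y \<in> convex hull (X ` J)" using F(2) E(1) by (simp add: J_def)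
  ultimately obtain u where "\<forall>x\<in>X ` J. 0 \<le> u x" "(\<Sum>x\<in>X ` J. u x *\<^sub>R x) = t *\<^sub>R y"
   by (auto simp: convex_hull_finite)
  then have "t *\<^sub>R y \<in> simplicial_cone (X ` J)"
   unfolding simplicial_cone_def by (intro CollectI exI[of _ u]) simp
  then show ?thesis using simplicial_cone_scale[OF t(1)] by blast
 qed
 ultimately show ?thesis using J cJ by blast
qed

text \<open>Both plane normals are at most 1 on all sample points. Evaluated at y, each coefficient
  sum therefore bounds the other, and they agree. A vertex of J outside L has value strictly below 1
  for the normal of L, so equality forces its coefficient to vanish.\<close>

lemma cone_overlap:
 assumes J: "J \<subseteq> I" "card J = DIM('a)" "below_plane X I J" "y \<in> simplicial_cone (X ` J)"
  and L: "L \<subseteq> I" "card L = DIM('a)" "below_plane X I L" "y \<in> simplicial_cone (X ` L)" and ne: "J \<noteq> L"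
 shows "y \<in> span (X ` (J \<inter> L))" "card (J \<inter> L) < DIM('a)"
proof -
 have fin: "finite J" "finite L" using J(1) L(1) I finite_subset by blast+
 show "card (J \<inter> L) < DIM('a)"
 proof (rule ccontr)
  assume "\<not> ?thesis"
  then have "card J \<le> card (J \<inter> L)" "card L \<le> card (J \<inter> L)" using J(2) L(2) by auto
  then have "J \<inter> L = J" "J \<inter> L = L" using card_seteq[OF fin(1), of "J \<inter> L"] card_seteq[OF fin(2), of "J \<inter> L"] by auto
  then show False using ne by blast
 qed
 have coeffs: "\<exists>c. y = (\<Sum>j\<in>K. c j *\<^sub>R X j) \<and> (\<forall>j\<in>K. 0 \<le> c j)"
  if K: "K \<subseteq> I" "card K = DIM('a)" "y \<in> simplicial_cone (X ` K)" for K
 proof -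
  have inj: "inj_on X K" using general_position_independent[OF I gp K(1)] K(2) by simp
  obtain c where "y = (\<Sum>x\<in>X ` K. c x *\<^sub>R x)" "\<forall>x\<in>X ` K. 0 \<le> c x" using K(3) unfolding simplicial_cone_def by blast
  then show ?thesis by (intro exI[of _ "%j. c (X j)"]) (simp add: sum.reindex[OF inj])
 qed
 have le: "plane_normal (X ` K') \<bullet> X i \<le> 1" "i \<in> K' ==> plane_normal (X ` K') \<bullet> X i = 1"
  if K': "K' \<subseteq> I" "card K' = DIM('a)" "below_plane X I K'" "i \<in> I" for K' i
 proof -
  note p = plane_normal_inner(1)[OF general_position_basis[OF I gp K'(1,2)]]
  show 1: "plane_normal (X ` K') \<bullet> X i = 1" if "i \<in> K'" using p that by blast
  show "plane_normal (X ` K') \<bullet> X i \<le> 1"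
   using 1 K'(3,4) unfolding below_plane_def by (cases "i \<in> K'") (auto simp: less_imp_le)
 qed
 obtain c where c: "y = (\<Sum>j\<in>J. c j *\<^sub>R X j)" "\<forall>j\<in>J. 0 \<le> c j" using coeffs J by blast
 obtain e where e: "y = (\<Sum>j\<in>L. e j *\<^sub>R X j)" "\<forall>j\<in>L. 0 \<le> e j" using coeffs L by blast
 define a where "a = plane_normal (X ` J)"
 define b where "b = plane_normal (X ` L)"
 let ?f = "%j. b \<bullet> X j"
 have "a \<bullet> y = (\<Sum>j\<in>J. c j)"
  unfolding c(1) a_def using le(2)[OF J(1-3)] J(1) by (auto simp: inner_sum_right intro!: sum.cong)
 moreover have "b \<bullet> y = (\<Sum>j\<in>L. e j)"
  unfolding e(1) b_def using le(2)[OF L(1-3)] L(1) by (auto simp: inner_sum_right intro!: sum.cong)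
 moreover have "a \<bullet> y = (\<Sum>j\<in>L. e j * (a \<bullet> X j))" unfolding e(1) by (simp add: inner_sum_right)
 moreover have "b \<bullet> y = (\<Sum>j\<in>J. c j * ?f j)" unfolding c(1) by (simp add: inner_sum_right)
 moreover have "(\<Sum>j\<in>L. e j * (a \<bullet> X j)) \<le> (\<Sum>j\<in>L. e j)"
  using le(1)[OF J(1-3)] e(2) L(1) unfolding a_def by (intro sum_mono) (auto intro: mult_left_le)
 moreover have "(\<Sum>j\<in>J. c j * ?f j) \<le> (\<Sum>j\<in>J. c j)"
  using le(1)[OF L(1-3)] c(2) J(1) unfolding b_def by (intro sum_mono) (auto intro: mult_left_le)
 ultimately have "(\<Sum>j\<in>J. c j - c j * ?f j) = 0" by (simp add: sum_subtractf)
 moreover have "0 \<le> c j - c j * ?f j" if "j \<in> J" for j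
  using le(1)[OF L(1-3), of j] c(2) that J(1) unfolding b_def by (auto intro: mult_left_le)
 ultimately have z: "c j - c j * ?f j = 0" if "j \<in> J" for j
  using sum_nonneg_eq_0_iff[OF fin(1), of "%j. c j - c j * ?f j"] that by blast
 have "c j = 0" if "j \<in> J - L" for j
 proof -
  have "?f j < 1" using L(3) that J(1) unfolding below_plane_def b_def by blast
  moreover have "c j * (1 - b \<bullet> X j) = 0" using z[of j] that by (simp add: algebra_simps)
  ultimately show ?thesis by simp
 qed
 then have "y = (\<Sum>j\<in>J \<inter> L. c j *\<^sub>R X j)"
  unfolding c(1) using fin by (intro sum.mono_neutral_right) auto
 then show "y \<in> span (X ` (J \<inter> L))" by (simp only:) (intro span_sum span_scale span_base imageI)
qed

text \<open>Distinct cones overlap only in finitely many spans of fewer than n points, which form a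
  null set; every other nonzero point lies in exactly one cone.\<close>

lemma cone_tiling:
 assumes 0: "0 \<in> interior (convex hull (X ` I))"
 shows "measure lborel (cball 0 1 :: 'a set) = (\<Sum>J | J \<subseteq> I \<and> card J = DIM('a).
   (if below_plane X I J then 1 else 0) * measure lborel (cball 0 1 \<inter> simplicial_cone (X ` J)))"
proof -
 define S where "S = {J. J \<subseteq> I \<and> card J = DIM('a) \<and> below_plane X I J}"
 have fS: "finite S" using I by (auto simp: S_def intro: finite_subset[OF _ finite_Pow_iff[THEN iffD2, OF I]])
 have fin: "finite (X ` J)" if "J \<in> S" for J using that I finite_subset by (auto simp: S_def)
 have cone [measurable]: "simplicial_cone (X ` J) \<in> sets borel" if "J \<in> S" for J by (rule borel_simplicial_cone[OF fin[OF that]])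
 define N where "N = (\<Union>K\<in>{K. K \<subseteq> I \<and> card K < DIM('a)}. span (X ` K))"
 have N: "N \<in> null_sets lborel"
  unfolding N_def
 proof (rule null_sets_UN')
  show "countable {K. K \<subseteq> I \<and> card K < DIM('a)}" using I by (intro countable_finite) auto
  fix K assume K: "K \<in> {K. K \<subseteq> I \<and> card K < DIM('a)}"
  then have fK: "finite K" using I finite_subset by blast
  have "dim (span (X ` K)) \<le> card (X ` K)" using fK by (simp add: dim_le_card')
  also have "\<dots> < DIM('a)" using card_image_le[OF fK, of X] K by auto
  finally have "negligible (span (X ` K))" by (rule negligible_lowdim)
  then show "span (X ` K) \<in> null_sets lborel"
   by (simp add: negligible_iff_null_sets null_sets_completion_iff borel_closed closed_span)
 qed
 let ?f = "%J. cball 0 1 \<inter> simplicial_cone (X ` J)"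
 have "AE y in lborel. y \<notin> insert 0 N"
  using AE_not_in[OF N] AE_lborel_singleton[of 0] by eventually_elim simp
 then have AE: "AE y in lborel. (\<Sum>J\<in>S. indicator (?f J) y) = (indicator (cball 0 1) y :: ennreal)"
 proof eventually_elim
  case (elim y)
  then obtain J where J: "J \<in> S" "y \<in> simplicial_cone (X ` J)" using cone_cover[OF 0, of y] by (auto simp: S_def)
  have "y \<notin> simplicial_cone (X ` L)" if "L \<in> S - {J}" for L
   using cone_overlap[of J y L] J that elim by (auto simp: S_def N_def)
  then have "(\<Sum>L\<in>S. indicator (cball 0 1 \<inter> simplicial_cone (X ` L)) y :: ennreal) = (\<Sum>L\<in>{J}. indicator (cball 0 1 \<inter> simplicial_cone (X ` L)) y)"
   using J fS by (intro sum.mono_neutral_right) (auto simp: indicator_def)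
  then show ?case using J(2) by (simp add: indicator_def)
 qed
 have fin_meas: "emeasure lborel (?f J) = ennreal (measure lborel (?f J))" for J
 proof -
  have "emeasure lborel (?f J) < \<infinity>"
   by (intro emeasure_bounded_finite bounded_Int) auto
  then show ?thesis by (intro emeasure_eq_ennreal_measure) auto
 qed
 let ?g = "cball 0 1 :: 'a set"
 have "ennreal (measure lborel ?g) = emeasure lborel ?g"
  using emeasure_bounded_finite[of "?g"] by (intro emeasure_eq_ennreal_measure[symmetric]) auto
 also have "\<dots> = (\<integral>\<^sup>+y. indicator (cball 0 1) y \<partial>(lborel :: 'a measure))" by simp
 also have "\<dots> = (\<integral>\<^sup>+y. (\<Sum>J\<in>S. indicator (?f J) y) \<partial>lborel)"
  using AE by (intro nn_integral_cong_AE) auto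
 also have "\<dots> = (\<Sum>J\<in>S. emeasure lborel (?f J))"
  by (subst nn_integral_sum) (auto intro!: sum.cong nn_integral_indicator borel_measurable_indicator)
 also have "\<dots> = ennreal (\<Sum>J\<in>S. measure lborel (?f J))"
  unfolding fin_meas by (rule sum_ennreal) simp
 finally have "measure lborel ?g = (\<Sum>J\<in>S. measure lborel (?f J))"
  by (subst (asm) ennreal_inj) (auto intro: sum_nonneg)
 also have "\<dots> = (\<Sum>J | J \<subseteq> I \<and> card J = DIM('a). (if below_plane X I J then 1 else 0) * measure lborel (?f J))"
  using I by (intro sum.mono_neutral_cong_left) (auto simp: S_def)
 finally show ?thesis .
qed

end

lemma measure_sphere_measure: "measure sphere_measure (sphere 0 1 :: 'a::euclidean_space set) = DIM('a) * measure lborel (cball 0 1 :: 'a set)"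
 by (simp add: measure_def[of sphere_measure] emeasure_sphere_measure_space content_cball)

section \<open>Samples without the origin in the interior of their hull\<close>

lemma exists_halfspace_if_not_interior:
 fixes Q :: "'a::euclidean_space set"
 assumes Q: "convex Q" and 0: "0 \<notin> interior Q"
 shows "\<exists>w. w \<noteq> 0 \<and> (\<forall>x\<in>Q. 0 \<le> w \<bullet> x)"
proof (cases "interior Q = {}")
 case True
 then obtain a b where a: "a \<noteq> 0" "Q \<subseteq> {x. a \<bullet> x = b}"
  using empty_interior_subset_hyperplane[OF Q] by metis
 show ?thesis
 proof (cases "b \<ge> 0")
  case True
  then show ?thesis using a by (intro exI[of _ a]) auto
 next
  case False
  then show ?thesis using a by (intro exI[of _ "- a"]) auto
 qed
next
 case False
 obtain a where a: "a \<noteq> 0" "\<forall>x\<in>interior Q. 0 \<le> a \<bullet> x"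
  using separating_hyperplane_set_0[OF convex_interior[OF Q] 0] by blast
 then have "closure (interior Q) \<subseteq> {x. a \<bullet> x \<ge> 0}" by (intro closure_minimal closed_halfspace_ge) auto
 then show ?thesis using a(1) closure_subset[of Q] convex_closure_interior[OF Q False] by auto
qed

lemma ex_direction_net: "\<exists>U :: 'a::euclidean_space set. finite U \<and> U \<subseteq> sphere 0 1 \<and> sphere 0 1 \<subseteq> (\<Union>u\<in>U. ball u (1 / 2))"
proof -
 have "compact (sphere 0 1 :: 'a set)" by simp
 moreover have "sphere 0 1 \<subseteq> (\<Union>u\<in>(sphere 0 1 :: 'a set). ball u (1 / 2))" by auto
 ultimately show ?thesis
  using compactE_image[of "sphere 0 1 :: 'a set" "sphere 0 1" "%u. ball u (1/2)"] by (metis open_ball)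
qed

text \<open>All points then lie in a half-space w \<bullet> x \<ge> 0. A net direction u within 1/2
  of w satisfies u \<bullet> X i > - 1/2, so the exceptional event is covered by finitely many fixed
  events, each stating that all points lie below a plane with normal of length 2.\<close>

lemma net_direction_below:
 fixes X :: "'i => 'a::euclidean_space"
 assumes U: "sphere 0 1 \<subseteq> (\<Union>u\<in>U. ball u (1 / 2))" and X: "\<And>i. i \<in> I ==> norm (X i) = 1"
  and 0: "0 \<notin> interior (convex hull (X ` I))"
 shows "\<exists>u\<in>U. \<forall>i\<in>I. (- 2 *\<^sub>R u) \<bullet> X i < 1"
proof -
 obtain v where v: "v \<noteq> 0" "\<And>x. x \<in> convex hull (X ` I) ==> 0 \<le> v \<bullet> x"
  using exists_halfspace_if_not_interior[OF convex_convex_hull 0] by blast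
 define w where "w = v /\<^sub>R norm v"
 have w: "norm w = 1" "0 \<le> w \<bullet> X i" if "i \<in> I" for i
  using v(1) v(2)[of "X i"] that by (simp_all add: w_def hull_inc)
 have "norm w = 1" using v(1) by (simp add: w_def)
 then obtain u where u: "u \<in> U" "dist u w < 1 / 2" using U by fastforce
 have "(- 2 *\<^sub>R u) \<bullet> X i < 1" if i: "i \<in> I" for i
 proof -
  have "(w - u) \<bullet> X i \<le> norm (w - u) * norm (X i)" by (rule norm_cauchy_schwarz)
  also have "\<dots> < 1 / 2" using u(2) X[OF i] by (simp add: dist_norm norm_minus_commute)
  finally show ?thesis using w(2)[OF i] by (simp add: inner_diff_left)
 qed
 then show ?thesis using u(1) by blast
qed

section \<open>Second-order expansion of the contribution of one facet\<close>

definition squared_distances :: "'a::euclidean_space set => real" where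
 "squared_distances A = (\<Sum>x\<in>A. \<Sum>y\<in>A. (norm (x - y))\<^sup>2)"

text \<open>One minus the squared distance of the hyperplane from the origin, about twice the height
  of a shallow cap. In the chart with normal (1, z) it is |z|^2 / (1 + |z|^2).\<close>

definition depth :: "'a::euclidean_space set => real" where
 "depth A = 1 - 1 / (norm (plane_normal A))\<^sup>2"

definition near_term :: "real => 'a::euclidean_space set => real" where
 "near_term p A = simplex_det A * (squared_distances A / (4 * (real DIM('a) + 1)) - p / 2 * depth A) / fact (DIM('a) - 1)"

lemma plane_normal_ge_1:
 fixes A :: "'a::euclidean_space set"
 assumes A: "independent A" "card A = DIM('a)" and unit: "\<And>x. x \<in> A ==> norm x = 1"
 shows "norm (plane_normal A) \<ge> 1"
proof -
 obtain x where x: "x \<in> A" using basis_span(3)[OF A] by blast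
 have "1 \<le> norm (plane_normal A) * norm x"
  using norm_cauchy_schwarz[of "plane_normal A" x] plane_normal_inner(1)[OF A x] by simp
 then show ?thesis using unit[OF x] by simp
qed

lemma sphere_cap_bounds:
 fixes A :: "'a::euclidean_space set"
 assumes A: "independent A" "card A = DIM('a)" and unit: "\<And>x. x \<in> A ==> norm x = 1" and p: "p \<le> 1"
 defines "V \<equiv> DIM('a) * measure lborel (cball 0 1 :: 'a set)"
 shows "\<bar>DIM('a) * measure lborel (cball 0 1 \<inter> simplicial_cone A) - facet_term p A\<bar> \<le> V"
proof -
 have fA: "finite A" by (rule basis_span[OF A])
 have ad: "aff_dim A = int DIM('a) - 1"
 proof -
  have "aff_dim A = aff_dim {z. plane_normal A \<bullet> z = 1}" unfolding plane_normal_inner(2)[OF A, symmetric] by simp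
  then show ?thesis using plane_normal_inner(3)[OF A] by simp
 qed
 let ?f = "DIM('a) * measure lborel (cball 0 1 \<inter> simplicial_cone A)"
 have "facet_term p A \<le> V" unfolding V_def using unit by (intro facet_term_le[OF fA ad _ p]) auto
 moreover have "facet_term p A \<ge> 0" by (rule facet_term_nonneg)
 moreover have "?f \<le> V"
  unfolding V_def
 proof (intro mult_left_mono measure_mono_fmeasurable)
  show "cball 0 1 \<in> fmeasurable (lborel :: 'a measure)"
   by (intro fmeasurableI emeasure_bounded_finite) auto
  show "cball 0 1 \<inter> simplicial_cone A \<in> sets lborel" using borel_simplicial_cone[OF fA] by simp
 qed auto
 moreover have "?f \<ge> 0" by simp
 ultimately show ?thesis by linarith
qed

text \<open>Cone and facet terms share the leading value \<open>simplex_det A\<close> / (n - 1)!,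
  which cancels. Their first corrections make up \<open>near_term\<close>, and both remainders are
  quadratic in the depth.\<close>

lemma cap_difference_estimate:
 "\<exists>K\<ge>0. \<forall>A::'a::euclidean_space set. independent A \<longrightarrow> card A = DIM('a) \<longrightarrow> (\<forall>x\<in>A. norm x = 1) \<longrightarrow> norm (plane_normal A) \<le> 2 \<longrightarrow>
   \<bar>DIM('a) * measure lborel (cball 0 1 \<inter> simplicial_cone A) - facet_term p A - near_term p A\<bar> \<le> K * (simplex_det A * (depth A)\<^sup>2)"
proof -
 obtain C where C: "C \<ge> 0" "\<And>z. z \<in> {0..3/4} ==> \<bar>(1 - z) powr (- p / 2) - (1 + p / 2 * z)\<bar> \<le> C * z\<^sup>2"
  using powr_second_order[of p] by blast
 let ?f = "fact (DIM('a) - 1) :: real"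
 let ?K = "(18 * 4 ^ DIM('a) + C) / ?f"
 let ?g = "%A. cball 0 1 \<inter> simplicial_cone A"
 show ?thesis
 proof (intro exI[of _ ?K] conjI allI impI)
  fix A :: "'a set" assume A: "independent A" "card A = DIM('a)" and unit: "\<forall>x\<in>A. norm x = 1" and small: "norm (plane_normal A) \<le> 2"
  define r where "r = norm (plane_normal A)"
  define z where "z = depth A"
  define D where "D = simplex_det A"
  define Q where "Q = squared_distances A / (4 * (real DIM('a) + 1))"
  define v where "v = fact DIM('a) * measure lborel (?g A)"
  have r: "1 \<le> r" "r \<le> 2" using plane_normal_ge_1[OF A] unit small by (auto simp: r_def)
  have zr: "z = 1 - 1 / r\<^sup>2" by (simp add: z_def depth_def r_def)
  have r2: "1 \<le> r\<^sup>2" "r\<^sup>2 \<le> 4" using power_mono[of 1 r 2] power_mono[of r 2 2] r by auto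
  have "r\<^sup>2 > 0" using r2 by linarith
  then have "1 / 4 \<le> 1 / r\<^sup>2" "1 / r\<^sup>2 \<le> 1" using r2 by (simp_all add: pos_le_divide_eq pos_divide_le_eq)
  then have z: "z \<in> {0..3/4}" by (simp add: zr)
  have D: "D \<ge> 0" unfolding D_def by (rule simplex_det_nonneg)
  note ce = cone_estimate[OF A bspec[OF unit] small, folded squared_distances_def depth_def, folded z_def D_def Q_def v_def]
  have pw: "(1 - z) powr (- p / 2) = r powr p"
  proof -
   have "(1 - z) powr (- p / 2) = (r powr (- 2)) powr (- p / 2)" using r(1) by (simp add: zr powr_minus_divide powr_realpow)
   also have "\<dots> = r powr p" by (simp add: powr_powr)
   finally show ?thesis .
  qed
  have ft: "facet_term p A = r powr p * D / ?f" unfolding facet_term_basis[OF A] r_def D_def ..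
  have vf: "DIM('a) * measure lborel (?g A) = v / ?f"
   using fact_reduce[of "DIM('a)", where 'a=real] DIM_positive[where 'a='a] by (simp add: v_def)
  have b1: "\<bar>v - D * (1 + Q)\<bar> \<le> 18 * 4 ^ DIM('a) * (D * z\<^sup>2)"
   using ce by (simp add: algebra_simps abs_le_iff)
  have b2: "\<bar>D * (r powr p) - D * (1 + p / 2 * z)\<bar> \<le> C * (D * z\<^sup>2)"
  proof -
   have "\<bar>D * (r powr p) - D * (1 + p / 2 * z)\<bar> = D * \<bar>r powr p - (1 + p / 2 * z)\<bar>"
    unfolding right_diff_distrib[symmetric] abs_mult using D by simp
   also have "\<dots> \<le> D * (C * z\<^sup>2)" using C(2)[OF z] D unfolding pw by (rule mult_left_mono)
   finally show ?thesis by (simp add: mult_ac)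
  qed
  have "v / ?f - r powr p * D / ?f - near_term p A = ((v - D * (1 + Q)) - (D * (r powr p) - D * (1 + p / 2 * z))) / ?f"
   unfolding near_term_def D_def[symmetric] Q_def[symmetric] z_def[symmetric] by (simp add: field_simps)
  also have "\<bar>\<dots>\<bar> = \<bar>(v - D * (1 + Q)) - (D * (r powr p) - D * (1 + p / 2 * z))\<bar> / ?f" by simp
  also have "\<dots> \<le> (18 * 4 ^ DIM('a) * (D * z\<^sup>2) + C * (D * z\<^sup>2)) / ?f"
   by (rule divide_right_mono) (use b1 b2 in linarith, simp)
  also have "\<dots> = ?K * (D * z\<^sup>2)" by (simp add: algebra_simps)
  finally show "\<bar>DIM('a) * measure lborel (?g A) - facet_term p A - near_term p A\<bar> \<le> ?K * (simplex_det A * (depth A)\<^sup>2)"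
   unfolding vf ft D_def z_def .
 qed (use C(1) in simp)
qed

definition near :: "'a::euclidean_space set => real" where
 "near A = (if 1 \<le> norm (plane_normal A) \<and> norm (plane_normal A) < 2 then 1 else 0)"

definition far :: "'a::euclidean_space set => real" where
 "far A = (if 2 \<le> norm (plane_normal A) then 1 else 0)"

text \<open>The cones tile the ball only when the origin is interior. Otherwise crude bounds are
  used: V for the sphere, at most V per index set for the surface area, and at most V per index set
  beyond the listed error for the main term, which explains the factor 1 + 2 card.\<close>

lemma Lp_difference_pointwise:
 fixes p :: real
 assumes p: "p \<le> 1"
 defines "V \<equiv> DIM('a) * measure lborel (cball 0 1 :: 'a::euclidean_space set)"
 shows "\<exists>K\<ge>0. \<forall>(X::'i => 'a) I. finite I \<longrightarrow> general_position X I \<longrightarrow> (\<forall>i\<in>I. norm (X i) = 1) \<longrightarrow>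
  \<bar>V - Lp_surface_area p (convex hull (X ` I)) - (\<Sum>J | J \<subseteq> I \<and> card J = DIM('a). (if below_plane X I J then 1 else 0) * (near (X ` J) * near_term p (X ` J)))\<bar>
  \<le> (\<Sum>J | J \<subseteq> I \<and> card J = DIM('a). (if below_plane X I J then 1 else 0) * (K * (near (X ` J) * (simplex_det (X ` J) * (depth (X ` J))\<^sup>2)) + V * far (X ` J)))
   + (if 0 \<in> interior (convex hull (X ` I)) then 0 else (1 + 2 * real (card {J. J \<subseteq> I \<and> card J = DIM('a)})) * V)"
proof -
 obtain K where K: "K \<ge> 0" "\<And>A::'a set. independent A ==> card A = DIM('a) ==> (\<forall>x\<in>A. norm x = 1) ==> norm (plane_normal A) \<le> 2 ==>
   \<bar>DIM('a) * measure lborel (cball 0 1 \<inter> simplicial_cone A) - facet_term p A - near_term p A\<bar> \<le> K * (simplex_det A * (depth A)\<^sup>2)"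
  using cap_difference_estimate[of p, where 'a='a] by blast
 have V0: "V \<ge> 0" by (simp add: V_def)
 show ?thesis
 proof (intro exI[of _ K] conjI allI impI)
  fix X :: "'i => 'a" and I assume I: "finite I" and gp: "general_position X I" and unit: "\<forall>i\<in>I. norm (X i) = 1"
  define S where "S = {J. J \<subseteq> I \<and> card J = DIM('a)}"
  define b where "b J = (if below_plane X I J then 1 else 0 :: real)" for J
  have b01: "0 \<le> b J" "b J \<le> 1" for J by (auto simp: b_def)
  define m where "m J = DIM('a) * measure lborel (cball 0 1 \<inter> simplicial_cone (X ` J))" for J
  define M where "M J = near (X ` J) * near_term p (X ` J)" for J
  define R where "R J = K * (near (X ` J) * (simplex_det (X ` J) * (depth (X ` J))\<^sup>2)) + V * far (X ` J)" for J
  have basis: "independent (X ` J)" "card (X ` J) = DIM('a)" "\<forall>x\<in>X ` J. norm x = 1" "aff_dim (X ` J) = int DIM('a) - 1" if "J \<in> S" for J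
   using general_position_basis[OF I gp, of J] general_position_aff_dim[OF I gp, of J] that unit by (auto simp: S_def)
  have dV: "\<bar>m J - facet_term p (X ` J)\<bar> \<le> V" if "J \<in> S" for J
   unfolding m_def V_def using basis[OF that] by (intro sphere_cap_bounds p) auto
  have each: "\<bar>m J - facet_term p (X ` J) - M J\<bar> \<le> R J" if J: "J \<in> S" for J
  proof (cases "norm (plane_normal (X ` J)) < 2")
   case True
   moreover have "1 \<le> norm (plane_normal (X ` J))" using basis[OF J] by (intro plane_normal_ge_1) auto
   ultimately show ?thesis using K(2)[OF basis(1-3)[OF J]] by (simp add: M_def R_def m_def near_def far_def)
  next
   case False
   then show ?thesis using dV[OF J] by (simp add: M_def R_def near_def far_def)
  qed
  have "Lp_surface_area p (convex hull (X ` I)) = (\<Sum>J\<in>S. (if one_sided (affine hull (X ` J)) (X ` (I - J)) then 1 else 0) * facet_term p (X ` J))"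
   unfolding S_def by (rule Lp_surface_area_general_position[OF I gp])
  note Lp = this
  show "\<bar>V - Lp_surface_area p (convex hull (X ` I)) - (\<Sum>J | J \<subseteq> I \<and> card J = DIM('a). (if below_plane X I J then 1 else 0) * (near (X ` J) * near_term p (X ` J)))\<bar>
  \<le> (\<Sum>J | J \<subseteq> I \<and> card J = DIM('a). (if below_plane X I J then 1 else 0) * (K * (near (X ` J) * (simplex_det (X ` J) * (depth (X ` J))\<^sup>2)) + V * far (X ` J)))
   + (if 0 \<in> interior (convex hull (X ` I)) then 0 else (1 + 2 * real (card {J. J \<subseteq> I \<and> card J = DIM('a)})) * V)"
   unfolding S_def[symmetric] b_def[symmetric] M_def[symmetric] R_def[symmetric]
  proof (cases "0 \<in> interior (convex hull (X ` I))")
   case True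
   then have 0: "0 \<in> convex hull (X ` I)" using interior_subset by blast
   have "Lp_surface_area p (convex hull (X ` I)) = (\<Sum>J\<in>S. b J * facet_term p (X ` J))"
    unfolding Lp b_def using general_position_one_sided[OF I gp _ _ 0] by (intro sum.cong) (auto simp: S_def)
   moreover have "V = (\<Sum>J\<in>S. b J * m J)"
    unfolding V_def cone_tiling[OF I gp True] S_def b_def m_def by (simp add: sum_distrib_left mult_ac)
   ultimately have "V - Lp_surface_area p (convex hull (X ` I)) - (\<Sum>J\<in>S. b J * M J) = (\<Sum>J\<in>S. b J * (m J - facet_term p (X ` J) - M J))"
    by (simp add: sum_subtractf right_diff_distrib)
   also have "\<bar>\<dots>\<bar> \<le> (\<Sum>J\<in>S. b J * R J)"
    using each b01 by (intro order_trans[OF sum_abs] sum_mono) (simp add: abs_mult mult_left_mono)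
   finally show "\<bar>V - Lp_surface_area p (convex hull (X ` I)) - (\<Sum>J\<in>S. b J * M J)\<bar> \<le> (\<Sum>J\<in>S. b J * R J) + (if 0 \<in> interior (convex hull (X ` I)) then 0 else (1 + 2 * real (card S)) * V)"
    using True by simp
  next
   case False
   have ftb: "0 \<le> facet_term p (X ` J)" "facet_term p (X ` J) \<le> V" if "J \<in> S" for J
   proof -
    have "finite (X ` J)" using that I finite_subset by (auto simp: S_def)
    then show "facet_term p (X ` J) \<le> V" unfolding V_def using basis[OF that] by (intro facet_term_le p) auto
   qed (rule facet_term_nonneg)
   have "0 \<le> Lp_surface_area p (convex hull (X ` I))"
    unfolding Lp using ftb by (intro sum_nonneg) auto
   moreover have "Lp_surface_area p (convex hull (X ` I)) \<le> (\<Sum>J\<in>S. V)"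
    unfolding Lp using ftb V0 by (intro sum_mono) auto
   moreover have "\<bar>\<Sum>J\<in>S. b J * M J\<bar> \<le> (\<Sum>J\<in>S. b J * R J + V)"
   proof (intro order_trans[OF sum_abs] sum_mono)
    fix J assume J: "J \<in> S"
    have "\<bar>M J\<bar> \<le> R J + V" using each[OF J] dV[OF J] by linarith
    then have "b J * \<bar>M J\<bar> \<le> b J * (R J + V)" using b01 by (intro mult_left_mono) auto
    also have "\<dots> \<le> b J * R J + V" using V0 b01[of J] by (simp add: distrib_left mult_left_le_one_le)
    finally show "\<bar>b J * M J\<bar> \<le> b J * R J + V" using b01 by (simp add: abs_mult)
   qed
   ultimately show "\<bar>V - Lp_surface_area p (convex hull (X ` I)) - (\<Sum>J\<in>S. b J * M J)\<bar> \<le> (\<Sum>J\<in>S. b J * R J) + (if 0 \<in> interior (convex hull (X ` I)) then 0 else (1 + 2 * real (card S)) * V)"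
    using False V0 by (simp add: sum.distrib algebra_simps)
  qed
 qed (rule K(1))
qed

section \<open>Integrating out the other sample points\<close>

context sphere_sample
begin

text \<open>In the chart around a point of the hyperplane, membership in the hyperplane is a linear equation.\<close>

lemma sphere_hyperplane_null:
 assumes a: "a \<noteq> 0"
 shows "(\<integral>\<^sup>+x. indicator {z. a \<bullet> z = b} x \<partial>(sphere_measure :: 'a measure)) = 0"
proof (cases "\<exists>v. norm v = 1 \<and> a \<bullet> v = b")
 case False
 then have "(\<integral>\<^sup>+x. indicator {z. a \<bullet> z = b} x \<partial>(sphere_measure :: 'a measure)) = (\<integral>\<^sup>+x. 0 \<partial>(sphere_measure :: 'a measure))"
  by (intro nn_integral_cong) (auto simp: indicator_def)
 then show ?thesis by simp
next
 case True
 then obtain v where v: "norm v = 1" "a \<bullet> v = b" by blast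
 obtain T :: "real \<times> (real, 'm) vec => 'a" where T: "linear T" "\<And>x. norm (T x) = norm x" and Tv: "T (1, 0) = v"
  using ex_tangent_isometry[OF v(1)] by blast
 define c where "c = (- (a \<bullet> T (1, 0)), snd (adjoint T a))"
 have Ta: "a \<bullet> T (s, y) = s * (a \<bullet> T (1, 0)) + snd (adjoint T a) \<bullet> y" for s y
 proof -
  have "a \<bullet> T (s, y) = adjoint T a \<bullet> (s, y)" using adjoint_works[OF T(1), of "(s, y)" a] by (simp add: inner_commute)
  moreover have "a \<bullet> T (1, 0) = fst (adjoint T a)"
   using adjoint_works[OF T(1), of "(1, 0)" a] by (simp add: inner_commute inner_prod_def)
  ultimately show ?thesis by (simp add: inner_prod_def mult.commute)
 qed
 have c0: "c \<noteq> 0"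
 proof
  assume "c = 0"
  then have "a \<bullet> T x = 0" for x using Ta[of "fst x" "snd x"] by (simp add: c_def zero_prod_def)
  moreover obtain S :: "'a => real \<times> (real, 'm) vec" where "linear S" "\<And>x. norm (S x) = norm x"
   using ex_isometry_to_unit[of "0 :: 'a" "0 :: real \<times> (real, 'm) vec"] dim by auto
  moreover have "range T = UNIV"
  proof -
   have "inj T" using T by (metis linear_injective_0 norm_eq_zero)
   then have "dim (range T) = DIM('a)" using dim_image_eq[OF T(1), of UNIV] dim by simp
   then show ?thesis using T(1) by (metis dim_eq_full linear_subspace_image span_eq_iff subspace_UNIV)
  qed
  ultimately have "a \<bullet> a = 0" by (metis rangeE UNIV_I)
  then show False using a by simp
 qed
 have AE: "AE p in lborel. c \<bullet> p \<noteq> 0" by (rule AE_lborel_inner_neq[OF c0])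
 have "(\<integral>\<^sup>+x. indicator {z. a \<bullet> z = b} x \<partial>(sphere_measure :: 'a measure))
  = (\<integral>\<^sup>+p. ennreal (chord_weight 1 (fst p) (snd p)) * indicator {z. a \<bullet> z = b} (T (chord_point (fst p) (snd p))) \<partial>lborel)"
  using dim by (intro nn_integral_sphere_chord[OF T]) auto
 also have "\<dots> = (\<integral>\<^sup>+p. 0 \<partial>(lborel :: (real \<times> (real, 'm) vec) measure))"
 proof (rule nn_integral_cong_AE)
  show "AE p in lborel. ennreal (chord_weight 1 (fst p) (snd p)) * indicator {z. a \<bullet> z = b} (T (chord_point (fst p) (snd p))) = 0"
   using AE
  proof eventually_elim
   case (elim p)
   obtain s y where p: "p = (s, y)" by (cases p)
   show ?case
   proof (cases "s > 0")
    case True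
    define q where "q = (norm y)\<^sup>2 + s\<^sup>2"
    have q: "q > 0" using True by (simp add: q_def add_nonneg_pos)
    have "a \<bullet> T (chord_point s y) = ((norm y)\<^sup>2 - s\<^sup>2) / q * b + 2 * s / q * (snd (adjoint T a) \<bullet> y)"
     using True by (simp add: chord_point_def Ta q_def[symmetric] Tv v(2))
    moreover have "((norm y)\<^sup>2 - s\<^sup>2) / q = 1 - 2 * s / q * s"
    proof -
     have "(norm y)\<^sup>2 - s\<^sup>2 = q - 2 * s * s" by (simp add: q_def power2_eq_square)
     then show ?thesis using q by (simp only: diff_divide_distrib) simp
    qed
    \<comment> \<open>The chord point misses the plane by the positive factor 2 s / q times c
      \<bullet> p.\<close>
    ultimately have "a \<bullet> T (chord_point s y) = b + 2 * s / q * (snd (adjoint T a) \<bullet> y - s * b)"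
     by (simp only:) (simp add: algebra_simps)
    moreover have "snd (adjoint T a) \<bullet> y - s * b \<noteq> 0" using elim by (simp add: c_def p inner_prod_def Tv v(2) mult.commute)
    ultimately have "a \<bullet> T (chord_point s y) \<noteq> b" using True q by simp
    then show ?thesis by (simp add: p)
   qed (simp add: p chord_weight_def)
  qed
 qed
 finally show ?thesis by simp
qed

lemma P_hyperplane_null:
 assumes a: "a \<noteq> 0"
 shows "(\<integral>\<^sup>+x. indicator {z. a \<bullet> z = b} x \<partial>P) = 0"
proof -
 have m: "(%x. indicator {z. a \<bullet> z = b} x :: ennreal) \<in> borel_measurable borel"
  by (intro borel_measurable_indicator borel_closed closed_hyperplane)
 have "(\<integral>\<^sup>+x. indicator {z. a \<bullet> z = b} x \<partial>P) = (\<integral>\<^sup>+x. ennreal (F x) * indicator {z. a \<bullet> z = b} x \<partial>sphere_measure)"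
  by (rule nn_integral_P[OF measurable_P[OF m]])
 also have "\<dots> \<le> (\<integral>\<^sup>+x. ennreal hi * indicator {z. a \<bullet> z = b} x \<partial>sphere_measure)"
  by (intro nn_integral_mono mult_right_mono ennreal_leI F_hi) auto
 also have "\<dots> = ennreal hi * (\<integral>\<^sup>+x. indicator {z. a \<bullet> z = b} x \<partial>sphere_measure)"
  by (rule nn_integral_cmult) (rule measurable_sphere_measure[OF m])
 finally show ?thesis using sphere_hyperplane_null[OF a] by simp
qed

lemma measurable_sample: "j \<in> K ==> (%X. X j) \<in> borel_measurable (PiM K (%_. P))"
 using measurable_compose[OF measurable_component_singleton[of j K "%_. P"] measurable_P[of "%x. x"]] by simp

text \<open>The set Z serves both halves of general position, as with Z = {0} the affine hull is a
  linear span. For fixed other points this hull lies in a hyperplane, which P does not charge, and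
  the j-th point is integrated over.\<close>

lemma AE_not_in_affine_hull:
 fixes Z :: "'a set" and K :: "nat set"
 assumes K: "finite K" "j \<in> K" "L \<subseteq> K - {j}" and Z: "Z = {} \<or> Z = {0}" and card: "card Z + card L \<le> DIM('a)"
 shows "AE X in PiM K (%_. P). X j \<notin> affine hull (Z \<union> X ` L)"
proof (cases "Z = {} \<and> L = {}")
 case True
 then show ?thesis by simp
next
 case False
 have fL: "finite L" using K finite_subset by blast
 define I where "I = (if Z = {} then Some ` L else insert None (Some ` L))"
 define x where "x i X = (case i of None => 0 | Some l => X l)" for i and X :: "nat => 'a"
 have im: "(%i. x i X) ` I = Z \<union> X ` L" for X using Z by (auto simp: I_def x_def image_image)
 let ?f = "%_. P"
 have xm: "x i \<in> borel_measurable (PiM K ?f)" if "i \<in> I" for i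
  using that K measurable_sample[of _ K] unfolding x_def I_def by (auto split: if_splits option.splits)
 have dm: "(%X. infdist (X j) (affine hull (Z \<union> X ` L))) \<in> borel_measurable (PiM K ?f)"
  unfolding im[symmetric] using fL by (intro measurable_infdist_affine_hull xm measurable_sample K) (auto simp: I_def)
 define g where "g X = (if infdist (X j) (affine hull (Z \<union> X ` L)) = 0 then 1 else 0 :: ennreal)" for X
 have gm: "g \<in> borel_measurable (PiM K ?f)" unfolding g_def using dm by measurable
 have K': "insert j (K - {j}) = K" using K by blast
 let ?g = "%X. \<integral>\<^sup>+y. g (X(j := y)) \<partial>P"
 have "(\<integral>\<^sup>+X. g X \<partial>PiM (insert j (K - {j})) ?f) = (\<integral>\<^sup>+X. ?g X \<partial>PiM (K - {j}) ?f)"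
 proof (rule PP.product_nn_integral_insert)
  show "finite (K - {j})" "j \<notin> K - {j}" using K(1) by auto
  show "g \<in> borel_measurable (PiM (insert j (K - {j})) ?f)" unfolding K' by (rule gm)
 qed
 also have "\<dots> = (\<integral>\<^sup>+X. 0 \<partial>PiM (K - {j}) ?f)"
 proof (rule nn_integral_cong)
  fix X :: "nat => 'a"
  let ?S = "Z \<union> X ` L"
  have fS: "finite ?S" using Z fL by auto
  have "card ?S \<le> card Z + card L" using card_Un_le[of Z "X ` L"] card_image_le[OF fL, of X] by linarith
  then have "aff_dim ?S < int DIM('a)" using aff_dim_le_card[OF fS] card by linarith
  then obtain a b where a: "a \<noteq> 0" "?S \<subseteq> {x. a \<bullet> x = b}" by (rule aff_lowdim_subset_hyperplane)
  have sub: "affine hull ?S \<subseteq> {x. a \<bullet> x = b}" using a(2) affine_hyperplane by (rule hull_minimal)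
  have ne: "affine hull ?S \<noteq> {}" using False Z by auto
  have "?g X \<le> (\<integral>\<^sup>+y. indicator {x. a \<bullet> x = b} y \<partial>P)"
  proof (rule nn_integral_mono)
   fix y
   have "(X(j := y)) ` L = X ` L" using K by auto
   then have e: "g (X(j := y)) = (if infdist y (affine hull ?S) = 0 then 1 else 0)" by (simp add: g_def)
   show "g (X(j := y)) \<le> indicator {x. a \<bullet> x = b} y"
    unfolding e using sub in_closed_iff_infdist_zero[OF closed_affine_hull ne, of y] by (auto simp: indicator_def)
  qed
  then show "?g X = 0" using P_hyperplane_null[OF a(1), of b] by simp
 qed
 finally have "(\<integral>\<^sup>+X. g X \<partial>PiM K ?f) = 0" unfolding K' by simp
 then have "AE X in PiM K ?f. g X = 0" using nn_integral_0_iff_AE[OF gm] by simp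
 then show ?thesis
 proof eventually_elim
  case (elim X)
  then show ?case by (auto simp: g_def split: if_splits)
 qed
qed

lemma AE_general_position:
 assumes K: "finite K"
 shows "AE X in PiM K (%_. P). general_position X (K :: nat set)"
proof -
 let ?f = "%_. P"
 have "AE X in PiM K ?f. \<forall>L\<in>Pow K. \<forall>j\<in>K - L. (card L < DIM('a) \<longrightarrow> X j \<notin> span (X ` L)) \<and> (card L = DIM('a) \<longrightarrow> X j \<notin> affine hull (X ` L))"
 proof (intro AE_finite_allI AE_conjI)
  fix L j assume L: "L \<in> Pow K" and j: "j \<in> K - L"
  have s: "span (X ` L) = affine hull ({0} \<union> X ` L)" for X :: "nat => 'a"
   using affine_hull_span_0[of "insert 0 (X ` L)"] by (simp add: hull_inc span_insert_0)
  show "AE X in PiM K ?f. card L < DIM('a) \<longrightarrow> X j \<notin> span (X ` L)"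
  proof (cases "card L < DIM('a)")
   case True
   have "AE X in PiM K ?f. X j \<notin> affine hull ({0} \<union> X ` L)"
    using L j True by (intro AE_not_in_affine_hull K) auto
   then show ?thesis by eventually_elim (simp add: s)
  qed simp
  show "AE X in PiM K ?f. card L = DIM('a) \<longrightarrow> X j \<notin> affine hull (X ` L)"
  proof (cases "card L = DIM('a)")
   case True
   have "AE X in PiM K ?f. X j \<notin> affine hull ({} \<union> X ` L)"
    using L j True by (intro AE_not_in_affine_hull K) auto
   then show ?thesis by eventually_elim simp
  qed simp
 qed (use K in auto)
 then show ?thesis by eventually_elim (auto simp: general_position_def)
qed

text \<open>The rate of \<open>below_le_exp\<close> at |a| = 2, where sqrt (|a|^2 - 1) = sqrt
  3.\<close>

definition far_rate :: real where
 "far_rate = lo * unit_ball_vol CARD('m) / 2 ^ DIM('a) * sqrt 3 ^ CARD('m)"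

lemma far_rate_pos: "far_rate > 0"
 unfolding far_rate_def using lo_pos by simp

text \<open>Shrinking the normal to length 2 enlarges the region below the plane.\<close>

lemma below_le_exp_far:
 assumes a: "norm a \<ge> 2"
 shows "below a ^ k \<le> exp (- (real k * far_rate))"
proof -
 define a' where "a' = (2 / norm a) *\<^sub>R a"
 have a': "norm a' = 2" using a by (auto simp: a'_def)
 have "below a \<le> below a'"
  unfolding below_def
 proof (rule P.finite_measure_mono)
  show "{z \<in> sphere 0 1. a \<bullet> z < 1} \<subseteq> {z \<in> sphere 0 1. a' \<bullet> z < 1}"
  proof safe
   fix z assume z: "a \<bullet> z < 1"
   show "a' \<bullet> z < 1"
   proof (cases "a \<bullet> z \<le> 0")
    case True
    then have "2 / norm a * (a \<bullet> z) \<le> 0" by (intro mult_nonneg_nonpos) auto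
    then show ?thesis by (simp add: a'_def)
   next
    case False
    then have "2 / norm a * (a \<bullet> z) \<le> 1 * (a \<bullet> z)" using a by (intro mult_right_mono) (auto simp: divide_le_eq)
    then show ?thesis using z by (simp add: a'_def)
   qed
  qed
  have "{z \<in> sphere 0 1. a' \<bullet> z < 1} = space P - {z. a' \<bullet> z \<ge> 1} \<inter> sphere 0 1" by auto
  also have "\<dots> \<in> sets P" using cap_sets[of a'] by (rule sets.compl_sets)
  finally show "{z \<in> sphere 0 1. a' \<bullet> z < 1} \<in> sets P" .
 qed
 then have "below a ^ k \<le> below a' ^ k" using below_bounds by (intro power_mono) auto
 also have "\<dots> \<le> exp (- (real k * (lo * unit_ball_vol CARD('m) / 2 ^ DIM('a) * sqrt ((norm a')\<^sup>2 - 1) ^ CARD('m))))"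
  using a' by (intro below_le_exp) auto
 also have "\<dots> = exp (- (real k * far_rate))" by (simp add: a' far_rate_def)
 finally show ?thesis .
qed

lemma nn_integral_below: "(\<integral>\<^sup>+z. indicator {z. a \<bullet> z < 1} z \<partial>P) = ennreal (below a)"
proof -
 have "(\<integral>\<^sup>+z. indicator {z. a \<bullet> z < 1} z \<partial>P) = (\<integral>\<^sup>+z. indicator {z \<in> sphere 0 1. a \<bullet> z < 1} z \<partial>P)"
  by (intro nn_integral_cong) (auto simp: indicator_def)
 also have "\<dots> = emeasure P {z \<in> sphere 0 1. a \<bullet> z < 1}"
 proof (rule nn_integral_indicator)
  have "{z \<in> sphere 0 1. a \<bullet> z < 1} = space P - {z. a \<bullet> z \<ge> 1} \<inter> sphere 0 1" by auto
  also have "\<dots> \<in> sets P" using cap_sets[of a] by (rule sets.compl_sets)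
  finally show "{z \<in> sphere 0 1. a \<bullet> z < 1} \<in> sets P" .
 qed
 finally show ?thesis by (simp add: below_def P.emeasure_eq_measure)
qed

lemma nn_integral_all_below:
 assumes R: "finite (R :: nat set)"
 shows "(\<integral>\<^sup>+Y. (\<Prod>i\<in>R. indicator {z. a \<bullet> z < 1} (Y i)) \<partial>PiM R (%_. P)) = ennreal (below a ^ card R)"
proof -
 have "(\<integral>\<^sup>+Y. (\<Prod>i\<in>R. indicator {z. a \<bullet> z < 1} (Y i)) \<partial>PiM R (%_. P)) = (\<Prod>i\<in>R. \<integral>\<^sup>+z. indicator {z. a \<bullet> z < 1} z \<partial>P)"
  by (intro PP.product_nn_integral_prod R measurable_P borel_measurable_indicator borel_open open_halfspace_lt)
 then show ?thesis by (simp add: nn_integral_below ennreal_power below_bounds)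
qed

lemma measurable_all_below:
 "(%Y. \<Prod>i\<in>R. indicator {z. a \<bullet> z < 1} (Y i) :: ennreal) \<in> borel_measurable (PiM R (%_. P))" for R :: "nat set"
 using measurable_sample[of _ R] by (intro borel_measurable_prod_ennreal) (auto intro!: borel_measurable_indicator' borel_open open_halfspace_lt)

lemma measurable_sample_plane_normal:
 assumes "J \<subseteq> K" "finite J"
 shows "(%X. plane_normal (X ` J)) \<in> borel_measurable (PiM K (%_. P))"
 using assms by (intro measurable_plane_normal measurable_sample) auto

lemma measurable_below_plane:
 fixes N :: nat
 assumes J: "J \<subseteq> {..<N}"
 shows "{X \<in> space (PiM {..<N} (%_. P)). below_plane X {..<N} J} \<in> sets (PiM {..<N} (%_. P))"
 unfolding below_plane_def
proof (rule sets.sets_Collect_finite_All)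
 have "finite J" using J finite_subset by blast
 note [measurable] = measurable_sample_plane_normal[OF J this]
 fix i assume "i \<in> {..<N} - J"
 then have "i \<in> {..<N}" by simp
 note [measurable] = measurable_sample[OF this]
 show "{X \<in> space (PiM {..<N} (%_. P)). plane_normal (X ` J) \<bullet> X i < 1} \<in> sets (PiM {..<N} (%_. P))" by measurable
qed simp

text \<open>The points outside J are independent of those in J and enter only by lying below the
  plane, which has a power of \<open>below\<close> as conditional probability. The bijection f
  labels the vertices other than j0 by the tangential indices; H need not be symmetric in
  them.\<close>

lemma sample_reduction:
 fixes f :: "'m => nat" and H :: "'a => ('m => 'a) => ennreal"
 assumes J: "J \<subseteq> {..<N}" and j0: "j0 \<in> J" and f: "bij_betw f UNIV (J - {j0})"
  and Hm: "(%p. H (fst p) (snd p)) \<in> borel_measurable (P \<Otimes>\<^sub>M PiM UNIV (%_. P))"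
 shows "(\<integral>\<^sup>+X. H (X j0) (%i. X (f i)) * (if below_plane X {..<N} J then 1 else 0) \<partial>PiM {..<N} (%_. P))
  = (\<integral>\<^sup>+v. (\<integral>\<^sup>+x. H v x * ennreal (below (plane_normal (insert v (range x))) ^ (N - card J)) \<partial>PiM UNIV (%_. P)) \<partial>P)"
proof -
 define R where "R = {..<N} - J"
 have fJ: "finite J" using J finite_subset by blast
 have JR: "J \<inter> R = {}" "J \<union> R = {..<N}" "finite R" using J by (auto simp: R_def)
 have cR: "card R = N - card J" using J fJ by (simp add: R_def card_Diff_subset)
 have Jf: "J = insert j0 (range f)" using f j0 by (auto simp: bij_betw_def)
 have injf: "inj f" using f by (auto simp: bij_betw_def)
 have im: "X ` J = insert (X j0) (range (%i. X (f i)))" for X :: "nat => 'a" unfolding Jf by auto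
 define h where "h X = H (X j0) (%i. X (f i))" for X
 let ?f = "%_. P"
 have toP: "(%X. (X j0, %i. X (f i))) \<in> measurable (PiM K ?f) (P \<Otimes>\<^sub>M PiM UNIV ?f)" if "J \<subseteq> K" for K
  using that Jf by (intro measurable_Pair measurable_PiM_single' measurable_component_singleton) (auto simp: space_PiM)
 have hm: "h \<in> borel_measurable (PiM K ?f)" if "J \<subseteq> K" for K
  using measurable_compose[OF toP[OF that] Hm] by (simp add: h_def[abs_def])
 note pm = measurable_sample_plane_normal[OF _ fJ]
 define b where "b X = (if below_plane X {..<N} J then 1 else 0 :: ennreal)" for X :: "nat => 'a"
 have bm: "b \<in> borel_measurable (PiM {..<N} ?f)"
  unfolding b_def using measurable_below_plane[OF J] by (intro measurable_If) auto
 let ?g = "%v f. \<integral>\<^sup>+X. h (X(j0 := v)) * ennreal (below (plane_normal (X(j0 := v) ` J)) ^ card R) \<partial>PiM (range f) ?f"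
 let ?h = "%X. \<integral>\<^sup>+Y. h (merge J R (X, Y)) * b (merge J R (X, Y)) \<partial>PiM R ?f"
 let ?p = "%v. \<integral>\<^sup>+x. H v x * ennreal (below (plane_normal (insert v (range x))) ^ (N - card J)) \<partial>PiM UNIV ?f"
 let ?q = "%X. below (plane_normal (X ` J)) ^ card R"
 let ?r = "%a. \<integral>\<^sup>+Y. (\<Prod>i\<in>R. indicator {z. a \<bullet> z < 1} (Y i)) \<partial>PiM R ?f"
 have "(\<integral>\<^sup>+X. h X * b X \<partial>PiM {..<N} ?f) = (\<integral>\<^sup>+X. ?h X \<partial>PiM J ?f)"
  unfolding JR(2)[symmetric] using hm[OF J] bm by (intro PP.product_nn_integral_fold JR fJ) (auto simp: JR(2))
 also have "\<dots> = (\<integral>\<^sup>+X. h X * ennreal (?q X) \<partial>PiM J ?f)"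
 proof (rule nn_integral_cong)
  fix X :: "nat => 'a"
  define a where "a = plane_normal (X ` J)"
  have mJ: "merge J R (X, Y) j = X j" if "j \<in> J" for j Y using that by (simp add: merge_def)
  have mR: "merge J R (X, Y) i = Y i" if "i \<in> R" for i Y using that JR(1) by (auto simp: merge_def)
  have imJ: "merge J R (X, Y) ` J = X ` J" for Y using mJ by (intro image_cong) auto
  have hX: "h (merge J R (X, Y)) = h X" for Y unfolding h_def using mJ Jf by (simp add: mJ)
  have bX: "b (merge J R (X, Y)) = (\<Prod>i\<in>R. indicator {z. a \<bullet> z < 1} (Y i))" for Y
   unfolding b_def below_plane_def R_def[symmetric] imJ a_def[symmetric] using JR(3) by (auto simp: mR indicator_def prod_zero_iff)
  have "?h X = h X * ?r a"
   unfolding hX bX by (rule nn_integral_cmult[OF measurable_all_below])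
  also have "?r a = ennreal (below a ^ card R)"
   by (rule nn_integral_all_below[OF JR(3)])
  finally show "?h X = h X * ennreal (?q X)"
   unfolding a_def .
 qed
 also have "\<dots> = (\<integral>\<^sup>+X. h X * ennreal (?q X) \<partial>PiM (insert j0 (range f)) ?f)"
  unfolding Jf[symmetric] ..
 also have "\<dots> = (\<integral>\<^sup>+v. ?g v f \<partial>P)"
 proof (rule PP.product_nn_integral_insert_rev)
  show "finite (range f)" by simp
  show "j0 \<notin> range f" using f by (auto simp: bij_betw_def)
  note [measurable] = hm[OF subset_refl] pm[OF subset_refl]
  show "(%X. h X * ennreal (?q X)) \<in> borel_measurable (PiM (insert j0 (range f)) ?f)"
   unfolding Jf[symmetric] by measurable
 qed
 also have "\<dots> = (\<integral>\<^sup>+v. ?p v \<partial>P)"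
 proof (rule nn_integral_cong)
  fix v assume "v \<in> space P"
  define G where "G x = H v x * ennreal (below (plane_normal (insert v (range x))) ^ (N - card J))" for x
  have Gm: "G \<in> borel_measurable (PiM UNIV ?f)"
  proof -
   have [measurable]: "H v \<in> borel_measurable (PiM UNIV ?f)"
    using measurable_compose[OF measurable_Pair1' Hm, of v] \<open>v \<in> space P\<close> by simp
   note [measurable] = measurable_insert_range(2)[OF _ measurable_sample_component, of "%_. v"]
   show ?thesis unfolding G_def by measurable
  qed
  have d: "distr (PiM (range f) ?f) (PiM UNIV ?f) (%X. \<lambda>i\<in>UNIV. X (f i)) = PiM UNIV ?f"
   by (rule distr_PiM_reindex[where K="range f" and I=UNIV and M="%_. P"]) (use injf prob_space_P in auto)
  have "(\<integral>\<^sup>+x. G x \<partial>PiM UNIV ?f) = (\<integral>\<^sup>+X. G (%i. X (f i)) \<partial>PiM (range f) ?f)"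
  proof -
   have rm: "(%X. \<lambda>i\<in>UNIV. X (f i)) \<in> measurable (PiM (range f) ?f) (PiM UNIV ?f)"
    by (intro measurable_restrict measurable_component_singleton) auto
   have "(\<integral>\<^sup>+x. G x \<partial>PiM UNIV ?f) = (\<integral>\<^sup>+X. G (\<lambda>i\<in>UNIV. X (f i)) \<partial>PiM (range f) ?f)"
    using nn_integral_distr[OF rm, unfolded d, OF Gm] .
   then show ?thesis by (simp only: restrict_UNIV)
  qed
  also have "\<dots> = ?g v f"
  proof (rule nn_integral_cong)
   fix X :: "nat => 'a"
   have "f i \<noteq> j0" for i using f by (auto simp: bij_betw_def)
   then have e: "(X(j0 := v)) (f i) = X (f i)" for i by simp
   show "G (%i. X (f i)) = h (X(j0 := v)) * ennreal (below (plane_normal (X(j0 := v) ` J)) ^ card R)"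
    unfolding G_def h_def im e cR by simp
  qed
  finally show "?g v f
   = ?p v"
   unfolding G_def by (rule sym)
 qed
 finally show ?thesis unfolding h_def b_def .
qed

end

section \<open>Moments of one candidate facet over the sample\<close>

lemma ex_bij_to_pair:
 fixes i0 :: "'m::finite"
 assumes J: "finite J" "card J = CARD('m) + 1" "j \<in> J" "l \<in> J" "j \<noteq> l"
 shows "\<exists>f. bij_betw f (UNIV :: 'm set) (J - {j}) \<and> f i0 = l"
proof -
 have "card (J - {j}) = CARD('m)" using J by simp
 then obtain g where g: "bij_betw g (UNIV :: 'm set) (J - {j})"
  using finite_same_card_bij[of "UNIV :: 'm set" "J - {j}"] J(1) by auto
 then obtain i1 where i1: "g i1 = l" using J by (metis DiffI bij_betw_imp_surj_on imageE singletonD)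
 have "bij_betw (Transposition.transpose i0 i1) UNIV UNIV" by (rule bij_transpose)
 from bij_betw_trans[OF this g] show ?thesis
  by (intro exI[of _ "g \<circ> Transposition.transpose i0 i1"]) (simp add: i1)
qed

context sphere_sample
begin

abbreviation "sample_space N \<equiv> PiM {..<N} (%_. P)"

definition weight :: "nat => nat set => (nat => 'a) => real" where
 "weight N J X = (if below_plane X {..<N} J then 1 else 0)"

lemma weight_measurable: "J \<subseteq> {..<N} ==> weight N J \<in> borel_measurable (sample_space N)"
 unfolding weight_def[abs_def] using measurable_below_plane[of J N] by (intro measurable_If) auto

lemma weight_bounds: "0 \<le> weight N J X" "weight N J X \<le> 1"
 by (simp_all add: weight_def)

text \<open>With DIM('a) in the place of N the functional has no power of \<open>below\<close>;
  integrating out the other points supplies it with exponent N - n.\<close>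

lemma moment_nn_integral:
 fixes f :: "'m => nat"
 assumes J: "J \<subseteq> {..<N}" "card J = DIM('a)" and j: "j \<in> J" and f: "bij_betw f UNIV (J - {j})"
 shows "(\<integral>\<^sup>+X. ennreal (weight N J X * simplex_functional k q DIM('a) (X j) (%i. X (f i))) \<partial>sample_space N) = sample_moment k q N"
proof -
 have "(\<integral>\<^sup>+X. ennreal (weight N J X * simplex_functional k q DIM('a) (X j) (%i. X (f i))) \<partial>sample_space N)
  = (\<integral>\<^sup>+X. ennreal (simplex_functional k q DIM('a) (X j) (%i. X (f i))) * (if below_plane X {..<N} J then 1 else 0) \<partial>sample_space N)"
  by (intro nn_integral_cong) (simp add: weight_def)
 also have "\<dots> = (\<integral>\<^sup>+v. (\<integral>\<^sup>+x. ennreal (simplex_functional k q DIM('a) v x) * ennreal (below (plane_normal (insert v (range x))) ^ (N - card J)) \<partial>PiM UNIV (%_. P)) \<partial>P)"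
  by (rule sample_reduction[OF J(1) j f simplex_functional_joint])
 also have "\<dots> = sample_moment k q N"
  unfolding sample_moment_def
 proof (intro nn_integral_cong)
  fix v x
  show "ennreal (simplex_functional k q DIM('a) v x) * ennreal (below (plane_normal (insert v (range x))) ^ (N - card J)) = ennreal (simplex_functional k q N v x)"
   using simplex_functional_nonneg[of k q "DIM('a)" v x] unfolding J(2) by (simp add: ennreal_mult'[symmetric] simplex_functional_def)
 qed
 finally show ?thesis .
qed

lemma moment_integral:
 fixes f :: "'m => nat"
 assumes J: "J \<subseteq> {..<N}" "card J = DIM('a)" and j: "j \<in> J" and f: "bij_betw f UNIV (J - {j})"
  and fin: "sample_moment k q N < top"
 shows "has_bochner_integral (sample_space N) (%X. weight N J X * simplex_functional k q DIM('a) (X j) (%i. X (f i))) (enn2real (sample_moment k q N))"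
proof (rule has_bochner_integral_nn_integral)
 have "f i \<in> {..<N}" for i using f J(1) by (auto simp: bij_betw_def)
 then have "(%X. simplex_functional k q DIM('a) (X j) (%i. X (f i))) \<in> borel_measurable (sample_space N)"
  using j J(1) by (intro simplex_functional_measurable measurable_sample) auto
 then show "(%X. weight N J X * simplex_functional k q DIM('a) (X j) (%i. X (f i))) \<in> borel_measurable (sample_space N)"
  using weight_measurable[OF J(1)] by measurable
 show "(\<integral>\<^sup>+X. ennreal (weight N J X * simplex_functional k q DIM('a) (X j) (%i. X (f i))) \<partial>sample_space N) = ennreal (enn2real (sample_moment k q N))"
  unfolding moment_nn_integral[OF J j f] using fin by simp
qed (auto intro!: AE_I2 mult_nonneg_nonneg weight_bounds simplex_functional_nonneg)

lemma simplex_functional_image: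
 fixes f :: "'m => nat"
 assumes j: "j \<in> J" and f: "bij_betw f UNIV (J - {j})"
 shows "simplex_functional k q DIM('a) (X j) (%i. X (f i)) =
  near (X ` J) * (simplex_det (X ` J) * depth (X ` J) ^ q * (\<Prod>i\<in>UNIV. ((norm (X j - X (f i)))\<^sup>2) ^ k i))"
proof -
 have "J = insert j (range f)" using f j by (auto simp: bij_betw_def)
 then have im: "insert (X j) (range (%i. X (f i))) = X ` J" by auto
 show ?thesis unfolding simplex_functional_def im near_def depth_def by simp
qed

lemma depth_moment:
 assumes J: "J \<subseteq> {..<N}" "card J = DIM('a)" and fin: "sample_moment (%_. 0) q N < top"
 shows "has_bochner_integral (sample_space N) (%X. weight N J X * (near (X ` J) * (simplex_det (X ` J) * depth (X ` J) ^ q))) (enn2real (sample_moment (%_. 0) q N))"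
proof -
 have "finite J" using J(1) finite_subset by blast
 obtain j l where jl: "j \<in> J" "l \<in> J" "j \<noteq> l"
 proof -
  have "\<not> card J \<le> Suc 0" using J(2) dim by simp
  then show thesis using that card_le_Suc0_iff_eq[OF \<open>finite J\<close>] by blast
 qed
 obtain f where f: "bij_betw f (UNIV :: 'm set) (J - {j})"
  using ex_bij_to_pair[OF \<open>finite J\<close> _ jl, where 'm='m] J(2) dim by auto
 show ?thesis using moment_integral[OF J jl(1) f fin] unfolding simplex_functional_image[OF jl(1) f] by simp
qed

text \<open>The labelling of the vertices can start at j and put l at the index i0, so all ordered
  pairs of distinct vertices have the same moment.\<close>

lemma distance_moment:
 fixes i0 :: 'm
 assumes J: "J \<subseteq> {..<N}" "card J = DIM('a)" and jl: "j \<in> J" "l \<in> J" "j \<noteq> l"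
  and fin: "sample_moment (%i. if i = i0 then 1 else 0) 0 N < top"
 shows "has_bochner_integral (sample_space N) (%X. weight N J X * (near (X ` J) * (simplex_det (X ` J) * (norm (X j - X l))\<^sup>2))) (enn2real (sample_moment (%i. if i = i0 then 1 else 0) 0 N))"
proof -
 have "finite J" using J(1) finite_subset by blast
 then obtain f where f: "bij_betw f (UNIV :: 'm set) (J - {j})" "f i0 = l"
  using ex_bij_to_pair[OF _ _ jl, of i0] J(2) dim by auto
 have "(\<Prod>i\<in>UNIV. ((norm (X j - X (f i)))\<^sup>2) ^ (if i = i0 then 1 else 0)) = (norm (X j - X l))\<^sup>2" for X :: "nat => 'a"
  by (subst prod.remove[of _ i0]) (auto simp: f(2) intro!: prod.neutral)
 then show ?thesis using moment_integral[OF J jl(1) f(1) fin] unfolding simplex_functional_image[OF jl(1) f(1)] by simp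
qed

lemma squared_distances_moment:
 fixes i0 :: 'm
 assumes J: "J \<subseteq> {..<N}" "card J = DIM('a)"
  and fin: "sample_moment (%i. if i = i0 then 1 else 0) 0 N < top"
 shows "has_bochner_integral (sample_space N) (%X. weight N J X * (near (X ` J) * (simplex_det (X ` J) * (\<Sum>j\<in>J. \<Sum>l\<in>J. (norm (X j - X l))\<^sup>2))))
  (real DIM('a) * (real DIM('a) - 1) * enn2real (sample_moment (%i. if i = i0 then 1 else 0) 0 N))"
proof -
 let ?m = "enn2real (sample_moment (%i. if i = i0 then 1 else 0) 0 N)"
 have fJ: "finite J" using J(1) finite_subset by blast
 let ?f = "\<Sum>j\<in>J. \<Sum>l\<in>J. if j = l then 0 else ?m"
 have "has_bochner_integral (sample_space N) (%X. \<Sum>j\<in>J. \<Sum>l\<in>J. weight N J X * (near (X ` J) * (simplex_det (X ` J) * (norm (X j - X l))\<^sup>2)))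
  ?f"
 proof (intro has_bochner_integral_sum)
  fix j l assume jl: "j \<in> J" "l \<in> J"
  show "has_bochner_integral (sample_space N) (%X. weight N J X * (near (X ` J) * (simplex_det (X ` J) * (norm (X j - X l))\<^sup>2))) (if j = l then 0 else ?m)"
   using distance_moment[OF J jl _ fin] by (cases "j = l") (simp_all add: has_bochner_integral_zero)
 qed
 moreover have "?f = real DIM('a) * (real DIM('a) - 1) * ?m"
 proof -
  have "(\<Sum>l\<in>J. if j = l then 0 else ?m) = (real DIM('a) - 1) * ?m" if "j \<in> J" for j
  proof -
   have "(\<Sum>l\<in>J. if j = l then 0 else ?m) = (\<Sum>l\<in>J - {j}. ?m)"
    using fJ that by (subst sum.remove[of _ j]) (auto intro!: sum.cong)
   then show ?thesis using that fJ J(2) DIM_positive[where 'a='a] by (simp add: of_nat_diff Suc_leI)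
  qed
  then show ?thesis using J(2) by simp
 qed
 ultimately show ?thesis by (simp add: sum_distrib_left)
qed

text \<open>On the far event the conditional probability that all other points lie below the plane
  is exponentially small, uniformly over the simplices.\<close>

lemma far_moment:
 assumes J: "J \<subseteq> {..<N}" "card J = DIM('a)"
 shows "integrable (sample_space N) (%X. weight N J X * far (X ` J))"
  and "(\<integral>X. weight N J X * far (X ` J) \<partial>sample_space N) \<le> exp (- (real (N - DIM('a)) * far_rate))"
proof -
 have fJ: "finite J" using J(1) finite_subset by blast
 interpret PN: prob_space "sample_space N" by (intro prob_space_PiM prob_space_P)
 have m: "(%X. weight N J X * far (X ` J)) \<in> borel_measurable (sample_space N)"
  using weight_measurable[OF J(1)] measurable_sample_plane_normal[OF J(1) fJ] unfolding far_def by measurable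
 show "integrable (sample_space N) (%X. weight N J X * far (X ` J))"
  by (rule PN.integrable_const_bound[where B=1, OF AE_I2 m]) (simp add: weight_def far_def)
 obtain j where j: "j \<in> J" using J(2) DIM_positive[where 'a='a] by fastforce
 let ?h = "UNIV :: 'm set"
 have "card (J - {j}) = CARD('m)" using j fJ J(2) dim by simp
 then obtain f where f: "bij_betw f ?h (J - {j})"
  using finite_same_card_bij[of "?h" "J - {j}"] fJ by auto
 have Jf: "J = insert j (range f)" using f j by (auto simp: bij_betw_def)
 have im: "X ` J = insert (X j) (range (%i. X (f i)))" for X :: "nat => 'a" unfolding Jf by auto
 define H where "H v x = ennreal (far (insert v (range x)))" for v and x :: "'m => 'a"
 let ?p = "%_. P"
 have Hm: "(%p. H (fst p) (snd p)) \<in> borel_measurable (P \<Otimes>\<^sub>M PiM UNIV ?p)"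
 proof -
  note [measurable] = measurable_insert_range(2)[OF measurable_pair_sample]
  show ?thesis unfolding H_def far_def by measurable
 qed
 interpret Q: prob_space "PiM ?h ?p" by (intro prob_space_PiM prob_space_P)
 let ?f = "exp (- (real (N - DIM('a)) * far_rate))"
 let ?g = "\<integral>\<^sup>+X. ennreal (weight N J X * far (X ` J)) \<partial>sample_space N"
 have "?g = (\<integral>\<^sup>+X. H (X j) (%i. X (f i)) * (if below_plane X {..<N} J then 1 else 0) \<partial>sample_space N)"
  by (intro nn_integral_cong) (simp add: weight_def H_def im)
 also have "\<dots> = (\<integral>\<^sup>+v. (\<integral>\<^sup>+x. H v x * ennreal (below (plane_normal (insert v (range x))) ^ (N - card J)) \<partial>PiM UNIV ?p) \<partial>P)"
  by (rule sample_reduction[OF J(1) j f Hm])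
 also have "\<dots> \<le> (\<integral>\<^sup>+v. (\<integral>\<^sup>+x. ennreal ?f \<partial>PiM ?h ?p) \<partial>P)"
 proof (intro nn_integral_mono)
  fix v :: 'a and x :: "'m => 'a"
  show "H v x * ennreal (below (plane_normal (insert v (range x))) ^ (N - card J)) \<le> ennreal ?f"
   using below_le_exp_far[of "plane_normal (insert v (range x))" "N - DIM('a)"] unfolding J(2) by (auto simp: H_def far_def intro: ennreal_leI)
 qed
 also have "\<dots> = ennreal ?f"
  using P.emeasure_space_1 prob_space.emeasure_space_1[OF prob_space_PiM[OF prob_space_P], of "?h"] by simp
 finally have "?g \<le> ennreal ?f" .
 then show "(\<integral>X. weight N J X * far (X ` J) \<partial>sample_space N) \<le> ?f"
  by (intro integral_real_bounded) auto
qed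

lemma half_space_moment:
 assumes a: "norm a = 2"
 shows "integrable (sample_space N) (%X. if \<forall>i<N. a \<bullet> X i < 1 then 1 else 0 :: real)"
  and "(\<integral>X. (if \<forall>i<N. a \<bullet> X i < 1 then 1 else 0) \<partial>sample_space N) \<le> exp (- (real N * far_rate))"
proof -
 interpret PN: prob_space "sample_space N" by (intro prob_space_PiM prob_space_P)
 let ?f = "%X. if \<forall>i<N. a \<bullet> X i < 1 then 1 else 0"
 have e: "ennreal (?f X) = (\<Prod>i\<in>{..<N}. indicator {z. a \<bullet> z < 1} (X i))" for X :: "nat => 'a"
  by (auto simp: indicator_def prod_zero_iff)
 have e': "?f X = enn2real (\<Prod>i\<in>{..<N}. indicator {z. a \<bullet> z < 1} (X i))" for X :: "nat => 'a"
  by (subst e[symmetric]) simp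
 let ?g = "%X. if \<forall>i<N. a \<bullet> X i < 1 then 1 else 0 :: real"
 have m: "?g \<in> borel_measurable (sample_space N)"
  unfolding e' using measurable_all_below[of a "{..<N}"] by measurable
 show "integrable (sample_space N) ?g"
  by (rule PN.integrable_const_bound[where B=1, OF AE_I2 m]) simp
 have "(\<integral>\<^sup>+X. ennreal (?f X) \<partial>sample_space N) = ennreal (below a ^ N)"
  unfolding e using nn_integral_all_below[of "{..<N}" a] by simp
 also have "\<dots> \<le> ennreal (exp (- (real N * far_rate)))" using a by (intro ennreal_leI below_le_exp_far) simp
 finally show "(\<integral>X. ?f X \<partial>sample_space N) \<le> exp (- (real N * far_rate))"
  by (intro integral_real_bounded) auto
qed

end

section \<open>The expected difference\<close>

lemma powr_times_exp_tendsto_0: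
 fixes b r :: real
 assumes r: "r > 0"
 shows "(%N. real N powr b * exp (- (real N * r))) \<longlonglongrightarrow> 0"
 using r by real_asymp

lemma binomial_div_power_tendsto: "(%N. real (N choose n) / real N ^ n) \<longlonglongrightarrow> 1 / fact n"
proof -
 let ?f = "%N. \<Prod>i<n. 1 - real i / real N"
 have lim: "(%N. ?f N / fact n) \<longlonglongrightarrow> (\<Prod>i<n. 1 - 0) / fact n"
  by (intro tendsto_divide tendsto_prod tendsto_diff tendsto_const lim_const_over_n) auto
 have "eventually (%N. ?f N / fact n = real (N choose n) / real N ^ n) sequentially"
 proof (rule eventually_sequentiallyI)
  fix N :: nat assume N: "1 \<le> N"
  have "real (N choose n) = (\<Prod>i<n. real N - real i) / fact n"
   by (simp add: binomial_gbinomial gbinomial_prod_rev atLeast0LessThan)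
  moreover have "?f N = (\<Prod>i<n. real N - real i) / real N ^ n"
  proof -
   have "?f N = (\<Prod>i<n. (real N - real i) / real N)"
    using N by (intro prod.cong) (auto simp: diff_divide_distrib)
   then show ?thesis by (simp add: prod_dividef)
  qed
  ultimately show "?f N / fact n = real (N choose n) / real N ^ n" by simp
 qed
 then show ?thesis using Lim_transform_eventually[OF lim] by simp
qed

context sphere_sample
begin

lemma measurable_one_sided:
 fixes N :: nat
 assumes J: "J \<subseteq> {..<N}"
 shows "{X \<in> space (sample_space N). one_sided (affine hull (X ` J)) (X ` ({..<N} - J))} \<in> sets (sample_space N)"
proof -
 have fJ: "finite J" using J finite_subset by blast
 let ?f = "sample_space N"
 let ?g = "%X. affine hull (X ` J)"
 have d: "(%X. infdist (z X) (?g X)) \<in> borel_measurable ?f" if "z \<in> borel_measurable ?f" for z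
  using J fJ that by (intro measurable_infdist_affine_hull measurable_sample) auto
 have "{X \<in> space ?f. (\<forall>i\<in>{..<N} - J. infdist (X i) (?g X) > 0) \<and>
   (\<forall>i\<in>{..<N} - J. \<forall>k\<in>{..<N} - J. infdist ((1 / 2) *\<^sub>R (X i + X k)) (?g X) = (infdist (X i) (?g X) + infdist (X k) (?g X)) / 2)} \<in> sets ?f"
 proof (intro sets.sets_Collect_conj sets.sets_Collect_finite_All)
  fix i assume "i \<in> {..<N} - J"
  then have i: "i \<in> {..<N}" by simp
  note [measurable] = d[OF measurable_sample[OF i]]
  show "{X \<in> space ?f. infdist (X i) (?g X) > 0} \<in> sets ?f" by measurable
 next
  fix i k assume "i \<in> {..<N} - J" "k \<in> {..<N} - J"
  then have i: "i \<in> {..<N}" "k \<in> {..<N}" by simp_all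
  have "(%X. (1 / 2) *\<^sub>R (X i + X k)) \<in> borel_measurable ?f"
   by (intro borel_measurable_scaleR borel_measurable_add borel_measurable_const measurable_sample i)
  note [measurable] = d[OF measurable_sample[OF i(1)]] d[OF measurable_sample[OF i(2)]] d[OF this]
  show "{X \<in> space ?f. infdist ((1 / 2) *\<^sub>R (X i + X k)) (?g X) = (infdist (X i) (?g X) + infdist (X k) (?g X)) / 2} \<in> sets ?f"
   by measurable
 qed auto
 then show ?thesis by (simp add: one_sided_def)
qed

text \<open>The formula over index sets also covers degenerate samples, so measurability holds on
  the whole sample space.\<close>

lemma measurable_Lp_surface_area:
 fixes N :: nat
 shows "(%X. Lp_surface_area p (convex hull (X ` {..<N}))) \<in> borel_measurable (sample_space N)"
proof -
 let ?f = "sample_space N"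
 have "(%X. (if one_sided (affine hull (X ` J)) (X ` ({..<N} - J)) then 1 else 0) *
   ((if p = 1 then 1 else infdist 0 (affine hull (X ` J)) powr (1 - p)) * hull_facet_volume (X ` J))) \<in> borel_measurable ?f"
  if "J \<in> Pow {..<N}" for J
 proof -
  have J: "J \<subseteq> {..<N}" using that by simp
  then have fJ: "finite J" using finite_subset by blast
  have [measurable]: "(%X. if one_sided (affine hull (X ` J)) (X ` ({..<N} - J)) then 1 else 0 :: real) \<in> borel_measurable ?f"
   using measurable_one_sided[OF J] by (intro measurable_If) auto
  have [measurable]: "(%X. infdist 0 (affine hull (X ` J))) \<in> borel_measurable ?f"
   using J fJ by (intro measurable_infdist_affine_hull measurable_sample) auto
  have [measurable]: "(%X. hull_facet_volume (X ` J)) \<in> borel_measurable ?f"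
   using J fJ by (intro measurable_hull_facet_volume measurable_sample) auto
  show ?thesis by measurable
 qed
 then show ?thesis unfolding Lp_surface_area_convex_hull[OF finite_lessThan] by (rule borel_measurable_sum)
qed

definition facet_sets :: "nat => nat set set" where
 "facet_sets N = {J. J \<subseteq> {..<N} \<and> card J = DIM('a)}"

lemma card_facet_sets: "card (facet_sets N) = N choose DIM('a)"
 unfolding facet_sets_def using n_subsets[of "{..<N}" "DIM('a)"] by simp

text \<open>All index sets of size n have the same moments, so integrating the pointwise estimate
  turns the sums into multiples of a binomial coefficient. The constant C is uniform in N, and
  finiteness of the moments is secured for large N by their limits.\<close>

lemma expectation_estimate:
 fixes i0 :: 'm
 assumes p: "p \<le> 1"
 defines "V \<equiv> DIM('a) * measure lborel (cball 0 1 :: 'a set)" and "n \<equiv> real DIM('a)"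
 shows "\<exists>C\<ge>0. \<forall>N. sample_moment (%_. 0) 1 N < top \<longrightarrow> sample_moment (%_. 0) 2 N < top \<longrightarrow> sample_moment (%i. if i = i0 then 1 else 0) 0 N < top \<longrightarrow>
  \<bar>(\<integral>X. V - Lp_surface_area p (convex hull (X ` {..<N})) \<partial>sample_space N)
   - real (N choose DIM('a)) * ((n * (n - 1) * enn2real (sample_moment (%i. if i = i0 then 1 else 0) 0 N) / (4 * (n + 1)) - p / 2 * enn2real (sample_moment (%_. 0) 1 N)) / fact (DIM('a) - 1))\<bar>
  \<le> C * real (N choose DIM('a)) * (enn2real (sample_moment (%_. 0) 2 N) + exp (- (real (N - DIM('a)) * far_rate)))
   + C * (1 + 2 * real (N choose DIM('a))) * exp (- (real N * far_rate))"
proof -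
 have V0: "V \<ge> 0" by (simp add: V_def)
 let ?r = "%K X J. K * (near (X ` J) * (simplex_det (X ` J) * (depth (X ` J))\<^sup>2)) + V * far (X ` J)"
 obtain K where K: "K \<ge> 0" "\<And>(X::nat => 'a) I. finite I ==> general_position X I ==> (\<forall>i\<in>I. norm (X i) = 1) ==>
  \<bar>V - Lp_surface_area p (convex hull (X ` I)) - (\<Sum>J | J \<subseteq> I \<and> card J = DIM('a). (if below_plane X I J then 1 else 0) * (near (X ` J) * near_term p (X ` J)))\<bar>
  \<le> (\<Sum>J | J \<subseteq> I \<and> card J = DIM('a). (if below_plane X I J then 1 else 0) * ?r K X J)
   + (if 0 \<in> interior (convex hull (X ` I)) then 0 else (1 + 2 * real (card {J. J \<subseteq> I \<and> card J = DIM('a)})) * V)"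
  using Lp_difference_pointwise[OF p, where 'a='a and 'i=nat] unfolding V_def by blast
 obtain U :: "'a set" where U: "finite U" "U \<subseteq> sphere 0 1" "sphere 0 1 \<subseteq> (\<Union>u\<in>U. ball u (1 / 2))"
  using ex_direction_net by blast
 define C where "C = K + V + V * card U"
 have C: "C \<ge> 0" "K \<le> C" "V \<le> C" "V * card U \<le> C" using K(1) V0 by (auto simp: C_def)
 let ?f = "%N J X. weight N J X * (near (X ` J) * (simplex_det (X ` J) * (\<Sum>j\<in>J. \<Sum>l\<in>J. (norm (X j - X l))\<^sup>2))) / (4 * (n + 1)) - p / 2 * (weight N J X * (near (X ` J) * (simplex_det (X ` J) * depth (X ` J) ^ 1)))"
 let ?g = "%N. - (real (N - DIM('a)) * far_rate)"
 let ?h = "%N. - (real N * far_rate)"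
 let ?p = "%N. sample_moment (%i. if i = i0 then 1 else 0) 0 N"
 let ?q = "%_. 0"
 let ?u = "%N R X. \<Sum>u\<in>U. if \<forall>i<N. (- 2 *\<^sub>R u) \<bullet> X i < 1 then 1 else 0"
 let ?v = "%M N. \<integral>X. M X \<partial>sample_space N"
 let ?w = "%N. sample_space N"
 show ?thesis
 proof (intro exI[of _ C] conjI allI impI C(1))
  fix N assume fin: "sample_moment ?q 1 N < top" "sample_moment ?q 2 N < top" "?p N < top"
  define mh where "mh = enn2real (sample_moment ?q 1 N)"
  define ms where "ms = enn2real (sample_moment ?q 2 N)"
  define md where "md = enn2real (?p N)"
  let ?S = "facet_sets N"
  interpret PN: prob_space "?w N" by (intro prob_space_PiM prob_space_P)
  have J: "J \<subseteq> {..<N}" "card J = DIM('a)" if "J \<in> ?S" for J using that by (auto simp: facet_sets_def)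
  define Z where "Z X = V - Lp_surface_area p (convex hull (X ` {..<N}))" for X :: "nat => 'a"
  define M where "M X = (\<Sum>J\<in>?S. ?f N J X / fact (DIM('a) - 1))" for X
  define R where "R X = (\<Sum>J\<in>?S. K * (weight N J X * (near (X ` J) * (simplex_det (X ` J) * depth (X ` J) ^ 2))) + V * (weight N J X * far (X ` J)))" for X
  define E where "E X = (1 + 2 * real (card ?S)) * V * ?u N R X" for X :: "nat => 'a"
  define eM where "eM = real (card ?S) * ((n * (n - 1) * md / (4 * (n + 1)) - p / 2 * mh) / fact (DIM('a) - 1))"
  have "has_bochner_integral (?w N) M (\<Sum>J\<in>?S. (n * (n - 1) * md / (4 * (n + 1)) - p / 2 * mh) / fact (DIM('a) - 1))"
   unfolding M_def n_def md_def mh_def using fin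
   by (intro has_bochner_integral_sum has_bochner_integral_divide has_bochner_integral_diff has_bochner_integral_mult_right
     squared_distances_moment[OF J] depth_moment[OF J]) auto
  then have M: "integrable (?w N) M" "?v M N = eM"
   by (simp_all add: has_bochner_integral_iff eM_def)
  have s: "has_bochner_integral (?w N) (%X. weight N J X * (near (X ` J) * (simplex_det (X ` J) * depth (X ` J) ^ 2))) ms" if "J \<in> ?S" for J
   unfolding ms_def by (rule depth_moment[OF J[OF that] fin(2)])
  have Ri: "integrable (?w N) R"
   unfolding R_def using s far_moment(1)[OF J]
   by (intro Bochner_Integration.integrable_sum Bochner_Integration.integrable_add integrable_mult_right) (auto simp: has_bochner_integral_iff)
  have RE: "?v R N \<le> real (card ?S) * (K * ms + V * exp (?g N))"
  proof -
   have "?v R N = (\<Sum>J\<in>?S. K * ms + V * (\<integral>X. weight N J X * far (X ` J) \<partial>sample_space N))"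
    unfolding R_def using s far_moment(1)[OF J]
    by (subst Bochner_Integration.integral_sum) (auto simp: has_bochner_integral_iff intro!: sum.cong)
   also have "\<dots> \<le> (\<Sum>J\<in>?S. K * ms + V * exp (?g N))"
    using V0 by (intro sum_mono add_left_mono mult_left_mono far_moment(2) J) auto
   finally show ?thesis by simp
  qed
  have u2: "norm (- 2 *\<^sub>R u) = 2" if "u \<in> U" for u using that U(2) by auto
  have Ei: "integrable (?w N) E"
   unfolding E_def using half_space_moment(1)[OF u2] by (intro integrable_mult_right Bochner_Integration.integrable_sum) auto
  have EE: "?v E N \<le> (1 + 2 * real (card ?S)) * V * (card U * exp (?h N))"
  proof -
   have "?v E N = (1 + 2 * real (card ?S)) * V * (\<Sum>u\<in>U. \<integral>X. (if \<forall>i<N. (- 2 *\<^sub>R u) \<bullet> X i < 1 then 1 else 0) \<partial>sample_space N)"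
    unfolding E_def using half_space_moment(1)[OF u2]
    by (subst integral_mult_right_zero, subst Bochner_Integration.integral_sum) auto
   also have "\<dots> \<le> (1 + 2 * real (card ?S)) * V * (\<Sum>u\<in>U. exp (?h N))"
    using V0 by (intro mult_left_mono sum_mono half_space_moment(2) u2) auto
   finally show ?thesis by simp
  qed
  have AE: "AE X in sample_space N. \<bar>Z X - M X\<bar> \<le> R X + E X"
   using AE_general_position[OF finite_lessThan[of N]] AE_space
  proof eventually_elim
   case (elim X)
   have unit: "\<forall>i\<in>{..<N}. norm (X i) = 1"
    using elim(2) by (auto simp: space_PiM PiE_def Pi_def)
   note k = K(2)[OF finite_lessThan elim(1) unit, folded facet_sets_def Z_def]
   have m: "M X = (\<Sum>J\<in>?S. (if below_plane X {..<N} J then 1 else 0) * (near (X ` J) * near_term p (X ` J)))"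
    unfolding M_def
   proof (intro sum.cong refl)
    fix J assume "J \<in> ?S"
    then have "inj_on X J" using general_position_independent(1)[OF finite_lessThan elim(1)] J by simp
    then have sq: "squared_distances (X ` J) = (\<Sum>j\<in>J. \<Sum>l\<in>J. (norm (X j - X l))\<^sup>2)"
     by (simp add: squared_distances_def sum.reindex)
    show "?f N J X / fact (DIM('a) - 1)
     = (if below_plane X {..<N} J then 1 else 0) * (near (X ` J) * near_term p (X ` J))"
     unfolding near_term_def sq weight_def n_def by (simp add: right_diff_distrib diff_divide_distrib)
   qed
   have r: "R X = (\<Sum>J\<in>?S. (if below_plane X {..<N} J then 1 else 0) * ?r K X J)"
    unfolding R_def weight_def by (intro sum.cong) auto
   have e: "(if 0 \<in> interior (convex hull (X ` {..<N})) then 0 else (1 + 2 * real (card ?S)) * V) \<le> E X"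
   proof (cases "0 \<in> interior (convex hull (X ` {..<N}))")
    case True
    then show ?thesis using V0 by (auto simp: E_def intro!: mult_nonneg_nonneg sum_nonneg)
   next
    case False
    then obtain u where u: "u \<in> U" "\<forall>i\<in>{..<N}. (- 2 *\<^sub>R u) \<bullet> X i < 1"
     using net_direction_below[OF U(3), of "{..<N}" X] unit by blast
    \<comment> \<open>The event that the origin is not interior is dominated by the sum over the net
      of half-space events, whose probabilities are bounded.\<close>
    have "(1::real) = (if \<forall>i<N. (- 2 *\<^sub>R u) \<bullet> X i < 1 then 1 else 0)" using u(2) by auto
    also have "\<dots> \<le> ?u N R X"
     using U(1) u(1) by (intro member_le_sum) auto
    finally have "(1 + 2 * real (card ?S)) * V * 1 \<le> E X" unfolding E_def using V0 by (intro mult_left_mono) auto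
    then show ?thesis using False by simp
   qed
   show ?case using k e unfolding m[symmetric] r[symmetric] by linarith
  qed
  have Zm: "Z \<in> borel_measurable (?w N)"
   unfolding Z_def[abs_def] using measurable_Lp_surface_area[of p N] by measurable
  \<comment> \<open>Integrability comes from the same estimate, by domination.\<close>
  have Zi: "integrable (?w N) Z"
  proof (rule Bochner_Integration.integrable_bound)
   show "integrable (?w N) (%X. \<bar>M X\<bar> + (R X + E X))" using M(1) Ri Ei by auto
   show "AE X in sample_space N. norm (Z X) \<le> norm (\<bar>M X\<bar> + (R X + E X))"
    using AE by eventually_elim auto
  qed (rule Zm)
  have "\<bar>?v Z N - eM\<bar> = \<bar>\<integral>X. Z X - M X \<partial>sample_space N\<bar>"
   using Zi M by simp
  also have "\<dots> \<le> (\<integral>X. \<bar>Z X - M X\<bar> \<partial>sample_space N)" by (rule integral_abs_bound)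
  also have "\<dots> \<le> (\<integral>X. R X + E X \<partial>sample_space N)"
   using AE Zi M(1) Ri Ei by (intro integral_mono_AE) auto
  also have "\<dots> = ?v R N + ?v E N" using Ri Ei by simp
  also have "\<dots> \<le> real (card ?S) * (K * ms + V * exp (?g N)) + (1 + 2 * real (card ?S)) * V * (card U * exp (?h N))"
   using RE EE by (rule add_mono)
  also have "\<dots> \<le> real (card ?S) * (C * ms + C * exp (?g N)) + (1 + 2 * real (card ?S)) * (C * exp (?h N))"
  proof (intro add_mono mult_left_mono)
   show "K * ms \<le> C * ms" "V * exp (?g N) \<le> C * exp (?g N)"
    using C by (auto intro!: mult_right_mono simp: ms_def)
   have "V * card U * exp (?h N) \<le> C * exp (?h N)" using C by (intro mult_right_mono) auto
   then have "(1 + 2 * real (card ?S)) * (V * card U * exp (?h N)) \<le> (1 + 2 * real (card ?S)) * (C * exp (?h N))"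
    by (intro mult_left_mono) auto
   then show "(1 + 2 * real (card ?S)) * V * (card U * exp (?h N)) \<le> (1 + 2 * real (card ?S)) * (C * exp (?h N))"
    by (simp only: mult.assoc)
  qed simp
  also have "\<dots> = C * real (N choose DIM('a)) * (ms + exp (?g N)) + C * (1 + 2 * real (N choose DIM('a))) * exp (?h N)"
   unfolding card_facet_sets by (simp add: algebra_simps)
  finally show "\<bar>(\<integral>X. V - Lp_surface_area p (convex hull (X ` {..<N})) \<partial>sample_space N)
   - real (N choose DIM('a)) * ((n * (n - 1) * enn2real (?p N) / (4 * (n + 1)) - p / 2 * enn2real (sample_moment ?q 1 N)) / fact (DIM('a) - 1))\<bar>
  \<le> C * real (N choose DIM('a)) * (enn2real (sample_moment ?q 2 N) + exp (?g N))
   + C * (1 + 2 * real (N choose DIM('a))) * exp (?h N)"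
   unfolding Z_def eM_def card_facet_sets mh_def ms_def md_def .
 qed
qed

end

context sphere_sample
begin

text \<open>Since N choose n is about N^n / n!, the factor N^(2/d) times this count is the scale
  N^(n + 2/d) of the moments. At that scale the quadratic depth moment, the far simplices and the
  samples without an interior origin all vanish.\<close>

lemma expectation_limit:
 assumes p: "p \<le> 1"
 defines "V \<equiv> DIM('a) * measure lborel (cball 0 1 :: 'a set)" and "n \<equiv> real DIM('a)" and "d \<equiv> real CARD('m)"
 shows "(%N. real N powr (2 / d) * (\<integral>X. V - Lp_surface_area p (convex hull (X ` {..<N})) \<partial>PiM {..<N} (%_. P)))
  \<longlonglongrightarrow> 1 / fact DIM('a) * ((n * (n - 1) * (base_value * (2 * (d\<^sup>2 + d + 2) / (d * (d + 1)))) / (4 * (n + 1)) - p / 2 * base_value) / fact (DIM('a) - 1))"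
proof -
 fix i0 :: 'm
 let ?n = "DIM('a)"
 let ?u = "%_. 0"
 define mh where "mh N = enn2real (sample_moment ?u 1 N)" for N
 define ms where "ms N = enn2real (sample_moment ?u 2 N)" for N
 define md where "md N = enn2real (sample_moment (%i. if i = i0 then 1 else 0) 0 N)" for N
 define q where "q N = real N powr (n + 2 / d)" for N
 define t where "t N = real (N choose ?n) / real N ^ ?n" for N
 define e where "e N = (\<integral>X. V - Lp_surface_area p (convex hull (X ` {..<N})) \<partial>PiM {..<N} (%_. P))" for N :: nat
 define a where "a N = (n * (n - 1) * md N / (4 * (n + 1)) - p / 2 * mh N) / fact (?n - 1)" for N
 have d0: "d > 0" by (simp add: d_def)
 have t: "t \<longlonglongrightarrow> 1 / fact ?n" unfolding t_def by (rule binomial_div_power_tendsto)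
 let ?g = "%N. real N powr (real ?n + 2 / CARD('m))"
 have real_lim: "(%N. q N * enn2real (f N)) \<longlonglongrightarrow> l" if "(%N. ennreal (?g N) * f N) \<longlonglongrightarrow> ennreal l" "l \<ge> 0" for f l
 proof -
  have "(%N. enn2real (ennreal (?g N) * f N)) \<longlonglongrightarrow> enn2real (ennreal l)"
   using that by (intro tendsto_enn2real) auto
  then show ?thesis using that(2) by (simp add: enn2real_mult q_def n_def d_def)
 qed
 \<comment> \<open>A finite limit of the scaled moments makes the moments themselves finite for
   large N.\<close>
 have fin: "eventually (%N. f N < top) sequentially" if "(%N. ennreal (?g N) * f N) \<longlonglongrightarrow> ennreal l" for f l
 proof -
  have "eventually (%N. ennreal (?g N) * f N < top) sequentially"
   using that by (rule order_tendstoD(2)) simp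
  then show ?thesis using eventually_gt_at_top[of 0]
  proof eventually_elim
   case (elim N)
   then have "ennreal (?g N) \<noteq> 0" by simp
   then show ?case using elim(1) by (auto simp: ennreal_mult_less_top)
  qed
 qed
 have base0: "base_value \<ge> 0"
  unfolding base_value_def density_moment_def
  by (intro mult_nonneg_nonneg Gamma_real_nonneg integral_nonneg_AE AE_I2) (auto intro!: add_pos_nonneg)
 define r where "r = 2 * (d\<^sup>2 + d + 2) / (d * (d + 1))"
 have r0: "r \<ge> 0" unfolding r_def using d0 by (intro divide_nonneg_nonneg mult_nonneg_nonneg add_nonneg_nonneg) auto
 have mh: "(%N. q N * mh N) \<longlonglongrightarrow> base_value" unfolding mh_def by (rule real_lim[OF height_moment_tendsto base0])
 have md: "(%N. q N * md N) \<longlonglongrightarrow> base_value * r"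
  unfolding md_def r_def d_def by (rule real_lim[OF distance_moment_tendsto]) (use base0 r0 in \<open>simp add: r_def d_def\<close>)
 have sq: "(%N. ennreal (?g N) * sample_moment ?u 2 N) \<longlonglongrightarrow> ennreal 0"
  using square_moment_tendsto by simp
 have ms: "(%N. q N * ms N) \<longlonglongrightarrow> 0" unfolding ms_def by (rule real_lim[OF sq]) simp
 let ?f = "%N. (n * (n - 1) * (q N * md N) / (4 * (n + 1)) - p / 2 * (q N * mh N)) / fact (?n - 1)"
 let ?p = "1 / fact ?n * ((n * (n - 1) * (base_value * r) / (4 * (n + 1)) - p / 2 * base_value) / fact (?n - 1))"
 have l1: "(%N. t N * ?f N)
  \<longlonglongrightarrow> ?p"
  by (intro tendsto_intros t md mh) (auto simp: n_def)
 have qt: "eventually (%N. real N powr (2 / d) * real (N choose ?n) = t N * q N) sequentially"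
 proof (rule eventually_sequentiallyI)
  fix N :: nat assume "1 \<le> N"
  then show "real N powr (2 / d) * real (N choose ?n) = t N * q N"
   by (simp add: t_def q_def n_def powr_add powr_realpow)
 qed
 let ?q = "%N. real (N choose ?n) * a N"
 have ev: "eventually (%N. t N * ?f N = real N powr (2 / d) * ?q N) sequentially"
  using qt
 proof eventually_elim
  case (elim N)
  have "t N * ?f N = (t N * q N) * a N"
   unfolding a_def by (simp add: right_diff_distrib diff_divide_distrib mult_ac)
  also have "\<dots> = real N powr (2 / d) * ?q N" unfolding elim[symmetric] by simp
  finally show ?case .
 qed
 have main: "(%N. real N powr (2 / d) * ?q N) \<longlonglongrightarrow> ?p"
  by (rule Lim_transform_eventually[OF l1 ev])
 let ?h = "%N. - (real N * far_rate)"
 let ?r = "%N. ms N + exp (- (real (N - ?n) * far_rate))"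
 obtain C where C: "C \<ge> 0" "\<And>N. sample_moment ?u 1 N < top ==> sample_moment ?u 2 N < top ==> sample_moment (%i. if i = i0 then 1 else 0) 0 N < top ==>
  \<bar>e N - real (N choose ?n) * a N\<bar> \<le> C * real (N choose ?n) * ?r N + C * (1 + 2 * real (N choose ?n)) * exp (?h N)"
  using expectation_estimate[OF p, of i0] unfolding e_def a_def mh_def md_def ms_def V_def n_def by blast
 define B where "B N = C * t N * (q N * ms N + exp (real ?n * far_rate) * (q N * exp (?h N)))
   + C * (real N powr (2 / d) * exp (?h N) + 2 * t N * (q N * exp (?h N)))" for N
 have qe: "(%N. q N * exp (?h N)) \<longlonglongrightarrow> 0"
  unfolding q_def by (rule powr_times_exp_tendsto_0[OF far_rate_pos])
 have "B \<longlonglongrightarrow> C * (1 / fact ?n) * (0 + exp (real ?n * far_rate) * 0) + C * (0 + 2 * (1 / fact ?n) * 0)"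
  unfolding B_def[abs_def] by (intro tendsto_intros t ms qe powr_times_exp_tendsto_0[OF far_rate_pos])
 then have B: "B \<longlonglongrightarrow> 0" by simp
 have bound: "eventually (%N. norm (real N powr (2 / d) * e N - real N powr (2 / d) * ?q N) \<le> B N) sequentially"
  using qt fin[OF height_moment_tendsto] fin[OF sq] fin[OF distance_moment_tendsto[of i0]] eventually_ge_at_top[of ?n]
 proof eventually_elim
  case (elim N)
  let ?w = "real N powr (2 / d)"
  have ex: "exp (- (real (N - ?n) * far_rate)) = exp (real ?n * far_rate) * exp (?h N)"
   using elim(5) by (simp add: of_nat_diff left_diff_distrib flip: exp_add)
  have "norm (?w * e N - ?w * ?q N) = ?w * \<bar>e N - real (N choose ?n) * a N\<bar>"
   by (simp add: right_diff_distrib[symmetric] abs_mult)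
  also have "\<dots> \<le> ?w * (C * real (N choose ?n) * ?r N + C * (1 + 2 * real (N choose ?n)) * exp (?h N))"
   using elim by (intro mult_left_mono C(2)) auto
  also have "\<dots> = C * (?w * real (N choose ?n)) * ?r N + C * (?w * exp (?h N) + 2 * (?w * real (N choose ?n)) * exp (?h N))"
   by (simp add: algebra_simps)
  also have "\<dots> = B N" unfolding elim(1) ex B_def by (simp add: algebra_simps)
  finally show ?case .
 qed
 have diff: "(%N. real N powr (2 / d) * e N - real N powr (2 / d) * ?q N) \<longlonglongrightarrow> 0"
  by (rule tendsto_0_le[OF B, where K=1]) (use bound in \<open>auto elim!: eventually_mono\<close>)
 from tendsto_add[OF diff main] show ?thesis unfolding e_def r_def by simp
qed

end

theorem corollary1p4:
  fixes f :: "'a::euclidean_space \<Rightarrow> real" and n :: nat and p :: real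
  assumes "n = DIM('a)" and "n \<ge> 2"
    and "continuous_on (sphere 0 1) f"
    and "\<And>x. x \<in> sphere 0 1 \<Longrightarrow> f x > 0"
    and "(\<integral>x. f x \<partial>sphere_measure) = 1"
    and "p \<le> 1"
  shows "(\<lambda>N. real N powr (2 / (real n - 1)) *
            (\<integral>X. Lp_surface_area_diff p (random_polytope N X) \<partial>random_points f N))
         \<longlonglongrightarrow> 1 / 2 * (1 - p + (real n - 1)\<^sup>2 / (real n + 1)) *
           ((\<integral>x. f x powr (- 2 / (real n - 1)) \<partial>sphere_measure) /
              unit_ball_vol (real n - 1) powr (2 / (real n - 1))) *
           (Gamma (real n + 2 / (real n - 1)) / fact (n - 1))"
proof -
 note n = assms(1,2) and f = assms(3,4,5) and p = assms(6)
 let ?S = "sphere 0 1 :: 'a set"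
 have ne: "?S \<noteq> {}" by simp
 obtain x0 where x0: "x0 \<in> ?S" "\<And>x. x \<in> ?S ==> f x0 \<le> f x"
  using continuous_attains_inf[OF compact_sphere ne f(1)] by blast
 obtain x1 where x1: "x1 \<in> ?S" "\<And>x. x \<in> ?S ==> f x \<le> f x1"
  using continuous_attains_sup[OF compact_sphere ne f(1)] by blast
 \<comment> \<open>Off the sphere F takes the minimum of f, which preserves the global bounds and
   Borel measurability.\<close>
 define F where "F x = (if x \<in> ?S then f x else f x0)" for x
 have F: "F x = f x" if "x \<in> ?S" for x using that by (simp add: F_def)
 have Fm: "F \<in> borel_measurable borel"
  unfolding F_def by (intro borel_measurable_continuous_on_if f(1) continuous_on_const) auto
 \<comment> \<open>A non-integrable function has integral 0 by convention, so the value 1 implies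
   integrability.\<close>
 have int: "integrable sphere_measure f" using f(3) not_integrable_integral_eq by fastforce
 let ?q = "\<integral>\<^sup>+x. ennreal (F x) \<partial>sphere_measure"
 have F1: "?q = 1"
 proof -
  have "?q = (\<integral>\<^sup>+x. ennreal (f x) \<partial>sphere_measure)"
   by (intro nn_integral_cong) (simp add: F)
  also have "\<dots> = ennreal (\<integral>x. f x \<partial>sphere_measure)"
   using f(2) by (intro nn_integral_eq_integral int AE_I2) (auto intro: less_imp_le)
  finally show ?thesis using f(3) by simp
 qed
 have dim: "DIM('a) = CARD('a hyperplane_index) + 1" using card_hyperplane_index[where 'a='a] n by simp
 interpret sphere_sample F "f x0" "f x1" "TYPE('a hyperplane_index)"
 proof
  show "continuous_on ?S F" using f(1) by (rule continuous_on_eq) (simp add: F)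
  show "0 < f x0" using f(2) x0(1) by blast
  show "f x0 \<le> F x" "F x \<le> f x1" for x using x0 x1 by (auto simp: F_def)
 qed (use dim Fm F1 in auto)
 have P: "random_points f N = PiM {..<N} (%_. P)" for N
 proof -
  have "density sphere_measure (%x. ennreal (f x)) = density sphere_measure (%x. ennreal (F x))"
  proof (rule density_cong)
   show "(%x. ennreal (F x)) \<in> borel_measurable sphere_measure" using Fm by (intro measurable_sphere_measure) measurable
   show "(%x. ennreal (f x)) \<in> borel_measurable sphere_measure" using borel_measurable_integrable[OF int] by measurable
   show "AE x in sphere_measure. ennreal (f x) = ennreal (F x)" by (rule AE_I2) (simp add: F)
  qed
  then show ?thesis by (simp add: random_points_def P_def)
 qed
 define d where "d = real CARD('a hyperplane_index)"
 have d: "real n - 1 = d" "real n = d + 1" "real DIM('a) = d + 1" "d > 0" using dim n(1) by (auto simp: d_def)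
 let ?r = "\<integral>x. f x powr (- 2 / d) \<partial>sphere_measure"
 have dm: "density_moment (- 2 / d) = ?r"
  unfolding density_moment_def by (intro Bochner_Integration.integral_cong) (auto simp: F)
 define A where "A = ?r / unit_ball_vol d powr (2 / d)"
 define G where "G = Gamma (real n + 2 / d)"
 have base: "base_value = fact n * (A * G)"
  unfolding base_value_def d_def[symmetric] dm A_def G_def n(1)[symmetric] by (simp add: powr_minus_divide)
 let ?f = "2 * (d\<^sup>2 + d + 2) / (d * (d + 1))"
 let ?g = "1 / fact n * (((d + 1) * d * (base_value * ?f) / (4 * (d + 2)) - p / 2 * base_value) / fact (n - 1))"
 let ?h = "1 - p + d\<^sup>2 / (d + 2)"
 let ?p = "%b c. 1 / b * (((d + 1) * d * ((b * (A * G)) * ?f) / (4 * (d + 2)) - p / 2 * (b * (A * G))) / c)"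
 have "(%N. real N powr (2 / d) * (\<integral>X. Lp_surface_area_diff p (random_polytope N X) \<partial>random_points f N))
  \<longlonglongrightarrow> ?g"
 proof -
  have e: "(d + 1) - 1 = d" "(d + 1) + 1 = d + 2" by simp_all
  show ?thesis
   using expectation_limit[OF p]
   unfolding Lp_surface_area_diff_def random_polytope_def P measure_sphere_measure d_def[symmetric] n(1)[symmetric] d(2) e .
 qed
 moreover have "?g
  = 1 / 2 * ?h * A * (G / fact (n - 1))"
 proof -
  have "?p b c = 1 / 2 * ?h * A * (G / c)"
   if "b \<noteq> 0" "c \<noteq> 0" for b c :: real
  proof -
   have "d + 2 \<noteq> 0" "d \<noteq> 0" "d + 1 \<noteq> 0" using d(4) by auto
   \<comment> \<open>Here d^2 + d + 2 = (d + 2) + d^2; division by d + 2 splits off the 1 that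
     appears in 1 - p.\<close>
   then have "(d + 1) * d * ((b * (A * G)) * ?f) / (4 * (d + 2)) = b * (A * G) * (1 / 2 * (1 + d\<^sup>2 / (d + 2)))"
    by (simp add: divide_simps) (simp add: algebra_simps power2_eq_square)
   then have "?p b c
    = 1 / b * (b * (A * G) * (1 / 2 * ?h) / c)" by (simp add: algebra_simps)
   also have "\<dots> = 1 / 2 * ?h * A * (G / c)" using that by simp
   finally show ?thesis .
  qed
  from this[of "fact n" "fact (n - 1)"] show ?thesis unfolding base by simp
 qed
 moreover have "d + 2 = real n + 1" using d(2) by simp
 ultimately show ?thesis unfolding d(1) A_def G_def by simp
qed

end
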